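(* Let $Q\in \mathrm{GL}(\mathbb{R}^2)$, $K\in\mathbb{N}$, let the points $z_K^p\in T_K(p)$ ($p\in\Lambda^Q$) be chosen arbitrarily, let $P^Q(K)=\{z_K^p : p\in\Lambda^Q\}\cap I^2$ and $N=N^Q(K)=\#P^Q(K)$ (with $N\geq 1$). Then $$\mathcal{D}\big(L(P^Q(K))\big)\ \leq\ \Big(d^Q(K)+\sqrt{2}\cdot C_L^Q+M^Q(K)\Big)\frac{\sqrt{|\det(Q)|}}{\sqrt{N}}+O(N^{-1}),$$ where the implied constant in $O(N^{-1})$ depends only on $Q$ (not on $K$ or on the choice of the points $z_K^p$).
   Context: Spherical caps and discrepancy. $\mathbb{S}^2\subset\mathbb{R}^3$ is the unit sphere, $\sigma$ its normalized surface measure. For $w\in\mathbb{S}^2$ and $t\in[-1,1]$, $C(w,t)=\{x\in\mathbb{S}^2 : \langle w,x\rangle\geq t\}$ and $\partial C(w,t)=\{x\in\mathbb{S}^2:\langle w,x\rangle=t\}$. For a finite set $P_N=\{p_1,\dots,p_N\}\subset\mathbb{S}^2$ of $N$ points, the spherical cap discrepancy is $$\mathcal{D}(P_N)=\sup_{w\in\mathbb{S}^2}\sup_{-1\leq t\leq 1}\Big|\frac1N\sum_{j=1}^N\chi_{C(w,t)}(p_j)-\sigma(C(w,t))\Big|.$$ Lambert map. $I^2=[0,1)\times(0,1)$, $\partial I^2$ is the boundary of the unit square, and $\mathbb{S}^2_p$ is $\mathbb{S}^2$ with the poles $(0,0,\pm1)$ removed. The Lambert map is the (area preserving) bijection $L:I^2\to\mathbb{S}^2_p$,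 $$L(x,y)=\big(2\sqrt{y-y^2}\cos(2\pi x),\,2\sqrt{y-y^2}\sin(2\pi x),\,1-2y\big).$$ For $A\subset\mathbb{S}^2$, $L^{-1}(A)$ means $L^{-1}(A\cap\mathbb{S}^2_p)\subset I^2$. Lattices and point sets. For $Q\in\mathrm{GL}(\mathbb{R}^2)$ (invertible $2\times2$ real matrices): $\Lambda^Q=Q\mathbb{Z}^2$, $\Omega^Q=Q[0,1)^2$, and for $K\in\mathbb{N}$, $p\in\Lambda^Q$: $T_K(p)=\frac1K(p+\Omega^Q)$; these sets tile $\mathbb{R}^2$. For each $p\in\Lambda^Q$ an arbitrary point $z_K^p\in T_K(p)$ is chosen. $\lambda$ is Lebesgue measure on $\mathbb{R}^2$; $e_1,e_2$ is the standard basis. The three quantities. (1) $d^Q(K)=\frac1K\Big|N^Q(K)-\frac{K^2}{|\det(Q)|}\Big|$. (2) $C_L^Q=\sup_{w\in\mathbb{S}^2}\sup_{-1\leq t\leq1}\mathrm{length}\big(Q^{-1}(L^{-1}(\partial C(w,t)))\big)$. (3) Let $f(x)=\max\big(\min(x,1)+\min(2-x,0),0\big)$ and let $\rho:[0,4]\to\partial I^2$, $\rho(x)=f(x)e_1+f(4-x)e_2$ (a parametrization of $\partial I^2$). For $S\subset[0,1]$ let $R(S)=\{x\in[0,4] : f(4-x)\in S\}$ and $$Ad(S,K)=\big\{p\in\Lambda^Q : T_K(p)^o\cap\rho(R(S))\neq\emptyset\big\},$$ where $T_K(p)^o$ is the interior of $T_K(p)$. Then $$M^Q(K)=\sup_{0\leq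 a<b\leq1}\frac{K}{|\det(Q)|}\Big|\sum_{p\in Ad([a,b],K)}\Big(\frac{\chi_{P^Q(K)}(z_K^p)}{N^Q(K)}-\lambda\big(T_K(p)\cap I^2\big)\Big)\Big|.$$ *)

theory Defs
  imports "HOL-Analysis.Analysis"
begin

text \<open>
  Normalized surface measure on the unit sphere: the uniform distribution on the unit ball
  pushed forward along the radial projection \<open>x \<mapsto> x / \<parallel>x\<parallel>\<close>.  Thus a Borel set \<open>A\<close> of the
  sphere has measure vol (cone over \<open>A\<close>) / vol (ball).  The value \<open>sgn 0 = 0\<close> off the sphere
  only concerns a null set.
\<close>
definition sphere_measure :: "(real^3) measure" where
  "sphere_measure = distr (uniform_measure lborel (ball 0 1)) borel sgn"

text \<open>
  One-dimensional Hausdorff (outer) measure.  Boundedness of the covering sets is demanded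
  explicitly because \<^const>\<open>diameter\<close> is an unspecified real on unbounded sets.
\<close>
definition length_pre :: "real \<Rightarrow> 'a::metric_space set \<Rightarrow> ennreal" where
  "length_pre \<delta> A =
     (INF U \<in> {U :: nat \<Rightarrow> 'a set. A \<subseteq> (\<Union>i. U i) \<and> (\<forall>i. bounded (U i) \<and> diameter (U i) \<le> \<delta>)}.
        \<Sum>i. ennreal (diameter (U i)))"

definition hausdorff_length :: "'a::metric_space set \<Rightarrow> ennreal" where
  "hausdorff_length A = (SUP \<delta>\<in>{0<..}. length_pre \<delta> A)"

definition cap :: "real^3 \<Rightarrow> real \<Rightarrow> (real^3) set" where
  "cap w t = {x \<in> sphere 0 1. w \<bullet> x \<ge> t}"

definition cap_boundary :: "real^3 \<Rightarrow> real \<Rightarrow> (real^3) set" where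
  "cap_boundary w t = {x \<in> sphere 0 1. w \<bullet> x = t}"

definition cap_discrepancy :: "(real^3) set \<Rightarrow> real" where
  "cap_discrepancy P =
     (SUP w\<in>sphere 0 1. SUP t\<in>{-1..1}.
        \<bar>1 / real (card P) * (\<Sum>p\<in>P. indicator (cap w t) p) - measure sphere_measure (cap w t)\<bar>)"

definition unit_square :: "(real^2) set" where
  "unit_square = {v. 0 \<le> v $ 1 \<and> v $ 1 < 1 \<and> 0 < v $ 2 \<and> v $ 2 < 1}"

definition lambert :: "real^2 \<Rightarrow> real^3" where
  "lambert v =
     vector [2 * sqrt (v $ 2 - (v $ 2)\<^sup>2) * cos (2 * pi * v $ 1),
             2 * sqrt (v $ 2 - (v $ 2)\<^sup>2) * sin (2 * pi * v $ 1),
             1 - 2 * v $ 2]"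

text \<open>The map \<^const>\<open>lambert\<close> sends the square into the sphere without its poles, so
  intersecting \<open>A\<close> with the latter is unnecessary.\<close>
definition lambert_preimage :: "(real^3) set \<Rightarrow> (real^2) set" where
  "lambert_preimage A = {v \<in> unit_square. lambert v \<in> A}"

definition plane_lattice :: "real^2^2 \<Rightarrow> (real^2) set" where
  "plane_lattice Q = (*v) Q ` {v. \<forall>i. v $ i \<in> \<int>}"

definition fundamental_domain :: "real^2^2 \<Rightarrow> (real^2) set" where
  "fundamental_domain Q = (*v) Q ` {v. \<forall>i. 0 \<le> v $ i \<and> v $ i < 1}"

definition tile :: "real^2^2 \<Rightarrow> nat \<Rightarrow> real^2 \<Rightarrow> (real^2) set" where
  "tile Q K p = (\<lambda>v. (1 / real K) *\<^sub>R (p + v)) ` fundamental_domain Q"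

definition lattice_points :: "real^2^2 \<Rightarrow> (real^2 \<Rightarrow> real^2) \<Rightarrow> (real^2) set" where
  "lattice_points Q z = z ` plane_lattice Q \<inter> unit_square"

definition count_defect :: "real^2^2 \<Rightarrow> nat \<Rightarrow> (real^2 \<Rightarrow> real^2) \<Rightarrow> real" where
  "count_defect Q K z =
     1 / real K * \<bar>real (card (lattice_points Q z)) - (real K)\<^sup>2 / \<bar>det Q\<bar>\<bar>"

definition cap_length :: "real^2^2 \<Rightarrow> ennreal" where
  "cap_length Q =
     (SUP w\<in>sphere 0 1. SUP t\<in>{-1..1}.
        hausdorff_length ((*v) (matrix_inv Q) ` lambert_preimage (cap_boundary w t)))"

text \<open>With this function the path below runs once counterclockwise around the boundary of the
  unit square, starting and ending at the origin.\<close>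
definition edge_fun :: "real \<Rightarrow> real" where
  "edge_fun x = max (min x 1 + min (2 - x) 0) 0"

definition square_boundary_path :: "real \<Rightarrow> real^2" where
  "square_boundary_path x = edge_fun x *\<^sub>R axis 1 1 + edge_fun (4 - x) *\<^sub>R axis 2 1"

definition height_params :: "real set \<Rightarrow> real set" where
  "height_params S = {x \<in> {0..4}. edge_fun (4 - x) \<in> S}"

definition adjacent :: "real^2^2 \<Rightarrow> nat \<Rightarrow> real set \<Rightarrow> (real^2) set" where
  "adjacent Q K S =
     {p \<in> plane_lattice Q. interior (tile Q K p) \<inter> square_boundary_path ` height_params S \<noteq> {}}"

definition boundary_defect :: "real^2^2 \<Rightarrow> nat \<Rightarrow> (real^2 \<Rightarrow> real^2) \<Rightarrow> real" where
  "boundary_defect Q K z =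
     (SUP (a, b) \<in> {(a, b). 0 \<le> a \<and> a < b \<and> b \<le> 1}.
        real K / \<bar>det Q\<bar> *
        \<bar>\<Sum>p\<in>adjacent Q K {a..b}.
           indicator (lattice_points Q z) (z p) / real (card (lattice_points Q z))
             - measure lborel (tile Q K p \<inter> unit_square)\<bar>)"

end

theory Submission
  imports Defs "HOL-Real_Asymp.Real_Asymp"
begin

text \<open>
  In the lattice coordinates \<open>(u, v) = K Q\<^sup>-\<^sup>1(x, y)\<close> the tiles are the unit cells of \<open>\<int>\<^sup>2\<close>.  For every cell
  compare the point it contributes with the area of the part it shares with the preimage \<open>A\<close> of a cap.
  Cells met by the boundary curve of \<open>A\<close> contribute at most the part of the cell on the wrong side of
  the curve; cutting the curve into boundedly many monotone convex or concave graphs over a lattice axis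
  and summing column by column, these parts add up to at most \<open>\<Sum> \<bar>\<Delta>u\<bar> + \<bar>\<Delta>v\<bar>/2\<close> (or with \<open>u\<close> and \<open>v\<close>
  exchanged), where the total variations of \<open>x\<close> and of \<open>y\<close> along the curve are at most 1 and 2.
  Cells across the edge of the square are collected in a sum over an interval of heights, which \<open>M\<close>
  bounds.  There remain cells that only touch the edge with their closed sides: these are counted
  directly, choosing between the interval where the edge lies in \<open>A\<close> and the complementary one.
  Everything is absorbed by \<open>\<surd>2 C\<close>, because nearly vertical great circles show
  \<open>C \<ge> 2\<parallel>Q\<^sup>-\<^sup>1 e\<^sub>2\<parallel> + \<parallel>Q\<^sup>-\<^sup>1 e\<^sub>1\<parallel>\<close>.
  Caps in general position suffice, all others being limits of them, and complements of caps give the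
  opposite inequality.
\<close>

section \<open>Chords and Hausdorff length\<close>

text \<open>Write V and R for the norms of the preimages under Q of e2 and e1. Counting every cell
  met by the curve costs |\<Delta>u| + |\<Delta>v| for each piece and by Cauchy-Schwarz can use up
  sqrt 2 (2V + R) completely. Nothing would be left for the edge, and the edge needs room: tiles and
  square are half-open, so a tile whose interior misses the square can put its point on the edge x =
  0, and a tile inside can put it on an excluded edge. The sets Ad, defined by interiors, do not see
  these tiles, and there can be of the order of K of them. Halving one increment is what pays for
  them. It comes from convexity: in each column the part on one side of the graph is compared with a
  trapezoid instead of a union of whole cells. The error term is uniform in the cap because the
  curve is cut at roots of polynomials of bounded degree. General position means that the circle is
  not horizontal and misses both poles, so its heights fill a compact part of (-1, 1). The length of
  the given boundary never enters: the estimate is proved with constants of Q alone, and C is used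
  only through its lower bound.\<close>

lemma connected_diameter_cover:
  fixes C :: "'a::metric_space set" and U :: "nat \<Rightarrow> 'a set"
  assumes C: "connected C" "x \<in> C" "y \<in> C"
    and cov: "C \<subseteq> (\<Union>i. U i)" and bnd: "\<And>i. bounded (U i)"
  shows "ennreal (dist x y) \<le> (\<Sum>i. if U i \<inter> C = {} then 0 else ennreal (diameter (U i)))"
proof -
  \<comment> \<open>The distance from \<open>x\<close> is 1-Lipschitz and sends \<open>C\<close>
    onto a set containing the interval from 0 to \<open>dist x y\<close>. Each covering set goes
    into an interval as long as its diameter, so the claim becomes subadditivity of Lebesgue measure
    on the line. Counting only sets that meet \<open>C\<close> allows one cover to serve several
    disjoint sets.\<close>
  define g where "g = (\<lambda>z. dist x z)"
  define J where "J i = (if U i \<inter> C = {} then {} else {Inf (g ` U i) .. Inf (g ` U i) + diameter (U i)})" for i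
  have "connected (g ` C)"
    by (intro connected_continuous_image C) (auto simp: g_def intro!: continuous_intros)
  moreover have "0 \<in> g ` C" "dist x y \<in> g ` C" using C by (auto simp: g_def image_iff)
  ultimately have sub: "{0..dist x y} \<subseteq> g ` C"
    by (meson connected_contains_Icc)
  have inJ: "g ` (U i \<inter> C) \<subseteq> J i" for i
  proof
    fix s assume "s \<in> g ` (U i \<inter> C)"
    then obtain z where z: "z \<in> U i" "z \<in> C" "s = g z" by auto
    have bb: "bdd_below (g ` U i)" by (auto simp: g_def intro!: bdd_belowI[of _ 0])
    have "Inf (g ` U i) \<le> s" using z bb by (auto intro: cInf_lower)
    moreover have "s - diameter (U i) \<le> Inf (g ` U i)"
    proof (rule cInf_greatest)
      show "g ` U i \<noteq> {}" using z by auto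
      fix r assume "r \<in> g ` U i"
      then obtain z' where z': "z' \<in> U i" "r = g z'" by auto
      have "dist z z' \<le> diameter (U i)" using bnd z z' by (intro diameter_bounded_bound) auto
      moreover have "g z \<le> g z' + dist z z'" unfolding g_def by (metis dist_commute dist_triangle)
      ultimately show "s - diameter (U i) \<le> r" using z z' by auto
    qed
    ultimately show "s \<in> J i" using z by (auto simp: J_def)
  qed
  have "{0..dist x y} \<subseteq> (\<Union>i. J i)"
  proof
    fix s assume "s \<in> {0..dist x y}"
    then obtain z where "z \<in> C" "s = g z" using sub by auto
    then show "s \<in> (\<Union>i. J i)" using cov inJ by blast
  qed
  then have "emeasure lborel {0..dist x y} \<le> emeasure lborel (\<Union>i. J i)"
    by (intro emeasure_mono) (auto simp: J_def)
  also have "\<dots> \<le> (\<Sum>i. emeasure lborel (J i))"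
    by (intro emeasure_subadditive_countably) (auto simp: J_def)
  also have "\<dots> \<le> (\<Sum>i. if U i \<inter> C = {} then 0 else ennreal (diameter (U i)))"
    by (intro suminf_le) (auto simp: J_def diameter_ge_0 bnd)
  finally show ?thesis by simp
qed

text \<open>Disjoint compact sets are a positive distance apart. Once the mesh is below this
  distance a covering set meets at most one of them, so the estimates for the single sets add up
  without charging any diameter twice.\<close>

lemma hausdorff_length_ge_compact:
  fixes C :: "'k \<Rightarrow> 'a::heine_borel set"
  assumes I: "finite I"
    and C: "\<And>k. k \<in> I \<Longrightarrow> compact (C k)" "\<And>k. k \<in> I \<Longrightarrow> connected (C k)"
      "\<And>k. k \<in> I \<Longrightarrow> x k \<in> C k \<and> y k \<in> C k" "\<And>k. k \<in> I \<Longrightarrow> C k \<subseteq> A"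
    and disj: "\<And>k l. k \<in> I \<Longrightarrow> l \<in> I \<Longrightarrow> k \<noteq> l \<Longrightarrow> C k \<inter> C l = {}"
  shows "ennreal (\<Sum>k\<in>I. dist (x k) (y k)) \<le> hausdorff_length A"
proof -
  have "\<exists>e>0. \<forall>p\<in>C k. \<forall>q\<in>C l. e \<le> dist p q" if "k \<in> I" "l \<in> I" "k \<noteq> l" for k l
    using separate_compact_closed[OF C(1)[OF that(1)] compact_imp_closed[OF C(1)[OF that(2)]] disj[OF that]] by blast
  then obtain e where e: "\<And>k l. k \<in> I \<Longrightarrow> l \<in> I \<Longrightarrow> k \<noteq> l \<Longrightarrow> e k l > 0 \<and> (\<forall>p\<in>C k. \<forall>q\<in>C l. e k l \<le> dist p q)"
    by metis
  \<comment> \<open>The inserted 1 keeps the minimum defined and positive when there is no pair of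
    distinct indices.\<close>
  define E where "E = insert 1 ((\<lambda>(k,l). e k l) ` {(k,l). k \<in> I \<and> l \<in> I \<and> k \<noteq> l})"
  have finE: "finite E"
    unfolding E_def using I by (auto intro!: finite_imageI finite_subset[of "{(k,l). k \<in> I \<and> l \<in> I \<and> k \<noteq> l}" "I \<times> I"])
  define d where "d = Min E / 2"
  have Epos: "Min E > 0" using finE e by (subst Min_gr_iff) (auto simp: E_def)
  have Emin: "Min E \<le> e k l" if "k \<in> I" "l \<in> I" "k \<noteq> l" for k l
    using finE that by (intro Min_le) (auto simp: E_def)
  have dpos: "d > 0" using Epos by (simp add: d_def)
  have "ennreal (\<Sum>k\<in>I. dist (x k) (y k)) \<le> length_pre d A"
    unfolding length_pre_def
  proof (rule INF_greatest)
    fix U :: "nat \<Rightarrow> 'a set"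
    assume "U \<in> {U. A \<subseteq> (\<Union>i. U i) \<and> (\<forall>i. bounded (U i) \<and> diameter (U i) \<le> d)}"
    then have U: "A \<subseteq> (\<Union>i. U i)" "\<And>i. bounded (U i)" "\<And>i. diameter (U i) \<le> d" by auto
    have one: "k = l" if kl: "k \<in> I" "l \<in> I" "U i \<inter> C k \<noteq> {}" "U i \<inter> C l \<noteq> {}" for i k l
    proof (rule ccontr)
      assume ne: "k \<noteq> l"
      obtain p q where pq: "p \<in> U i" "p \<in> C k" "q \<in> U i" "q \<in> C l" using kl by auto
      have "dist p q \<le> d" using diameter_bounded_bound[OF U(2) pq(1,3)] U(3)[of i] by linarith
      moreover have "2 * d \<le> dist p q" using Emin[OF kl(1,2) ne] e[OF kl(1,2) ne] pq by (force simp: d_def)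
      ultimately show False using dpos by linarith
    qed
    have "ennreal (\<Sum>k\<in>I. dist (x k) (y k)) = (\<Sum>k\<in>I. ennreal (dist (x k) (y k)))"
      by (simp add: sum_ennreal)
    also have "\<dots> \<le> (\<Sum>k\<in>I. \<Sum>i. if U i \<inter> C k = {} then 0 else ennreal (diameter (U i)))"
    proof (rule sum_mono)
      fix k assume k: "k \<in> I"
      have "C k \<subseteq> (\<Union>i. U i)" using C(4)[OF k] U(1) by (rule subset_trans)
      then show "ennreal (dist (x k) (y k)) \<le> (\<Sum>i. if U i \<inter> C k = {} then 0 else ennreal (diameter (U i)))"
        using C(2,3)[OF k] U(2) by (intro connected_diameter_cover) simp_all
    qed
    also have "\<dots> = (\<Sum>i. \<Sum>k\<in>I. if U i \<inter> C k = {} then 0 else ennreal (diameter (U i)))"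
      by (simp add: suminf_sum)
    also have "\<dots> \<le> (\<Sum>i. ennreal (diameter (U i)))"
    proof (intro suminf_le)
      fix i
      show "(\<Sum>k\<in>I. if U i \<inter> C k = {} then 0 else ennreal (diameter (U i))) \<le> ennreal (diameter (U i))"
      proof (cases "\<exists>k\<in>I. U i \<inter> C k \<noteq> {}")
        case True
        then obtain k where k: "k \<in> I" "U i \<inter> C k \<noteq> {}" by auto
        have "(\<Sum>l\<in>I. if U i \<inter> C l = {} then 0 else ennreal (diameter (U i)))
            = (\<Sum>l\<in>I. if l = k then ennreal (diameter (U i)) else 0)"
          using one k by (intro sum.cong) auto
        then show ?thesis using I k by simp
      next
        case False
        then show ?thesis by simp
      qed
    qed auto
    finally show "ennreal (\<Sum>k\<in>I. dist (x k) (y k)) \<le> (\<Sum>i. ennreal (diameter (U i)))" .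
  qed
  also have "\<dots> \<le> hausdorff_length A"
    unfolding hausdorff_length_def using dpos by (intro SUP_upper) auto
  finally show ?thesis .
qed

text \<open>Consecutive arcs share end points, so the closed arcs are not disjoint. The parameter
  intervals are shrunk slightly, the compact case is applied, and the chords converge by
  continuity.\<close>

lemma hausdorff_length_ge_arcs:
  fixes c :: "'k \<Rightarrow> real \<Rightarrow> 'a::heine_borel"
  assumes I: "finite I" and lm: "\<And>k. k \<in> I \<Longrightarrow> l k < m k"
    and cont: "\<And>k. k \<in> I \<Longrightarrow> continuous_on {l k..m k} (c k)"
    and sub: "\<And>k. k \<in> I \<Longrightarrow> c k ` {l k<..<m k} \<subseteq> A"
    and disj: "\<And>k j. k \<in> I \<Longrightarrow> j \<in> I \<Longrightarrow> k \<noteq> j \<Longrightarrow> c k ` {l k<..<m k} \<inter> c j ` {l j<..<m j} = {}"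
  shows "ennreal (\<Sum>k\<in>I. dist (c k (l k)) (c k (m k))) \<le> hausdorff_length A"
proof -
  \<comment> \<open>The summand 3 limits each cut to a third of the interval, so that the shrunk
    interval is never empty.\<close>
  define a where "a k n = l k + (m k - l k) / (real n + 3)" for k n
  define b where "b k n = m k - (m k - l k) / (real n + 3)" for k n
  have ab: "l k < a k n" "a k n \<le> b k n" "b k n < m k" if "k \<in> I" for k n
  proof -
    define q where "q = (m k - l k) / (real n + 3)"
    have "q \<le> (m k - l k) / 3" unfolding q_def
      by (rule divide_left_mono) (use lm[OF that] in auto)
    moreover have "q > 0" using lm[OF that] by (simp add: q_def)
    moreover have "a k n = l k + q" "b k n = m k - q" by (auto simp: a_def b_def q_def)
    ultimately show "l k < a k n" "a k n \<le> b k n" "b k n < m k" using lm[OF that] by simp_all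
  qed
  have le: "ennreal (\<Sum>k\<in>I. dist (c k (a k n)) (c k (b k n))) \<le> hausdorff_length A" for n
  proof (rule hausdorff_length_ge_compact[where C = "\<lambda>k. c k ` {a k n..b k n}"])
    fix k assume k: "k \<in> I"
    have s: "{a k n..b k n} \<subseteq> {l k<..<m k}" using ab[OF k, of n] by auto
    then have "continuous_on {a k n..b k n} (c k)"
      by (intro continuous_on_subset[OF cont[OF k]]) auto
    then show "compact (c k ` {a k n..b k n})" "connected (c k ` {a k n..b k n})"
      by (auto intro!: compact_continuous_image connected_continuous_image)
    show "c k (a k n) \<in> c k ` {a k n..b k n} \<and> c k (b k n) \<in> c k ` {a k n..b k n}"
      using ab[OF k, of n] by auto
    show "c k ` {a k n..b k n} \<subseteq> A" using s sub[OF k] by blast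
    fix j assume j: "j \<in> I" "k \<noteq> j"
    have "{a j n..b j n} \<subseteq> {l j<..<m j}" using ab[OF j(1), of n] by auto
    then show "c k ` {a k n..b k n} \<inter> c j ` {a j n..b j n} = {}" using disj[OF k j] s by blast
  qed (rule I)
  have lim0: "(\<lambda>n. (m k - l k) / (real n + 3)) \<longlonglongrightarrow> 0" for k
    by (intro real_tendsto_divide_at_top[OF tendsto_const]) real_asymp
  have "(\<lambda>n. dist (c k (a k n)) (c k (b k n))) \<longlonglongrightarrow> dist (c k (l k)) (c k (m k))" if k: "k \<in> I" for k
  proof (intro tendsto_dist)
    have "(\<lambda>n. a k n) \<longlonglongrightarrow> l k" "(\<lambda>n. b k n) \<longlonglongrightarrow> m k"
      unfolding a_def b_def using tendsto_add[OF tendsto_const lim0, of "l k" k] tendsto_diff[OF tendsto_const lim0, of "m k" k] by auto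
    moreover have "\<forall>n. a k n \<in> {l k..m k}" "\<forall>n. b k n \<in> {l k..m k}"
      using ab[OF k] by (meson atLeastAtMost_iff less_imp_le order.trans)+
    moreover have "l k \<in> {l k..m k}" "m k \<in> {l k..m k}" using lm[OF k] by auto
    ultimately show "(\<lambda>n. c k (a k n)) \<longlonglongrightarrow> c k (l k)" "(\<lambda>n. c k (b k n)) \<longlonglongrightarrow> c k (m k)"
      by (auto intro!: continuous_on_tendsto_compose[OF cont[OF k]])
  qed
  then have "(\<lambda>n. \<Sum>k\<in>I. dist (c k (a k n)) (c k (b k n))) \<longlonglongrightarrow> (\<Sum>k\<in>I. dist (c k (l k)) (c k (m k)))"
    by (intro tendsto_sum) auto
  then have "(\<lambda>n. ennreal (\<Sum>k\<in>I. dist (c k (a k n)) (c k (b k n)))) \<longlonglongrightarrow> ennreal (\<Sum>k\<in>I. dist (c k (l k)) (c k (m k)))"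
    by (rule tendsto_ennrealI)
  then show ?thesis using le by (intro LIMSEQ_le_const2) auto
qed

section \<open>Areas cut from unit cells by a graph\<close>

definition cell :: "int \<times> int \<Rightarrow> (real \<times> real) set" where
  "cell c = {(u, v). real_of_int (fst c) \<le> u \<and> u < real_of_int (fst c) + 1
                   \<and> real_of_int (snd c) \<le> v \<and> v < real_of_int (snd c) + 1}"

lemma mem_cell: "(u, v) \<in> cell c \<longleftrightarrow> \<lfloor>u\<rfloor> = fst c \<and> \<lfloor>v\<rfloor> = snd c"
  by (auto simp: cell_def floor_eq_iff)

lemma cell_disjoint: "c \<noteq> d \<Longrightarrow> cell c \<inter> cell d = {}"
  by (auto simp: mem_cell prod_eq_iff)

lemma cell_eq_Times: "cell c = {real_of_int (fst c)..<real_of_int (fst c) + 1} \<times> {real_of_int (snd c)..<real_of_int (snd c) + 1}"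
  by (auto simp: cell_def)

lemma cell_borel [measurable]: "cell c \<in> sets borel"
  unfolding cell_eq_Times by (intro borel_Times) auto

lemma emeasure_lborel_Times:
  fixes A B :: "real set"
  assumes "A \<in> sets borel" "B \<in> sets borel"
  shows "emeasure lborel (A \<times> B) = emeasure lborel A * emeasure lborel B"
  using assms by (subst lborel_prod[symmetric]) (auto simp: lborel.emeasure_pair_measure_Times)

lemma emeasure_cell: "emeasure lborel (cell c) = 1"
  by (simp add: cell_eq_Times emeasure_lborel_Times)

lemma measure_cell: "measure lborel (cell c) = 1"
  by (simp add: measure_def emeasure_cell)

lemma measure_cell_Int_le: "measure lborel (cell c \<inter> X) \<le> 1"
proof (cases "cell c \<inter> X \<in> sets lborel")
  case True
  then have "measure lborel (cell c \<inter> X) \<le> measure lborel (cell c)"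
    by (intro measure_mono_fmeasurable) (auto simp: fmeasurable_def emeasure_cell)
  then show ?thesis by (simp add: measure_cell)
next
  case False
  then show ?thesis by (simp add: measure_notin_sets)
qed

lemma emeasure_trapezoid:
  fixes i a b c d :: real
  assumes "a \<le> c" "a + b \<le> c + d"
  defines "S \<equiv> {(u, v). i \<le> u \<and> u \<le> i + 1 \<and> a + b * (u - i) \<le> v \<and> v \<le> c + d * (u - i)}"
  shows "emeasure lborel S = ennreal ((c + d / 2) - (a + b / 2))" "S \<in> sets borel"
proof -
  have le: "a + b * (u - i) \<le> c + d * (u - i)" if "i \<le> u" "u \<le> i + 1" for u
  proof -
    have "0 \<le> (c - a) * (1 - (u - i)) + (c + d - a - b) * (u - i)" using that assms by auto
    then show ?thesis by (simp add: algebra_simps)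
  qed
  have cl: "closed S" unfolding S_def case_prod_beta
    by (intro closed_Collect_conj closed_Collect_le continuous_intros)
  then show S: "S \<in> sets borel" by auto
  have "emeasure lborel S = emeasure (lborel \<Otimes>\<^sub>M lborel) S" by (simp add: lborel_prod)
  also have "\<dots> = (\<integral>\<^sup>+u. emeasure lborel (Pair u -` S) \<partial>lborel)"
    by (rule lborel.emeasure_pair_measure_alt) (use S in \<open>simp only: lborel_prod sets_lborel\<close>)
  also have "\<dots> = (\<integral>\<^sup>+u. ennreal ((c + d * (u - i)) - (a + b * (u - i))) * indicator {i..i+1} u \<partial>lborel)"
  proof (intro nn_integral_cong)
    fix u
    have "Pair u -` S = (if i \<le> u \<and> u \<le> i + 1 then {a + b * (u - i)..c + d * (u - i)} else {})"
      by (auto simp: S_def)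
    then show "emeasure lborel (Pair u -` S) = ennreal ((c + d * (u - i)) - (a + b * (u - i))) * indicator {i..i+1} u"
      using le[of u] by (auto simp: indicator_def)
  qed
  also have "\<dots> = ennreal ((c * (i + 1) + d * (i + 1 - i)\<^sup>2 / 2 - a * (i + 1) - b * (i + 1 - i)\<^sup>2 / 2)
       - (c * i + d * (i - i)\<^sup>2 / 2 - a * i - b * (i - i)\<^sup>2 / 2))"
    by (intro nn_integral_FTC_Icc[where F = "\<lambda>u. c * u + d * (u - i)\<^sup>2 / 2 - a * u - b * (u - i)\<^sup>2 / 2"])
       (auto intro!: derivative_eq_intros simp: le, simp add: field_simps)
  also have "\<dots> = ennreal ((c + d / 2) - (a + b / 2))" by (simp add: algebra_simps)
  finally show "emeasure lborel S = ennreal ((c + d / 2) - (a + b / 2))" .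
qed

text \<open>These are the rows that a monotone graph can meet over column \<open>i\<close>. The
  closed inequalities admit too many rows, which is harmless: \<open>column_bound\<close> estimates
  the area of a union and does not count cells.\<close>

definition hits :: "(real \<Rightarrow> real) \<Rightarrow> int \<Rightarrow> int set" where
  "hits f i = {j. min (f i) (f (i + 1)) - 1 \<le> real_of_int j \<and> real_of_int j \<le> max (f i) (f (i + 1))}"

lemma finite_hits: "finite (hits f i)"
proof (rule finite_subset)
  show "hits f i \<subseteq> {\<lceil>min (f i) (f (i + 1)) - 1\<rceil>..\<lfloor>max (f i) (f (i + 1))\<rfloor>}"
    by (clarsimp simp: hits_def le_floor_iff simp del: ceiling_diff_one) linarith
qed simp

text \<open>The pieces in the different cells of a column are disjoint, and all lie in the trapezoid
  between the affine minorant and the top of the highest cell in question. For \<open>s = -1\<close>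
  the picture is reflected.\<close>

lemma column_bound:
  fixes f :: "real \<Rightarrow> real" and i :: int
  assumes s: "s = 1 \<or> s = -1"
    and lin: "\<And>u. real_of_int i \<le> u \<Longrightarrow> u \<le> real_of_int i + 1 \<Longrightarrow> a + b * (u - i) \<le> s * f u"
  shows "(\<Sum>j\<in>hits f i. measure lborel (cell (i, j) \<inter> {(u, v). 0 \<le> s * (v - f u)}))
     \<le> max (s * f i) (s * f (i + 1)) + 1 - (a + b / 2)"
proof -
  define M where "M = max (s * f i) (s * f (i + 1)) + 1"
  define S where "S = (if s = 1 then {(u, v). real_of_int i \<le> u \<and> u \<le> real_of_int i + 1 \<and> a + b * (u - i) \<le> v \<and> v \<le> M + 0 * (u - i)}
     else {(u, v). real_of_int i \<le> u \<and> u \<le> real_of_int i + 1 \<and> (-M) + 0 * (u - i) \<le> v \<and> v \<le> (- a) + (- b) * (u - i)})"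
  have ends: "a \<le> M" "a + b \<le> M" using lin[of i] lin[of "i + 1"] by (auto simp: M_def)
  have em: "emeasure lborel S = ennreal (M - (a + b / 2))" and Sm: "S \<in> sets lborel"
    using s emeasure_trapezoid[of a M b 0 i] emeasure_trapezoid[of "-M" "-a" 0 "-b" i] ends
    by (auto simp: S_def)
  define X where "X j = cell (i, j) \<inter> {(u, v). 0 \<le> s * (v - f u)}" for j
  define J where "J = {j\<in>hits f i. X j \<in> sets lborel}"
  have sub: "X j \<subseteq> S" if "j \<in> hits f i" for j
  proof (clarsimp simp: X_def, goal_cases)
    case (1 u v)
    have u: "real_of_int i \<le> u" "u \<le> real_of_int i + 1" "real_of_int j \<le> v" "v \<le> j + 1"
      using 1 by (auto simp: cell_def)
    have "min (f i) (f (real_of_int i + 1)) - 1 \<le> v" "v \<le> max (f i) (f (real_of_int i + 1)) + 1"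
      using that u by (auto simp: hits_def)
    moreover have "max (- f i) (- f (real_of_int i + 1)) = - min (f i) (f (real_of_int i + 1))" by linarith
    ultimately have "s * v \<le> M"
      using s by (auto simp: M_def)
    moreover have "a + b * (u - i) \<le> s * v" using lin[OF u(1,2)] 1 by (simp add: algebra_simps)
    ultimately show ?case using s u by (elim disjE) (simp_all add: S_def)
  qed
  have fin: "finite J" by (simp add: J_def finite_hits)
  have "(\<Sum>j\<in>hits f i. measure lborel (X j)) = (\<Sum>j\<in>J. measure lborel (X j))"
    by (intro sum.mono_neutral_right) (auto simp: finite_hits J_def measure_notin_sets)
  also have "\<dots> = measure lborel (\<Union>j\<in>J. X j)"
  proof (rule measure_finite_Union[symmetric])
    show "disjoint_family_on X J"
      unfolding disjoint_family_on_def
    proof (intro ballI impI)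
      fix j j' :: int assume "j \<noteq> j'"
      then have "cell (i, j) \<inter> cell (i, j') = {}" by (intro cell_disjoint) simp
      then show "X j \<inter> X j' = {}" unfolding X_def by blast
    qed
    show "X ` J \<subseteq> sets lborel" by (auto simp: J_def)
    fix j assume "j \<in> J"
    then have "emeasure lborel (X j) \<le> emeasure lborel S" using emeasure_mono[OF sub Sm] by (simp add: J_def)
    then show "emeasure lborel (X j) \<noteq> \<infinity>" by (auto simp: em top_unique)
  qed (rule fin)
  also have "\<dots> \<le> measure lborel S"
  proof (rule measure_mono_fmeasurable)
    show "(\<Union>j\<in>J. X j) \<subseteq> S" using sub by (auto simp: J_def)
    show "(\<Union>j\<in>J. X j) \<in> sets lborel" using fin by (intro sets.finite_UN) (simp_all add: J_def)
    show "S \<in> fmeasurable lborel" using Sm em by (simp add: fmeasurable_def)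
  qed
  also have "\<dots> = M - (a + b / 2)" using ends by (simp add: measure_def em)
  finally show ?thesis by (simp add: X_def M_def)
qed

text \<open>If \<open>s * f\<close> is concave, its chord over the column is an affine minorant, and
  the column costs 1 plus half of its increment. If it is convex, the chord of the preceding column,
  prolonged, lies below the graph; the loss is the change of slope, which telescopes to at most
  \<open>2 * L\<close>, and half of it enters.\<close>

lemma column_area:
  fixes f :: "real \<Rightarrow> real" and m :: int
  assumes s: "s = 1 \<or> s = -1" and L: "0 \<le> L"
    and cv: "convex_on {p..q} f \<or> concave_on {p..q} f"
    and lip: "\<And>x y. x \<in> {p..q} \<Longrightarrow> y \<in> {p..q} \<Longrightarrow> \<bar>f x - f y\<bar> \<le> L * \<bar>x - y\<bar>"
    and mono: "mono_on {p..q} f \<or> antimono_on {p..q} f"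
    and mN: "p \<le> real_of_int m" "real_of_int m + real N \<le> q"
  shows "(\<Sum>k<N. \<Sum>j\<in>hits f (m + int k). measure lborel (cell (m + int k, j) \<inter> {(u, v). 0 \<le> s * (v - f u)}))
      \<le> real N + \<bar>f q - f p\<bar> / 2 + L"
proof -
  define g where "g u = s * f u" for u
  define D where "D k = g (m + int k + 1) - g (m + int k)" for k
  \<comment> \<open>\<open>D k - e k\<close> is the slope of the minorant used in column
    \<open>k\<close>. The first column of a convex graph has no predecessor and takes the slope
    \<open>- L\<close> from the Lipschitz bound.\<close>
  define e where "e k = (if concave_on {p..q} g then 0 else if k = 0 then D 0 + L else D k - D (k - 1))" for k :: nat
  have inI: "real_of_int (m + int k) \<in> {p..q}" "real_of_int (m + int k) + 1 \<in> {p..q}" if "k < N" for k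
  proof -
    have "real (Suc k) \<le> real N" using that by (simp only: of_nat_le_iff)
    then have "real k + 1 \<le> real N" by simp
    then show "real_of_int (m + int k) \<in> {p..q}" "real_of_int (m + int k) + 1 \<in> {p..q}" using mN by auto
  qed
  have glip: "\<bar>g x - g y\<bar> \<le> L * \<bar>x - y\<bar>" if "x \<in> {p..q}" "y \<in> {p..q}" for x y
    using lip[OF that] s by (auto simp: g_def)
  have gcv: "convex_on {p..q} g \<or> concave_on {p..q} g"
    using cv s by (auto simp: g_def[abs_def] concave_on_def)
  have step: "(\<Sum>j\<in>hits f (m + int k). measure lborel (cell (m + int k, j) \<inter> {(u, v). 0 \<le> s * (v - f u)}))
      \<le> 1 + \<bar>D k\<bar> / 2 + e k / 2" if k: "k < N" for k
  proof -
    define i where "i = m + int k"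
    have lin: "g i + (D k - e k) * (u - i) \<le> g u" if u: "real_of_int i \<le> u" "u \<le> i + 1" for u
    proof -
      have uI: "u \<in> {p..q}" using u inI[OF k] by (auto simp: i_def)
      consider (cc) "concave_on {p..q} g" | (c0) "\<not> concave_on {p..q} g" "k = 0" | (cs) "\<not> concave_on {p..q} g" "k > 0" by auto
      then show ?thesis
      proof cases
        case cc
        have "g ((1 - (u - i)) *\<^sub>R real_of_int i + (u - i) *\<^sub>R (real_of_int i + 1)) \<ge> (1 - (u - i)) * g i + (u - i) * g (real_of_int i + 1)"
          using inI[OF k] u by (intro concave_onD[OF cc]) (auto simp: i_def)
        moreover have "(1 - (u - i)) *\<^sub>R real_of_int i + (u - i) *\<^sub>R (real_of_int i + 1) = u" by (simp add: algebra_simps)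
        ultimately show ?thesis using cc by (simp add: e_def D_def i_def algebra_simps)
      next
        case c0
        have "\<bar>g u - g i\<bar> \<le> L * \<bar>u - i\<bar>" using glip uI inI[OF k] by (auto simp: i_def)
        then show ?thesis using c0 u by (simp add: e_def algebra_simps)
      next
        case cs
        then have cv': "convex_on {p..q} g" using gcv by auto
        have k1: "k - 1 < N" using k by auto
        have sh: "real_of_int (m + int (k - 1) + 1) = i" "real_of_int (m + int (k - 1)) = real_of_int i - 1"
          using cs by (auto simp: i_def of_nat_diff)
        have "D (k - 1) = g i - g (real_of_int i - 1)" by (simp only: D_def sh)
        then have ee: "D k - e k = g i - g (real_of_int i - 1)" using cs by (simp add: e_def)
        have i1: "real_of_int i - 1 \<in> {p..q}" using inI(1)[OF k1] unfolding sh(2) .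
        define \<theta> where "\<theta> = 1 / (1 + (u - i))"
        have th: "0 \<le> \<theta>" "\<theta> \<le> 1" using u by (auto simp: \<theta>_def)
        have "g ((1 - \<theta>) *\<^sub>R (real_of_int i - 1) + \<theta> *\<^sub>R u) \<le> (1 - \<theta>) * g (real_of_int i - 1) + \<theta> * g u"
          using i1 uI th by (intro convex_onD[OF cv']) auto
        moreover have th1: "\<theta> * (1 + (u - i)) = 1" using u by (simp add: \<theta>_def)
        then have "(1 - \<theta>) *\<^sub>R (real_of_int i - 1) + \<theta> *\<^sub>R u = real_of_int i" by (simp add: algebra_simps)
        ultimately have "g i \<le> (1 - \<theta>) * g (real_of_int i - 1) + \<theta> * g u" by simp
        then have "g i * (1 + (u - i)) \<le> ((1 - \<theta>) * g (real_of_int i - 1) + \<theta> * g u) * (1 + (u - i))"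
          using u by (intro mult_right_mono) auto
        also have "\<dots> = (1 + (u - i) - \<theta> * (1 + (u - i))) * g (real_of_int i - 1) + \<theta> * (1 + (u - i)) * g u"
          by (simp add: algebra_simps)
        also have "\<dots> = (u - i) * g (real_of_int i - 1) + g u" unfolding th1 by simp
        finally have "g i * (1 + (u - i)) \<le> (u - i) * g (real_of_int i - 1) + g u" .
        then show ?thesis unfolding ee by (simp add: algebra_simps)
      qed
    qed
    have "(\<Sum>j\<in>hits f i. measure lborel (cell (i, j) \<inter> {(u, v). 0 \<le> s * (v - f u)}))
      \<le> max (s * f i) (s * f (i + 1)) + 1 - (g i + (D k - e k) / 2)"
      using lin by (intro column_bound[OF s]) (auto simp: g_def)
    also have "\<dots> = 1 + \<bar>D k\<bar> / 2 + e k / 2"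
      by (auto simp: g_def D_def i_def max_def abs_if field_simps)
    finally show ?thesis by (simp add: i_def)
  qed
  have esum: "(\<Sum>k<n. e k) \<le> 2 * L" if "n \<le> N" for n
  proof -
    have DL: "\<bar>D k\<bar> \<le> L" if "k < N" for k using glip[OF inI(2)[OF that] inI(1)[OF that]] by (simp add: D_def)
    show ?thesis
    proof (cases "concave_on {p..q} g")
      case True then show ?thesis using L by (simp add: e_def)
    next
      case False
      have "(\<Sum>k<Suc n. e k) = D n + L" for n
        using False by (induction n) (auto simp: e_def)
      then show ?thesis using DL[of "n - 1"] that L by (cases n) auto
    qed
  qed
  have Dsum: "(\<Sum>k<N. \<bar>D k\<bar>) \<le> \<bar>f q - f p\<bar>"
  proof -
    have ad: "\<bar>D k\<bar> = \<bar>f (m + int k + 1) - f (m + int k)\<bar>" for k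
      using s by (auto simp: D_def g_def)
    have mq: "real_of_int m \<in> {p..q}" "real_of_int m + N \<in> {p..q}" "p \<in> {p..q}" "q \<in> {p..q}" using mN by auto
    have tel: "(\<Sum>k<N. f (m + int k + 1) - f (m + int k)) = f (m + N) - f m"
      using sum_lessThan_telescope[of "\<lambda>k. f (m + int k)" N] by (simp add: add.commute add.left_commute)
    from mono show ?thesis
    proof
      assume mo: "mono_on {p..q} f"
      have "(\<Sum>k<N. \<bar>D k\<bar>) = (\<Sum>k<N. f (m + int k + 1) - f (m + int k))"
        unfolding ad using inI mono_onD[OF mo] by (intro sum.cong refl abs_of_nonneg) (auto simp: )
      then show ?thesis using tel mono_onD[OF mo mq(3,1)] mono_onD[OF mo mq(2,4)] mq by auto
    next
      assume mo: "antimono_on {p..q} f"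
      have "(\<Sum>k<N. \<bar>D k\<bar>) = - (\<Sum>k<N. f (m + int k + 1) - f (m + int k))"
        unfolding ad sum_negf[symmetric] using inI monotone_onD[OF mo] by (intro sum.cong refl abs_of_nonpos) (auto simp: )
      then show ?thesis using tel monotone_onD[OF mo mq(3,1)] monotone_onD[OF mo mq(2,4)] mq by auto
    qed
  qed
  have "(\<Sum>k<N. \<Sum>j\<in>hits f (m + int k). measure lborel (cell (m + int k, j) \<inter> {(u, v). 0 \<le> s * (v - f u)}))
      \<le> (\<Sum>k<N. 1 + \<bar>D k\<bar> / 2 + e k / 2)" by (intro sum_mono step) auto
  also have "\<dots> = real N + (\<Sum>k<N. \<bar>D k\<bar>) / 2 + (\<Sum>k<N. e k) / 2"
    by (simp add: sum.distrib sum_divide_distrib)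
  also have "\<dots> \<le> real N + \<bar>f q - f p\<bar> / 2 + L" using Dsum esum[of N] by simp
  finally show ?thesis .
qed

section \<open>The boundary circle in cylindrical coordinates\<close>

text \<open>\<open>r\<close> and \<open>s\<close> are the horizontal and the vertical component of
  the normal vector, whose longitude is taken to be 0 here. The linear form takes the values
  \<open>s\<close> and \<open>- s\<close> at the poles, so \<open>t_neq\<close> keeps the circle
  away from them.\<close>

locale cap_curve =
  fixes r s t :: real
  assumes r_pos: "0 < r" and rs: "r\<^sup>2 + s\<^sup>2 = 1" and t_less: "\<bar>t\<bar> < 1"
    and t_neq: "t \<noteq> s" "t \<noteq> - s"
begin

text \<open>At height h the circle satisfies r sqrt(1 - h^2) cos \<theta> = t - s h.
  \<open>hmin\<close> and \<open>hmax\<close> are its extreme heights, \<open>ang\<close> is the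
  solution \<theta> in [0, pi], the other being its negative, and \<open>disc\<close> is the square
  of r sqrt(1 - h^2) sin \<theta>. \<open>dang\<close> is the derivative of \<open>ang\<close>, and
  \<open>dnum\<close> the numerator of the second derivative, over a positive denominator.\<close>

definition "hmin = t * s - r * sqrt (1 - t\<^sup>2)"
definition "hmax = t * s + r * sqrt (1 - t\<^sup>2)"
definition "disc h = r\<^sup>2 * (1 - t\<^sup>2) - (h - t * s)\<^sup>2"
definition "ang h = arccos ((t - s * h) / (r * sqrt (1 - h\<^sup>2)))"
definition "dang h = (s - t * h) / ((1 - h\<^sup>2) * sqrt (disc h))"
definition "dnum h = - t * (1 - h\<^sup>2) * disc h + (s - t * h) * (2 * h * disc h + (1 - h\<^sup>2) * (h - t * s))"

lemma t2: "t\<^sup>2 < 1" using t_less by (simp add: abs_square_less_1)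

lemma s2: "s\<^sup>2 < 1" using rs r_pos by (smt (verit) zero_less_power)

lemma disc_alt: "disc h = r\<^sup>2 * (1 - h\<^sup>2) - (t - s * h)\<^sup>2"
proof -
  have "r\<^sup>2 = 1 - s\<^sup>2" using rs by simp
  then show ?thesis unfolding disc_def by (simp only:) (simp add: power2_eq_square algebra_simps)
qed

lemma disc_factor: "disc h = (hmax - h) * (h - hmin)"
proof -
  have "sqrt (1 - t\<^sup>2) * sqrt (1 - t\<^sup>2) = 1 - t\<^sup>2" using t2 by simp
  then have "r * sqrt (1 - t\<^sup>2) * (r * sqrt (1 - t\<^sup>2)) = r\<^sup>2 * (1 - t\<^sup>2)"
    by (simp add: power2_eq_square mult.assoc mult.left_commute)
  then show ?thesis by (simp add: disc_def hmax_def hmin_def power2_eq_square algebra_simps)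
qed

lemma hmin_less_hmax: "hmin < hmax"
  using r_pos t2 by (simp add: hmin_def hmax_def)

lemma ts_less: "\<bar>t * s\<bar> < 1"
proof -
  have "\<bar>s\<bar> < 1" using s2 by (simp add: abs_square_less_1)
  then show ?thesis using t_less by (metis abs_ge_zero abs_mult mult_strict_mono' mult_1)
qed

text \<open>The squares of the two sides differ by (t - s)^2 for the upper pole and by (t + s)^2 for
  the lower one; strictness is therefore the statement that the circle misses the poles.\<close>

lemma hmax_less: "hmax < 1" and hmin_gr: "-1 < hmin"
proof -
  have sq: "(r * sqrt (1 - t\<^sup>2))\<^sup>2 = (1 - s\<^sup>2) * (1 - t\<^sup>2)"
    using rs t2 by (simp add: power_mult_distrib)
  have "(1 - t * s)\<^sup>2 = (1 - s\<^sup>2) * (1 - t\<^sup>2) + (t - s)\<^sup>2" "(1 + t * s)\<^sup>2 = (1 - s\<^sup>2) * (1 - t\<^sup>2) + (t + s)\<^sup>2"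
    by (simp_all add: power2_eq_square algebra_simps)
  moreover have "(t - s)\<^sup>2 > 0" "(t + s)\<^sup>2 > 0" using t_neq by (auto simp: add_eq_0_iff)
  ultimately have "(r * sqrt (1 - t\<^sup>2))\<^sup>2 < (1 - t * s)\<^sup>2" "(r * sqrt (1 - t\<^sup>2))\<^sup>2 < (1 + t * s)\<^sup>2"
    using sq by linarith+
  then have "r * sqrt (1 - t\<^sup>2) < 1 - t * s" "r * sqrt (1 - t\<^sup>2) < 1 + t * s"
    using ts_less by (auto intro: power2_less_imp_less)
  then show "hmax < 1" "-1 < hmin" by (auto simp: hmax_def hmin_def)
qed

lemma h_range: assumes "hmin \<le> h" "h \<le> hmax" shows "-1 < h" "h < 1" "h\<^sup>2 < 1" "0 < 1 - h\<^sup>2"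
proof -
  show "-1 < h" "h < 1" using assms hmin_gr hmax_less by linarith+
  then show "h\<^sup>2 < 1" "0 < 1 - h\<^sup>2" by (auto simp: abs_square_less_1)
qed

lemma disc_nonneg: "hmin \<le> h \<Longrightarrow> h \<le> hmax \<Longrightarrow> 0 \<le> disc h"
  by (simp add: disc_factor)

lemma disc_pos: "hmin < h \<Longrightarrow> h < hmax \<Longrightarrow> 0 < disc h"
  by (simp add: disc_factor)

lemma quot_square:
  assumes "\<bar>h\<bar> < 1"
  shows "1 - ((t - s * h) / (r * sqrt (1 - h\<^sup>2)))\<^sup>2 = disc h / (r * sqrt (1 - h\<^sup>2))\<^sup>2"
proof -
  define W where "W = (r * sqrt (1 - h\<^sup>2))\<^sup>2"
  have W: "W = r\<^sup>2 * (1 - h\<^sup>2)" "W > 0"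
    using assms r_pos abs_square_less_1[of h] by (simp_all add: W_def power_mult_distrib)
  show ?thesis unfolding disc_alt power_divide W_def[symmetric] W(1)[symmetric]
    using W(2) by (simp add: field_simps)
qed

lemma quot_bounds:
  assumes "hmin \<le> h" "h \<le> hmax"
  shows "-1 \<le> (t - s * h) / (r * sqrt (1 - h\<^sup>2))" "(t - s * h) / (r * sqrt (1 - h\<^sup>2)) \<le> 1"
proof -
  have "((t - s * h) / (r * sqrt (1 - h\<^sup>2)))\<^sup>2 \<le> 1"
    using quot_square[of h] h_range[OF assms] disc_nonneg[OF assms]
    by (smt (verit) divide_nonneg_nonneg zero_le_power2)
  then have "\<bar>(t - s * h) / (r * sqrt (1 - h\<^sup>2))\<bar> \<le> 1" by (simp add: abs_square_le_1)
  then show "-1 \<le> (t - s * h) / (r * sqrt (1 - h\<^sup>2))" "(t - s * h) / (r * sqrt (1 - h\<^sup>2)) \<le> 1" by linarith+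
qed

lemma rad_pos: "hmin \<le> h \<Longrightarrow> h \<le> hmax \<Longrightarrow> 0 < r * sqrt (1 - h\<^sup>2)"
  using h_range r_pos by simp

lemma ang_bounds: "hmin \<le> h \<Longrightarrow> h \<le> hmax \<Longrightarrow> 0 \<le> ang h \<and> ang h \<le> pi"
  unfolding ang_def using quot_bounds by (simp add: arccos_lbound arccos_ubound)

lemma cos_ang: "hmin \<le> h \<Longrightarrow> h \<le> hmax \<Longrightarrow> r * sqrt (1 - h\<^sup>2) * cos (ang h) = t - s * h"
  unfolding ang_def using quot_bounds[of h] rad_pos[of h]
  by (subst cos_arccos) (simp_all only: nonzero_mult_div_cancel_left times_divide_eq_right less_imp_neq[THEN not_sym] not_False_eq_True)

lemma sin_ang:
  assumes "hmin \<le> h" "h \<le> hmax"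
  shows "r * sqrt (1 - h\<^sup>2) * sin (ang h) = sqrt (disc h)"
proof -
  have "sin (ang h) = sqrt (1 - ((t - s * h) / (r * sqrt (1 - h\<^sup>2)))\<^sup>2)"
    unfolding ang_def using quot_bounds[OF assms] by (simp add: sin_arccos)
  also have "\<dots> = sqrt (disc h) / (r * sqrt (1 - h\<^sup>2))"
    using quot_square[of h] h_range[OF assms] rad_pos[OF assms] by (simp add: real_sqrt_divide abs_less_iff)
  finally show ?thesis using rad_pos[OF assms]
    by (simp only: nonzero_mult_div_cancel_left times_divide_eq_right less_imp_neq[THEN not_sym] not_False_eq_True)
qed

lemma ang_strict: assumes "hmin < h" "h < hmax" shows "0 < ang h" "ang h < pi"
proof -
  have "sin (ang h) \<noteq> 0" using sin_ang[of h] disc_pos[OF assms] assms by auto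
  then have "ang h \<noteq> 0" "ang h \<noteq> pi" by auto
  then show "0 < ang h" "ang h < pi" using ang_bounds[of h] assms by auto
qed

lemma continuous_ang: "continuous_on {hmin..hmax} ang"
  unfolding ang_def[abs_def]
proof (intro continuous_intros ballI)
  fix h assume h: "h \<in> {hmin..hmax}"
  show "r * sqrt (1 - h\<^sup>2) \<noteq> 0" using rad_pos[of h] h by auto
  show "-1 \<le> (t - s * h) / (r * sqrt (1 - h\<^sup>2)) \<and> (t - s * h) / (r * sqrt (1 - h\<^sup>2)) \<le> 1"
    using quot_bounds[of h] h by auto
qed

lemma deriv_ang:
  assumes "hmin < h" "h < hmax"
  shows "(ang has_real_derivative dang h) (at h)"
proof -
  define S where "S = sqrt (1 - h\<^sup>2)"
  have hr: "0 < 1 - h\<^sup>2" "\<bar>h\<bar> < 1" using h_range[of h] assms by auto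
  have S: "S > 0" "S\<^sup>2 = 1 - h\<^sup>2" using hr by (auto simp: S_def)
  define g where "g = (\<lambda>h. (t - s * h) / (r * sqrt (1 - h\<^sup>2)))"
  have "(g has_real_derivative ((- s) * (r * S) - (t - s * h) * (r * (- (h / S)))) / (r * S * (r * S))) (at h)"
    unfolding g_def using hr r_pos
    by (auto intro!: derivative_eq_intros simp: S_def[symmetric] S(1)[THEN less_imp_neq, THEN not_sym] field_simps)
  moreover have "((- s) * (r * S) - (t - s * h) * (r * (- (h / S)))) / (r * S * (r * S)) = (t * h - s) / (r * S ^ 3)"
  proof -
    have "((- s) * (r * S) - (t - s * h) * (r * (- (h / S)))) * S = r * (- s * S\<^sup>2 + (t - s * h) * h)"
      using S(1) by (simp add: field_simps power2_eq_square)
    also have "\<dots> = r * (t * h - s)" unfolding S(2) by (simp add: algebra_simps power2_eq_square)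
    finally show ?thesis using S(1) r_pos by (simp add: divide_simps power3_eq_cube)
  qed
  ultimately have dg: "(g has_real_derivative (t * h - s) / (r * S ^ 3)) (at h)" by simp
  have q: "1 - (g h)\<^sup>2 = disc h / (r * S)\<^sup>2" using quot_square[OF hr(2)] by (simp add: g_def S_def)
  have "0 < 1 - (g h)\<^sup>2" unfolding q using disc_pos[OF assms] S r_pos by simp
  then have "\<bar>g h\<bar> < 1" by (simp add: abs_square_less_1)
  then have g1: "-1 < g h" "g h < 1" by auto
  have "((\<lambda>h. arccos (g h)) has_real_derivative inverse (- sqrt (1 - (g h)\<^sup>2)) * ((t * h - s) / (r * S ^ 3))) (at h)"
    by (rule DERIV_chain2[OF DERIV_arccos[OF g1] dg])
  moreover have "inverse (- sqrt (1 - (g h)\<^sup>2)) * ((t * h - s) / (r * S ^ 3)) = dang h"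
  proof -
    have "sqrt (1 - (g h)\<^sup>2) = sqrt (disc h) / (r * S)" unfolding q using S r_pos by (simp add: real_sqrt_divide)
    moreover define E where "E = sqrt (disc h)"
    moreover have "E > 0" using disc_pos[OF assms] by (simp add: E_def)
    ultimately show ?thesis using S(1) r_pos unfolding dang_def S(2)[symmetric] E_def[symmetric]
      by (simp add: field_simps power2_eq_square power3_eq_cube)
  qed
  ultimately show ?thesis by (simp add: ang_def[abs_def] g_def)
qed

lemma deriv_dang:
  assumes "hmin < h" "h < hmax"
  shows "(dang has_real_derivative dnum h / ((1 - h\<^sup>2)\<^sup>2 * disc h * sqrt (disc h))) (at h)"
proof -
  have hr: "0 < 1 - h\<^sup>2" "0 < disc h" using h_range[of h] disc_pos assms by auto
  have dd: "(disc has_real_derivative - 2 * (h - t * s)) (at h)"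
    unfolding disc_def[abs_def] by (auto intro!: derivative_eq_intros)
  define S where "S = sqrt (disc h)"
  have S: "S > 0" "disc h = S * S" using hr by (auto simp: S_def)
  have "((\<lambda>h. sqrt (disc h)) has_real_derivative - (h - t * s) / S) (at h)"
    using hr by (auto intro!: derivative_eq_intros dd simp: S_def field_simps)
  moreover have "((\<lambda>h. 1 - h\<^sup>2) has_real_derivative - 2 * h) (at h)" by (auto intro!: derivative_eq_intros)
  ultimately have "((\<lambda>h. (1 - h\<^sup>2) * sqrt (disc h)) has_real_derivative (- 2 * h * S + (1 - h\<^sup>2) * (- (h - t * s) / S))) (at h)"
    by (intro DERIV_cong[OF DERIV_mult]) (auto simp: S_def)
  moreover have "((\<lambda>h. s - t * h) has_real_derivative - t) (at h)" by (auto intro!: derivative_eq_intros)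
  ultimately have "((\<lambda>h. (s - t * h) / ((1 - h\<^sup>2) * sqrt (disc h))) has_real_derivative
     ((- t) * ((1 - h\<^sup>2) * S) - (s - t * h) * (- 2 * h * S + (1 - h\<^sup>2) * (- (h - t * s) / S))) / (((1 - h\<^sup>2) * S) * ((1 - h\<^sup>2) * S))) (at h)"
    using hr by (intro DERIV_cong[OF DERIV_divide]) (auto simp: S_def)
  moreover have "((- t) * ((1 - h\<^sup>2) * S) - (s - t * h) * (- 2 * h * S + (1 - h\<^sup>2) * (- (h - t * s) / S))) / (((1 - h\<^sup>2) * S) * ((1 - h\<^sup>2) * S))
      = dnum h / ((1 - h\<^sup>2)\<^sup>2 * disc h * S)"
  proof -
    define w where "w = 1 - h\<^sup>2"
    have w: "w > 0" using hr by (simp add: w_def)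
    show ?thesis using S(1) w unfolding dnum_def w_def[symmetric] S(2)
      by (simp add: divide_simps power2_eq_square) (simp add: algebra_simps)
  qed
  ultimately show ?thesis by (simp add: dang_def[abs_def] S_def)
qed

section \<open>Bounds for the number of break points by degrees of polynomials\<close>

lemma card_poly_zeros_le:
  fixes p :: "real poly"
  assumes "p \<noteq> 0" "degree p \<le> n" "A \<subseteq> {x. poly p x = 0}"
  shows "finite A" "card A \<le> n"
proof -
  have fin: "finite {x. poly p x = 0}" using assms(1) by (rule poly_roots_finite)
  show "finite A" using finite_subset[OF assms(3) fin] .
  show "card A \<le> n" using card_mono[OF fin assms(3)] card_poly_roots_bound[OF assms(1)] assms(2) by linarith
qed

definition "disc_poly = [: r\<^sup>2 * (1 - t\<^sup>2) - (t * s)\<^sup>2, 2 * t * s, - 1 :]"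

lemma poly_disc: "poly disc_poly h = disc h"
  by (simp add: disc_poly_def disc_def power2_eq_square algebra_simps)

lemma disc_one: "disc 1 = - (t - s)\<^sup>2" by (simp add: disc_alt)

text \<open>Squaring removes the root and leaves an equation of degree 6 whose two sides differ by
  (s - t)^2 at h = 1, so it is not an identity. The bound does not depend on the cap, which is what
  makes the final error term uniform.\<close>

lemma card_dang_eq:
  defines "A c \<equiv> {h \<in> {hmin<..<hmax}. dang h = c}"
  shows "finite (A c)" "card (A c) \<le> 6"
proof -
  define p where "p = [:s, - t:]\<^sup>2 - smult (c\<^sup>2) ([:1, 0, - 1:]\<^sup>2 * disc_poly)"
  have ev: "poly p h = (s - t * h)\<^sup>2 - c\<^sup>2 * ((1 - h\<^sup>2)\<^sup>2 * disc h)" for h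
    by (simp add: p_def poly_disc power2_eq_square algebra_simps)
  have "poly p 1 = (s - t)\<^sup>2" by (simp add: ev)
  then have p0: "p \<noteq> 0" using t_neq by auto
  have d: "degree disc_poly \<le> 2" "degree [:s, - t:] \<le> 1" "degree [:1, 0, - 1::real:] \<le> 2"
    by (simp_all add: disc_poly_def)
  have "degree ([:1, 0, - 1:]\<^sup>2 * disc_poly) \<le> 6"
    using d degree_mult_le[of "[:1, 0, - 1:]\<^sup>2" disc_poly] degree_power_le[of "[:1, 0, - 1::real:]" 2] by linarith
  moreover have "degree ([:s, - t:]\<^sup>2) \<le> 6" using d degree_power_le[of "[:s,-t:]" 2] by linarith
  ultimately have "degree p \<le> 6"
    unfolding p_def by (intro degree_diff_le) (auto intro: order.trans[OF degree_smult_le])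
  moreover have "A c \<subseteq> {x. poly p x = 0}"
  proof
    fix h assume "h \<in> A c"
    then have h: "hmin < h" "h < hmax" "dang h = c" by (auto simp: A_def)
    have pos: "(1 - h\<^sup>2) * sqrt (disc h) > 0" using h_range[of h] disc_pos h by simp
    define M where "M = (1 - h\<^sup>2) * sqrt (disc h)"
    have "(s - t * h) / M = c" "M > 0" using h pos by (simp_all add: dang_def M_def)
    then have "s - t * h = c * ((1 - h\<^sup>2) * sqrt (disc h))" unfolding M_def[symmetric] by (simp add: field_simps)
    then have "(s - t * h)\<^sup>2 = c\<^sup>2 * ((1 - h\<^sup>2)\<^sup>2 * (sqrt (disc h))\<^sup>2)" by (simp add: power_mult_distrib)
    then show "h \<in> {x. poly p x = 0}" using disc_pos[of h] h by (simp add: ev)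
  qed
  ultimately show "finite (A c)" "card (A c) \<le> 6" using card_poly_zeros_le[OF p0] by blast+
qed

text \<open>The zeros are the possible inflections of the longitude. The polynomial has the value 2
  (t - s)^3 at h = 1 and hence does not vanish identically.\<close>

lemma card_dnum_zeros:
  defines "A \<equiv> {h. dnum h = 0}"
  shows "finite A" "card A \<le> 6"
proof -
  define p where "p = [:- t:] * [:1, 0, - 1:] * disc_poly + [:s, - t:] * ([:0, 2:] * disc_poly + [:1, 0, - 1:] * [:- (t * s), 1:])"
  have ev: "poly p h = dnum h" for h
    by (simp add: p_def poly_disc dnum_def power2_eq_square algebra_simps)
  have "poly p 1 = 2 * (t - s) ^ 3" by (simp add: ev dnum_def disc_one power2_eq_square power3_eq_cube algebra_simps)
  then have p0: "p \<noteq> 0" using t_neq by auto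
  have d: "degree disc_poly \<le> 2" "degree [:s, - t:] \<le> 1" "degree [:1, 0, - 1::real:] \<le> 2" "degree [:0, 2::real:] \<le> 1"
    "degree [:- (t * s), 1:] \<le> 1" "degree [:-t:] \<le> 0"
    by (simp_all add: disc_poly_def)
  have 1: "degree ([:0, 2:] * disc_poly) \<le> 5" "degree ([:1, 0, - 1:] * [:- (t * s), 1:]) \<le> 5"
     "degree ([:- t:] * [:1, 0, - 1:]) \<le> 2"
    using d degree_mult_le[of "[:0, 2:]" disc_poly] degree_mult_le[of "[:1, 0, - 1:]" "[:- (t * s), 1:]"]
      degree_mult_le[of "[:- t:]" "[:1, 0, - 1:]"] by linarith+
  have 2: "degree ([:0, 2:] * disc_poly + [:1, 0, - 1:] * [:- (t * s), 1:]) \<le> 5" by (intro degree_add_le 1)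
  have "degree p \<le> 6" unfolding p_def
  proof (intro degree_add_le)
    show "degree ([:- t:] * [:1, 0, - 1:] * disc_poly) \<le> 6"
      using degree_mult_le[of "[:- t:] * [:1, 0, - 1:]" disc_poly] d 1 by linarith
    show "degree ([:s, - t:] * ([:0, 2:] * disc_poly + [:1, 0, - 1:] * [:- (t * s), 1:])) \<le> 6"
      using degree_mult_le[of "[:s, - t:]" "[:0, 2:] * disc_poly + [:1, 0, - 1:] * [:- (t * s), 1:]"] d 2 by linarith
  qed
  moreover have "A \<subseteq> {x. poly p x = 0}" by (auto simp: A_def ev)
  ultimately show "finite A" "card A \<le> 6" using card_poly_zeros_le[OF p0] by blast+
qed

lemma dang_sign: assumes "hmin < h" "h < hmax" shows "0 < dang h \<longleftrightarrow> t * h < s" "dang h < 0 \<longleftrightarrow> s < t * h"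
proof -
  have "(1 - h\<^sup>2) * sqrt (disc h) > 0" using h_range[of h] disc_pos assms by simp
  then show "0 < dang h \<longleftrightarrow> t * h < s" "dang h < 0 \<longleftrightarrow> s < t * h"
    by (auto simp: dang_def zero_less_divide_iff divide_less_0_iff)
qed

lemma ang_mono:
  assumes "hmin \<le> x" "x \<le> y" "y \<le> hmax"
    and "\<And>h. x < h \<Longrightarrow> h < y \<Longrightarrow> t * h < s"
  shows "ang x \<le> ang y"
proof (cases "x = y")
  case False
  then have "x < y" using assms by auto
  then have "ang x < ang y"
  proof (rule DERIV_pos_imp_increasing_open)
    show "continuous_on {x..y} ang" using continuous_on_subset[OF continuous_ang] assms by auto
    fix h assume "x < h" "h < y"
    then show "\<exists>z. (ang has_real_derivative z) (at h) \<and> 0 < z"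
      using deriv_ang[of h] dang_sign[of h] assms by auto
  qed
  then show ?thesis by simp
qed simp

lemma ang_antimono:
  assumes "hmin \<le> x" "x \<le> y" "y \<le> hmax"
    and "\<And>h. x < h \<Longrightarrow> h < y \<Longrightarrow> s < t * h"
  shows "ang y \<le> ang x"
proof (cases "x = y")
  case False
  then have "x < y" using assms by auto
  then have "ang y < ang x"
  proof (rule DERIV_neg_imp_decreasing_open)
    show "continuous_on {x..y} ang" using continuous_on_subset[OF continuous_ang] assms by auto
    fix h assume "x < h" "h < y"
    then show "\<exists>z. (ang has_real_derivative z) (at h) \<and> z < 0"
      using deriv_ang[of h] dang_sign[of h] assms by auto
  qed
  then show ?thesis by simp
qed simp

text \<open>If the boundary circle separates the poles, its longitude is monotone; otherwise it turns
  around once, at height \<open>s / t\<close>, while staying in a half-circle of longitudes.\<close>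

lemma ang_variation:
  "\<exists>W. (\<forall>x y. hmin \<le> x \<longrightarrow> x \<le> y \<longrightarrow> y \<le> hmax \<longrightarrow> \<bar>ang y - ang x\<bar> \<le> W y - W x) \<and> W hmax - W hmin \<le> pi"
proof -
  consider (m) "\<forall>h. -1 < h \<longrightarrow> h < 1 \<longrightarrow> t * h < s" | (a) "\<forall>h. -1 < h \<longrightarrow> h < 1 \<longrightarrow> s < t * h"
    | (tp) "\<bar>s\<bar> < t" | (tm) "\<bar>s\<bar> < - t"
  proof -
    have th: "\<bar>t * h\<bar> \<le> \<bar>t\<bar>" if "-1 < h" "h < 1" for h
      using that by (auto simp: abs_mult intro!: mult_left_le)
    show ?thesis
    proof (cases "\<bar>s\<bar> < \<bar>t\<bar>")
      case True then show ?thesis using that(3,4) by linarith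
    next
      case False
      then have "\<bar>t\<bar> < \<bar>s\<bar>" using t_neq by linarith
      then show ?thesis using that(1,2) th by (smt (verit))
    qed
  qed
  then show ?thesis
  proof cases
    case m
    have "ang x \<le> ang y" if "hmin \<le> x" "x \<le> y" "y \<le> hmax" for x y
      using that m hmin_gr hmax_less by (intro ang_mono) auto
    then show ?thesis using ang_bounds[of hmin] ang_bounds[of hmax] hmin_less_hmax
      by (intro exI[of _ ang]) auto
  next
    case a
    have "ang y \<le> ang x" if "hmin \<le> x" "x \<le> y" "y \<le> hmax" for x y
      using that a hmin_gr hmax_less by (intro ang_antimono) auto
    then show ?thesis using ang_bounds[of hmin] ang_bounds[of hmax] hmin_less_hmax
      by (intro exI[of _ "\<lambda>x. - ang x"]) auto
  next
    case tp
    \<comment> \<open>This is the turning height, clipped to the range of heights so that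
      \<open>s / t\<close> need not be compared with its ends.\<close>
    define c where "c = max hmin (min hmax (s / t))"
    have cr: "hmin \<le> c" "c \<le> hmax" using hmin_less_hmax by (auto simp: c_def)
    have lt: "t * h < s" if "hmin < h" "h < c" for h
    proof -
      have "h < s / t" using that by (auto simp: c_def)
      then show ?thesis using tp by (simp add: field_simps)
    qed
    have gt: "s < t * h" if "c < h" "h < hmax" for h
    proof -
      have "s / t < h" using that by (auto simp: c_def min_def max_def split: if_splits)
      then show ?thesis using tp by (simp add: field_simps)
    qed
    have up: "ang x \<le> ang y" if "hmin \<le> x" "x \<le> y" "y \<le> c" for x y
      using that cr lt by (intro ang_mono) auto
    have dn: "ang y \<le> ang x" if "c \<le> x" "x \<le> y" "y \<le> hmax" for x y
      using that cr gt by (intro ang_antimono) auto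
    have half: "ang c \<le> pi / 2"
    proof -
      have "\<bar>s * c\<bar> \<le> \<bar>s\<bar>" using h_range[OF cr] by (auto simp: abs_mult intro!: mult_left_le)
      then have "0 < r * sqrt (1 - c\<^sup>2) * cos (ang c)" unfolding cos_ang[OF cr] using tp by linarith
      then have "0 < cos (ang c)" using rad_pos[OF cr] by (simp only: zero_less_mult_pos)
      then show ?thesis using ang_bounds[OF cr] cos_monotone_0_pi_le[of "pi/2" "ang c"] by (cases "ang c \<le> pi/2") auto
    qed
    \<comment> \<open>Past the maximum at \<open>c\<close> the sign is reversed. The total is twice
      \<open>ang c\<close> minus both end values, at most pi because \<open>ang c\<close> is at most
      pi / 2.\<close>
    define W where "W x = (if x \<le> c then ang x else 2 * ang c - ang x)" for x
    have "\<bar>ang y - ang x\<bar> \<le> W y - W x" if "hmin \<le> x" "x \<le> y" "y \<le> hmax" for x y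
      using that up[of x y] dn[of x y] up[of x c] dn[of c y] cr by (auto simp: W_def)
    moreover have "W hmax - W hmin \<le> pi"
      using half ang_bounds[of hmin] ang_bounds[of hmax] cr hmin_less_hmax by (auto simp: W_def)
    ultimately show ?thesis by blast
  next
    case tm
    define c where "c = max hmin (min hmax (s / t))"
    have cr: "hmin \<le> c" "c \<le> hmax" using hmin_less_hmax by (auto simp: c_def)
    have gt: "s < t * h" if "hmin < h" "h < c" for h
    proof -
      have "h < s / t" using that by (auto simp: c_def)
      then show ?thesis using tm by (simp add: field_simps)
    qed
    have lt: "t * h < s" if "c < h" "h < hmax" for h
    proof -
      have "s / t < h" using that by (auto simp: c_def min_def max_def split: if_splits)
      then show ?thesis using tm by (simp add: field_simps)
    qed
    have dn: "ang y \<le> ang x" if "hmin \<le> x" "x \<le> y" "y \<le> c" for x y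
      using that cr gt by (intro ang_antimono) auto
    have up: "ang x \<le> ang y" if "c \<le> x" "x \<le> y" "y \<le> hmax" for x y
      using that cr lt by (intro ang_mono) auto
    have half: "pi / 2 \<le> ang c"
    proof -
      have "\<bar>s * c\<bar> \<le> \<bar>s\<bar>" using h_range[OF cr] by (auto simp: abs_mult intro!: mult_left_le)
      then have "0 < r * sqrt (1 - c\<^sup>2) * (- cos (ang c))" unfolding mult_minus_right cos_ang[OF cr] using tm by linarith
      then have "0 < - cos (ang c)" using rad_pos[OF cr] by (simp only: zero_less_mult_pos)
      then have "cos (ang c) < 0" by simp
      then show ?thesis using ang_bounds[OF cr] cos_monotone_0_pi_le[of "ang c" "pi/2"] by (cases "pi/2 \<le> ang c") auto
    qed
    define W where "W x = (if x \<le> c then - ang x else ang x - 2 * ang c)" for x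
    have "\<bar>ang y - ang x\<bar> \<le> W y - W x" if "hmin \<le> x" "x \<le> y" "y \<le> hmax" for x y
      using that up[of x y] dn[of x y] dn[of x c] up[of c y] cr by (auto simp: W_def)
    moreover have "W hmax - W hmin \<le> pi"
      using half ang_bounds[of hmin] ang_bounds[of hmax] cr hmin_less_hmax by (auto simp: W_def)
    ultimately show ?thesis by blast
  qed
qed

end

section \<open>Pieces of curves over the lattice axes\<close>

text \<open>The pairs x < y form a connected triangle on which f y - f x is continuous and never 0,
  so it keeps one sign.\<close>

lemma inj_on_sgn:
  fixes f :: "real \<Rightarrow> real"
  assumes cont: "continuous_on {l..m} f" and inj: "inj_on f {l..m}"
  shows "\<exists>\<sigma>. (\<sigma> = 1 \<or> \<sigma> = -1) \<and> (\<forall>x\<in>{l..m}. \<forall>y\<in>{l..m}. x < y \<longrightarrow> 0 < \<sigma> * (f y - f x))"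
proof -
  define D where "D = {P \<in> {l..m} \<times> {l..m}. fst P < snd P}"
  define g where "g P = f (snd P) - f (fst P)" for P :: "real \<times> real"
  have "D = ({l..m} \<times> {l..m}) \<inter> {P. inner (1, -1) P < 0}" by (auto simp: D_def inner_prod_def)
  then have "convex D" by (simp add: convex_Int convex_Times convex_halfspace_lt)
  moreover have "continuous_on D g" unfolding g_def
    by (intro continuous_intros continuous_on_compose2[OF cont]) (auto simp: D_def)
  ultimately have con: "connected (g ` D)" by (intro connected_continuous_image convex_connected)
  have nz: "0 \<notin> g ` D" using inj by (auto simp: g_def D_def inj_on_def)
  have one: "z * w > 0" if "z \<in> g ` D" "w \<in> g ` D" for z w
  proof (rule ccontr)
    assume "\<not> z * w > 0"
    then have "z \<le> 0 \<and> 0 \<le> w \<or> w \<le> 0 \<and> 0 \<le> z" by (simp add: zero_less_mult_iff not_less) linarith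
    then have "0 \<in> g ` D" using connectedD_interval[OF con that, of 0] connectedD_interval[OF con that(2,1), of 0] by blast
    then show False using nz by blast
  qed
  have mem: "f y - f x \<in> g ` D" if "x \<in> {l..m}" "y \<in> {l..m}" "x < y" for x y
    by (rule image_eqI[of _ _ "(x, y)"]) (use that in \<open>auto simp: g_def D_def\<close>)
  show ?thesis
  proof (cases "\<exists>z\<in>g ` D. z > 0")
    case True
    then obtain z where "z \<in> g ` D" "z > 0" by auto
    then have "w > 0" if "w \<in> g ` D" for w using one[OF \<open>z \<in> g ` D\<close> that] by (simp add: zero_less_mult_iff)
    then have "0 < f y - f x" if "x \<in> {l..m}" "y \<in> {l..m}" "x < y" for x y using mem[OF that] by blast
    then show ?thesis by (intro exI[of _ 1]) simp
  next
    case False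
    then have "w < 0" if "w \<in> g ` D" for w using nz that by (cases w "0::real" rule: linorder_cases) auto
    then have "f y - f x < 0" if "x \<in> {l..m}" "y \<in> {l..m}" "x < y" for x y using mem[OF that] by blast
    then show ?thesis by (intro exI[of _ "-1"]) simp
  qed
qed

text \<open>The increments of the sum and of the difference of the two functions have constant sign.
  Their product is the difference of the squares of the two increments, so one and the same
  increment dominates throughout the interval.\<close>

lemma abs_class:
  fixes U V :: "real \<Rightarrow> real"
  assumes "continuous_on {l..m} U" "continuous_on {l..m} V"
    and "inj_on (\<lambda>h. a * U h + b * V h) {l..m}" "inj_on (\<lambda>h. a * U h - b * V h) {l..m}"
  shows "(\<forall>x\<in>{l..m}. \<forall>y\<in>{l..m}. \<bar>b * (V y - V x)\<bar> \<le> \<bar>a * (U y - U x)\<bar>) \<or>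
         (\<forall>x\<in>{l..m}. \<forall>y\<in>{l..m}. \<bar>a * (U y - U x)\<bar> \<le> \<bar>b * (V y - V x)\<bar>)"
proof -
  obtain \<sigma> where s: "\<sigma> = 1 \<or> \<sigma> = -1" "\<And>x y. x \<in> {l..m} \<Longrightarrow> y \<in> {l..m} \<Longrightarrow> x < y \<Longrightarrow> 0 < \<sigma> * ((a * U y + b * V y) - (a * U x + b * V x))"
    using inj_on_sgn[OF _ assms(3)] assms(1,2) by (force intro!: continuous_intros)
  obtain \<tau> where t: "\<tau> = 1 \<or> \<tau> = -1" "\<And>x y. x \<in> {l..m} \<Longrightarrow> y \<in> {l..m} \<Longrightarrow> x < y \<Longrightarrow> 0 < \<tau> * ((a * U y - b * V y) - (a * U x - b * V x))"
    using inj_on_sgn[OF _ assms(4)] assms(1,2) by (force intro!: continuous_intros)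
  have key: "0 < \<sigma> * \<tau> * ((a * (U y - U x))\<^sup>2 - (b * (V y - V x))\<^sup>2)" if "x \<in> {l..m}" "y \<in> {l..m}" "x < y" for x y
  proof -
    have "0 < (\<sigma> * ((a * U y + b * V y) - (a * U x + b * V x))) * (\<tau> * ((a * U y - b * V y) - (a * U x - b * V x)))"
      using s(2)[OF that] t(2)[OF that] by (rule mult_pos_pos)
    then show ?thesis by (simp add: power2_eq_square algebra_simps)
  qed
  have neq: "x < y \<or> y < x \<or> x = y" for x y :: real by auto
  have "\<sigma> * \<tau> = 1 \<or> \<sigma> * \<tau> = -1" using s(1) t(1) by auto
  then show ?thesis
  proof
    assume "\<sigma> * \<tau> = 1"
    then have k: "(b * (V y - V x))\<^sup>2 \<le> (a * (U y - U x))\<^sup>2" if "x \<in> {l..m}" "y \<in> {l..m}" "x < y" for x y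
      using key[OF that] by simp
    have "\<bar>b * (V y - V x)\<bar> \<le> \<bar>a * (U y - U x)\<bar>" if "x \<in> {l..m}" "y \<in> {l..m}" for x y
      using k[OF that] k[OF that(2,1)] neq[of x y]
      by (auto simp: abs_le_square_iff power2_eq_square algebra_simps)
    then show ?thesis by blast
  next
    assume "\<sigma> * \<tau> = -1"
    then have k: "(a * (U y - U x))\<^sup>2 \<le> (b * (V y - V x))\<^sup>2" if "x \<in> {l..m}" "y \<in> {l..m}" "x < y" for x y
      using key[OF that] by simp
    have "\<bar>a * (U y - U x)\<bar> \<le> \<bar>b * (V y - V x)\<bar>" if "x \<in> {l..m}" "y \<in> {l..m}" for x y
      using k[OF that] k[OF that(2,1)] neq[of x y]
      by (auto simp: abs_le_square_iff power2_eq_square algebra_simps)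
    then show ?thesis by blast
  qed
qed

text \<open>The Lipschitz bound controls the extra area of a convex piece and the number of cells in
  the two end columns. The last conjunct reflects the axis chosen in \<open>curve_to_arc\<close>:
  slopes between 1/7 and 7 are read over the axis with the smaller increment, the others over the
  axis with the larger one.\<close>

definition graph_arc :: "real \<Rightarrow> real \<Rightarrow> (real \<Rightarrow> real) \<Rightarrow> bool" where
  "graph_arc p q f \<longleftrightarrow> p < q \<and> (convex_on {p..q} f \<or> concave_on {p..q} f)
     \<and> (mono_on {p..q} f \<or> antimono_on {p..q} f)
     \<and> (\<forall>x\<in>{p..q}. \<forall>y\<in>{p..q}. \<bar>f x - f y\<bar> \<le> 7 * \<bar>x - y\<bar>)
     \<and> (\<bar>q - p\<bar> \<le> \<bar>f q - f p\<bar> \<or> 7 * \<bar>f q - f p\<bar> \<le> \<bar>q - p\<bar>)"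

lemma graph_arc_continuous: "graph_arc p q f \<Longrightarrow> continuous_on {p..q} f"
proof -
  assume "graph_arc p q f"
  then have "7-lipschitz_on {p..q} f"
    by (intro lipschitz_onI) (auto simp: graph_arc_def dist_real_def)
  then show ?thesis by (rule lipschitz_on_continuous_on)
qed

text \<open>A piece of the curve \<open>x = X h\<close>, \<open>y = (1 - h) / 2\<close> read in the lattice coordinates \<open>(u, v)\<close> with
  \<open>x = q11 u + q12 v\<close>, \<open>y = q21 u + q22 v\<close>.\<close>

locale plane_curve =
  fixes q11 q12 q21 q22 l m :: real and X :: "real \<Rightarrow> real"
  assumes det_nz: "q11 * q22 - q12 * q21 \<noteq> 0" and lm: "l < m"
    and contX: "continuous_on {l..m} X"
    and cvX: "convex_on {l..m} X \<or> concave_on {l..m} X"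
begin

definition "dt = q11 * q22 - q12 * q21"
definition "lu x y = (q22 * x - q12 * y) / dt"
definition "lv x y = (q11 * y - q21 * x) / dt"
definition "cu h = lu (X h) ((1 - h) / 2)"
definition "cv h = lv (X h) ((1 - h) / 2)"

lemma dt_nz: "dt \<noteq> 0" using det_nz by (simp add: dt_def)

lemma xy_lu_lv: "q11 * lu x y + q12 * lv x y = x" "q21 * lu x y + q22 * lv x y = y"
proof -
  have "q11 * (q22 * x - q12 * y) + q12 * (q11 * y - q21 * x) = x * dt"
    "q21 * (q22 * x - q12 * y) + q22 * (q11 * y - q21 * x) = y * dt" by (simp_all add: dt_def algebra_simps)
  then have "q11 * lu x y + q12 * lv x y = x * dt / dt" "q21 * lu x y + q22 * lv x y = y * dt / dt"
    unfolding lu_def lv_def by (simp_all only: times_divide_eq_right add_divide_distrib[symmetric])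
  then show "q11 * lu x y + q12 * lv x y = x" "q21 * lu x y + q22 * lv x y = y" using dt_nz by auto
qed

lemma cont_cu: "continuous_on {l..m} cu" and cont_cv: "continuous_on {l..m} cv"
  unfolding cu_def[abs_def] cv_def[abs_def] lu_def lv_def
  by (auto intro!: continuous_intros contX simp: dt_nz)

text \<open>A linear map multiplies the oriented area of a triangle by its determinant, and the
  second coordinate of the curve is affine in the height. Convexity of \<open>X\<close> as a
  function of the height thus decides convexity of the curve in lattice coordinates.\<close>

lemma orientation:
  "(cu h3 - cu h1) * (cv h2 - cv h1) - (cu h2 - cu h1) * (cv h3 - cv h1)
     = ((X h2 - X h1) * (h3 - h1) - (X h3 - X h1) * (h2 - h1)) / (2 * dt)"
proof -
  define x2 x3 y2 y3 where "x2 = X h2 - X h1" "x3 = X h3 - X h1" "y2 = - (h2 - h1) / 2" "y3 = - (h3 - h1) / 2"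
  have e: "cu h2 - cu h1 = (q22 * x2 - q12 * y2) / dt" "cu h3 - cu h1 = (q22 * x3 - q12 * y3) / dt"
    "cv h2 - cv h1 = (q11 * y2 - q21 * x2) / dt" "cv h3 - cv h1 = (q11 * y3 - q21 * x3) / dt"
    unfolding cu_def cv_def lu_def lv_def x2_x3_y2_y3_def using dt_nz by (simp_all add: field_simps)
  have "(cu h3 - cu h1) * (cv h2 - cv h1) - (cu h2 - cu h1) * (cv h3 - cv h1) = dt * (x3 * y2 - x2 * y3) / (dt * dt)"
    unfolding e using dt_nz by (simp add: field_simps) (simp add: dt_def algebra_simps)
  also have "\<dots> = (x3 * y2 - x2 * y3) / dt" using dt_nz by simp
  also have "\<dots> = (x2 * (h3 - h1) - x3 * (h2 - h1)) / (2 * dt)" unfolding x2_x3_y2_y3_def using dt_nz by (simp add: field_simps)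
  finally show ?thesis by (simp add: x2_x3_y2_y3_def)
qed

text \<open>Convexity is stated for three heights in increasing or decreasing order, because the
  coordinate u, which replaces the height as parameter, may run either way.\<close>

lemma orientation_sign:
  "\<exists>s. (s = 1 \<or> s = -1) \<and> (\<forall>h1\<in>{l..m}. \<forall>h3\<in>{l..m}. \<forall>h2.
      (h1 \<le> h2 \<and> h2 \<le> h3 \<or> h3 \<le> h2 \<and> h2 \<le> h1) \<longrightarrow> 0 \<le> s * (h3 - h1) * ((X h2 - X h1) * (h3 - h1) - (X h3 - X h1) * (h2 - h1)))"
proof -
  have main: "0 \<le> (h3 - h1) * (- ((g h2 - g h1) * (h3 - h1) - (g h3 - g h1) * (h2 - h1)))"
    if cv: "convex_on {l..m} g" and h: "h1 \<in> {l..m}" "h3 \<in> {l..m}" "h1 \<le> h2 \<and> h2 \<le> h3 \<or> h3 \<le> h2 \<and> h2 \<le> h1"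
    for g :: "real \<Rightarrow> real" and h1 h2 h3
  proof (cases "h1 = h3")
    case False
    define \<theta> where "\<theta> = (h2 - h1) / (h3 - h1)"
    have th: "0 \<le> \<theta>" "\<theta> \<le> 1" using h(3) False by (auto simp: \<theta>_def field_simps divide_nonpos_neg zero_le_divide_iff divide_le_eq_1)
    have "\<theta> * (h3 - h1) = h2 - h1" using False by (simp add: \<theta>_def)
    then have e: "(1 - \<theta>) *\<^sub>R h1 + \<theta> *\<^sub>R h3 = h2" by (simp add: algebra_simps)
    have "g ((1 - \<theta>) *\<^sub>R h1 + \<theta> *\<^sub>R h3) \<le> (1 - \<theta>) * g h1 + \<theta> * g h3" using th h by (intro convex_onD[OF cv]) auto
    then have "0 \<le> \<theta> * (g h3 - g h1) - (g h2 - g h1)" unfolding e by (simp add: algebra_simps)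
    then have "0 \<le> (h3 - h1)\<^sup>2 * (\<theta> * (g h3 - g h1) - (g h2 - g h1))" by (intro mult_nonneg_nonneg) auto
    also have "\<dots> = (h3 - h1) * (\<theta> * (h3 - h1) * (g h3 - g h1) - (h3 - h1) * (g h2 - g h1))"
      by (simp add: power2_eq_square algebra_simps)
    also have "\<dots> = (h3 - h1) * (- ((g h2 - g h1) * (h3 - h1) - (g h3 - g h1) * (h2 - h1)))"
      unfolding \<open>\<theta> * (h3 - h1) = h2 - h1\<close> by (simp add: algebra_simps)
    finally show ?thesis .
  qed simp
  from cvX show ?thesis
  proof
    assume "convex_on {l..m} X"
    from main[OF this] show ?thesis by (intro exI[of _ "-1"]) (auto simp: algebra_simps)
  next
    assume "concave_on {l..m} X"
    then have "convex_on {l..m} (\<lambda>x. - X x)" by (simp add: concave_on_def)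
    from main[OF this] show ?thesis by (intro exI[of _ 1]) (auto simp: algebra_simps)
  qed
qed

text \<open>The piece is the graph of \<open>cv\<close> composed with the inverse of
  \<open>cu\<close>. The last conjunct compares two ways of leaving the curve, horizontally in the
  square and along the second lattice axis: the signed offsets agree up to a positive factor and one
  fixed sign. This lets a sign condition in the square be read off from the graph.\<close>

lemma column_arc:
  assumes inju: "inj_on cu {l..m}" and injv: "inj_on cv {l..m}"
    and lip: "\<And>x y. x \<in> {l..m} \<Longrightarrow> y \<in> {l..m} \<Longrightarrow> \<bar>cv y - cv x\<bar> \<le> 7 * \<bar>cu y - cu x\<bar>"
    and cls: "\<bar>cu m - cu l\<bar> \<le> \<bar>cv m - cv l\<bar> \<or> 7 * \<bar>cv m - cv l\<bar> \<le> \<bar>cu m - cu l\<bar>"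
  shows "\<exists>p q f s. graph_arc p q f \<and> (s = 1 \<or> s = -1) \<and> q - p = \<bar>cu m - cu l\<bar> \<and> \<bar>f q - f p\<bar> = \<bar>cv m - cv l\<bar>
     \<and> cu ` {l..m} = {p..q} \<and> cu ` {l<..<m} = {p<..<q} \<and> (\<forall>h\<in>{l..m}. f (cu h) = cv h)
     \<and> (\<forall>x. \<forall>h\<in>{l..m}. lu x ((1 - h) / 2) \<in> {p..q} \<longrightarrow>
          (\<exists>c>0. x - X h = s * c * (lv x ((1 - h) / 2) - f (lu x ((1 - h) / 2)))))"
proof -
  obtain \<kappa> where k: "\<kappa> = 1 \<or> \<kappa> = -1" "\<And>x y. x \<in> {l..m} \<Longrightarrow> y \<in> {l..m} \<Longrightarrow> x < y \<Longrightarrow> 0 < \<kappa> * (cu y - cu x)"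
    using inj_on_sgn[OF cont_cu inju] by blast
  obtain \<nu> where n: "\<nu> = 1 \<or> \<nu> = -1" "\<And>x y. x \<in> {l..m} \<Longrightarrow> y \<in> {l..m} \<Longrightarrow> x < y \<Longrightarrow> 0 < \<nu> * (cv y - cv x)"
    using inj_on_sgn[OF cont_cv injv] by blast
  define p q where "p = min (cu l) (cu m)" and "q = max (cu l) (cu m)"
  define f where "f u = cv (the_inv_into {l..m} cu u)" for u
  have fc: "f (cu h) = cv h" if "h \<in> {l..m}" for h using the_inv_into_f_f[OF inju that] by (simp add: f_def)
  have lmI: "l \<in> {l..m}" "m \<in> {l..m}" using lm by auto
  have img: "cu ` {l..m} = {p..q}"
  proof
    show "cu ` {l..m} \<subseteq> {p..q}"
    proof
      fix u assume "u \<in> cu ` {l..m}"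
      then obtain h where h: "h \<in> {l..m}" "u = cu h" by auto
      have "0 \<le> \<kappa> * (cu h - cu l)" "0 \<le> \<kappa> * (cu m - cu h)"
        using k(2)[OF lmI(1) h(1)] k(2)[OF h(1) lmI(2)] h by (cases "h = l"; cases "h = m"; auto)+
      then show "u \<in> {p..q}" using k(1) h by (auto simp: p_def q_def)
    qed
    have "connected (cu ` {l..m})" by (intro connected_continuous_image cont_cu) auto
    moreover have "p \<in> cu ` {l..m}" "q \<in> cu ` {l..m}" using lmI by (auto simp: p_def q_def min_def max_def)
    ultimately show "{p..q} \<subseteq> cu ` {l..m}" by (meson connected_contains_Icc)
  qed
  have ends: "{cu l, cu m} = {p, q}" by (auto simp: p_def q_def min_def max_def)
  have pq: "p < q" using k(2)[OF lmI lm] k(1) by (auto simp: p_def q_def)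
  have imgo: "cu ` {l<..<m} = {p<..<q}"
  proof -
    have "{l<..<m} = {l..m} - {l, m}" by auto
    then have "cu ` {l<..<m} = cu ` {l..m} - cu ` {l, m}"
      using inj_on_image_set_diff[OF inju, of "{l..m}" "{l, m}"] lm by auto
    then show ?thesis unfolding img using ends by auto
  qed
  have qp: "q - p = \<bar>cu m - cu l\<bar>" by (auto simp: p_def q_def)
  have fqp: "\<bar>f q - f p\<bar> = \<bar>cv m - cv l\<bar>" using fc[OF lmI(1)] fc[OF lmI(2)] by (auto simp: p_def q_def min_def max_def)
  have ord: "0 < \<kappa> * (h2 - h1)" if "h1 \<in> {l..m}" "h2 \<in> {l..m}" "cu h1 < cu h2" for h1 h2
    using k(1) k(2)[OF that(1,2)] k(2)[OF that(2,1)] that(3)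
    by (cases h1 h2 rule: linorder_cases) auto
  have arc: "graph_arc p q f"
    unfolding graph_arc_def
  proof (intro conjI pq ballI)
    fix x y assume "x \<in> {p..q}" "y \<in> {p..q}"
    then obtain h1 h2 where h: "h1 \<in> {l..m}" "x = cu h1" "h2 \<in> {l..m}" "y = cu h2" unfolding img[symmetric] by auto
    then show "\<bar>f x - f y\<bar> \<le> 7 * \<bar>x - y\<bar>" using lip[of h2 h1] fc by auto
  next
    show "\<bar>q - p\<bar> \<le> \<bar>f q - f p\<bar> \<or> 7 * \<bar>f q - f p\<bar> \<le> \<bar>q - p\<bar>" using cls fqp qp by auto
  next
    have mon: "0 \<le> \<kappa> * \<nu> * (f y - f x)" if "x \<in> {p..q}" "y \<in> {p..q}" "x \<le> y" for x y
    proof (cases "x = y")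
      case False
      note xy = that
      obtain h1 h2 where h: "h1 \<in> {l..m}" "x = cu h1" "h2 \<in> {l..m}" "y = cu h2" using xy(1,2) unfolding img[symmetric] by auto
      have "0 < \<kappa> * (h2 - h1)" using ord[OF h(1,3)] that False h by auto
      then show ?thesis using n(2)[OF h(1,3)] n(2)[OF h(3,1)] h fc k(1) n(1) by (auto simp: algebra_simps)
    qed simp
    show "mono_on {p..q} f \<or> antimono_on {p..q} f"
    proof (cases "\<kappa> * \<nu> = 1")
      case True then show ?thesis using mon by (intro disjI1 mono_onI) auto
    next
      case False
      then have "\<kappa> * \<nu> = -1" using k(1) n(1) by auto
      then show ?thesis using mon by (intro disjI2 monotone_onI) auto
    qed
  next
    obtain s where s: "s = 1 \<or> s = -1" and os: "\<And>h1 h2 h3. h1 \<in> {l..m} \<Longrightarrow> h3 \<in> {l..m} \<Longrightarrow>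
      (h1 \<le> h2 \<and> h2 \<le> h3 \<or> h3 \<le> h2 \<and> h2 \<le> h1) \<Longrightarrow> 0 \<le> s * (h3 - h1) * ((X h2 - X h1) * (h3 - h1) - (X h3 - X h1) * (h2 - h1))"
      using orientation_sign by blast
    have tri: "0 \<le> s * \<kappa> * dt * ((x3 - x1) * (f x2 - f x1) - (x2 - x1) * (f x3 - f x1))"
      if x: "x1 \<in> {p..q}" "x3 \<in> {p..q}" "x2 \<in> {p..q}" "x1 < x2" "x2 < x3" for x1 x2 x3
    proof -
      obtain h1 h2 h3 where h: "h1 \<in> {l..m}" "x1 = cu h1" "h2 \<in> {l..m}" "x2 = cu h2" "h3 \<in> {l..m}" "x3 = cu h3"
        using x(1-3) unfolding img[symmetric] by auto
      have o: "0 < \<kappa> * (h2 - h1)" "0 < \<kappa> * (h3 - h2)" "0 < \<kappa> * (h3 - h1)"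
        using ord[OF h(1,3)] ord[OF h(3,5)] ord[OF h(1,5)] x h by auto
      then have btw: "h1 \<le> h2 \<and> h2 \<le> h3 \<or> h3 \<le> h2 \<and> h2 \<le> h1" using k(1) by auto
      define Z where "Z = (X h2 - X h1) * (h3 - h1) - (X h3 - X h1) * (h2 - h1)"
      have "0 \<le> (s * (h3 - h1) * Z) * (\<kappa> * (h3 - h1))" using mult_nonneg_nonneg[OF os[OF h(1,5) btw, folded Z_def] less_imp_le[OF o(3)]] .
      then have "0 \<le> (h3 - h1)\<^sup>2 * (s * \<kappa> * Z)" by (simp add: power2_eq_square algebra_simps)
      moreover have "(h3 - h1)\<^sup>2 > 0" using o(3) by auto
      ultimately have "0 \<le> s * \<kappa> * Z" by (simp add: zero_le_mult_iff)
      moreover have e: "dt * ((x3 - x1) * (f x2 - f x1) - (x2 - x1) * (f x3 - f x1)) = Z / 2"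
        unfolding h(2,4,6) fc[OF h(1)] fc[OF h(3)] fc[OF h(5)] orientation Z_def[symmetric] using dt_nz by simp
      ultimately have "s * \<kappa> * (dt * ((x3 - x1) * (f x2 - f x1) - (x2 - x1) * (f x3 - f x1))) \<ge> 0" unfolding e by simp
      then show ?thesis by (simp only: mult.assoc)
    qed
    have gen: "g ((1 - t) *\<^sub>R x + t *\<^sub>R y) \<le> (1 - t) * g x + t * g y"
      if c: "c > 0" "\<And>x1 x2 x3. x1 \<in> {p..q} \<Longrightarrow> x3 \<in> {p..q} \<Longrightarrow> x2 \<in> {p..q} \<Longrightarrow> x1 < x2 \<Longrightarrow> x2 < x3 \<Longrightarrow>
           0 \<le> - c * ((x3 - x1) * (g x2 - g x1) - (x2 - x1) * (g x3 - g x1))"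
        and t: "t > 0" "t < 1" "x \<in> {p..q}" "y \<in> {p..q}" "x < y" for g :: "real \<Rightarrow> real" and c t x y
    proof -
      define z where "z = (1 - t) *\<^sub>R x + t *\<^sub>R y"
      have z1: "z - x = t * (y - x)" by (simp add: z_def algebra_simps)
      have z2: "y - z = (1 - t) * (y - x)" by (simp add: z_def algebra_simps)
      have "x < z" "z < y" using z1 z2 mult_pos_pos[of t "y - x"] mult_pos_pos[of "1 - t" "y - x"] t by linarith+
      then have "0 \<le> - c * ((y - x) * (g z - g x) - (z - x) * (g y - g x))" using t by (intro c(2)) auto
      then have "0 \<le> c * ((z - x) * (g y - g x) - (y - x) * (g z - g x))" by (simp add: algebra_simps)
      then have "0 \<le> (z - x) * (g y - g x) - (y - x) * (g z - g x)" using c(1) by (simp add: zero_le_mult_iff)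
      then have "0 \<le> (y - x) * (t * (g y - g x) - (g z - g x))" unfolding z1 by (simp add: algebra_simps)
      then have "0 \<le> t * (g y - g x) - (g z - g x)" using t by (simp add: zero_le_mult_iff)
      then show ?thesis unfolding z_def[symmetric] by (simp add: algebra_simps)
    qed
    show "convex_on {p..q} f \<or> concave_on {p..q} f"
    proof (cases "s * \<kappa> * dt < 0")
      case True
      have "convex_on {p..q} f"
      proof (rule convex_on_linorderI)
        fix t x y :: real assume "t > 0" "t < 1" "x \<in> {p..q}" "y \<in> {p..q}" "x < y"
        then show "f ((1 - t) *\<^sub>R x + t *\<^sub>R y) \<le> (1 - t) * f x + t * f y"
          using True by (intro gen[where c = "- (s * \<kappa> * dt)"]) (linarith, simp only: minus_minus, rule tri, assumption+)
      qed simp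
      then show ?thesis ..
    next
      case False
      then have pos: "s * \<kappa> * dt > 0" using s k(1) dt_nz by auto
      have "convex_on {p..q} (\<lambda>x. - f x)"
      proof (rule convex_on_linorderI)
        fix t x y :: real assume "t > 0" "t < 1" "x \<in> {p..q}" "y \<in> {p..q}" "x < y"
        moreover have eq: "- (s * \<kappa> * dt) * ((x3 - x1) * (- f x2 - - f x1) - (x2 - x1) * (- f x3 - - f x1))
           = s * \<kappa> * dt * ((x3 - x1) * (f x2 - f x1) - (x2 - x1) * (f x3 - f x1))" for x1 x2 x3
          by (simp add: algebra_simps)
        ultimately show "- f ((1 - t) *\<^sub>R x + t *\<^sub>R y) \<le> (1 - t) * (- f x) + t * (- f y)"
          using pos by (intro gen[where c = "s * \<kappa> * dt"]) (assumption, simp only: eq, rule tri, assumption+)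
      qed simp
      then show ?thesis by (simp add: concave_on_def)
    qed
  qed
  \<comment> \<open>One factor is the direction in which u runs along the curve, the other the
    orientation of the lattice basis.\<close>
  define s where "s = \<kappa> * sgn dt"
  have s1: "s = 1 \<or> s = -1" using k(1) dt_nz by (auto simp: s_def sgn_if)
  have side: "\<exists>c>0. x - X h = s * c * (lv x ((1 - h) / 2) - f (lu x ((1 - h) / 2)))"
    if h: "h \<in> {l..m}" and u: "lu x ((1 - h) / 2) \<in> {p..q}" for x h
  proof -
    \<comment> \<open>Two points of the curve are compared with (x, y): the one with parameter
      \<open>h\<close> at the same height, and the one with parameter \<open>g\<close> over the same
      u. The second differs from (x, y) by \<delta> along the lattice axis; monotonicity of
      \<open>cu\<close> between \<open>g\<close> and \<open>h\<close> turns \<delta> into the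
      horizontal offset.\<close>
    define y where "y = (1 - h) / 2"
    obtain g where g: "g \<in> {l..m}" "lu x y = cu g" using u unfolding y_def img[symmetric] by auto
    define \<delta> where "\<delta> = lv x y - f (lu x y)"
    have fl: "f (lu x y) = cv g" using g fc by auto
    have lvd: "lv x y = cv g + \<delta>" by (simp add: \<delta>_def fl)
    have "x = q11 * cu g + q12 * (cv g + \<delta>)" "y = q21 * cu g + q22 * (cv g + \<delta>)"
      using xy_lu_lv[of x y] g(2) lvd by auto
    moreover have "X g = q11 * cu g + q12 * cv g" "(1 - g) / 2 = q21 * cu g + q22 * cv g"
      using xy_lu_lv[of "X g" "(1 - g) / 2"] by (auto simp: cu_def cv_def)
    ultimately have xd: "x - X g = q12 * \<delta>" and yd: "y - (1 - g) / 2 = q22 * \<delta>" by (auto simp: algebra_simps)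
    have hg: "h - g = - 2 * q22 * \<delta>" using yd unfolding y_def by (simp add: field_simps)
    have cuh: "cu h - cu g = (q22 * (X h - X g) - q12 * ((g - h) / 2)) / dt" for h
      unfolding cu_def lu_def using dt_nz by (simp add: field_simps)
    have "\<exists>c>0. x - X h = s * c * \<delta>"
    proof (cases "\<delta> = 0")
      case True
      then show ?thesis using hg xd by (intro exI[of _ 1]) auto
    next
      case False
      show ?thesis
      proof (cases "q22 = 0")
        case True
        then have "h = g" using hg by simp
        have z: "q22 * (X m - X l) = 0" using True by simp
        have "cu m - cu l = (q22 * (X m - X l) - q12 * ((l - m) / 2)) / dt"
          unfolding cu_def lu_def using dt_nz by (simp add: field_simps)
        also have "\<dots> = q12 * (m - l) / (2 * dt)" unfolding z using dt_nz by (simp add: field_simps)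
        finally have "0 < \<kappa> * (q12 * (m - l) / (2 * dt))" using k(2)[OF lmI lm] by simp
        then have "q12 = s * \<bar>q12\<bar>" "\<bar>q12\<bar> > 0" using k(1) lm dt_nz
          by (auto simp: s_def sgn_if zero_less_mult_iff zero_less_divide_iff divide_less_0_iff mult_less_0_iff)
        then show ?thesis using xd \<open>h = g\<close> by (intro exI[of _ "\<bar>q12\<bar>"]) auto
      next
        case q: False
        then have ne: "h \<noteq> g" using hg False by auto
        define c1 where "c1 = \<kappa> * (cu h - cu g) / (h - g)"
        have "c1 > 0" using ne k(2)[OF h g(1)] k(2)[OF g(1) h] unfolding c1_def
          by (cases h g rule: linorder_cases) (auto simp: zero_less_divide_iff algebra_simps)
        have "\<kappa> * \<kappa> = 1" using k(1) by auto
        then have "cu h - cu g = \<kappa> * c1 * (h - g)" using ne by (simp add: c1_def)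
        also have "\<dots> = - 2 * q22 * (\<kappa> * c1 * \<delta>)" unfolding hg by simp
        finally have "(q22 * (X h - X g) - q12 * ((g - h) / 2)) / dt = - 2 * q22 * (\<kappa> * c1 * \<delta>)" unfolding cuh .
        moreover have "(g - h) / 2 = q22 * \<delta>" using hg by simp
        ultimately have "q22 * ((X h - X g) - q12 * \<delta>) / dt = q22 * (- 2 * (\<kappa> * c1 * \<delta>))" by (simp add: algebra_simps)
        moreover have "A = dt * B" if "q22 * A / dt = q22 * B" for A B :: real
        proof -
          have "q22 * A = q22 * (dt * B)" using that dt_nz by (simp add: field_simps)
          then show ?thesis using q by simp
        qed
        ultimately have "(X h - X g) - q12 * \<delta> = dt * (- 2 * (\<kappa> * c1 * \<delta>))" by blast
        then have "x - X h = 2 * dt * \<kappa> * c1 * \<delta>" using xd by simp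
        also have "dt = sgn dt * \<bar>dt\<bar>" by (simp add: sgn_mult_abs)
        finally have "x - X h = s * (2 * \<bar>dt\<bar> * c1) * \<delta>" by (simp add: s_def mult_ac)
        then show ?thesis using \<open>c1 > 0\<close> dt_nz by (intro exI[of _ "2 * \<bar>dt\<bar> * c1"]) auto
      qed
    qed
    then show ?thesis by (simp add: \<delta>_def y_def)
  qed
  show ?thesis
    by (intro exI[of _ p] exI[of _ q] exI[of _ f] exI[of _ s] conjI arc s1 qp fqp img imgo ballI allI impI fc side)
qed

end

text \<open>A piece of a plane curve that is a graph over the first coordinate, or over the second one
  if \<open>arow\<close> holds; \<open>asgn\<close> selects one of the two sides of the graph.\<close>

datatype arc = Arc (arow: bool) (ap: real) (aq: real) (af: "real \<Rightarrow> real") (asgn: real)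

definition sw :: "bool \<Rightarrow> 'a \<times> 'a \<Rightarrow> 'a \<times> 'a" where
  "sw b P = (if b then prod.swap P else P)"

definition side :: "arc \<Rightarrow> real \<times> real \<Rightarrow> real" where
  "side A P = asgn A * (snd (sw (arow A) P) - af A (fst (sw (arow A) P)))"

definition arc_pts :: "arc \<Rightarrow> (real \<times> real) set" where
  "arc_pts A = {P. ap A < fst (sw (arow A) P) \<and> fst (sw (arow A) P) < aq A
                  \<and> snd (sw (arow A) P) = af A (fst (sw (arow A) P))}"

definition arc_closure :: "arc \<Rightarrow> (real \<times> real) set" where
  "arc_closure A = {P. ap A \<le> fst (sw (arow A) P) \<and> fst (sw (arow A) P) \<le> aq A
                  \<and> snd (sw (arow A) P) = af A (fst (sw (arow A) P))}"

definition arc_full :: "arc \<Rightarrow> int \<times> int \<Rightarrow> bool" where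
  "arc_full A c \<longleftrightarrow> ap A \<le> fst (sw (arow A) c) \<and> real_of_int (fst (sw (arow A) c)) + 1 \<le> aq A"

definition arc_hit :: "arc \<Rightarrow> int \<times> int \<Rightarrow> bool" where
  "arc_hit A c \<longleftrightarrow> arc_full A c \<and> snd (sw (arow A) c) \<in> hits (af A) (fst (sw (arow A) c))"

definition arc_ok :: "arc \<Rightarrow> bool" where
  "arc_ok A \<longleftrightarrow> graph_arc (ap A) (aq A) (af A) \<and> (asgn A = 1 \<or> asgn A = -1)"

section \<open>Arcs and cells: one-sided areas, end cells, crossings\<close>

lemma sw_sw [simp]: "sw b (sw b P) = P" by (simp add: sw_def)

lemma sw_cell: "sw b P \<in> cell (sw b c) \<longleftrightarrow> P \<in> cell c"
  by (cases P; cases c) (auto simp: sw_def mem_cell)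

text \<open>The exchange of coordinates is an involution that preserves measurability both ways, so
  sets that are not measurable have \<open>measure\<close> 0 on either side. This generality suits
  the pieces cut by an arbitrary \<open>af\<close>.\<close>

lemma measure_swap:
  fixes S :: "(real \<times> real) set"
  shows "measure lborel (prod.swap -` S) = measure lborel S"
proof -
  have m: "prod.swap \<in> borel_measurable (borel :: (real \<times> real) measure)"
    by (intro borel_measurable_continuous_onI continuous_on_swap)
  have sw: "prod.swap -` (prod.swap -` S) = S" by (auto simp: prod.swap_def)
  show ?thesis
  proof (cases "S \<in> sets borel")
    case True
    have "emeasure (lborel \<Otimes>\<^sub>M lborel) S = emeasure (distr (lborel \<Otimes>\<^sub>M lborel) (lborel \<Otimes>\<^sub>M lborel) (\<lambda>(x, y). (y, x))) S"
      by (subst lborel_pair.distr_pair_swap) (rule refl)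
    also have "(\<lambda>(x, y). (y, x)) = (prod.swap :: real \<times> real \<Rightarrow> _)" by (auto simp: fun_eq_iff)
    also have "emeasure (distr (lborel \<Otimes>\<^sub>M lborel) (lborel \<Otimes>\<^sub>M lborel) prod.swap) S = emeasure (lborel \<Otimes>\<^sub>M lborel) (prod.swap -` S)"
      unfolding lborel_prod using True m by (subst emeasure_distr) auto
    finally show ?thesis by (simp add: measure_def lborel_prod)
  next
    case False
    have "prod.swap -` S \<notin> sets borel"
    proof
      assume "prod.swap -` S \<in> sets borel"
      then have "prod.swap -` (prod.swap -` S) \<inter> space borel \<in> sets borel" using m by (rule measurable_sets[rotated])
      then show False using False by (simp add: sw)
    qed
    then show ?thesis using False by (simp add: measure_notin_sets)
  qed
qed

lemma measure_sw:
  fixes S :: "(real \<times> real) set"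
  shows "measure lborel (cell c \<inter> {P. sw b P \<in> S}) = measure lborel (cell (sw b c) \<inter> S)"
proof (cases b)
  case True
  have "cell c \<inter> {P. sw b P \<in> S} = prod.swap -` (cell (sw b c) \<inter> S)"
    using sw_cell[of b _ c] True by (auto simp: sw_def)
  then show ?thesis by (simp only: measure_swap)
qed (simp add: sw_def)

text \<open>After the exchange of coordinates, if any, the cells lie over the columns contained in
  the domain, and \<open>column_area\<close> applies with the Lipschitz constant 7. The summand 7
  covers all columns of the arc together.\<close>

lemma arc_area:
  assumes ok: "arc_ok A" and C: "finite C" "\<And>c. c \<in> C \<Longrightarrow> arc_hit A c"
  shows "(\<Sum>c\<in>C. measure lborel (cell c \<inter> {P. 0 \<le> side A P})) \<le> (aq A - ap A) + \<bar>af A (aq A) - af A (ap A)\<bar> / 2 + 7"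
proof (cases "C = {}")
  case True
  then show ?thesis using ok by (simp add: arc_ok_def graph_arc_def)
next
  case False
  define p q f s b where "p = ap A" "q = aq A" "f = af A" "s = asgn A" "b = arow A"
  define m where "m = \<lceil>p\<rceil>"
  define N where "N = nat (\<lfloor>q\<rfloor> - m)"
  have full: "m \<le> fst (sw b c) \<and> fst (sw b c) + 1 \<le> \<lfloor>q\<rfloor> \<and> snd (sw b c) \<in> hits f (fst (sw b c))" if "c \<in> C" for c
  proof -
    have "p \<le> fst (sw b c)" "real_of_int (fst (sw b c) + 1) \<le> q" "snd (sw b c) \<in> hits f (fst (sw b c))"
      using C(2)[OF that] by (auto simp: arc_hit_def arc_full_def p_q_f_s_b_def)
    then show ?thesis by (simp add: m_def ceiling_le_iff le_floor_iff)
  qed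
  have mq: "m \<le> \<lfloor>q\<rfloor>" using full False by fastforce
  define \<mu> where "\<mu> = (\<lambda>c. measure lborel (cell c \<inter> {(u, v). 0 \<le> s * (v - f u)}))"
  have "(\<Sum>c\<in>C. measure lborel (cell c \<inter> {P. 0 \<le> side A P})) = (\<Sum>c\<in>C. \<mu> (sw b c))"
  proof (intro sum.cong refl)
    fix c
    have "{P. 0 \<le> side A P} = {P. sw b P \<in> {(u, v). 0 \<le> s * (v - f u)}}"
      by (auto simp: side_def p_q_f_s_b_def case_prod_beta)
    then show "measure lborel (cell c \<inter> {P. 0 \<le> side A P}) = \<mu> (sw b c)"
      by (simp only: measure_sw \<mu>_def)
  qed
  also have "\<dots> = (\<Sum>c\<in>sw b ` C. \<mu> c)"
  proof -
    have "inj_on (sw b) C" by (metis inj_onI sw_sw)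
    then show ?thesis by (simp add: sum.reindex)
  qed
  also have "\<dots> \<le> (\<Sum>c\<in>(\<lambda>(k, j). (m + int k, j)) ` (SIGMA k:{..<N}. hits f (m + int k)). \<mu> c)"
  proof (rule sum_mono2)
    show "finite ((\<lambda>(k, j). (m + int k, j)) ` (SIGMA k:{..<N}. hits f (m + int k)))"
      by (intro finite_imageI finite_SigmaI finite_hits) auto
    show "sw b ` C \<subseteq> (\<lambda>(k, j). (m + int k, j)) ` (SIGMA k:{..<N}. hits f (m + int k))"
    proof
      fix d assume "d \<in> sw b ` C"
      then obtain c where c: "c \<in> C" "d = sw b c" by auto
      define k where "k = nat (fst d - m)"
      have k: "fst d = m + int k" "k < N" using full[OF c(1)] c mq by (auto simp: k_def N_def)
      then have "d = (\<lambda>(k, j). (m + int k, j)) (k, snd d)" "(k, snd d) \<in> (SIGMA k:{..<N}. hits f (m + int k))"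
        using full[OF c(1)] c by (auto simp: prod_eq_iff)
      then show "d \<in> (\<lambda>(k, j). (m + int k, j)) ` (SIGMA k:{..<N}. hits f (m + int k))" by (rule image_eqI)
    qed
  qed (simp add: \<mu>_def)
  also have "\<dots> = (\<Sum>(k, j)\<in>(SIGMA k:{..<N}. hits f (m + int k)). \<mu> (m + int k, j))"
    by (subst sum.reindex) (auto simp: inj_on_def case_prod_beta)
  also have "\<dots> = (\<Sum>k<N. \<Sum>j\<in>hits f (m + int k). \<mu> (m + int k, j))"
    by (subst sum.Sigma) (auto simp: finite_hits)
  also have "\<dots> \<le> real N + \<bar>f q - f p\<bar> / 2 + 7"
    unfolding \<mu>_def
  proof (rule column_area)
    show "p \<le> real_of_int m" by (simp add: m_def)
    show "real_of_int m + real N \<le> q" using mq by (simp add: N_def)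
  qed (use ok in \<open>auto simp: arc_ok_def graph_arc_def p_q_f_s_b_def\<close>)
  also have "real N \<le> q - p" using mq by (simp add: N_def m_def) linarith
  finally show ?thesis by (simp add: p_q_f_s_b_def)
qed

lemma arc_hitI:
  assumes ok: "arc_ok A" and full: "arc_full A c" and P: "P \<in> arc_pts A" "P \<in> cell c"
  shows "arc_hit A c"
proof -
  define u v where "u = fst (sw (arow A) P)" "v = snd (sw (arow A) P)"
  define i j where "i = fst (sw (arow A) c)" "j = snd (sw (arow A) c)"
  have uv: "ap A < u" "u < aq A" "v = af A u" using P by (auto simp: arc_pts_def u_v_def)
  have "(u, v) \<in> cell (i, j)" using sw_cell[of "arow A" P c] P by (simp add: u_v_def i_j_def)
  then have c: "real_of_int i \<le> u" "u \<le> real_of_int i + 1" "real_of_int j \<le> v" "v < real_of_int j + 1" by (auto simp: cell_def)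
  have I: "real_of_int i \<in> {ap A..aq A}" "real_of_int i + 1 \<in> {ap A..aq A}" "u \<in> {ap A..aq A}"
    using full uv by (auto simp: arc_full_def i_j_def)
  have "mono_on {ap A..aq A} (af A) \<or> antimono_on {ap A..aq A} (af A)" using ok by (auto simp: arc_ok_def graph_arc_def)
  then have "min (af A i) (af A (real_of_int i + 1)) \<le> v \<and> v \<le> max (af A i) (af A (real_of_int i + 1))"
  proof
    assume "mono_on {ap A..aq A} (af A)"
    from mono_onD[OF this I(1,3) c(1)] mono_onD[OF this I(3,2) c(2)] show ?thesis using uv by auto
  next
    assume "antimono_on {ap A..aq A} (af A)"
    from monotone_onD[OF this I(1,3) c(1)] monotone_onD[OF this I(3,2) c(2)] show ?thesis using uv by auto
  qed
  then have "j \<in> hits (af A) i" using c by (auto simp: hits_def)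
  then show ?thesis using full by (simp add: arc_hit_def i_j_def)
qed

text \<open>Only the first and the last column can stick out of the domain. Inside one column the
  graph varies by less than 7, so its integer parts stay within 8 of a fixed one: 17 cells for each
  of the two columns.\<close>

lemma arc_end_cells:
  assumes ok: "arc_ok A"
  defines "E \<equiv> {c. arc_pts A \<inter> cell c \<noteq> {} \<and> \<not> arc_full A c}"
  shows "finite E" "card E \<le> 34"
proof -
  define I where "I = {\<lfloor>ap A\<rfloor>, \<lceil>aq A\<rceil> - 1}"
  define E' where "E' = sw (arow A) ` E"
  have E'D: "\<exists>u. ap A < u \<and> u < aq A \<and> \<lfloor>u\<rfloor> = i \<and> \<lfloor>af A u\<rfloor> = j \<and> i \<in> I" if "(i, j) \<in> E'" for i j
  proof -
    obtain c P where cP: "(i, j) = sw (arow A) c" "P \<in> arc_pts A" "P \<in> cell c" "\<not> arc_full A c"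
      using \<open>(i, j) \<in> E'\<close> by (auto simp: E'_def E_def)
    obtain u v where uv: "sw (arow A) P = (u, v)" by force
    have c: "(u, v) \<in> cell (i, j)" using sw_cell[of "arow A" P c] cP uv by simp
    have a: "ap A < u" "u < aq A" "v = af A u" using cP uv by (auto simp: arc_pts_def)
    have "\<not> (ap A \<le> i \<and> real_of_int i + 1 \<le> aq A)" using cP(1,4) by (metis arc_full_def fst_conv)
    then have "i = \<lfloor>ap A\<rfloor> \<or> i = \<lceil>aq A\<rceil> - 1"
      using c a by (auto simp: cell_def floor_eq_iff) linarith+
    then show ?thesis using c a by (intro exI[of _ u]) (auto simp: I_def mem_cell)
  qed
  define B where "B i = {j. (i, j) \<in> E'}" for i
  have B: "finite (B i) \<and> card (B i) \<le> 17" for i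
  proof (cases "B i = {}")
    case False
    then obtain j0 where "(i, j0) \<in> E'" by (auto simp: B_def)
    then obtain u0 where u0: "ap A < u0" "u0 < aq A" "\<lfloor>u0\<rfloor> = i" using E'D by blast
    have "B i \<subseteq> {\<lfloor>af A u0\<rfloor> - 8..\<lfloor>af A u0\<rfloor> + 8}"
    proof
      fix j assume "j \<in> B i"
      then obtain u where u: "ap A < u" "u < aq A" "\<lfloor>u\<rfloor> = i" "\<lfloor>af A u\<rfloor> = j" using E'D[of i j] by (auto simp: B_def)
      have "\<bar>af A u - af A u0\<bar> \<le> 7 * \<bar>u - u0\<bar>" using ok u u0 by (auto simp: arc_ok_def graph_arc_def)
      moreover have "\<bar>u - u0\<bar> < 1" using u(3) u0(3) by (simp add: floor_eq_iff) linarith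
      ultimately have d: "\<bar>af A u - af A u0\<bar> < 7" by (smt (verit))
      have "real_of_int j \<le> af A u" "af A u < real_of_int j + 1" using u(4) by linarith+
      moreover have "real_of_int \<lfloor>af A u0\<rfloor> \<le> af A u0" "af A u0 < real_of_int \<lfloor>af A u0\<rfloor> + 1" by linarith+
      ultimately have "real_of_int j < real_of_int (\<lfloor>af A u0\<rfloor> + 8)" "real_of_int (\<lfloor>af A u0\<rfloor> - 8) < real_of_int j"
        using d unfolding of_int_add of_int_diff of_int_numeral by linarith+
      then show "j \<in> {\<lfloor>af A u0\<rfloor> - 8..\<lfloor>af A u0\<rfloor> + 8}" by simp
    qed
    then have "finite (B i)" "card (B i) \<le> card {\<lfloor>af A u0\<rfloor> - 8..\<lfloor>af A u0\<rfloor> + 8}"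
      using finite_subset card_mono[of "{\<lfloor>af A u0\<rfloor> - 8..\<lfloor>af A u0\<rfloor> + 8}" "B i"] by blast+
    moreover have "card {\<lfloor>af A u0\<rfloor> - 8..\<lfloor>af A u0\<rfloor> + 8} = 17" by simp
    ultimately show ?thesis by simp
  qed simp
  have E'eq: "E' = (SIGMA i:I. B i)"
  proof (intro equalityI subsetI)
    fix c assume "c \<in> E'" then show "c \<in> (SIGMA i:I. B i)" using E'D[of "fst c" "snd c"] by (cases c) (auto simp: B_def)
  qed (auto simp: B_def)
  have fI: "finite I" "card I \<le> 2" by (auto simp: I_def card_insert_if)
  have fE': "finite E'" unfolding E'eq using fI B by (intro finite_SigmaI) auto
  have "card E' = (\<Sum>i\<in>I. card (B i))" unfolding E'eq using fI B by (intro card_SigmaI) auto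
  also have "\<dots> \<le> (\<Sum>i\<in>I. 17)" using B by (intro sum_mono) auto
  also have "\<dots> \<le> 34" using fI by simp
  finally have cE': "card E' \<le> 34" .
  have "inj_on (sw (arow A)) E" by (metis inj_onI sw_sw)
  then show "finite E" "card E \<le> 34" using fE' cE' by (auto simp: E'_def finite_image_iff card_image)
qed

text \<open>Walk from \<open>x\<close> straight towards the zero \<open>y\<close> and stop at the
  first zero. It lies on some arc, and just before it F is negative, so that \<open>side\<close> of
  this arc is positive there. On the way \<open>side\<close> cannot vanish, since its zeros in this
  column lie on the closed arc, where F is 0. Hence \<open>side\<close> is not negative at
  \<open>x\<close> itself. The argument does not mind several arcs crossing the same cell.\<close>

lemma zero_crossing_side:
  fixes F :: "real \<times> real \<Rightarrow> real"
  assumes F: "continuous_on UNIV F" and I: "finite I"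
    and ok: "\<And>k. k \<in> I \<Longrightarrow> arc_ok (A k)"
    and zero: "\<And>k P. k \<in> I \<Longrightarrow> P \<in> arc_closure (A k) \<Longrightarrow> F P = 0"
    and loc: "\<And>k P. k \<in> I \<Longrightarrow> P \<in> arc_pts (A k) \<Longrightarrow> \<forall>\<^sub>F R in at P. F R < 0 \<longrightarrow> 0 < side (A k) R"
    and W: "convex W" "W \<subseteq> cell c"
    and cov: "\<And>P. P \<in> W \<Longrightarrow> F P = 0 \<Longrightarrow> \<exists>k\<in>I. arc_full (A k) c \<and> P \<in> arc_pts (A k)"
    and x: "x \<in> W" "F x \<le> 0" and y: "y \<in> W" "F y = 0"
  shows "\<exists>k\<in>I. arc_hit (A k) c \<and> 0 \<le> side (A k) x"
proof (cases "F x = 0")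
  case True
  then obtain k where k: "k \<in> I" "arc_full (A k) c" "x \<in> arc_pts (A k)" using cov x by blast
  then have "arc_hit (A k) c" using arc_hitI[OF ok] W x by blast
  moreover have "side (A k) x = 0" using k by (auto simp: side_def arc_pts_def)
  ultimately show ?thesis using k by force
next
  case False
  then have Fx: "F x < 0" using x by simp
  define \<gamma> where "\<gamma> \<tau> = (1 - \<tau>) *\<^sub>R x + \<tau> *\<^sub>R y" for \<tau> :: real
  have g_cont: "continuous_on S \<gamma>" for S unfolding \<gamma>_def by (intro continuous_intros)
  have gW: "\<gamma> \<tau> \<in> W" if "0 \<le> \<tau>" "\<tau> \<le> 1" for \<tau>
    using W(1) x(1) y(1) that unfolding \<gamma>_def by (intro convexD) auto
  define Z where "Z = {\<tau> \<in> {0..1}. F (\<gamma> \<tau>) = 0}"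
  have Fg: "continuous_on S (\<lambda>\<tau>. F (\<gamma> \<tau>))" for S
    by (rule continuous_on_compose2[OF F g_cont]) auto
  have Zne: "1 \<in> Z" using y by (simp add: Z_def \<gamma>_def)
  have "closed Z" unfolding Z_def by (intro continuous_closed_preimage_constant Fg) auto
  moreover have "bounded Z" by (rule bounded_subset[of "{0..1}"]) (auto simp: Z_def)
  ultimately have "compact Z" by (simp add: compact_eq_bounded_closed)
  then obtain T where T: "T \<in> Z" "\<And>\<tau>. \<tau> \<in> Z \<Longrightarrow> T \<le> \<tau>" using compact_attains_inf[of Z] Zne by blast
  have T1: "0 < T" "T \<le> 1" "F (\<gamma> T) = 0"
  proof -
    have "T \<noteq> 0" using T(1) Fx by (auto simp: Z_def \<gamma>_def)
    then show "0 < T" "T \<le> 1" "F (\<gamma> T) = 0" using T(1) by (auto simp: Z_def)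
  qed
  have neg: "F (\<gamma> \<tau>) < 0" if "0 \<le> \<tau>" "\<tau> < T" for \<tau>
  proof (rule ccontr)
    assume nn: "\<not> F (\<gamma> \<tau>) < 0"
    note tr = that
    have "F (\<gamma> 0) < 0" using Fx by (simp add: \<gamma>_def)
    then obtain \<tau>' where "0 \<le> \<tau>'" "\<tau>' \<le> \<tau>" "F (\<gamma> \<tau>') = 0"
      using IVT'[of "\<lambda>\<tau>. F (\<gamma> \<tau>)" 0 0 \<tau>] Fg tr nn by auto
    then have "\<tau>' \<in> Z" using that T1 by (auto simp: Z_def)
    then show False using T(2) that \<open>\<tau>' \<le> \<tau>\<close> by force
  qed
  obtain k where k: "k \<in> I" "arc_full (A k) c" "\<gamma> T \<in> arc_pts (A k)" using cov[OF gW[of T]] T1 by auto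
  have hit: "arc_hit (A k) c" using arc_hitI[OF ok[OF k(1)] k(2,3)] gW[of T] W T1 by auto
  define g where "g = (\<lambda>\<tau>. side (A k) (\<gamma> \<tau>))"
  have dom: "ap (A k) \<le> fst (sw (arow (A k)) P) \<and> fst (sw (arow (A k)) P) \<le> aq (A k)" if "P \<in> W" for P
  proof -
    have "sw (arow (A k)) P \<in> cell (sw (arow (A k)) c)" using that W(2) sw_cell by blast
    then show ?thesis using k(2) by (auto simp: cell_def arc_full_def case_prod_beta)
  qed
  have g_con: "continuous_on {0..T} g"
  proof -
    have c1: "continuous_on {ap (A k)..aq (A k)} (af (A k))"
      using ok[OF k(1)] graph_arc_continuous by (simp add: arc_ok_def)
    have c2: "continuous_on {0..T} (\<lambda>\<tau>. fst (sw (arow (A k)) (\<gamma> \<tau>)))"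
      by (cases "arow (A k)") (auto simp: sw_def intro!: continuous_intros g_cont)
    have c3: "fst (sw (arow (A k)) (\<gamma> \<tau>)) \<in> {ap (A k)..aq (A k)}" if "\<tau> \<in> {0..T}" for \<tau>
      using dom gW T1 that by auto
    have "continuous_on {0..T} (\<lambda>\<tau>. af (A k) (fst (sw (arow (A k)) (\<gamma> \<tau>))))"
      by (rule continuous_on_compose2[OF c1 c2]) (use c3 in blast)
    moreover have "continuous_on {0..T} (\<lambda>\<tau>. snd (sw (arow (A k)) (\<gamma> \<tau>)))"
      by (cases "arow (A k)") (auto simp: sw_def intro!: continuous_intros g_cont)
    ultimately show ?thesis unfolding g_def side_def
      by (intro continuous_on_mult continuous_on_diff continuous_on_const)
  qed
  have asg: "asgn (A k) \<noteq> 0" using ok[OF k(1)] by (auto simp: arc_ok_def)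
  have nz: "g \<tau> \<noteq> 0" if "0 \<le> \<tau>" "\<tau> < T" for \<tau>
  proof
    assume "g \<tau> = 0"
    then have "\<gamma> \<tau> \<in> arc_closure (A k)" using dom[OF gW[of \<tau>]] that T1 asg by (auto simp: g_def side_def arc_closure_def)
    then show False using zero[OF k(1), of "\<gamma> \<tau>"] neg[OF that] by simp
  qed
  have "\<exists>\<tau>. 0 \<le> \<tau> \<and> \<tau> < T \<and> 0 < g \<tau>"
  proof -
    have ne: "\<gamma> \<tau> \<noteq> \<gamma> T" if "0 \<le> \<tau>" "\<tau> < T" for \<tau> using neg[OF that] T1(3) by force
    have "((\<lambda>\<tau>. \<gamma> \<tau>) \<longlongrightarrow> \<gamma> T) (at_left T)" using g_cont[of UNIV] by (simp add: continuous_on_def filterlim_at_split)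
    then have "filterlim \<gamma> (at (\<gamma> T)) (at_left T)"
      unfolding filterlim_at using ne T1(1) by (auto simp: eventually_at_left_field intro!: exI[of _ 0])
    then have "\<forall>\<^sub>F \<tau> in at_left T. F (\<gamma> \<tau>) < 0 \<longrightarrow> 0 < side (A k) (\<gamma> \<tau>)"
      by (rule eventually_compose_filterlim[OF loc[OF k(1,3)]])
    moreover have "\<forall>\<^sub>F \<tau> in at_left T. 0 \<le> \<tau> \<and> \<tau> < T"
      using T1(1) by (auto simp: eventually_at_left_field intro!: exI[of _ 0])
    ultimately have "\<forall>\<^sub>F \<tau> in at_left T. 0 \<le> \<tau> \<and> \<tau> < T \<and> 0 < g \<tau>"
      by eventually_elim (auto simp: g_def neg)
    then show ?thesis using eventually_happens trivial_limit_at_left_real by blast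
  qed
  then obtain \<tau> where t: "0 \<le> \<tau>" "\<tau> < T" "0 < g \<tau>" by auto
  have "0 \<le> g 0"
  proof (rule ccontr)
    assume "\<not> 0 \<le> g 0"
    then obtain \<tau>' where "0 \<le> \<tau>'" "\<tau>' \<le> \<tau>" "g \<tau>' = 0"
      using IVT'[of g 0 0 \<tau>] t continuous_on_subset[OF g_con, of "{0..\<tau>}"] by auto
    then show False using nz t by force
  qed
  then have "0 \<le> side (A k) x" by (simp add: g_def \<gamma>_def)
  then show ?thesis using k hit by blast
qed

text \<open>Every point of a wrong part lies on the counted side of an arc that hits its cell, so
  the wrong parts are covered by one-sided pieces. Exchanging the two sums leaves one application of
  \<open>arc_area\<close> for each arc.\<close>

lemma leftover_sum:
  fixes Wd :: "int \<times> int \<Rightarrow> (real \<times> real) set"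
  assumes C: "finite C" and I: "finite I" and ok: "\<And>k. k \<in> I \<Longrightarrow> arc_ok (A k)"
    and W: "\<And>c. c \<in> C \<Longrightarrow> Wd c \<subseteq> cell c"
      "\<And>c x. c \<in> C \<Longrightarrow> x \<in> Wd c \<Longrightarrow> \<exists>k\<in>I. arc_hit (A k) c \<and> 0 \<le> side (A k) x"
  shows "(\<Sum>c\<in>C. measure lborel (Wd c)) \<le> (\<Sum>k\<in>I. (aq (A k) - ap (A k)) + \<bar>af (A k) (aq (A k)) - af (A k) (ap (A k))\<bar> / 2 + 7)"
proof -
  define \<mu> where "\<mu> k c = measure lborel (cell c \<inter> {P. 0 \<le> side (A k) P})" for k c
  have meas: "cell c \<inter> {P. 0 \<le> side (A k) P} \<in> sets borel" if k: "k \<in> I" "arc_hit (A k) c" for k c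
  proof -
    define b S where "b = arow (A k)" "S = {P. fst (sw b P) \<in> {ap (A k)..aq (A k)}}"
    have gc: "continuous_on {ap (A k)..aq (A k)} (af (A k))"
      using graph_arc_continuous ok[OF k(1)] by (auto simp: arc_ok_def)
    have sc: "continuous_on T (sw b :: real \<times> real \<Rightarrow> _)" for T
      by (cases b) (auto simp: sw_def[abs_def] intro!: continuous_on_swap continuous_intros)
    have clS: "closed S"
    proof -
      have "S = {P. ap (A k) \<le> fst (sw b P)} \<inter> {P. fst (sw b P) \<le> aq (A k)}" by (auto simp: b_S_def)
      then show ?thesis by (auto intro!: closed_Int closed_Collect_le continuous_intros sc)
    qed
    have "continuous_on S (side (A k))" unfolding side_def[abs_def] b_S_def(1)[symmetric]
      by (intro continuous_intros sc continuous_on_compose2[OF gc]) (auto simp: b_S_def)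
    then have "closed (S \<inter> side (A k) -` {0..})" using clS by (rule continuous_closed_preimage) auto
    moreover have "cell c \<subseteq> S"
    proof
      fix P assume "P \<in> cell c"
      then have "sw b P \<in> cell (sw b c)" by (simp add: sw_cell)
      then show "P \<in> S" using k(2) by (auto simp: b_S_def cell_def arc_hit_def arc_full_def case_prod_beta)
    qed
    then have "cell c \<inter> {P. 0 \<le> side (A k) P} = cell c \<inter> (S \<inter> side (A k) -` {0..})" by auto
    ultimately show ?thesis by (metis borel_closed cell_borel sets.Int)
  qed
  have step: "measure lborel (Wd c) \<le> (\<Sum>k\<in>I. if arc_hit (A k) c then \<mu> k c else 0)" if c: "c \<in> C" for c
  proof (cases "Wd c \<in> sets lborel")
    case True
    define J where "J = {k \<in> I. arc_hit (A k) c}"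
    define UU where "UU = (\<Union>k\<in>J. cell c \<inter> {P. 0 \<le> side (A k) P})"
    have Um: "UU \<in> sets lborel" unfolding UU_def using I meas by (intro sets.finite_UN) (auto simp: J_def)
    have "emeasure lborel UU \<le> emeasure lborel (cell c)" by (intro emeasure_mono) (auto simp: UU_def)
    then have "UU \<in> fmeasurable lborel" using Um by (auto simp: fmeasurable_def emeasure_cell intro: le_less_trans)
    moreover have "Wd c \<subseteq> UU" using W(1)[OF c] W(2)[OF c] unfolding UU_def J_def by blast
    ultimately have "measure lborel (Wd c) \<le> measure lborel UU" using True by (intro measure_mono_fmeasurable)
    also have "\<dots> \<le> (\<Sum>k\<in>J. \<mu> k c)" unfolding UU_def \<mu>_def
      using I meas by (intro measure_UNION_le) (auto simp: J_def)
    also have "\<dots> = (\<Sum>k\<in>I. if arc_hit (A k) c then \<mu> k c else 0)"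
      unfolding J_def using I by (simp add: sum.inter_filter)
    finally show ?thesis .
  next
    case False
    then show ?thesis by (simp add: measure_notin_sets \<mu>_def sum_nonneg)
  qed
  have "(\<Sum>c\<in>C. measure lborel (Wd c)) \<le> (\<Sum>c\<in>C. \<Sum>k\<in>I. if arc_hit (A k) c then \<mu> k c else 0)"
    by (intro sum_mono step)
  also have "\<dots> = (\<Sum>k\<in>I. \<Sum>c\<in>C. if arc_hit (A k) c then \<mu> k c else 0)" by (rule sum.swap)
  also have "\<dots> = (\<Sum>k\<in>I. \<Sum>c\<in>{c\<in>C. arc_hit (A k) c}. \<mu> k c)"
    using C by (simp add: sum.inter_filter)
  also have "\<dots> \<le> (\<Sum>k\<in>I. (aq (A k) - ap (A k)) + \<bar>af (A k) (aq (A k)) - af (A k) (ap (A k))\<bar> / 2 + 7)"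
    unfolding \<mu>_def using C ok by (intro sum_mono arc_area) auto
  finally show ?thesis .
qed

lemma (in plane_curve) column_to_arc:
  assumes "inj_on cu {l..m}" "inj_on cv {l..m}"
    and "\<And>x y. x \<in> {l..m} \<Longrightarrow> y \<in> {l..m} \<Longrightarrow> \<bar>cv y - cv x\<bar> \<le> 7 * \<bar>cu y - cu x\<bar>"
    and "\<bar>cu m - cu l\<bar> \<le> \<bar>cv m - cv l\<bar> \<or> 7 * \<bar>cv m - cv l\<bar> \<le> \<bar>cu m - cu l\<bar>"
    and sg: "\<sigma> = 1 \<or> \<sigma> = -1"
  shows "\<exists>A. arc_ok A \<and> arow A = b \<and> aq A - ap A = \<bar>cu m - cu l\<bar> \<and> \<bar>af A (aq A) - af A (ap A)\<bar> = \<bar>cv m - cv l\<bar>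
     \<and> arc_closure A = (\<lambda>h. sw b (cu h, cv h)) ` {l..m} \<and> arc_pts A = (\<lambda>h. sw b (cu h, cv h)) ` {l<..<m}
     \<and> (\<forall>x. \<forall>h\<in>{l..m}. lu x ((1 - h) / 2) \<in> {ap A..aq A} \<longrightarrow>
          (\<exists>c>0. \<sigma> * (x - X h) = c * side A (sw b (lu x ((1 - h) / 2), lv x ((1 - h) / 2)))))"
proof -
  obtain p q f s where 1: "graph_arc p q f" "s = 1 \<or> s = -1" "q - p = \<bar>cu m - cu l\<bar>" "\<bar>f q - f p\<bar> = \<bar>cv m - cv l\<bar>"
     "cu ` {l..m} = {p..q}" "cu ` {l<..<m} = {p<..<q}" "\<And>h. h \<in> {l..m} \<Longrightarrow> f (cu h) = cv h"
     "\<And>x h. h \<in> {l..m} \<Longrightarrow> lu x ((1 - h) / 2) \<in> {p..q} \<Longrightarrow>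
          (\<exists>c>0. x - X h = s * c * (lv x ((1 - h) / 2) - f (lu x ((1 - h) / 2))))"
    using column_arc[OF assms(1-4)] by metis
  define A where "A = Arc b p q f (\<sigma> * s)"
  have ok: "arc_ok A" using 1(1,2) sg by (auto simp: arc_ok_def A_def)
  have cl: "arc_closure A = (\<lambda>h. sw b (cu h, cv h)) ` {l..m}"
  proof (intro equalityI subsetI)
    fix P assume P: "P \<in> arc_closure A"
    then have "fst (sw b P) \<in> {p..q}" by (auto simp: arc_closure_def A_def)
    then obtain h where h: "h \<in> {l..m}" "fst (sw b P) = cu h" unfolding 1(5)[symmetric] by auto
    then have "sw b P = (cu h, cv h)" using P 1(7) by (auto simp: arc_closure_def A_def prod_eq_iff)
    then have "P = sw b (cu h, cv h)" by (metis sw_sw)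
    then show "P \<in> (\<lambda>h. sw b (cu h, cv h)) ` {l..m}" using h by auto
  next
    fix P assume "P \<in> (\<lambda>h. sw b (cu h, cv h)) ` {l..m}"
    then obtain h where h: "h \<in> {l..m}" "P = sw b (cu h, cv h)" by auto
    then have "cu h \<in> {p..q}" using 1(5) by blast
    then show "P \<in> arc_closure A" using h 1(7) by (simp add: arc_closure_def A_def)
  qed
  have op: "arc_pts A = (\<lambda>h. sw b (cu h, cv h)) ` {l<..<m}"
  proof (intro equalityI subsetI)
    fix P assume P: "P \<in> arc_pts A"
    then have "fst (sw b P) \<in> {p<..<q}" by (auto simp: arc_pts_def A_def)
    then obtain h where h: "h \<in> {l<..<m}" "fst (sw b P) = cu h" unfolding 1(6)[symmetric] by auto
    then have "sw b P = (cu h, cv h)" using P 1(7)[of h] by (auto simp: arc_pts_def A_def prod_eq_iff)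
    then have "P = sw b (cu h, cv h)" by (metis sw_sw)
    then show "P \<in> (\<lambda>h. sw b (cu h, cv h)) ` {l<..<m}" using h by auto
  next
    fix P assume "P \<in> (\<lambda>h. sw b (cu h, cv h)) ` {l<..<m}"
    then obtain h where h: "h \<in> {l<..<m}" "P = sw b (cu h, cv h)" by auto
    then have "cu h \<in> {p<..<q}" using 1(6) by blast
    then show "P \<in> arc_pts A" using h 1(7)[of h] by (simp add: arc_pts_def A_def)
  qed
  have sd: "\<exists>c>0. \<sigma> * (x - X h) = c * side A (sw b (lu x ((1 - h) / 2), lv x ((1 - h) / 2)))"
    if "h \<in> {l..m}" "lu x ((1 - h) / 2) \<in> {p..q}" for x h
  proof -
    from 1(8)[OF that] obtain c where "c > 0" "x - X h = s * c * (lv x ((1 - h) / 2) - f (lu x ((1 - h) / 2)))" by auto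
    then show ?thesis by (intro exI[of _ c]) (auto simp: side_def A_def)
  qed
  show ?thesis
    by (intro exI[of _ A] conjI ok cl op allI ballI impI sd) (auto simp: A_def 1)
qed

lemma le_seven_times: "0 \<le> p \<Longrightarrow> 0 \<le> q \<Longrightarrow> 7 * p \<le> q \<Longrightarrow> p \<le> 7 * (q::real)"
  by simp

text \<open>Injectivity of these combinations of u and v makes both coordinates monotone on a piece
  and decides there, once and for all, how the increments compare with the ratios 1, 7 and
  1/7.\<close>

definition slopes :: "(real \<times> real) set" where
  "slopes = {(1, 0), (0, 1), (1, 1), (1, -1), (7, 1), (7, -1), (1, 7), (1, -7)}"

context plane_curve
begin

text \<open>In order of increasing |dv/du|, the ranges separated by 1/7, 1 and 7 are read over u, v,
  u and v. In each range the graph has Lipschitz constant at most 7.\<close>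

lemma curve_to_arc:
  assumes inj: "\<And>\<alpha> \<beta>. (\<alpha>, \<beta>) \<in> slopes \<Longrightarrow> inj_on (\<lambda>h. \<alpha> * cu h + \<beta> * cv h) {l..m}"
    and sg: "\<sigma> = 1 \<or> \<sigma> = -1"
  shows "\<exists>A. arc_ok A
     \<and> (aq A - ap A = \<bar>cu m - cu l\<bar> \<and> \<bar>af A (aq A) - af A (ap A)\<bar> = \<bar>cv m - cv l\<bar> \<or>
        aq A - ap A = \<bar>cv m - cv l\<bar> \<and> \<bar>af A (aq A) - af A (ap A)\<bar> = \<bar>cu m - cu l\<bar>)
     \<and> arc_closure A = (\<lambda>h. (cu h, cv h)) ` {l..m} \<and> arc_pts A = (\<lambda>h. (cu h, cv h)) ` {l<..<m}
     \<and> (\<forall>x. \<forall>h\<in>{l..m}. fst (sw (arow A) (lu x ((1 - h) / 2), lv x ((1 - h) / 2))) \<in> {ap A..aq A} \<longrightarrow>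
          (\<exists>c>0. \<sigma> * (x - X h) = c * side A (lu x ((1 - h) / 2), lv x ((1 - h) / 2))))"
proof -
  have iu: "inj_on cu {l..m}" using inj[of 1 0] by (simp add: slopes_def)
  have iv: "inj_on cv {l..m}" using inj[of 0 1] by (simp add: slopes_def)
  have lmI: "l \<in> {l..m}" "m \<in> {l..m}" using lm by auto
  have c11: "(\<forall>x\<in>{l..m}. \<forall>y\<in>{l..m}. \<bar>cv y - cv x\<bar> \<le> \<bar>cu y - cu x\<bar>) \<or>
         (\<forall>x\<in>{l..m}. \<forall>y\<in>{l..m}. \<bar>cu y - cu x\<bar> \<le> \<bar>cv y - cv x\<bar>)"
    using abs_class[OF cont_cu cont_cv, of 1 1, unfolded abs_mult abs_numeral abs_one mult_1] inj[of 1 1] inj[of 1 "-1"]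
    by (simp add: slopes_def)
  have c17: "(\<forall>x\<in>{l..m}. \<forall>y\<in>{l..m}. 7 * \<bar>cv y - cv x\<bar> \<le> \<bar>cu y - cu x\<bar>) \<or>
         (\<forall>x\<in>{l..m}. \<forall>y\<in>{l..m}. \<bar>cu y - cu x\<bar> \<le> 7 * \<bar>cv y - cv x\<bar>)"
    using abs_class[OF cont_cu cont_cv, of 1 7, unfolded abs_mult abs_numeral abs_one mult_1] inj[of 1 7] inj[of 1 "-7"]
    by (simp add: slopes_def)
  have c71: "(\<forall>x\<in>{l..m}. \<forall>y\<in>{l..m}. \<bar>cv y - cv x\<bar> \<le> 7 * \<bar>cu y - cu x\<bar>) \<or>
         (\<forall>x\<in>{l..m}. \<forall>y\<in>{l..m}. 7 * \<bar>cu y - cu x\<bar> \<le> \<bar>cv y - cv x\<bar>)"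
    using abs_class[OF cont_cu cont_cv, of 7 1, unfolded abs_mult abs_numeral abs_one mult_1] inj[of 7 1] inj[of 7 "-1"]
    by (simp add: slopes_def)
  consider (col) "\<forall>x\<in>{l..m}. \<forall>y\<in>{l..m}. \<bar>cv y - cv x\<bar> \<le> 7 * \<bar>cu y - cu x\<bar>"
        "\<bar>cu m - cu l\<bar> \<le> \<bar>cv m - cv l\<bar> \<or> 7 * \<bar>cv m - cv l\<bar> \<le> \<bar>cu m - cu l\<bar>"
    | (row) "\<forall>x\<in>{l..m}. \<forall>y\<in>{l..m}. \<bar>cu y - cu x\<bar> \<le> 7 * \<bar>cv y - cv x\<bar>"
        "\<bar>cv m - cv l\<bar> \<le> \<bar>cu m - cu l\<bar> \<or> 7 * \<bar>cu m - cu l\<bar> \<le> \<bar>cv m - cv l\<bar>"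
  proof -
    from c17 show ?thesis
    proof
      assume a: "\<forall>x\<in>{l..m}. \<forall>y\<in>{l..m}. 7 * \<bar>cv y - cv x\<bar> \<le> \<bar>cu y - cu x\<bar>"
      have "\<bar>cv y - cv x\<bar> \<le> 7 * \<bar>cu y - cu x\<bar>" if "x \<in> {l..m}" "y \<in> {l..m}" for x y
        by (rule le_seven_times[OF abs_ge_zero abs_ge_zero a[rule_format, OF that]])
      moreover have "7 * \<bar>cv m - cv l\<bar> \<le> \<bar>cu m - cu l\<bar>" using a[rule_format, OF lmI] .
      ultimately show ?thesis using col by blast
    next
      assume a: "\<forall>x\<in>{l..m}. \<forall>y\<in>{l..m}. \<bar>cu y - cu x\<bar> \<le> 7 * \<bar>cv y - cv x\<bar>"
      from c11 show ?thesis
      proof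
        assume b: "\<forall>x\<in>{l..m}. \<forall>y\<in>{l..m}. \<bar>cv y - cv x\<bar> \<le> \<bar>cu y - cu x\<bar>"
        have "\<bar>cu y - cu x\<bar> \<le> 7 * \<bar>cv y - cv x\<bar>" if "x \<in> {l..m}" "y \<in> {l..m}" for x y
          using a[rule_format, OF that] .
        moreover have "\<bar>cv m - cv l\<bar> \<le> \<bar>cu m - cu l\<bar>" using b[rule_format, OF lmI] .
        ultimately show ?thesis using row by blast
      next
        assume b: "\<forall>x\<in>{l..m}. \<forall>y\<in>{l..m}. \<bar>cu y - cu x\<bar> \<le> \<bar>cv y - cv x\<bar>"
        from c71 show ?thesis
        proof
          assume d: "\<forall>x\<in>{l..m}. \<forall>y\<in>{l..m}. \<bar>cv y - cv x\<bar> \<le> 7 * \<bar>cu y - cu x\<bar>"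
          have "\<bar>cv y - cv x\<bar> \<le> 7 * \<bar>cu y - cu x\<bar>" if "x \<in> {l..m}" "y \<in> {l..m}" for x y
            using d[rule_format, OF that] .
          moreover have "\<bar>cu m - cu l\<bar> \<le> \<bar>cv m - cv l\<bar>" using b[rule_format, OF lmI] .
          ultimately show ?thesis using col by blast
        next
          assume d: "\<forall>x\<in>{l..m}. \<forall>y\<in>{l..m}. 7 * \<bar>cu y - cu x\<bar> \<le> \<bar>cv y - cv x\<bar>"
          have "\<bar>cu y - cu x\<bar> \<le> 7 * \<bar>cv y - cv x\<bar>" if "x \<in> {l..m}" "y \<in> {l..m}" for x y
            by (rule le_seven_times[OF abs_ge_zero abs_ge_zero d[rule_format, OF that]])
          moreover have "7 * \<bar>cu m - cu l\<bar> \<le> \<bar>cv m - cv l\<bar>" using d[rule_format, OF lmI] .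
          ultimately show ?thesis using row by blast
        qed
      qed
    qed
  qed
  then show ?thesis
  proof cases
    case col
    show ?thesis
      by (rule ex_forward[OF column_to_arc[OF iu iv col(1)[rule_format] col(2) sg, of False]]) (simp_all add: sw_def)
  next
    case row
    interpret T: plane_curve q12 q11 q22 q21 l m X
      using det_nz lm contX cvX by unfold_locales (auto simp: mult.commute)
    have dT: "T.dt = - dt" by (simp add: T.dt_def dt_def algebra_simps)
    have sT: "T.lu = lv" "T.lv = lu"
      unfolding fun_eq_iff T.lu_def T.lv_def lu_def lv_def dT by (auto simp: minus_divide_left[symmetric] divide_simps)
    have cT: "T.cu = cv" "T.cv = cu" unfolding fun_eq_iff T.cu_def T.cv_def cu_def cv_def sT by auto
    show ?thesis
      by (rule ex_forward[OF T.column_to_arc[unfolded cT sT, OF iv iu row(1)[rule_format] row(2) sg, of True]]) (simp_all add: sw_def)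
  qed
qed

end

text \<open>The derivative is required in the open interval only, because \<open>ang\<close> has
  vertical tangents at the extreme heights; continuity suffices at the ends.\<close>

lemma convex_on_MVT:
  fixes f :: "real \<Rightarrow> real"
  assumes cont: "continuous_on {l..m} f"
    and der: "\<And>x. l < x \<Longrightarrow> x < m \<Longrightarrow> (f has_real_derivative f' x) (at x)"
    and mono: "\<And>x y. l < x \<Longrightarrow> x \<le> y \<Longrightarrow> y < m \<Longrightarrow> f' x \<le> f' y"
  shows "convex_on {l..m} f"
proof (rule convex_on_linorderI)
  fix t x y :: real assume t: "t > 0" "t < 1" and xy: "x \<in> {l..m}" "y \<in> {l..m}" "x < y"
  define z where "z = (1 - t) *\<^sub>R x + t *\<^sub>R y"
  have z: "z - x = t * (y - x)" "y - z = (1 - t) * (y - x)" by (auto simp: z_def algebra_simps)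
  have zz: "x < z" "z < y" using z mult_pos_pos[of t "y - x"] mult_pos_pos[of "1 - t" "y - x"] t xy by linarith+
  have M: "\<exists>c. a < c \<and> c < b \<and> f b - f a = (b - a) * f' c" if "a \<in> {l..m}" "b \<in> {l..m}" "a < b" for a b
  proof -
    have "continuous_on {a..b} f" by (rule continuous_on_subset[OF cont]) (use that in auto)
    moreover have "f differentiable (at z)" if "a < z" "z < b" for z
      using der[of z] that \<open>a \<in> {l..m}\<close> \<open>b \<in> {l..m}\<close> by (auto simp: real_differentiable_def)
    ultimately obtain k c where c: "a < c" "c < b" "(f has_real_derivative k) (at c)" "f b - f a = (b - a) * k"
      using MVT[OF \<open>a < b\<close>] by blast
    then have "k = f' c" using that by (intro DERIV_unique[OF c(3) der]) auto
    then show ?thesis using c by blast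
  qed
  obtain c where c: "x < c" "c < z" "f z - f x = (z - x) * f' c" using M[of x z] xy zz by auto
  obtain d where d: "z < d" "d < y" "f y - f z = (y - z) * f' d" using M[of z y] xy zz by auto
  have "f' c \<le> f' d" using c d xy by (intro mono) auto
  then have "t * (1 - t) * (y - x) * f' c \<le> t * (1 - t) * (y - x) * f' d" using t xy by (intro mult_left_mono) auto
  then have "(1 - t) * (f z - f x) \<le> t * (f y - f z)" unfolding c(3) d(3) z by (simp add: mult_ac)
  then show "f ((1 - t) *\<^sub>R x + t *\<^sub>R y) \<le> (1 - t) * f x + t * f y"
    unfolding z_def[symmetric] by (simp add: algebra_simps)
qed simp

lemma convex_concave_affine:
  fixes f :: "real \<Rightarrow> real"
  assumes "convex_on S f \<or> concave_on S f"
  shows "convex_on S (\<lambda>x. a + b * f x) \<or> concave_on S (\<lambda>x. a + b * f x)"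
proof -
  have S: "convex S" using assms by (auto simp: convex_on_def concave_on_def)
  have main: "convex_on S (\<lambda>x. a + b * g x)" if "convex_on S g" "b \<ge> 0" for g :: "real \<Rightarrow> real" and a b
    using that S by (intro convex_on_add convex_on_cmul) (auto simp: convex_on_const)
  show ?thesis
  proof (cases "b \<ge> 0")
    case True
    show ?thesis using assms main[of f b a] main[of "\<lambda>x. - f x" b "-a"] True by (auto simp: concave_on_def)
  next
    case False
    show ?thesis using assms main[of f "-b" "-a"] main[of "\<lambda>x. - f x" "-b" "a"] False by (auto simp: concave_on_def)
  qed
qed

section \<open>The boundary circle in the unit square\<close>

lemma sum_consecutive:
  fixes g :: "real \<Rightarrow> real"
  assumes "finite B" "B \<noteq> {}"
  shows "(\<Sum>b\<in>B - {Max B}. g (Min {b'\<in>B. b < b'}) - g b) = g (Max B) - g (Min B)"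
  using assms
proof (induction rule: finite_linorder_max_induct)
  case (insert b A)
  show ?case
  proof (cases "A = {}")
    case False
    define m where "m = Max A"
    have m: "m \<in> A" "\<And>a. a \<in> A \<Longrightarrow> a \<le> m" using insert(1) False by (auto simp: m_def)
    have M: "Max (insert b A) = b" "Min (insert b A) = Min A"
      using insert(1,2) False by (auto intro!: Max_eqI simp: min_def) (meson Min_in less_imp_le not_le)
    have bA: "b \<notin> A" using insert(2) by auto
    have s1: "Min {b' \<in> insert b A. x < b'} = Min {b' \<in> A. x < b'}" if "x \<in> A - {m}" for x
    proof -
      have fin: "finite {b' \<in> A. x < b'}" using insert(1) by auto
      have "x < m" using m(2)[of x] that by auto
      then have ne: "{b' \<in> A. x < b'} \<noteq> {}" using m by auto
      have "{b' \<in> insert b A. x < b'} = insert b {b' \<in> A. x < b'}" using insert(2) that by auto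
      moreover have "Min {b' \<in> A. x < b'} < b" using Min_in[OF fin ne] insert(2) by auto
      ultimately show ?thesis using Min_insert[OF fin ne, of b] by (simp add: min_absorb2)
    qed
    have s2: "Min {b' \<in> insert b A. m < b'} = b"
    proof -
      have "{b' \<in> insert b A. m < b'} = {b}" using insert(2) m(1,2) by (auto simp: not_less[symmetric] simp del: not_less)
      then show ?thesis by simp
    qed
    define G where "G x = g (Min {b'\<in>insert b A. x < b'}) - g x" for x
    have e: "insert b A - {b} = insert m (A - {m})" using bA m by auto
    have "(\<Sum>x\<in>insert b A - {b}. G x) = G m + (\<Sum>x\<in>A - {m}. G x)"
      unfolding e using insert(1) by (subst sum.insert) auto
    moreover have "G m = g b - g m" unfolding G_def s2 ..
    ultimately have "(\<Sum>x\<in>insert b A - {Max (insert b A)}. g (Min {b'\<in>insert b A. x < b'}) - g x)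
      = (g b - g m) + (\<Sum>x\<in>A - {m}. g (Min {b'\<in>insert b A. x < b'}) - g x)"
      unfolding M(1) G_def by simp
    also have "(\<Sum>x\<in>A - {m}. g (Min {b'\<in>insert b A. x < b'}) - g x) = (\<Sum>x\<in>A - {m}. g (Min {b'\<in>A. x < b'}) - g x)"
      using s1 by (intro sum.cong) auto
    also have "\<dots> = g m - g (Min A)" using insert.IH False by (simp add: m_def)
    finally show ?thesis by (simp add: M)
  qed simp
qed simp

locale cap_square = cap_curve r s t for r s t +
  fixes \<phi> :: real
begin

text \<open>\<open>sqF x y\<close> is <w, L(x, y)> - t for the normal w of longitude
  \<open>\<phi>\<close>. Clamping the second coordinate extends it continuously to the whole plane,
  periodic in x and constant beyond the poles, so that cells reaching over the edge need no separate
  function.\<close>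

definition "hgt y = 1 - 2 * max 0 (min 1 (y::real))"
definition "sqF x y = r * sqrt (1 - (hgt y)\<^sup>2) * cos (2 * pi * x - \<phi>) + s * hgt y - t"

lemma hgt_eq: "0 \<le> y \<Longrightarrow> y \<le> 1 \<Longrightarrow> hgt y = 1 - 2 * y" by (simp add: hgt_def)

lemma hgt_bounds: "\<bar>hgt y\<bar> \<le> 1" by (auto simp: hgt_def max_def min_def)

lemma continuous_sqF: "continuous_on S (\<lambda>P. sqF (fst P) (snd P))"
  unfolding sqF_def hgt_def by (intro continuous_intros)

lemma sqF_periodic: "sqF (x + of_int n) y = sqF x y"
proof -
  have "cos (2 * pi * (x + of_int n) - \<phi>) = cos ((2 * pi * x - \<phi>) + 2 * pi * of_int n)" by (simp add: algebra_simps)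
  also have "\<dots> = cos (2 * pi * x - \<phi>)" by (simp add: cos_add cos_int_2pin sin_int_2pin)
  finally show ?thesis by (simp add: sqF_def)
qed

lemma sqF_on_circle:
  assumes "hmin \<le> h" "h \<le> hmax"
  shows "sqF x ((1 - h) / 2) = r * sqrt (1 - h\<^sup>2) * (cos (2 * pi * x - \<phi>) - cos (ang h))"
proof -
  have "hgt ((1 - h) / 2) = 1 - 2 * ((1 - h) / 2)" using h_range[OF assms] by (intro hgt_eq) auto
  then have "hgt ((1 - h) / 2) = h" by (simp add: field_simps)
  then show ?thesis using cos_ang[OF assms] by (simp add: sqF_def algebra_simps)
qed

lemma sqF_zero_height:
  assumes "sqF x y = 0" "0 \<le> y" "y \<le> 1"
  shows "hmin \<le> 1 - 2 * y" "1 - 2 * y \<le> hmax"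
proof -
  define h where "h = 1 - 2 * y"
  have h: "hgt y = h" "\<bar>h\<bar> \<le> 1" using assms hgt_bounds[of y] by (auto simp: h_def hgt_eq)
  then have h2: "h\<^sup>2 \<le> 1" by (simp add: abs_square_le_1)
  have "t - s * h = r * sqrt (1 - h\<^sup>2) * cos (2 * pi * x - \<phi>)" using assms h by (simp add: sqF_def)
  then have "(t - s * h)\<^sup>2 = r\<^sup>2 * (1 - h\<^sup>2) * (cos (2 * pi * x - \<phi>))\<^sup>2" using h2 by (simp add: power_mult_distrib)
  also have "\<dots> \<le> r\<^sup>2 * (1 - h\<^sup>2)" using h2
    by (intro mult_left_le) (auto simp: abs_square_le_1)
  finally have "0 \<le> (hmax - h) * (h - hmin)" unfolding disc_factor[symmetric] disc_alt by simp
  then have "hmin \<le> h \<and> h \<le> hmax" using hmin_less_hmax by (auto simp: zero_le_mult_iff)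
  then show "hmin \<le> 1 - 2 * y" "1 - 2 * y \<le> hmax" by (auto simp: h_def)
qed

lemma sqF_zero_iff:
  assumes "hmin \<le> h" "h \<le> hmax"
  shows "sqF x ((1 - h) / 2) = 0 \<longleftrightarrow> cos (2 * pi * x - \<phi>) = cos (ang h)"
proof -
  have "r * sqrt (1 - h\<^sup>2) \<noteq> 0" using rad_pos[OF assms] by (rule less_imp_neq[THEN not_sym])
  then show ?thesis unfolding sqF_on_circle[OF assms] by (simp only: mult_eq_0_iff right_minus_eq simp_thms)
qed

text \<open>Squaring gives a quadratic in y with the value (t - s)^2 at y = 0. Since both vertical
  edges of the square are this one meridian, the heights at which the edge lies in the cap form an
  interval or the complement of one.\<close>

lemma meridian_zeros:
  defines "E \<equiv> {y \<in> {0..1}. sqF 0 y = 0}"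
  shows "finite E" "card E \<le> 2"
proof -
  define w where "w = r * cos \<phi>"
  define p where "p = [:t - s, 2 * s:]\<^sup>2 - smult (w\<^sup>2) [:0, 4, - 4:]"
  have ev: "poly p y = (t - s * (1 - 2 * y))\<^sup>2 - w\<^sup>2 * (1 - (1 - 2 * y)\<^sup>2)" for y
    by (simp add: p_def power2_eq_square algebra_simps)
  have "poly p 0 = (t - s)\<^sup>2" by (simp add: ev)
  then have p0: "p \<noteq> 0" using t_neq by auto
  have "degree ([:t - s, 2 * s:]\<^sup>2) \<le> 2"
    using degree_power_le[of "[:t - s, 2 * s:]" 2] by (rule order.trans) auto
  moreover have "degree (smult (w\<^sup>2) [:0, 4, - 4::real:]) \<le> 2" by (rule order.trans[OF degree_smult_le]) simp
  ultimately have dp: "degree p \<le> 2" unfolding p_def by (intro degree_diff_le)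
  have sub: "E \<subseteq> {y. poly p y = 0}"
  proof
    fix y assume "y \<in> E"
    then have y: "0 \<le> y" "y \<le> 1" "sqF 0 y = 0" by (auto simp: E_def)
    have h2: "(1 - 2 * y)\<^sup>2 \<le> 1" using y by (simp add: abs_square_le_1 abs_le_iff)
    define S where "S = sqrt (1 - (1 - 2 * y)\<^sup>2)"
    have "r * S * cos \<phi> + s * (1 - 2 * y) - t = 0" using y(3) hgt_eq[OF y(1,2)] by (simp add: sqF_def S_def)
    moreover have "w * S = r * S * cos \<phi>" by (simp add: w_def)
    ultimately have "t - s * (1 - 2 * y) = w * sqrt (1 - (1 - 2 * y)\<^sup>2)" unfolding S_def[symmetric] by linarith
    then have "(t - s * (1 - 2 * y))\<^sup>2 = w\<^sup>2 * (1 - (1 - 2 * y)\<^sup>2)" using h2 by (simp add: power_mult_distrib)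
    then show "y \<in> {y. poly p y = 0}" by (simp add: ev)
  qed
  show "finite E" "card E \<le> 2" using card_poly_zeros_le[OF p0 dp sub] by auto
qed

end

locale cap_lattice = cap_square r s t \<phi> for r s t \<phi> +
  fixes q11 q12 q21 q22 :: real
  assumes det_nz: "q11 * q22 - q12 * q21 \<noteq> 0"
begin

text \<open>Up to a common factor, \<open>cA\<close> and \<open>cB\<close> are the coefficients of x
  and y in the functional \<alpha> u + \<beta> v. \<open>crit\<close> collects the heights at which
  this functional is stationary along a branch of the curve.\<close>

definition "cA \<alpha> \<beta> = \<alpha> * q22 - \<beta> * q21"
definition "cB \<alpha> \<beta> = \<beta> * q11 - \<alpha> * q12"
definition "crit \<sigma> \<alpha> \<beta> = {h \<in> {hmin<..<hmax}. dang h = pi * \<sigma> * cB \<alpha> \<beta> / cA \<alpha> \<beta>}"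
text \<open>The curve is cut at its extreme heights, at stationary points of the functionals, at
  inflections and where it crosses the edge x = 0. The total 106 is 2 + 16 * 6 + 6 + 2, with 8
  functionals on each of two branches.\<close>

definition "Bk = {hmin, hmax} \<union> (\<Union>(\<sigma>, \<alpha>, \<beta>) \<in> {1, -1} \<times> slopes. crit \<sigma> \<alpha> \<beta>) \<union> {h. dnum h = 0} \<inter> {hmin<..<hmax}
   \<union> {h \<in> {hmin<..<hmax}. sqF 0 ((1 - h) / 2) = 0}"
definition "Bl = Bk - {hmax}"
definition "nxt b = Min {b' \<in> Bk. b < b'}"
text \<open>The sign selects the branch of the circle, and \<open>xraw\<close> is its longitude in
  turns, not reduced modulo 1. No piece crosses an integer, so a single shift, read off at the
  midpoint, brings the whole piece into the square.\<close>

definition "xraw \<sigma> h = (\<phi> + \<sigma> * ang h) / (2 * pi)"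
definition "xn \<sigma> b = of_int \<lfloor>xraw \<sigma> ((b + nxt b) / 2)\<rfloor>"
definition "xc \<sigma> b h = xraw \<sigma> h - xn \<sigma> b"

lemma finite_card_Bk: "finite Bk" "card Bk \<le> 106"
proof -
  have fs: "finite slopes" "card slopes \<le> 8" by (auto simp: slopes_def card_insert_if)
  have c: "finite (crit \<sigma> \<alpha> \<beta>)" "card (crit \<sigma> \<alpha> \<beta>) \<le> 6" for \<sigma> \<alpha> \<beta>
    unfolding crit_def by (rule card_dang_eq)+
  have f1: "finite ({1, -1 :: real} \<times> slopes)" using fs by auto
  have "card ({1, -1 :: real} \<times> slopes) \<le> 16" using fs by (auto simp: card_cartesian_product card_insert_if)
  moreover have "card (\<Union>(\<sigma>, \<alpha>, \<beta>) \<in> {1, -1} \<times> slopes. crit \<sigma> \<alpha> \<beta>) \<le> (\<Sum>(\<sigma>, \<alpha>, \<beta>) \<in> {1, -1} \<times> slopes. card (crit \<sigma> \<alpha> \<beta>))"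
    using card_UN_le[OF f1, of "\<lambda>(\<sigma>, \<alpha>, \<beta>). crit \<sigma> \<alpha> \<beta>"] by (simp add: case_prod_beta)
  moreover have "\<dots> \<le> (\<Sum>(\<sigma>, \<alpha>, \<beta>) \<in> {1, -1 :: real} \<times> slopes. 6)" using c by (intro sum_mono) auto
  ultimately have k1: "card (\<Union>(\<sigma>, \<alpha>, \<beta>) \<in> {1, -1} \<times> slopes. crit \<sigma> \<alpha> \<beta>) \<le> 96" by (simp add: case_prod_beta)
  have k2: "finite ({h. dnum h = 0} \<inter> {hmin<..<hmax})" "card ({h. dnum h = 0} \<inter> {hmin<..<hmax}) \<le> 6"
    using card_dnum_zeros card_mono[of "{h. dnum h = 0}" "{h. dnum h = 0} \<inter> {hmin<..<hmax}"] by auto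
  define Z where "Z = {h \<in> {hmin<..<hmax}. sqF 0 ((1 - h) / 2) = 0}"
  have Zs: "(\<lambda>h. (1 - h) / 2) ` Z \<subseteq> {y \<in> {0..1}. sqF 0 y = 0}" using hmin_gr hmax_less by (auto simp: Z_def)
  have inj: "inj_on (\<lambda>h::real. (1 - h) / 2) Z" by (auto simp: inj_on_def)
  have k3: "finite Z" "card Z \<le> 2"
    using meridian_zeros finite_subset[OF Zs] card_mono[OF _ Zs] inj by (auto simp: finite_image_iff card_image)
  have k4: "finite (\<Union>(\<sigma>, \<alpha>, \<beta>) \<in> {1, -1} \<times> slopes. crit \<sigma> \<alpha> \<beta>)" using f1 c by auto
  show "finite Bk" unfolding Bk_def Z_def[symmetric] using k2 k3 k4 by blast
  have "card {hmin, hmax} \<le> 2" by (simp add: card_insert_if)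
  moreover define U D where "U = (\<Union>(\<sigma>, \<alpha>, \<beta>) \<in> {1, -1} \<times> slopes. crit \<sigma> \<alpha> \<beta>)" "D = {h. dnum h = 0} \<inter> {hmin<..<hmax}"
  moreover have "card ({hmin, hmax} \<union> U \<union> D \<union> Z) \<le> card {hmin, hmax} + card U + card D + card Z"
    using card_Un_le[of "{hmin, hmax} \<union> U \<union> D" Z] card_Un_le[of "{hmin, hmax} \<union> U" D] card_Un_le[of "{hmin, hmax}" U] by linarith
  ultimately have "card ({hmin, hmax} \<union> U \<union> D \<union> Z) \<le> 106" using k1[folded U_D_def] k2(2)[folded U_D_def] k3(2) by linarith
  then show "card Bk \<le> 106" by (simp only: Bk_def Z_def U_D_def)
qed

lemma Bk_range: "b \<in> Bk \<Longrightarrow> hmin \<le> b \<and> b \<le> hmax"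
  using hmin_less_hmax by (auto simp: Bk_def crit_def)

lemma Bk_ends: "hmin \<in> Bk" "hmax \<in> Bk" by (auto simp: Bk_def)

lemma nxt:
  assumes "b \<in> Bl"
  shows "b < nxt b" "nxt b \<in> Bk" "hmin \<le> b" "nxt b \<le> hmax" "\<And>h. b < h \<Longrightarrow> h < nxt b \<Longrightarrow> h \<notin> Bk"
proof -
  have b: "b \<in> Bk" "b < hmax" using assms Bk_range[of b] by (auto simp: Bl_def)
  have fin: "finite {b' \<in> Bk. b < b'}" and ne: "{b' \<in> Bk. b < b'} \<noteq> {}"
    using finite_card_Bk Bk_ends b by auto
  have "nxt b \<in> {b' \<in> Bk. b < b'}" unfolding nxt_def by (rule Min_in[OF fin ne])
  then show "b < nxt b" "nxt b \<in> Bk" "hmin \<le> b" "nxt b \<le> hmax" using Bk_range b by auto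
  fix h assume "b < h" "h < nxt b"
  then show "h \<notin> Bk" using Min_le[OF fin, of h] unfolding nxt_def by auto
qed

lemma in_piece:
  assumes "hmin \<le> h" "h \<le> hmax" "h \<notin> Bk"
  obtains b where "b \<in> Bl" "b < h" "h < nxt b"
proof -
  define b where "b = Max {b' \<in> Bk. b' < h}"
  have fin: "finite {b' \<in> Bk. b' < h}" and ne: "{b' \<in> Bk. b' < h} \<noteq> {}"
    using finite_card_Bk Bk_ends assms by (auto simp: less_le)
  have b: "b \<in> Bk" "b < h" using Max_in[OF fin ne] by (auto simp: b_def)
  then have Bl: "b \<in> Bl" using assms by (auto simp: Bl_def)
  moreover have "h < nxt b"
  proof (rule ccontr)
    assume "\<not> h < nxt b"
    then have "nxt b < h" using nxt(2)[OF Bl] assms by (cases "nxt b = h") auto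
    then have "nxt b \<le> b" using Max_ge[OF fin, of "nxt b"] nxt(2)[OF Bl] by (simp add: b_def[symmetric])
    then show False using nxt(1)[OF Bl] by simp
  qed
  ultimately show ?thesis using that b by blast
qed

lemma variation_sum: "(\<Sum>b\<in>Bl. \<bar>ang (nxt b) - ang b\<bar>) \<le> pi" "(\<Sum>b\<in>Bl. nxt b - b) = hmax - hmin"
proof -
  have M: "Max Bk = hmax" "Min Bk = hmin" using finite_card_Bk Bk_range Bk_ends by (auto intro!: Max_eqI Min_eqI)
  have tel: "(\<Sum>b\<in>Bl. g (nxt b) - g b) = g hmax - g hmin" for g :: "real \<Rightarrow> real"
    using sum_consecutive[of Bk g] finite_card_Bk Bk_ends by (auto simp: M Bl_def nxt_def)
  show "(\<Sum>b\<in>Bl. nxt b - b) = hmax - hmin" using tel[of "\<lambda>x. x"] .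
  obtain W where W: "\<And>x y. hmin \<le> x \<Longrightarrow> x \<le> y \<Longrightarrow> y \<le> hmax \<Longrightarrow> \<bar>ang y - ang x\<bar> \<le> W y - W x" "W hmax - W hmin \<le> pi"
    using ang_variation by blast
  have "(\<Sum>b\<in>Bl. \<bar>ang (nxt b) - ang b\<bar>) \<le> (\<Sum>b\<in>Bl. W (nxt b) - W b)"
    using nxt by (intro sum_mono W(1)) (auto intro: less_imp_le)
  also have "\<dots> \<le> pi" using tel[of W] W(2) by simp
  finally show "(\<Sum>b\<in>Bl. \<bar>ang (nxt b) - ang b\<bar>) \<le> pi" .
qed

lemma cont_xraw: "continuous_on {hmin..hmax} (xraw \<sigma>)"
  unfolding xraw_def[abs_def] by (intro continuous_intros continuous_ang) auto

lemma xraw_zero_iff: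
  assumes "hmin \<le> h" "h \<le> hmax" "\<sigma> = 1 \<or> \<sigma> = -1"
  shows "sqF (xraw \<sigma> h + of_int n) ((1 - h) / 2) = 0"
proof -
  have "cos (2 * pi * xraw \<sigma> h - \<phi>) = cos (\<sigma> * ang h)" by (simp add: xraw_def)
  also have "\<dots> = cos (ang h)" using assms by auto
  finally show ?thesis unfolding sqF_periodic using sqF_zero_iff[OF assms(1,2)] by simp
qed

lemma xc_range:
  assumes b: "b \<in> Bl" and h: "b < h" "h < nxt b" and \<sigma>: "\<sigma> = 1 \<or> \<sigma> = -1"
  shows "0 < xc \<sigma> b h" "xc \<sigma> b h < 1"
proof -
  define k where "k = \<lfloor>xraw \<sigma> ((b + nxt b) / 2)\<rfloor>"
  have noint: "xraw \<sigma> g \<noteq> of_int n" if "b < g" "g < nxt b" for g and n :: int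
  proof
    assume e: "xraw \<sigma> g = of_int n"
    have gr: "hmin < g" "g < hmax" using nxt[OF b] that by auto
    have "sqF (xraw \<sigma> g + of_int (- n)) ((1 - g) / 2) = 0" using gr \<sigma> by (intro xraw_zero_iff) auto
    then have "sqF 0 ((1 - g) / 2) = 0" using e by simp
    then have "g \<in> Bk" using gr by (auto simp: Bk_def)
    then show False using nxt(5)[OF b that] by simp
  qed
  have mid: "b < (b + nxt b) / 2" "(b + nxt b) / 2 < nxt b" using nxt(1)[OF b] by auto
  have con: "connected (xraw \<sigma> ` {b<..<nxt b})"
    using nxt[OF b] by (intro connected_continuous_image continuous_on_subset[OF cont_xraw]) auto
  have mk: "of_int k < xraw \<sigma> ((b + nxt b) / 2)" "xraw \<sigma> ((b + nxt b) / 2) < of_int k + 1"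
    using noint[OF mid, of k] unfolding k_def by linarith+
  have "of_int k < xraw \<sigma> h"
  proof (rule ccontr)
    assume "\<not> of_int k < xraw \<sigma> h"
    then have "of_int k \<in> xraw \<sigma> ` {b<..<nxt b}"
      using connectedD_interval[OF con, of "xraw \<sigma> h" "xraw \<sigma> ((b + nxt b) / 2)" "of_int k"] h mid mk by auto
    then obtain g where "b < g" "g < nxt b" "of_int k = xraw \<sigma> g" by auto
    then show False using noint[of g k] by simp
  qed
  moreover have "xraw \<sigma> h < of_int (k + 1)"
  proof (rule ccontr)
    assume "\<not> xraw \<sigma> h < of_int (k + 1)"
    then have "of_int (k + 1) \<in> xraw \<sigma> ` {b<..<nxt b}"
      using connectedD_interval[OF con, of "xraw \<sigma> ((b + nxt b) / 2)" "xraw \<sigma> h" "of_int (k + 1)"] h mid mk by auto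
    then obtain g where "b < g" "g < nxt b" "of_int (k + 1) = xraw \<sigma> g" by (auto simp del: of_int_add)
    then show False using noint[of g "k + 1"] by simp
  qed
  ultimately show "0 < xc \<sigma> b h" "xc \<sigma> b h < 1" by (auto simp: xc_def xn_def k_def)
qed

lemma arc_point_exists:
  assumes z: "sqF x y = 0" and x: "0 \<le> x" "x < 1" and y: "0 \<le> y" "y \<le> 1" and nb: "1 - 2 * y \<notin> Bk"
  obtains \<sigma> b where "\<sigma> = 1 \<or> \<sigma> = -1" "b \<in> Bl" "b < 1 - 2 * y" "1 - 2 * y < nxt b" "x = xc \<sigma> b (1 - 2 * y)"
proof -
  define h where "h = 1 - 2 * y"
  have h: "hmin \<le> h" "h \<le> hmax" using sqF_zero_height[OF z y] by (auto simp: h_def)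
  obtain b where b: "b \<in> Bl" "b < h" "h < nxt b" using in_piece[OF h] nb by (auto simp: h_def)
  have "sqF x ((1 - h) / 2) = 0" using z by (simp add: h_def)
  then have "cos (2 * pi * x - \<phi>) = cos (ang h)" by (simp only: sqF_zero_iff[OF h])
  then obtain n where n: "n \<in> \<int>" "2 * pi * x - \<phi> = ang h + 2 * n * pi \<or> 2 * pi * x - \<phi> = - ang h + 2 * n * pi"
    unfolding cos_eq by blast
  then obtain \<sigma> where \<sigma>: "\<sigma> = 1 \<or> \<sigma> = -1" "2 * pi * x - \<phi> = \<sigma> * ang h + 2 * n * pi" by (metis mult_1 mult_minus1)
  have "2 * pi * x = 2 * pi * (xraw \<sigma> h + n)" using \<sigma>(2) by (simp add: xraw_def field_simps)
  then have e: "x = xraw \<sigma> h + n" using mult_left_cancel[of "2 * pi" x "xraw \<sigma> h + n"] by simp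
  obtain m where m: "n = of_int m" using n(1) by (auto elim: Ints_cases)
  define d where "d = m + \<lfloor>xraw \<sigma> ((b + nxt b) / 2)\<rfloor>"
  have xd: "x - xc \<sigma> b h = of_int d" by (simp add: e m xc_def xn_def d_def)
  moreover have "\<bar>x - xc \<sigma> b h\<bar> < 1" using xc_range[OF b \<sigma>(1)] x by auto
  ultimately have "d = 0" by (simp flip: of_int_abs)
  then have "x = xc \<sigma> b h" using xd by simp
  then show ?thesis using that \<sigma> b by (auto simp: h_def)
qed

end

context cap_lattice
begin

definition "dtq = q11 * q22 - q12 * q21"
definition "latu K x y = K * ((q22 * x - q12 * y) / dtq)"
definition "latv K x y = K * ((q11 * y - q21 * x) / dtq)"
definition "sqx K P = (q11 * fst P + q12 * snd P) / K"
definition "sqy K P = (q21 * fst P + q22 * snd P) / K"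
definition "FK K P = sqF (sqx K P) (sqy K P)"
definition "cpt K \<sigma> b h = (latu K (xc \<sigma> b h) ((1 - h) / 2), latv K (xc \<sigma> b h) ((1 - h) / 2))"
definition "chu \<sigma> b = latu 1 (xc \<sigma> b (nxt b)) ((1 - nxt b) / 2) - latu 1 (xc \<sigma> b b) ((1 - b) / 2)"
definition "chv \<sigma> b = latv 1 (xc \<sigma> b (nxt b)) ((1 - nxt b) / 2) - latv 1 (xc \<sigma> b b) ((1 - b) / 2)"

text \<open>This is all that the sum over cells uses of a piece: its two total increments, its
  points, the vanishing of F on its closure, and the orientation that makes \<open>side\<close>
  positive where F is negative next to it.\<close>

definition "arc_for K \<sigma> b A \<longleftrightarrow> arc_ok A
   \<and> (aq A - ap A = K * \<bar>chu \<sigma> b\<bar> \<and> \<bar>af A (aq A) - af A (ap A)\<bar> = K * \<bar>chv \<sigma> b\<bar> \<or>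
      aq A - ap A = K * \<bar>chv \<sigma> b\<bar> \<and> \<bar>af A (aq A) - af A (ap A)\<bar> = K * \<bar>chu \<sigma> b\<bar>)
   \<and> arc_pts A = cpt K \<sigma> b ` {b<..<nxt b}
   \<and> (\<forall>P\<in>arc_closure A. FK K P = 0)
   \<and> (\<forall>P\<in>arc_pts A. \<forall>\<^sub>F R in at P. FK K R < 0 \<longrightarrow> 0 < side A R)"

lemma dtq_nz: "dtq \<noteq> 0" using det_nz by (simp add: dtq_def)

lemma sq_lat:
  assumes "K \<noteq> 0"
  shows "sqx K (latu K x y, latv K x y) = x" "sqy K (latu K x y, latv K x y) = y"
proof -
  have "q11 * (q22 * x - q12 * y) + q12 * (q11 * y - q21 * x) = x * dtq"
    "q21 * (q22 * x - q12 * y) + q22 * (q11 * y - q21 * x) = y * dtq" by (simp_all add: dtq_def algebra_simps)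
  moreover have "sqx K (latu K x y, latv K x y) = (q11 * (q22 * x - q12 * y) + q12 * (q11 * y - q21 * x)) / dtq"
     "sqy K (latu K x y, latv K x y) = (q21 * (q22 * x - q12 * y) + q22 * (q11 * y - q21 * x)) / dtq"
    using assms dtq_nz by (simp_all add: sqx_def sqy_def latu_def latv_def field_simps)
  ultimately show "sqx K (latu K x y, latv K x y) = x" "sqy K (latu K x y, latv K x y) = y" using dtq_nz by simp_all
qed

lemma lat_sq:
  assumes "K \<noteq> 0"
  shows "latu K (sqx K P) (sqy K P) = fst P" "latv K (sqx K P) (sqy K P) = snd P"
proof -
  define u v where "u = fst P" "v = snd P"
  have "q22 * (q11 * u + q12 * v) - q12 * (q21 * u + q22 * v) = u * dtq"
    "q11 * (q21 * u + q22 * v) - q21 * (q11 * u + q12 * v) = v * dtq" by (simp_all add: dtq_def algebra_simps)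
  moreover have "latu K (sqx K P) (sqy K P) = (q22 * (q11 * u + q12 * v) - q12 * (q21 * u + q22 * v)) / dtq"
    "latv K (sqx K P) (sqy K P) = (q11 * (q21 * u + q22 * v) - q21 * (q11 * u + q12 * v)) / dtq"
    using assms dtq_nz by (simp_all add: sqx_def sqy_def latu_def latv_def u_v_def field_simps)
  ultimately show "latu K (sqx K P) (sqy K P) = fst P" "latv K (sqx K P) (sqy K P) = snd P" using dtq_nz by (simp_all add: u_v_def)
qed

lemma continuous_FK: "continuous_on S (FK K)"
proof -
  have "continuous_on S (\<lambda>P. (sqx K P, sqy K P))" unfolding sqx_def sqy_def divide_inverse by (intro continuous_intros)
  from continuous_on_compose2[OF continuous_sqF this subset_UNIV] show ?thesis by (simp add: FK_def[abs_def])
qed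

lemma dnum_sign:
  assumes b: "b \<in> Bl"
  shows "(\<forall>h\<in>{b<..<nxt b}. 0 < dnum h) \<or> (\<forall>h\<in>{b<..<nxt b}. dnum h < 0)"
proof -
  have "continuous_on {b<..<nxt b} dnum" unfolding dnum_def[abs_def] disc_def by (intro continuous_intros)
  then have con: "connected (dnum ` {b<..<nxt b})" by (intro connected_continuous_image) auto
  have nz: "0 \<notin> dnum ` {b<..<nxt b}"
  proof
    assume "0 \<in> dnum ` {b<..<nxt b}"
    then obtain h where h: "b < h" "h < nxt b" "dnum h = 0" by auto
    then have "h \<in> Bk" using nxt[OF b] by (auto simp: Bk_def)
    then show False using nxt(5)[OF b h(1,2)] by simp
  qed
  show ?thesis
  proof (rule ccontr)
    assume "\<not> ?thesis"
    then obtain g h where "g \<in> {b<..<nxt b}" "dnum g \<le> 0" "h \<in> {b<..<nxt b}" "0 \<le> dnum h" by (auto simp: not_less)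
    then have "0 \<in> dnum ` {b<..<nxt b}" using connectedD_interval[OF con, of "dnum g" "dnum h" 0] by blast
    then show False using nz by simp
  qed
qed

lemma ang_convex:
  assumes b: "b \<in> Bl"
  shows "convex_on {b..nxt b} ang \<or> concave_on {b..nxt b} ang"
proof -
  note n = nxt[OF b]
  have inn: "hmin < h" "h < hmax" if "b < h" "h < nxt b" for h using n that by auto
  have cont: "continuous_on {b..nxt b} ang" by (rule continuous_on_subset[OF continuous_ang]) (use n in auto)
  have den: "0 < (1 - h\<^sup>2)\<^sup>2 * disc h * sqrt (disc h)" if "b < h" "h < nxt b" for h
    using h_range[of h] disc_pos[OF inn[OF that]] inn[OF that] by simp
  from dnum_sign[OF b] show ?thesis
  proof
    assume pos: "\<forall>h\<in>{b<..<nxt b}. 0 < dnum h"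
    have "convex_on {b..nxt b} ang"
    proof (rule convex_on_MVT[OF cont])
      fix x assume "b < x" "x < nxt b" then show "(ang has_real_derivative dang x) (at x)" using inn by (intro deriv_ang) auto
    next
      fix x y assume xy: "b < x" "x \<le> y" "y < nxt b"
      show "dang x \<le> dang y"
      proof (rule DERIV_nonneg_imp_nondecreasing[OF xy(2)])
        fix h assume "x \<le> h" "h \<le> y"
        then have h: "b < h" "h < nxt b" using xy by auto
        have "0 \<le> dnum h / ((1 - h\<^sup>2)\<^sup>2 * disc h * sqrt (disc h))"
          using pos h den[OF h] by (intro divide_nonneg_pos) (auto intro: less_imp_le)
        then show "\<exists>z. (dang has_real_derivative z) (at h) \<and> 0 \<le> z" using deriv_dang[OF inn[OF h]] by blast
      qed
    qed
    then show ?thesis ..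
  next
    assume neg: "\<forall>h\<in>{b<..<nxt b}. dnum h < 0"
    have "convex_on {b..nxt b} (\<lambda>x. - ang x)"
    proof (rule convex_on_MVT)
      show "continuous_on {b..nxt b} (\<lambda>x. - ang x)" using cont by (rule continuous_on_minus)
      fix x assume "b < x" "x < nxt b" then show "((\<lambda>x. - ang x) has_real_derivative - dang x) (at x)" using inn by (intro DERIV_minus deriv_ang) auto
    next
      fix x y assume xy: "b < x" "x \<le> y" "y < nxt b"
      have "dang y \<le> dang x"
      proof (rule DERIV_nonpos_imp_nonincreasing[OF xy(2)])
        fix h assume "x \<le> h" "h \<le> y"
        then have h: "b < h" "h < nxt b" using xy by auto
        have "dnum h / ((1 - h\<^sup>2)\<^sup>2 * disc h * sqrt (disc h)) \<le> 0"
          using neg h den[OF h] by (intro divide_nonpos_pos) (auto intro: less_imp_le)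
        then show "\<exists>z. (dang has_real_derivative z) (at h) \<and> z \<le> 0" using deriv_dang[OF inn[OF h]] by blast
      qed
      then show "- dang x \<le> - dang y" by simp
    qed
    then show ?thesis by (simp add: concave_on_def)
  qed
qed

lemma xc_affine: "xc \<sigma> b h = (\<phi> / (2 * pi) - xn \<sigma> b) + (\<sigma> / (2 * pi)) * ang h"
  by (simp add: xc_def xraw_def add_divide_distrib)

lemma cont_xc: "b \<in> Bl \<Longrightarrow> continuous_on {b..nxt b} (xc \<sigma> b)"
  unfolding xc_def[abs_def] using nxt[of b]
  by (intro continuous_intros continuous_on_subset[OF cont_xraw]) auto

text \<open>The derivative can vanish only at a height in \<open>crit\<close>, which is a break
  point and so not inside the piece; Rolle's theorem does the rest.\<close>

lemma functional_inj:
  assumes b: "b \<in> Bl" and \<sigma>: "\<sigma> = 1 \<or> \<sigma> = -1" and sl: "(\<alpha>, \<beta>) \<in> slopes"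
  shows "inj_on (\<lambda>h. cA \<alpha> \<beta> * xc \<sigma> b h + cB \<alpha> \<beta> * ((1 - h) / 2)) {b..nxt b}"
proof -
  define G where "G h = cA \<alpha> \<beta> * xc \<sigma> b h + cB \<alpha> \<beta> * ((1 - h) / 2)" for h
  note n = nxt[OF b]
  have nz: "\<not> (cA \<alpha> \<beta> = 0 \<and> cB \<alpha> \<beta> = 0)"
  proof
    assume "cA \<alpha> \<beta> = 0 \<and> cB \<alpha> \<beta> = 0"
    then have "cA \<alpha> \<beta> = 0" "cB \<alpha> \<beta> = 0" by auto
    then have "\<alpha> * dtq = 0" "\<beta> * dtq = 0" unfolding cA_def cB_def dtq_def by algebra+
    then show False using sl dtq_nz by (auto simp: slopes_def)
  qed
  have cG: "continuous_on {b..nxt b} G" unfolding G_def[abs_def] by (intro continuous_intros cont_xc[OF b]) auto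
  have dG: "(G has_real_derivative (cA \<alpha> \<beta> * (\<sigma> / (2 * pi) * dang h) - cB \<alpha> \<beta> / 2)) (at h)" if "b < h" "h < nxt b" for h
    unfolding G_def[abs_def] xc_affine
    using n that by (auto intro!: derivative_eq_intros deriv_ang)
  have ndG: "cA \<alpha> \<beta> * (\<sigma> / (2 * pi) * dang h) - cB \<alpha> \<beta> / 2 \<noteq> 0" if h: "b < h" "h < nxt b" for h
  proof
    assume e: "cA \<alpha> \<beta> * (\<sigma> / (2 * pi) * dang h) - cB \<alpha> \<beta> / 2 = 0"
    then have A: "cA \<alpha> \<beta> \<noteq> 0" using nz by auto
    have "\<sigma> * \<sigma> = 1" using \<sigma> by auto
    from e have "cA \<alpha> \<beta> * \<sigma> * dang h = pi * cB \<alpha> \<beta>" by (simp add: field_simps)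
    then have "\<sigma> * \<sigma> * dang h = pi * \<sigma> * cB \<alpha> \<beta> / cA \<alpha> \<beta>" using A by (simp add: field_simps)
    then have "dang h = pi * \<sigma> * cB \<alpha> \<beta> / cA \<alpha> \<beta>" using \<open>\<sigma> * \<sigma> = 1\<close> by simp
    then have "h \<in> crit \<sigma> \<alpha> \<beta>" using n h by (auto simp: crit_def)
    then have "h \<in> Bk" unfolding Bk_def using \<sigma> sl by blast
    then show False using n(5)[OF h] by simp
  qed
  have neq: "G x \<noteq> G y" if xy: "x \<in> {b..nxt b}" "y \<in> {b..nxt b}" "x < y" for x y
  proof
    assume "G x = G y"
    then obtain z where z: "x < z" "z < y" "(G has_real_derivative 0) (at z)"
      using Rolle[OF xy(3), of G] continuous_on_subset[OF cG, of "{x..y}"] dG xy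
      by (auto simp: real_differentiable_def) (meson less_le_trans le_less_trans)
    have "b < z" "z < nxt b" using z xy by auto
    then show False using DERIV_unique[OF z(3) dG] ndG by auto
  qed
  show ?thesis
  proof (rule inj_onI, fold G_def)
    fix x y assume "x \<in> {b..nxt b}" "y \<in> {b..nxt b}" "G x = G y"
    then show "x = y" using neq[of x y] neq[of y x] by (cases x y rule: linorder_cases) auto
  qed
qed

lemma exists_arc:
  assumes K: "0 < K" and b: "b \<in> Bl" and \<sigma>: "\<sigma> = 1 \<or> \<sigma> = -1"
  shows "\<exists>A. arc_for K \<sigma> b A"
proof -
  note n = nxt[OF b]
  have dK: "(q11 / K) * (q22 / K) - (q12 / K) * (q21 / K) = dtq / K\<^sup>2"
    using K by (simp add: dtq_def power2_eq_square diff_divide_distrib)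
  interpret C: plane_curve "q11 / K" "q12 / K" "q21 / K" "q22 / K" b "nxt b" "xc \<sigma> b"
  proof
    show "q11 / K * (q22 / K) - q12 / K * (q21 / K) \<noteq> 0" unfolding dK using dtq_nz K by simp
    show "convex_on {b..nxt b} (xc \<sigma> b) \<or> concave_on {b..nxt b} (xc \<sigma> b)"
      unfolding xc_affine[abs_def] by (rule convex_concave_affine[OF ang_convex[OF b]])
  qed (use n cont_xc[OF b] in auto)
  have Cdt: "C.dt = dtq / K\<^sup>2" unfolding C.dt_def by (rule dK)
  have Clu: "C.lu x y = latu K x y" "C.lv x y = latv K x y" for x y
    unfolding C.lu_def C.lv_def latu_def latv_def Cdt using K dtq_nz by (simp_all add: field_simps power2_eq_square)
  have Ccu: "(C.cu h, C.cv h) = cpt K \<sigma> b h" for h by (simp add: C.cu_def C.cv_def cpt_def Clu)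
  have lin: "latu K x y - latu K x' y' = K * (latu 1 x y - latu 1 x' y')" "latv K x y - latv K x' y' = K * (latv 1 x y - latv 1 x' y')"
    for x y x' y' by (simp_all add: latu_def latv_def right_diff_distrib)
  have sz: "\<bar>C.cu (nxt b) - C.cu b\<bar> = K * \<bar>chu \<sigma> b\<bar>" "\<bar>C.cv (nxt b) - C.cv b\<bar> = K * \<bar>chv \<sigma> b\<bar>"
    unfolding C.cu_def C.cv_def Clu lin chu_def chv_def using K by (simp_all add: abs_mult)
  have inj: "inj_on (\<lambda>h. \<alpha> * C.cu h + \<beta> * C.cv h) {b..nxt b}" if "(\<alpha>, \<beta>) \<in> slopes" for \<alpha> \<beta>
  proof -
    have e: "\<alpha> * C.cu h + \<beta> * C.cv h = K / dtq * (cA \<alpha> \<beta> * xc \<sigma> b h + cB \<alpha> \<beta> * ((1 - h) / 2))" for h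
      unfolding C.cu_def C.cv_def Clu latu_def latv_def cA_def cB_def using dtq_nz by (simp add: field_simps)
    show ?thesis using functional_inj[OF b \<sigma> that] K dtq_nz unfolding e by (auto simp: inj_on_def)
  qed
  obtain A where A: "arc_ok A"
     "(aq A - ap A = \<bar>C.cu (nxt b) - C.cu b\<bar> \<and> \<bar>af A (aq A) - af A (ap A)\<bar> = \<bar>C.cv (nxt b) - C.cv b\<bar> \<or>
        aq A - ap A = \<bar>C.cv (nxt b) - C.cv b\<bar> \<and> \<bar>af A (aq A) - af A (ap A)\<bar> = \<bar>C.cu (nxt b) - C.cu b\<bar>)"
     "arc_closure A = (\<lambda>h. (C.cu h, C.cv h)) ` {b..nxt b}" "arc_pts A = (\<lambda>h. (C.cu h, C.cv h)) ` {b<..<nxt b}"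
     "\<And>x h. h \<in> {b..nxt b} \<Longrightarrow> fst (sw (arow A) (C.lu x ((1 - h) / 2), C.lv x ((1 - h) / 2))) \<in> {ap A..aq A} \<Longrightarrow>
          (\<exists>c>0. \<sigma> * (x - xc \<sigma> b h) = c * side A (C.lu x ((1 - h) / 2), C.lv x ((1 - h) / 2)))"
    by (rule exE[OF C.curve_to_arc]) (erule inj, rule \<sigma>, elim conjE, rule that, assumption, assumption, assumption, assumption, blast)
  have Fc: "FK K (cpt K \<sigma> b h) = 0" if "h \<in> {b..nxt b}" for h
  proof -
    have "FK K (cpt K \<sigma> b h) = sqF (xc \<sigma> b h) ((1 - h) / 2)" using K by (simp add: FK_def cpt_def sq_lat)
    also have "xc \<sigma> b h = xraw \<sigma> h + of_int (- \<lfloor>xraw \<sigma> ((b + nxt b) / 2)\<rfloor>)" by (simp add: xc_def xn_def)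
    also have "sqF (xraw \<sigma> h + of_int (- \<lfloor>xraw \<sigma> ((b + nxt b) / 2)\<rfloor>)) ((1 - h) / 2) = 0"
      using that n \<sigma> by (intro xraw_zero_iff) auto
    finally show ?thesis .
  qed
  have loc: "\<forall>\<^sub>F R in at P. FK K R < 0 \<longrightarrow> 0 < side A R" if P: "P \<in> arc_pts A" for P
  proof -
    obtain h0 where h0: "b < h0" "h0 < nxt b" "P = cpt K \<sigma> b h0" using P A(4) by (auto simp: Ccu)
    have h0r: "hmin < h0" "h0 < hmax" using h0 n by auto
    define hh where "hh R = 1 - 2 * sqy K R" for R
    define th where "th R = \<sigma> * (2 * pi * (sqx K R + xn \<sigma> b) - \<phi>)" for R
    have Pxy: "sqx K P = xc \<sigma> b h0" "sqy K P = (1 - h0) / 2" using K by (auto simp: h0 cpt_def sq_lat)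
    have th_diff: "th R - ang h = 2 * pi * (\<sigma> * (sqx K R - xc \<sigma> b h))" for R h
    proof -
      have "\<sigma> * \<sigma> = 1" using \<sigma> by auto
      have "2 * pi * (\<sigma> * (sqx K R - xc \<sigma> b h)) = \<sigma> * (2 * pi * sqx K R - (\<phi> + \<sigma> * ang h - 2 * pi * xn \<sigma> b))"
        by (simp add: xc_def xraw_def field_simps)
      also have "\<dots> = th R - \<sigma> * \<sigma> * ang h" by (simp add: th_def algebra_simps)
      finally show ?thesis using \<open>\<sigma> * \<sigma> = 1\<close> by simp
    qed
    have thP: "th P = ang h0" using th_diff[of P h0] Pxy by simp
    \<comment> \<open>In this neighbourhood the height stays within the piece and the angle
      \<open>th\<close> within (0, pi), where cosine decreases. So F < 0 forces \<open>th\<close>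
      beyond \<open>ang\<close>, which is a horizontal offset of known sign, and the offset gives
      the sign of \<open>side\<close>.\<close>
    define Nb where "Nb = {R. b < hh R} \<inter> {R. hh R < nxt b} \<inter> {R. 0 < th R} \<inter> {R. th R < pi}
       \<inter> {R. ap A < fst (sw (arow A) R)} \<inter> {R. fst (sw (arow A) R) < aq A}"
    have csw: "continuous_on UNIV (\<lambda>R::real\<times>real. fst (sw (arow A) R))"
      by (cases "arow A") (auto simp: sw_def intro!: continuous_intros)
    have cX: "continuous_on UNIV (sqx K)" "continuous_on UNIV (sqy K)"
      unfolding sqx_def[abs_def] sqy_def[abs_def] divide_inverse by (intro continuous_intros)+
    have chh: "continuous_on UNIV hh" "continuous_on UNIV th"
      unfolding hh_def[abs_def] th_def[abs_def] by (intro continuous_intros cX)+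
    have opO: "open Nb" unfolding Nb_def
      by (intro open_Int open_Collect_less[OF continuous_on_const chh(1)] open_Collect_less[OF chh(1) continuous_on_const]
        open_Collect_less[OF continuous_on_const chh(2)] open_Collect_less[OF chh(2) continuous_on_const]
        open_Collect_less[OF continuous_on_const csw] open_Collect_less[OF csw continuous_on_const])
    have PO: "P \<in> Nb"
      using h0 Pxy thP ang_strict[OF h0r] P by (auto simp: Nb_def hh_def arc_pts_def)
    have main: "0 < side A R" if R: "R \<in> Nb" and neg: "FK K R < 0" for R
    proof -
      define h where "h = hh R"
      have h: "b < h" "h < nxt b" "hmin \<le> h" "h \<le> hmax" using R n by (auto simp: Nb_def h_def)
      have y: "sqy K R = (1 - h) / 2" by (simp add: h_def hh_def)
      have "r * sqrt (1 - h\<^sup>2) * (cos (2 * pi * sqx K R - \<phi>) - cos (ang h)) < 0"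
        using neg sqF_on_circle[OF h(3,4)] by (simp add: FK_def y)
      then have "cos (2 * pi * sqx K R - \<phi>) < cos (ang h)" 
        using mult_less_cancel_left_pos[OF rad_pos[OF h(3,4)], of "cos (2 * pi * sqx K R - \<phi>) - cos (ang h)" 0] by linarith
      also have "cos (2 * pi * sqx K R - \<phi>) = cos (th R)"
      proof -
        have "cos (th R) = cos (2 * pi * (sqx K R + xn \<sigma> b) - \<phi>)" using \<sigma> unfolding th_def
          by (elim disjE) (simp_all only: mult_1 mult_minus1 cos_minus)
        also have "\<dots> = cos ((2 * pi * sqx K R - \<phi>) + 2 * pi * of_int \<lfloor>xraw \<sigma> ((b + nxt b) / 2)\<rfloor>)"
          by (simp add: xn_def algebra_simps)
        also have "\<dots> = cos (2 * pi * sqx K R - \<phi>)" by (simp only: cos_add cos_int_2pin sin_int_2pin)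
        finally show ?thesis by simp
      qed
      finally have lt: "cos (th R) < cos (ang h)" .
      have "ang h < th R"
      proof (rule ccontr)
        assume "\<not> ang h < th R"
        then have "cos (ang h) \<le> cos (th R)"
          using R ang_bounds[OF h(3,4)] by (intro cos_monotone_0_pi_le) (auto simp: Nb_def)
        then show False using lt by simp
      qed
      then have "0 < 2 * pi * (\<sigma> * (sqx K R - xc \<sigma> b h))" unfolding th_diff[symmetric] by simp
      then have pos: "0 < \<sigma> * (sqx K R - xc \<sigma> b h)" by (rule zero_less_mult_pos) simp
      have RR: "(C.lu (sqx K R) ((1 - h) / 2), C.lv (sqx K R) ((1 - h) / 2)) = R"
        unfolding Clu y[symmetric] using K by (simp add: lat_sq)
      show ?thesis
      proof -
        have "fst (sw (arow A) R) \<in> {ap A..aq A}" using R by (auto simp: Nb_def)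
        then obtain c where c: "0 < c" "\<sigma> * (sqx K R - xc \<sigma> b h) = c * side A R" using A(5)[of h "sqx K R"] h unfolding RR by auto
        then have "0 < c * side A R" using pos by simp
        then show ?thesis using c(1) by (rule zero_less_mult_pos)
      qed
    qed
    show ?thesis unfolding eventually_at_topological using opO PO main by blast
  qed
  have "arc_for K \<sigma> b A"
    unfolding arc_for_def
  proof (intro conjI ballI)
    show "aq A - ap A = K * \<bar>chu \<sigma> b\<bar> \<and> \<bar>af A (aq A) - af A (ap A)\<bar> = K * \<bar>chv \<sigma> b\<bar> \<or>
      aq A - ap A = K * \<bar>chv \<sigma> b\<bar> \<and> \<bar>af A (aq A) - af A (ap A)\<bar> = K * \<bar>chu \<sigma> b\<bar>" using A(2) unfolding sz .
    show "arc_pts A = cpt K \<sigma> b ` {b<..<nxt b}" using A(4) unfolding Ccu .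
    fix P assume "P \<in> arc_closure A"
    then show "FK K P = 0" using Fc unfolding A(3) Ccu by auto
  qed (use A(1) loc in auto)
  then show ?thesis ..
qed

lemma arcs_family:
  assumes "0 < K"
  shows "\<exists>A. \<forall>k\<in>{1, -1} \<times> Bl. arc_for K (fst k) (snd k) (A k)"
  using exists_arc[OF assms] by (intro bchoice) auto

end

section \<open>Cells away from exceptional points\<close>

text \<open>The bounds on \<open>K\<close> make the image of a cell in the square less than 1/4 wide
  and high, so that it never reaches two opposite edges.\<close>

locale cap_cells = cap_lattice r s t \<phi> q11 q12 q21 q22 for r s t \<phi> q11 q12 q21 q22 +
  fixes K :: real
  assumes K_pos: "0 < K"
    and K_x: "4 * (\<bar>q11\<bar> + \<bar>q12\<bar>) < K" and K_y: "4 * (\<bar>q21\<bar> + \<bar>q22\<bar>) < K"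
    and phi_range: "0 \<le> \<phi>" "\<phi> < 2 * pi"
begin

abbreviation "X \<equiv> sqx K"
abbreviation "Y \<equiv> sqy K"
abbreviation "F \<equiv> FK K"

definition "mx = \<bar>q11\<bar> + \<bar>q12\<bar>"
definition "my = \<bar>q21\<bar> + \<bar>q22\<bar>"
definition "Om = {P. 0 \<le> X P \<and> X P < 1 \<and> 0 < Y P \<and> Y P < 1}"
definition "bd = {P. (X P = 0 \<or> X P = 1) \<and> 0 \<le> Y P \<and> Y P \<le> 1 \<or> (Y P = 0 \<or> Y P = 1) \<and> 0 \<le> X P \<and> X P \<le> 1}"
text \<open>Three kinds of exceptional points: crossings of the curve with the vertical edges,
  corners, and the highest and lowest points of the circle. The longitudes of the last are
  \<open>\<phi>\<close> or \<open>\<phi>\<close> + pi up to whole turns; all half turns from -4 to 4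
  are combined with both heights, since only their bounded number matters.\<close>

definition "SP = ({0, 1} \<times> {y \<in> {0..1}. sqF 0 y = 0}) \<union> ({0, 1} \<times> {0, 1})
   \<union> (\<lambda>(k, h). (\<phi> / (2 * pi) + real_of_int k / 2, (1 - h) / 2)) ` ({-4..4} \<times> {hmin, hmax})"
text \<open>The factor 4 exceeds pi, with which \<open>near_tip\<close> converts the width of a cell
  into a distance in height.\<close>

definition "C0 = 4 * (mx + my)"
definition "near c \<longleftrightarrow> (\<exists>p\<in>SP. \<exists>P\<in>cell c. \<bar>X P - fst p\<bar> \<le> C0 / K \<and> \<bar>Y P - snd p\<bar> \<le> C0 / K)"

lemma mxy_nonneg: "0 \<le> mx" "0 \<le> my" by (auto simp: mx_def my_def)

definition "dx = mx / K"
definition "dy = my / K"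
definition "dC = C0 / K"

lemma quarter: "dx < 1 / 4" "dy < 1 / 4"
  using K_pos K_x K_y by (auto simp: dx_def dy_def mx_def my_def field_simps)

lemma C0_ge: "dx \<le> dC" "dy \<le> dC" "pi * dx \<le> dC" "0 \<le> dC" "0 \<le> dx" "0 \<le> dy"
proof -
  have "pi * mx \<le> 4 * mx" using pi_less_4 mxy_nonneg by (intro mult_right_mono) auto
  then have "mx \<le> C0" "my \<le> C0" "pi * mx \<le> C0" "0 \<le> C0" using mxy_nonneg by (auto simp: C0_def)
  then show "dx \<le> dC" "dy \<le> dC" "pi * dx \<le> dC" "0 \<le> dC" "0 \<le> dx" "0 \<le> dy"
    unfolding dx_def dy_def dC_def times_divide_eq_right
    using K_pos mxy_nonneg by (auto intro!: divide_right_mono divide_nonneg_pos)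
qed

lemma same_cell:
  assumes "P \<in> cell c" "P' \<in> cell c"
  shows "\<bar>X P - X P'\<bar> \<le> dx" "\<bar>Y P - Y P'\<bar> \<le> dy"
proof -
  have d: "\<bar>fst P - fst P'\<bar> \<le> 1" "\<bar>snd P - snd P'\<bar> \<le> 1" using assms by (auto simp: cell_def)
  have "\<bar>q11 * (fst P - fst P') + q12 * (snd P - snd P')\<bar> \<le> mx"
    "\<bar>q21 * (fst P - fst P') + q22 * (snd P - snd P')\<bar> \<le> my"
    unfolding mx_def my_def using d
    by (auto intro!: order.trans[OF abs_triangle_ineq] add_mono simp: abs_mult mult_left_le)
  moreover have "X P - X P' = (q11 * (fst P - fst P') + q12 * (snd P - snd P')) / K"
    "Y P - Y P' = (q21 * (fst P - fst P') + q22 * (snd P - snd P')) / K"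
    by (simp_all add: sqx_def sqy_def diff_divide_distrib[symmetric] algebra_simps)
  ultimately show "\<bar>X P - X P'\<bar> \<le> dx" "\<bar>Y P - Y P'\<bar> \<le> dy"
    using K_pos unfolding dx_def dy_def by (auto simp: abs_divide intro!: divide_right_mono)
qed

lemma nearI:
  assumes "p \<in> SP" "P \<in> cell c" "\<bar>X P - fst p\<bar> \<le> dC" "\<bar>Y P - snd p\<bar> \<le> dC"
  shows "near c"
  using assms unfolding near_def dC_def by blast

lemma pole_values: "y \<le> 0 \<Longrightarrow> sqF x y = s - t" "1 \<le> y \<Longrightarrow> sqF x y = - s - t"
proof -
  assume "y \<le> 0" then have "hgt y = 1" by (simp add: hgt_def)
  then show "sqF x y = s - t" by (simp add: sqF_def)
next
  assume "1 \<le> y" then have "hgt y = -1" by (simp add: hgt_def)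
  then show "sqF x y = - s - t" by (simp add: sqF_def)
qed

lemma zero_inner: "F P = 0 \<Longrightarrow> 0 < Y P \<and> Y P < 1"
  using pole_values[of "Y P" "X P"] t_neq unfolding FK_def by (cases "Y P \<le> 0"; cases "1 \<le> Y P") auto

lemma zero_repr:
  assumes "sqF x y = 0" "0 < y" "y < 1"
  obtains \<sigma> n where "\<sigma> = 1 \<or> \<sigma> = -1" "x = xraw \<sigma> (1 - 2 * y) + of_int n"
proof -
  have h: "hmin \<le> 1 - 2 * y" "1 - 2 * y \<le> hmax" using sqF_zero_height[OF assms(1)] assms by auto
  have "sqF x ((1 - (1 - 2 * y)) / 2) = 0" using assms(1) by simp
  then have "cos (2 * pi * x - \<phi>) = cos (ang (1 - 2 * y))" unfolding sqF_zero_iff[OF h] .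
  then obtain n where n: "n \<in> \<int>" "2 * pi * x - \<phi> = ang (1 - 2 * y) + 2 * n * pi \<or> 2 * pi * x - \<phi> = - ang (1 - 2 * y) + 2 * n * pi"
    unfolding cos_eq by blast
  then obtain \<sigma> where \<sigma>: "\<sigma> = 1 \<or> \<sigma> = -1" "2 * pi * x - \<phi> = \<sigma> * ang (1 - 2 * y) + 2 * n * pi" by (metis mult_1 mult_minus1)
  have "2 * pi * x = 2 * pi * (xraw \<sigma> (1 - 2 * y) + n)" using \<sigma>(2) by (simp add: xraw_def field_simps)
  then have e: "x = xraw \<sigma> (1 - 2 * y) + n" using mult_left_cancel[of "2 * pi" x "xraw \<sigma> (1 - 2 * y) + n"] by simp
  then show ?thesis using that \<sigma>(1) n(1) by (auto elim!: Ints_cases)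
qed

text \<open>A small \<open>ang h\<close> or pi - \<open>ang h\<close> makes the root of
  \<open>disc h\<close> small, and \<open>disc h\<close> is the product of the distances of
  \<open>h\<close> from \<open>hmax\<close> and \<open>hmin\<close>. One of these distances is then
  small as well, and the point is close to the tip of the curve.\<close>

lemma near_tip:
  assumes \<sigma>: "\<sigma> = 1 \<or> \<sigma> = -1" and x: "x = xraw \<sigma> h + of_int n" "0 \<le> x" "x < 1"
    and h: "hmin \<le> h" "h \<le> hmax"
    and sm: "ang h \<le> 2 * pi * (dx) \<or> pi - ang h \<le> 2 * pi * (dx)"
  shows "\<exists>p\<in>SP. \<bar>x - fst p\<bar> \<le> dC \<and> \<bar>(1 - h) / 2 - snd p\<bar> \<le> dC"
proof -
  define w where "w = 2 * pi * (dx)"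
  have ab: "0 \<le> ang h" "ang h \<le> pi" using ang_bounds[OF h] by auto
  have w0: "0 \<le> w" using C0_ge(5) by (simp add: w_def)
  obtain j :: int where j: "j = 0 \<or> j = 1" "\<bar>ang h - j * pi\<bar> \<le> w"
  proof (cases "ang h \<le> w")
    case True then show ?thesis using that[of 0] ab by auto
  next
    case False then show ?thesis using that[of 1] sm ab by (auto simp: w_def)
  qed
  have "sin (ang h) \<le> w"
  proof -
    have "sin (ang h) = \<bar>sin (ang h - j * pi)\<bar>" using j(1) ab by (auto simp: sin_diff sin_ge_zero)
    also have "\<dots> \<le> \<bar>ang h - j * pi\<bar>" by (rule abs_sin_x_le_abs_x)
    finally show ?thesis using j by simp
  qed
  moreover have "r * sqrt (1 - h\<^sup>2) \<le> 1"
  proof -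
    have "r \<le> 1" using rs r_pos by (metis abs_le_square_iff abs_of_pos le_add_same_cancel1 one_power2 power2_abs abs_one zero_le_power2)
    moreover have "sqrt (1 - h\<^sup>2) \<le> 1" by simp
    moreover have "0 \<le> sqrt (1 - h\<^sup>2)" using h_range(4)[OF h] by simp
    ultimately show ?thesis by (simp add: mult_le_one)
  qed
  moreover have "0 \<le> sin (ang h)" using ab by (simp add: sin_ge_zero)
  ultimately have "r * sqrt (1 - h\<^sup>2) * sin (ang h) \<le> 1 * w"
    using rad_pos[OF h] by (intro mult_mono) auto
  then have "sqrt (disc h) \<le> w" unfolding sin_ang[OF h] by simp
  then have "(sqrt (disc h))\<^sup>2 \<le> w\<^sup>2" using disc_nonneg[OF h] by (intro power_mono) auto
  then have "disc h \<le> w * w" using disc_nonneg[OF h] by (simp add: power2_eq_square)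
  then have prod: "(hmax - h) * (h - hmin) \<le> w * w" by (simp add: disc_factor)
  have "hmax - h \<le> w \<or> h - hmin \<le> w"
  proof (rule ccontr)
    assume "\<not> ?thesis"
    then have "w < hmax - h" "w < h - hmin" by auto
    then have "w * w < (hmax - h) * (h - hmin)" using w0 by (intro mult_strict_mono') auto
    then show False using prod by simp
  qed
  then have "\<bar>h - hmin\<bar> \<le> w \<or> \<bar>h - hmax\<bar> \<le> w" using h by auto
  then obtain g where g: "g = hmin \<or> g = hmax" "\<bar>h - g\<bar> \<le> w" by blast
  define k where "k = (if \<sigma> = 1 then j else - j) + 2 * n"
  have xk: "x - (\<phi> / (2 * pi) + real_of_int k / 2) = \<sigma> * (ang h - j * pi) / (2 * pi)"
  proof -
    have kr: "real_of_int k = \<sigma> * real_of_int j + 2 * real_of_int n" using \<sigma> by (auto simp: k_def)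
    show ?thesis unfolding x(1) xraw_def kr by (simp add: add_divide_distrib diff_divide_distrib algebra_simps)
  qed
  have "\<bar>\<sigma> * (ang h - j * pi) / (2 * pi)\<bar> \<le> w / (2 * pi)"
    using \<sigma> j(2) by (auto simp: abs_mult intro!: divide_right_mono)
  also have "w / (2 * pi) = dx" by (simp add: w_def)
  finally have xd: "\<bar>x - (\<phi> / (2 * pi) + real_of_int k / 2)\<bar> \<le> dx" unfolding xk .
  have ph: "0 \<le> \<phi> / (2 * pi)" "\<phi> / (2 * pi) < 1" using phi_range by auto
  have "real_of_int k / 2 < 2" "- 2 < real_of_int k / 2" using xd x(2,3) ph quarter(1) unfolding abs_le_iff by linarith+
  then have "k \<in> {-4..4}" by auto
  then have "(\<phi> / (2 * pi) + real_of_int k / 2, (1 - g) / 2) \<in> SP" using g(1) unfolding SP_def by (intro UnI2) force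
  moreover have "\<bar>(1 - h) / 2 - (1 - g) / 2\<bar> \<le> pi * dx"
    using g(2) by (simp add: w_def abs_le_iff field_simps)
  ultimately show ?thesis using xd C0_ge by (intro bexI[of _ "(\<phi> / (2 * pi) + real_of_int k / 2, (1 - g) / 2)"]) auto
qed

text \<open>The zero set of F is periodic, so translates of the curve run outside the square. Two
  zeros in one cell, one inside and one outside, lie either on the same branch, which then crosses a
  vertical edge between them, or on the two opposite branches, which come that close only near a
  tip. In both cases an exceptional point is at hand.\<close>

lemma stray_zero_near:
  assumes P0: "P0 \<in> cell c" "P0 \<in> Om" "F P0 = 0" and P1: "P1 \<in> cell c" "F P1 = 0" "P1 \<notin> Om"
  shows "near c"
proof -
  define x0 y0 x1 y1 where "x0 = X P0" "y0 = Y P0" "x1 = X P1" "y1 = Y P1"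
  note defs = x0_y0_x1_y1_def
  have y: "0 < y0" "y0 < 1" "0 < y1" "y1 < 1" using zero_inner[OF P0(3)] zero_inner[OF P1(2)] by (auto simp: defs)
  have x0: "0 \<le> x0" "x0 < 1" using P0(2) by (auto simp: Om_def defs)
  have x1: "x1 < 0 \<or> 1 \<le> x1" using P1(3) y by (auto simp: Om_def defs)
  have d: "\<bar>x0 - x1\<bar> \<le> dx" "\<bar>y0 - y1\<bar> \<le> dy" using same_cell[OF P0(1) P1(1)] by (auto simp: defs)
  obtain \<sigma> n where s0: "\<sigma> = 1 \<or> \<sigma> = -1" "x0 = xraw \<sigma> (1 - 2 * y0) + of_int n"
    using zero_repr[of x0 y0] P0(3) y by (auto simp: FK_def defs)
  obtain \<tau> m where s1: "\<tau> = 1 \<or> \<tau> = -1" "x1 = xraw \<tau> (1 - 2 * y1) + of_int m"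
    using zero_repr[of x1 y1] P1(2) y by (auto simp: FK_def defs)
  define h0 h1 where "h0 = 1 - 2 * y0" "h1 = 1 - 2 * y1"
  have h0: "hmin \<le> h0" "h0 \<le> hmax" using sqF_zero_height[of x0 y0] P0(3) y by (auto simp: FK_def defs h0_h1_def)
  have h1: "hmin \<le> h1" "h1 \<le> hmax" using sqF_zero_height[of x1 y1] P1(2) y by (auto simp: FK_def defs h0_h1_def)
  note a = ang_bounds[OF h0] ang_bounds[OF h1]
  show ?thesis
  proof (cases "\<sigma> = \<tau>")
    case True
    have "\<bar>xraw \<sigma> h0 - xraw \<sigma> h1\<bar> \<le> 1 / 2"
    proof -
      have "xraw \<sigma> h0 - xraw \<sigma> h1 = \<sigma> * (ang h0 - ang h1) / (2 * pi)" by (simp add: xraw_def diff_divide_distrib[symmetric] algebra_simps)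
      moreover have "\<bar>\<sigma> * (ang h0 - ang h1) / (2 * pi)\<bar> \<le> pi / (2 * pi)"
        using s0(1) a by (auto simp: abs_mult intro!: divide_right_mono)
      ultimately show ?thesis by simp
    qed
    moreover have "real_of_int (n - m) = (x0 - x1) - (xraw \<sigma> h0 - xraw \<sigma> h1)" using s0(2) s1(2) True by (simp add: h0_h1_def)
    ultimately have "\<bar>real_of_int (n - m)\<bar> < 1"
      using d(1) quarter(1) abs_triangle_ineq4[of "x0 - x1" "xraw \<sigma> h0 - xraw \<sigma> h1"] by linarith
    then have "n - m = 0" by (simp only: of_int_abs[symmetric] of_int_less_1_iff zabs_less_one_iff)
    then have nm: "n = m" by simp
    define Z where "Z h = xraw \<sigma> h + of_int n" for h
    have Z: "Z h0 = x0" "Z h1 = x1" using s0(2) s1(2) True nm by (auto simp: Z_def h0_h1_def)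
    define I where "I = {min h0 h1..max h0 h1}"
    have "continuous_on I Z" unfolding Z_def I_def
      by (intro continuous_intros continuous_on_subset[OF cont_xraw]) (use h0 h1 in auto)
    then have con: "connected (Z ` I)" unfolding I_def by (intro connected_continuous_image) auto
    have mem: "x0 \<in> Z ` I" "x1 \<in> Z ` I" unfolding Z[symmetric] I_def by auto
    obtain j where j: "j \<in> {0, 1 :: real}" "j \<in> Z ` I" "\<bar>x0 - j\<bar> \<le> \<bar>x0 - x1\<bar>"
    proof (cases "x1 < 0")
      case True
      then show ?thesis using that[of 0] connectedD_interval[OF con mem(2,1), of 0] x0 by auto
    next
      case False
      then show ?thesis using that[of 1] connectedD_interval[OF con mem(1,2), of 1] x0 x1 by auto
    qed
    obtain h2 where h2: "h2 \<in> I" "Z h2 = j" using j(2) by auto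
    have h2r: "hmin \<le> h2" "h2 \<le> hmax" using h2(1) h0 h1 by (auto simp: I_def min_def max_def split: if_splits)
    have "sqF (xraw \<sigma> h2 + of_int (n - \<lfloor>j\<rfloor>)) ((1 - h2) / 2) = 0" using xraw_zero_iff[OF h2r s0(1)] .
    moreover have "xraw \<sigma> h2 + of_int (n - \<lfloor>j\<rfloor>) = 0" using h2(2) j(1) by (auto simp: Z_def)
    ultimately have "sqF 0 ((1 - h2) / 2) = 0" by simp
    then have sp: "(j, (1 - h2) / 2) \<in> SP" using j(1) h_range[OF h2r] by (auto simp: SP_def)
    have "\<bar>y0 - (1 - h2) / 2\<bar> \<le> \<bar>y0 - y1\<bar>" 
    proof -
      have "h0 \<le> h2 \<and> h2 \<le> h1 \<or> h1 \<le> h2 \<and> h2 \<le> h0" using h2(1) by (auto simp: I_def min_def max_def split: if_splits)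
      moreover define y2 where "y2 = (1 - h2) / 2"
      ultimately have "y1 \<le> y2 \<and> y2 \<le> y0 \<or> y0 \<le> y2 \<and> y2 \<le> y1" unfolding h0_h1_def by (elim disjE) (simp_all add: field_simps)
      then show ?thesis unfolding y2_def[symmetric] by auto
    qed
    then show ?thesis using sp j(3) d C0_ge P0(1) by (intro nearI[OF sp P0(1)]) (auto simp: defs)
  next
    case False
    then have t: "\<tau> = - \<sigma>" using s0(1) s1(1) by auto
    have "\<sigma> * (ang h0 + ang h1) / (2 * pi) = xraw \<sigma> h0 - xraw \<tau> h1"
      by (simp add: xraw_def t diff_divide_distrib[symmetric] algebra_simps)
    also have "\<dots> = (x0 - x1) + of_int (m - n)" using s0(2) s1(2) by (simp add: h0_h1_def)
    finally have e: "\<sigma> * ((ang h0 + ang h1) / (2 * pi)) = (x0 - x1) + of_int (m - n)" by simp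
    define k where "k = (if \<sigma> = 1 then m - n else n - m)"
    define u where "u = (ang h0 + ang h1) / (2 * pi)"
    have e': "\<sigma> * u = (x0 - x1) + of_int (m - n)" using e unfolding u_def .
    have uk: "\<bar>u - of_int k\<bar> \<le> dx" using e' d(1) s0(1) by (auto simp: k_def abs_le_iff)
    have u01: "0 \<le> u" "u \<le> 1" using a by (auto simp: u_def field_simps)
    have "- 1 < real_of_int k" "real_of_int k < 2" using uk u01 quarter(1) by (auto simp: abs_le_iff)
    then have "k = 0 \<or> k = 1" by auto
    then have sm: "ang h0 \<le> 2 * pi * (dx) \<or> pi - ang h0 \<le> 2 * pi * (dx)"
    proof
      assume "k = 0"
      then have "2 * pi * u \<le> 2 * pi * (dx)" using uk u01 by (intro mult_left_mono) auto
      then show ?thesis using a by (auto simp: u_def)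
    next
      assume "k = 1"
      then have "2 * pi * (1 - u) \<le> 2 * pi * (dx)" using uk u01 by (intro mult_left_mono) auto
      moreover have "2 * pi * (1 - u) = (pi - ang h0) + (pi - ang h1)" by (simp add: u_def field_simps)
      ultimately show ?thesis using a by auto
    qed
    have "x0 = xraw \<sigma> h0 + of_int n" using s0(2) by (simp add: h0_h1_def)
    from near_tip[OF s0(1) this x0 h0 sm] obtain p where "p \<in> SP" "\<bar>x0 - fst p\<bar> \<le> dC" "\<bar>(1 - h0) / 2 - snd p\<bar> \<le> dC" by auto
    moreover have "(1 - h0) / 2 = y0" by (simp add: h0_h1_def)
    ultimately show ?thesis using P0(1) by (intro nearI[of p P0]) (auto simp: defs)
  qed
qed

text \<open>If F were positive at \<open>x\<close>, the segment from \<open>x\<close> to the edge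
  point \<open>b\<close> would contain a zero, by hypothesis inside the square. Far from corners,
  \<open>x\<close> and \<open>b\<close> lie beyond or on the same edge, and by convexity so does the
  zero; only a zero on x = 0 remains, and that is an exceptional point.\<close>

lemma outside_nonpos:
  assumes nn: "\<not> near c" and cov: "\<And>P. P \<in> cell c \<Longrightarrow> F P = 0 \<Longrightarrow> P \<in> Om"
    and b: "b \<in> cell c" "b \<in> bd" "F b \<le> 0" and x: "x \<in> cell c" "x \<notin> Om"
  shows "F x \<le> 0"
proof (rule ccontr)
  assume "\<not> F x \<le> 0"
  then have Fx: "F x > 0" by simp
  define \<gamma> where "\<gamma> \<tau> = (1 - \<tau>) *\<^sub>R x + \<tau> *\<^sub>R b" for \<tau> :: real
  have cvx: "convex (cell c)" unfolding cell_eq_Times by (intro convex_Times) (auto simp: convex_real_interval)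
  have "continuous_on {0..1} (\<lambda>\<tau>. F (\<gamma> \<tau>))"
    by (rule continuous_on_compose2[OF continuous_FK[of UNIV]]) (auto simp: \<gamma>_def intro!: continuous_intros)
  moreover have "F (\<gamma> 0) > 0" "F (\<gamma> 1) \<le> 0" using Fx b by (auto simp: \<gamma>_def)
  ultimately obtain \<tau> where \<tau>: "0 \<le> \<tau>" "\<tau> \<le> 1" "F (\<gamma> \<tau>) = 0"
    using IVT2'[of "\<lambda>\<tau>. F (\<gamma> \<tau>)" 1 0 0] by auto
  define z where "z = \<gamma> \<tau>"
  have zc: "z \<in> cell c" unfolding z_def \<gamma>_def using cvx x b \<tau> by (intro convexD) auto
  have z: "z \<in> Om" "F z = 0" using cov[OF zc] \<tau> by (auto simp: z_def)
  have Xz: "X z = (1 - \<tau>) * X x + \<tau> * X b" "Y z = (1 - \<tau>) * Y x + \<tau> * Y b"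
    by (simp_all add: z_def \<gamma>_def sqx_def sqy_def add_divide_distrib[symmetric] algebra_simps)
  have zO: "0 \<le> X z" "X z < 1" "0 < Y z" "Y z < 1" using z by (auto simp: Om_def)
  note d = same_cell[OF zc x(1)] same_cell[OF zc b(1)]
  note q = quarter C0_ge
  have corner: False if "i \<in> {0, 1}" "j \<in> {0, 1}" "\<bar>X z - i\<bar> \<le> dx" "\<bar>Y z - j\<bar> \<le> dy" for i j :: real
    using nn nearI[of "(i, j)" z c] that zc q by (auto simp: SP_def)
  have cross: False if "X z = 0"
  proof -
    have "sqF 0 (Y z) = 0" using z(2) that by (simp add: FK_def)
    then have "(0, Y z) \<in> SP" using zO by (auto simp: SP_def)
    then show False using nn nearI[of "(0, Y z)" z c] zc q that by auto
  qed
  have cc: "0 \<le> (1 - \<tau>)" "0 \<le> \<tau>" using \<tau> by auto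
  have mulle: "(1 - \<tau>) * p + \<tau> * p' \<le> e" if "p \<le> e" "p' \<le> e" for p p' e :: real
    using convex_bound_le[OF that, of "1 - \<tau>" \<tau>] cc by simp
  have mulge: "e \<le> (1 - \<tau>) * p + \<tau> * p'" if "e \<le> p" "e \<le> p'" for p p' e :: real
    using mulle[of "- p" "- e" "- p'"] that by (simp add: algebra_simps)
  consider (v) i where "i \<in> {0, 1}" "X b = i" | (h) j where "j \<in> {0, 1}" "Y b = j" using b(2) by (auto simp: bd_def)
  then show False
  proof cases
    case v
    consider "X x < 0" | "1 \<le> X x" | "Y x \<le> 0" | "1 \<le> Y x" using x(2) by (auto simp: Om_def not_le not_less)
    then show False
    proof cases
      case 1
      then have "X b = 0" using v d q zO by (auto simp: abs_le_iff)
      then have "X z \<le> 0" using Xz(1) mulle[of "X x" 0 "X b"] 1 by simp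
      then show False using cross zO by auto
    next
      case 2
      then have "X b = 1" using v d q zO by (auto simp: abs_le_iff)
      then have "1 \<le> X z" using Xz(1) mulge[of 1 "X x" "X b"] 2 by simp
      then show False using zO by auto
    next
      case 3 then show False using corner[of i 0] v d zO by (auto simp: abs_le_iff)
    next
      case 4 then show False using corner[of i 1] v d zO by (auto simp: abs_le_iff)
    qed
  next
    case h
    consider "X x < 0" | "1 \<le> X x" | "Y x \<le> 0" | "1 \<le> Y x" using x(2) by (auto simp: Om_def not_le not_less)
    then show False
    proof cases
      case 1 then show False using corner[of 0 j] h d zO by (auto simp: abs_le_iff)
    next
      case 2 then show False using corner[of 1 j] h d zO by (auto simp: abs_le_iff)
    next
      case 3
      then have "Y b = 0" using h d q zO by (auto simp: abs_le_iff)
      then have "Y z \<le> 0" using Xz(2) mulle[of "Y x" 0 "Y b"] 3 by simp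
      then show False using zO by auto
    next
      case 4
      then have "Y b = 1" using h d q zO by (auto simp: abs_le_iff)
      then have "1 \<le> Y z" using Xz(2) mulge[of 1 "Y x" "Y b"] 4 by simp
      then show False using zO by auto
    qed
  qed
qed

end

section \<open>Position of a cell relative to the square\<close>

definition icell :: "int \<times> int \<Rightarrow> (real \<times> real) set" where
  "icell c = {real_of_int (fst c)<..<real_of_int (fst c) + 1} \<times> {real_of_int (snd c)<..<real_of_int (snd c) + 1}"

lemma icell_subset: "icell c \<subseteq> cell c" by (auto simp: icell_def cell_eq_Times)

lemma open_icell: "open (icell c)" by (simp add: icell_def open_Times)

lemma icell_borel [measurable]: "icell c \<in> sets borel" using open_icell by auto

lemma convex_icell: "convex (icell c)" by (simp add: icell_def convex_Times)

lemma emeasure_icell: "emeasure lborel (icell c) = 1"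
  by (simp add: icell_def emeasure_lborel_Times)

lemma fmeas_cell_Int: "B \<in> sets borel \<Longrightarrow> cell c \<inter> B \<in> fmeasurable lborel"
proof -
  assume "B \<in> sets borel"
  moreover have "cell c \<in> fmeasurable lborel" by (simp add: fmeasurable_def emeasure_cell)
  ultimately show ?thesis by (intro fmeasurable_Int_fmeasurable) auto
qed

lemma measure_cell_split:
  assumes "B \<in> sets borel" "B' \<in> sets borel"
  shows "measure lborel (cell c \<inter> B) = measure lborel (cell c \<inter> B \<inter> B') + measure lborel (cell c \<inter> B - B')"
proof -
  have "measure lborel (cell c \<inter> B) = measure lborel ((cell c \<inter> B \<inter> B') \<union> (cell c \<inter> B - B'))"
    by (rule arg_cong[where f = "measure lborel"]) auto
  also have "\<dots> = measure lborel (cell c \<inter> B \<inter> B') + measure lborel (cell c \<inter> B - B')"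
  proof (rule measure_Union)
    have "cell c \<inter> B \<inter> B' \<in> fmeasurable lborel" "cell c \<inter> B - B' \<in> fmeasurable lborel"
      using fmeas_cell_Int[of "B \<inter> B'" c] fmeas_cell_Int[of "B - B'" c] assms by (auto simp: Int_assoc Int_Diff)
    then show "emeasure lborel (cell c \<inter> B \<inter> B') \<noteq> \<infinity>" "emeasure lborel (cell c \<inter> B - B') \<noteq> \<infinity>"
      "cell c \<inter> B \<inter> B' \<in> sets lborel" "cell c \<inter> B - B' \<in> sets lborel" by (auto simp: fmeasurable_def)
  qed auto
  finally show ?thesis .
qed

text \<open>Moving a point of the half-open cell a little towards the centre brings it into the
  interior while it stays in the open set. Facts about interiors reach the points chosen on closed
  sides in this way.\<close>

lemma cell_to_icell:
  assumes "P \<in> cell c" "open U" "P \<in> U"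
  shows "icell c \<inter> U \<noteq> {}"
proof -
  define M where "M = (real_of_int (fst c) + 1/2, real_of_int (snd c) + 1/2)"
  define \<gamma> where "\<gamma> \<tau> = (1 - \<tau>) *\<^sub>R P + \<tau> *\<^sub>R M" for \<tau> :: real
  have "(\<gamma> \<longlongrightarrow> \<gamma> 0) (at_right 0)" unfolding \<gamma>_def by (intro tendsto_intros)
  moreover have "\<gamma> 0 = P" by (simp add: \<gamma>_def)
  ultimately have "\<forall>\<^sub>F \<tau> in at_right 0. \<gamma> \<tau> \<in> U" using assms(2,3) by (metis topological_tendstoD)
  moreover have "\<forall>\<^sub>F \<tau> in at_right 0. 0 < \<tau> \<and> \<tau> < (1::real)"
    by (auto simp: eventually_at_right_field intro!: exI[of _ 1])
  ultimately have "\<forall>\<^sub>F \<tau> in at_right 0. \<gamma> \<tau> \<in> U \<and> 0 < \<tau> \<and> \<tau> < 1" by eventually_elim auto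
  then obtain \<tau> where t: "\<gamma> \<tau> \<in> U" "0 < \<tau>" "\<tau> < 1" using eventually_happens trivial_limit_at_right_real by blast
  have lin: "(i::real) < (1 - \<tau>) * p + \<tau> * (i + 1/2) \<and> (1 - \<tau>) * p + \<tau> * (i + 1/2) < i + 1" if "i \<le> p" "p < i + 1" for i p
  proof -
    have "0 \<le> (1 - \<tau>) * (p - i)" "(1 - \<tau>) * (p - i) < (1 - \<tau>) * 1" using that t by (auto intro: mult_strict_left_mono)
    then show ?thesis using t by (simp add: algebra_simps)
  qed
  have "\<gamma> \<tau> \<in> icell c" using assms(1) lin by (cases P) (auto simp: \<gamma>_def M_def icell_def cell_def)
  then show ?thesis using t by blast
qed

context cap_cells
begin

definition "Sc = {c. cell c \<inter> Om \<noteq> {}}"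
definition "touch c \<longleftrightarrow> icell c \<inter> bd \<noteq> {}"
definition "hasz c \<longleftrightarrow> (\<exists>P\<in>cell c \<inter> Om. F P = 0)"
definition "osq = {P. 0 < X P \<and> X P < 1 \<and> 0 < Y P \<and> Y P < 1}"
text \<open>Both notions look at the interior of the cell only. A cell of either kind may still have
  points of its closed sides on the wrong side of the edge, and the chosen point may be one of
  them.\<close>

definition "insd c \<longleftrightarrow> icell c \<subseteq> osq"
definition "outs c \<longleftrightarrow> icell c \<inter> Om = {}"
text \<open>Cells treated as total losses: those near exceptional points, those in which the curve
  has a break point, and those in an end column of an arc. Their number is bounded in terms of Q
  alone.\<close>

definition "Xc A = {c. near c} \<union> {c. \<exists>P\<in>cell c \<inter> Om. F P = 0 \<and> 1 - 2 * Y P \<in> Bk}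
   \<union> (\<Union>k\<in>{1, -1} \<times> Bl. {c. arc_pts (A k) \<inter> cell c \<noteq> {} \<and> \<not> arc_full (A k) c})"

lemma continuous_XY: "continuous_on S X" "continuous_on S Y"
  unfolding sqx_def[abs_def] sqy_def[abs_def] divide_inverse by (intro continuous_intros)+

lemma open_osq: "open osq"
  unfolding osq_def
  by (intro open_Collect_conj open_Collect_less continuous_on_const continuous_XY)

lemma Om_borel [measurable]: "Om \<in> sets borel"
proof -
  have "Om = {P. 0 \<le> X P} \<inter> {P. X P < 1} \<inter> {P. 0 < Y P} \<inter> {P. Y P < 1}" by (auto simp: Om_def)
  moreover have "closed {P. 0 \<le> X P}" "open {P. X P < 1}" "open {P. 0 < Y P}" "open {P. Y P < 1}"
    by (intro closed_Collect_le open_Collect_less continuous_on_const continuous_XY)+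
  ultimately show ?thesis by (metis borel_closed borel_open sets.Int)
qed

lemma XY_convex_comb: "X ((1 - \<tau>) *\<^sub>R P + \<tau> *\<^sub>R Q) = (1 - \<tau>) * X P + \<tau> * X Q"
  "Y ((1 - \<tau>) *\<^sub>R P + \<tau> *\<^sub>R Q) = (1 - \<tau>) * Y P + \<tau> * Y Q"
  by (simp_all add: sqx_def sqy_def add_divide_distrib[symmetric] algebra_simps)

lemma convex_Om: "convex Om"
proof -
  have "linear X" "linear Y"
    by (auto simp: linear_iff sqx_def sqy_def add_divide_distrib[symmetric] algebra_simps)
  then have "convex (X -` {0..<1})" "convex (Y -` {0<..<1})" by (auto intro!: convex_linear_vimage simp: convex_real_interval)
  then have "convex (X -` {0..<1} \<inter> Y -` {0<..<1})" by (rule convex_Int)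
  moreover have "X -` {0..<1} \<inter> Y -` {0<..<1} = Om" by (auto simp: Om_def)
  ultimately show ?thesis by simp
qed

lemma convex_cell: "convex (cell c)"
  unfolding cell_eq_Times by (intro convex_Times) (auto simp: convex_real_interval)

lemma finite_Sc: "finite Sc"
proof -
  define B where "B = K * ((\<bar>q11\<bar> + \<bar>q12\<bar> + \<bar>q21\<bar> + \<bar>q22\<bar>) / \<bar>dtq\<bar>)"
  have bnd: "\<bar>fst P\<bar> \<le> B \<and> \<bar>snd P\<bar> \<le> B" if "P \<in> Om" for P
  proof -
    have xy: "\<bar>X P\<bar> \<le> 1" "\<bar>Y P\<bar> \<le> 1" using that by (auto simp: Om_def)
    have "\<bar>q22 * X P - q12 * Y P\<bar> \<le> \<bar>q22\<bar> + \<bar>q12\<bar>" "\<bar>q11 * Y P - q21 * X P\<bar> \<le> \<bar>q11\<bar> + \<bar>q21\<bar>"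
      using xy by (auto intro!: order.trans[OF abs_triangle_ineq4] add_mono simp: abs_mult mult_left_le)
    then have "\<bar>q22 * X P - q12 * Y P\<bar> \<le> \<bar>q11\<bar> + \<bar>q12\<bar> + \<bar>q21\<bar> + \<bar>q22\<bar>" "\<bar>q11 * Y P - q21 * X P\<bar> \<le> \<bar>q11\<bar> + \<bar>q12\<bar> + \<bar>q21\<bar> + \<bar>q22\<bar>"
      by linarith+
    then have "\<bar>latu K (X P) (Y P)\<bar> \<le> B" "\<bar>latv K (X P) (Y P)\<bar> \<le> B"
      using K_pos dtq_nz unfolding latu_def latv_def B_def by (auto simp: abs_mult abs_divide intro!: mult_left_mono divide_right_mono)
    then show ?thesis using K_pos by (simp add: lat_sq)
  qed
  have "Sc \<subseteq> {\<lfloor>-B\<rfloor>..\<lfloor>B\<rfloor>} \<times> {\<lfloor>-B\<rfloor>..\<lfloor>B\<rfloor>}"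
  proof
    fix c assume "c \<in> Sc"
    then obtain P where P: "P \<in> cell c" "P \<in> Om" by (auto simp: Sc_def)
    then have "fst c = \<lfloor>fst P\<rfloor>" "snd c = \<lfloor>snd P\<rfloor>" by (cases P, simp add: mem_cell)+
    then show "c \<in> {\<lfloor>-B\<rfloor>..\<lfloor>B\<rfloor>} \<times> {\<lfloor>-B\<rfloor>..\<lfloor>B\<rfloor>}"
      using bnd[OF P(2)] by (cases c) (auto simp: abs_le_iff intro!: floor_mono)
  qed
  then show ?thesis by (rule finite_subset) auto
qed

lemma measure_sum_cells:
  assumes "B \<in> sets borel" "B \<subseteq> Om"
  shows "measure lborel B = (\<Sum>c\<in>Sc. measure lborel (cell c \<inter> B))"
proof -
  have "B = (\<Union>c\<in>Sc. cell c \<inter> B)"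
  proof (intro equalityI subsetI)
    fix P assume P: "P \<in> B"
    have "P \<in> cell (\<lfloor>fst P\<rfloor>, \<lfloor>snd P\<rfloor>)" by (cases P) (simp add: mem_cell)
    then show "P \<in> (\<Union>c\<in>Sc. cell c \<inter> B)" using P assms(2) by (auto simp: Sc_def)
  qed auto
  then have "measure lborel B = measure lborel (\<Union>c\<in>Sc. cell c \<inter> B)" by simp
  also have "\<dots> = (\<Sum>c\<in>Sc. measure lborel (cell c \<inter> B))"
  proof (rule measure_finite_Union[OF finite_Sc])
    show "disjoint_family_on (\<lambda>c. cell c \<inter> B) Sc" using cell_disjoint by (fastforce simp: disjoint_family_on_def)
    show "(\<lambda>c. cell c \<inter> B) ` Sc \<subseteq> sets lborel" using assms by auto
    fix c show "emeasure lborel (cell c \<inter> B) \<noteq> \<infinity>" using fmeas_cell_Int[OF assms(1), of c] by (auto simp: fmeasurable_def)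
  qed
  finally show ?thesis .
qed

text \<open>The open cell is connected, and without edge points it is covered by the open square and
  the open exterior.\<close>

lemma not_touch: "\<not> touch c \<Longrightarrow> insd c \<or> outs c"
proof (rule disjCI)
  assume nt: "\<not> touch c" and "\<not> outs c"
  then obtain P where P: "P \<in> icell c" "P \<in> Om" by (auto simp: outs_def)
  define W where "W = - {P. 0 \<le> X P \<and> X P \<le> 1 \<and> 0 \<le> Y P \<and> Y P \<le> 1}"
  have "closed {P. 0 \<le> X P \<and> X P \<le> 1 \<and> 0 \<le> Y P \<and> Y P \<le> 1}"
    by (intro closed_Collect_conj closed_Collect_le continuous_on_const continuous_XY)
  then have oW: "open W" by (simp add: W_def open_Compl)
  have cov: "icell c \<subseteq> osq \<union> W" using nt by (auto simp: touch_def bd_def osq_def W_def)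
  have "P \<in> osq" using P nt by (auto simp: osq_def Om_def touch_def bd_def)
  moreover have "osq \<inter> W \<inter> icell c = {}" by (auto simp: osq_def W_def)
  ultimately have "W \<inter> icell c = {}"
    using connectedD[OF convex_connected[OF convex_icell] open_osq oW _ cov] P by blast
  then show "insd c" using cov by (auto simp: insd_def)
qed

lemma insd_measure:
  assumes "insd c"
  shows "measure lborel (cell c \<inter> Om) = 1" "measure lborel (cell c - Om) = 0"
proof -
  have "emeasure lborel (icell c) \<le> emeasure lborel (cell c \<inter> Om)"
  proof (rule emeasure_mono)
    have "osq \<subseteq> Om" by (auto simp: osq_def Om_def)
    then show "icell c \<subseteq> cell c \<inter> Om" using assms icell_subset[of c] unfolding insd_def by blast
  qed simp
  moreover have "emeasure lborel (cell c \<inter> Om) \<le> emeasure lborel (cell c)" by (intro emeasure_mono) auto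
  ultimately have "emeasure lborel (cell c \<inter> Om) = 1" by (simp add: emeasure_icell emeasure_cell)
  then show 1: "measure lborel (cell c \<inter> Om) = 1" by (simp add: measure_def)
  show "measure lborel (cell c - Om) = 0" using measure_cell_split[of UNIV Om c] 1 by (simp add: measure_cell)
qed

lemma outs_measure:
  assumes "outs c" "B \<subseteq> Om" "B \<in> sets borel"
  shows "measure lborel (cell c \<inter> B) = 0"
proof -
  have "measure lborel (cell c) = measure lborel (cell c \<inter> icell c) + measure lborel (cell c - icell c)"
    using measure_cell_split[of UNIV "icell c" c] by simp
  moreover have "cell c \<inter> icell c = icell c" using icell_subset[of c] by blast
  ultimately have z: "measure lborel (cell c - icell c) = 0" by (simp add: measure_cell) (simp add: measure_def emeasure_icell)
  have "measure lborel (cell c \<inter> B) \<le> measure lborel (cell c - icell c)"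
    using assms fmeas_cell_Int[of "- icell c" c] by (intro measure_mono_fmeasurable) (auto simp: outs_def Diff_eq)
  then show ?thesis using z by (simp add: measure_le_0_iff)
qed

text \<open>An edge point in the open cell is the limit of points on the segment towards the centre
  of the square. These lie in the square and eventually in the cell, so a weak inequality passes to
  the limit.\<close>

lemma limit_at_touch:
  assumes b: "b \<in> icell c" "b \<in> bd" and g: "continuous_on UNIV g" "\<And>P. P \<in> cell c \<inter> Om \<Longrightarrow> 0 \<le> g P"
  shows "(0::real) \<le> g b"
proof -
  define M where "M = (latu K (1/2) (1/2), latv K (1/2) (1/2))"
  have M: "X M = 1/2" "Y M = 1/2" using K_pos by (simp_all add: M_def sq_lat)
  define \<gamma> where "\<gamma> \<tau> = (1 - \<tau>) *\<^sub>R b + \<tau> *\<^sub>R M" for \<tau> :: real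
  have lim: "(\<gamma> \<longlongrightarrow> b) (at_right 0)"
  proof -
    have "(\<gamma> \<longlongrightarrow> (1 - 0) *\<^sub>R b + 0 *\<^sub>R M) (at_right 0)" unfolding \<gamma>_def by (intro tendsto_intros)
    then show ?thesis by simp
  qed
  then have ev1: "\<forall>\<^sub>F \<tau> in at_right 0. \<gamma> \<tau> \<in> icell c" using open_icell b(1) by (metis topological_tendstoD)
  have ev2: "\<forall>\<^sub>F \<tau> in at_right 0. 0 < \<tau> \<and> \<tau> < (1::real)"
    by (auto simp: eventually_at_right_field intro!: exI[of _ 1])
  have xb: "0 \<le> X b" "X b \<le> 1" "0 \<le> Y b" "Y b \<le> 1" using b(2) by (auto simp: bd_def)
  have "\<forall>\<^sub>F \<tau> in at_right 0. 0 \<le> g (\<gamma> \<tau>)"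
    using ev1 ev2
  proof eventually_elim
    case (elim \<tau>)
    have lin: "0 < (1 - \<tau>) * p + \<tau> * (1/2) \<and> (1 - \<tau>) * p + \<tau> * (1/2) < 1" if "0 \<le> p" "p \<le> 1" for p
    proof -
      have "0 \<le> (1 - \<tau>) * p" "(1 - \<tau>) * p \<le> (1 - \<tau>) * 1" using that elim mult_left_mono[of p 1 "1 - \<tau>"] by auto
      moreover have "0 < \<tau>" "\<tau> < 1" using elim by auto
      moreover define w where "w = (1 - \<tau>) * p"
      ultimately show ?thesis unfolding w_def[symmetric] by auto
    qed
    have "\<gamma> \<tau> \<in> Om" using lin[OF xb(1,2)] lin[OF xb(3,4)] by (auto simp: Om_def \<gamma>_def XY_convex_comb M)
    then show ?case using g(2) elim icell_subset by blast
  qed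
  moreover have "((\<lambda>\<tau>. g (\<gamma> \<tau>)) \<longlongrightarrow> g b) (at_right 0)"
    by (rule isCont_tendsto_compose[OF _ lim]) (metis g(1) continuous_on_eq_continuous_at open_UNIV UNIV_I)
  ultimately show ?thesis by (intro tendsto_lowerbound) auto
qed

lemma bd_zero_near:
  assumes "b \<in> cell c" "b \<in> bd" "F b = 0"
  shows "near c"
proof -
  have "X b \<in> {0, 1}" "0 \<le> Y b" "Y b \<le> 1" using assms(2) zero_inner[OF assms(3)] by (auto simp: bd_def)
  moreover have "sqF 0 (Y b) = 0" using assms(3) \<open>X b \<in> {0, 1}\<close> sqF_periodic[of 0 1 "Y b"] by (auto simp: FK_def)
  ultimately have "(X b, Y b) \<in> SP" by (auto simp: SP_def)
  then show ?thesis using assms(1) C0_ge by (intro nearI[of "(X b, Y b)"]) auto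
qed

text \<open>Outside the exceptional cells one zero in the square forces every zero of the cell into
  the square and into the open part of an arc whose column through the cell is complete. This is the
  covering needed for \<open>zero_crossing_side\<close>.\<close>

lemma arcs_cover:
  assumes c: "c \<notin> Xc A" and fam: "\<And>k. k \<in> {1, -1} \<times> Bl \<Longrightarrow> arc_for K (fst k) (snd k) (A k)"
    and P0: "P0 \<in> cell c" "P0 \<in> Om" "F P0 = 0" and P: "P \<in> cell c" "F P = 0"
  shows "P \<in> Om \<and> (\<exists>k\<in>{1, -1} \<times> Bl. arc_full (A k) c \<and> P \<in> arc_pts (A k))"
proof -
  have POm: "P \<in> Om" using stray_zero_near[OF P0 P] c by (auto simp: Xc_def)
  then have xy: "0 \<le> X P" "X P < 1" "0 \<le> Y P" "Y P \<le> 1" by (auto simp: Om_def)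
  have nb: "1 - 2 * Y P \<notin> Bk" using c P POm by (auto simp: Xc_def)
  obtain \<sigma> b where sb: "\<sigma> = 1 \<or> \<sigma> = -1" "b \<in> Bl" "b < 1 - 2 * Y P" "1 - 2 * Y P < nxt b" "X P = xc \<sigma> b (1 - 2 * Y P)"
    using arc_point_exists[of "X P" "Y P"] P(2) xy nb unfolding FK_def by metis
  have k: "(\<sigma>, b) \<in> {1, -1} \<times> Bl" using sb by auto
  have "cpt K \<sigma> b (1 - 2 * Y P) = P" using K_pos by (simp add: cpt_def sb(5)[symmetric] lat_sq)
  moreover have "cpt K \<sigma> b (1 - 2 * Y P) \<in> arc_pts (A (\<sigma>, b))" using fam[OF k] sb(3,4) unfolding arc_for_def by auto
  ultimately have pts: "P \<in> arc_pts (A (\<sigma>, b))" by simp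
  then have "arc_full (A (\<sigma>, b)) c" using c k P by (auto simp: Xc_def)
  then show ?thesis using POm k pts by blast
qed

end

section \<open>The error of a cap as a sum over cells\<close>

context cap_cells
begin

lemma hasz_outs_near:
  assumes "hasz c" "outs c"
  shows "near c"
proof -
  obtain P where P: "P \<in> cell c" "P \<in> Om" "F P = 0" using assms(1) by (auto simp: hasz_def)
  have "P \<notin> osq"
  proof
    assume "P \<in> osq"
    then have "icell c \<inter> osq \<noteq> {}" using cell_to_icell[OF P(1) open_osq] by blast
    moreover have "osq \<subseteq> Om" by (auto simp: osq_def Om_def)
    ultimately show False using assms(2) by (auto simp: outs_def)
  qed
  then have "P \<in> bd" using P(2) by (auto simp: osq_def Om_def bd_def)
  then show ?thesis using bd_zero_near P by blast
qed

lemma constant_sign: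
  assumes "\<not> hasz c"
  shows "(\<forall>P\<in>cell c \<inter> Om. 0 < F P) \<or> (\<forall>P\<in>cell c \<inter> Om. F P < 0)"
proof (rule ccontr)
  assume "\<not> ?thesis"
  then obtain P Q where PQ: "P \<in> cell c \<inter> Om" "F P \<le> 0" "Q \<in> cell c \<inter> Om" "0 \<le> F Q" by (auto simp: not_less)
  have "connected (F ` (cell c \<inter> Om))"
    by (intro connected_continuous_image continuous_FK convex_connected convex_Int convex_cell convex_Om)
  then have "0 \<in> F ` (cell c \<inter> Om)" using PQ connectedD_interval[of "F ` (cell c \<inter> Om)" "F P" "F Q" 0] by blast
  then show False using assms by (auto simp: hasz_def)
qed

text \<open>The weight of the chosen point, if it lies in the square, minus the area of the cell
  inside the square. It is a summand of M in units of lattice cells, with \<open>\<rho>\<close> the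
  area of the square divided by the number of points.\<close>

definition "mass (\<rho>::real) \<zeta> c = \<rho> * indicator Om (\<zeta> c) - measure lborel (cell c \<inter> Om)"

text \<open>\<open>H\<close> is a set of cells whose whole mass is split off, to be bounded by M.
  What remains of a cell is at most |\<rho> - 1| plus the area it has outside the cap. For cells
  with a zero of F this area goes to \<open>leftover_sum\<close>; for the others F has one sign and
  the hypotheses on \<open>touch\<close>, \<open>outs\<close> and \<open>insd\<close> exclude any
  loss. All cells in \<open>Yx\<close> and \<open>Xc A\<close> are simply charged 1.\<close>

lemma cap_cells_main:
  fixes \<rho> :: real
  assumes fam: "\<And>k. k \<in> {1, -1} \<times> Bl \<Longrightarrow> arc_for K (fst k) (snd k) (A k)"
    and \<zeta>: "\<And>c. \<zeta> c \<in> cell c" and \<rho>: "0 < \<rho>" and H: "H \<subseteq> Sc" and Yx: "finite Yx"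
    and Ar: "Ar \<in> sets borel" "{P \<in> Om. 0 < F P} \<subseteq> Ar" "Ar \<subseteq> {P \<in> Om. 0 \<le> F P}"
    and touch1: "\<And>c. c \<in> H \<Longrightarrow> c \<notin> Xc A \<Longrightarrow> c \<notin> Yx \<Longrightarrow> touch c \<Longrightarrow> \<exists>b\<in>icell c \<inter> bd. 0 \<le> F b"
    and touch2: "\<And>c. c \<in> Sc - H \<Longrightarrow> c \<notin> Xc A \<Longrightarrow> c \<notin> Yx \<Longrightarrow> touch c \<Longrightarrow> \<exists>b\<in>icell c \<inter> bd. F b \<le> 0"
    and extra1: "\<And>c. c \<in> Sc - H \<Longrightarrow> c \<notin> Xc A \<Longrightarrow> c \<notin> Yx \<Longrightarrow> outs c \<Longrightarrow> \<zeta> c \<notin> Ar"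
    and extra2: "\<And>c. c \<in> H \<Longrightarrow> c \<notin> Xc A \<Longrightarrow> c \<notin> Yx \<Longrightarrow> insd c \<Longrightarrow> \<zeta> c \<notin> Om
        \<Longrightarrow> (\<forall>P\<in>cell c \<inter> Om. F P < 0) \<Longrightarrow> False"
  shows "\<rho> * card {c \<in> Sc. \<zeta> c \<in> Ar} - measure lborel Ar
     \<le> (\<Sum>c\<in>H. mass \<rho> \<zeta> c) + \<bar>\<rho> - 1\<bar> * card Sc + card (Xc A \<inter> Sc) + card Yx
       + (\<Sum>k\<in>{1, -1} \<times> Bl. (aq (A k) - ap (A k)) + \<bar>af (A k) (aq (A k)) - af (A k) (ap (A k))\<bar> / 2 + 7)"
proof -
  define m where "m S = measure lborel S" for S :: "(real \<times> real) set"
  define ind where "ind S c = (indicator S (\<zeta> c) :: real)" for S c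
  have ind: "ind S c = (if \<zeta> c \<in> S then 1 else 0)" for S c by (simp add: ind_def indicator_def)
  have ArOm: "Ar \<subseteq> Om" using Ar(3) by auto
  define \<nu> where "\<nu> c = \<rho> * ind Ar c - m (cell c \<inter> Ar)" for c
  define cc where "cc c = \<nu> c - (if c \<in> H then mass \<rho> \<zeta> c else 0)" for c
  \<comment> \<open>A point outside \<open>H\<close> weighs about 1, whatever part of its cell lies
    in the square, so the missing area includes the part of the cell beyond the edge. For cells in
    \<open>H\<close> the mass already subtracts the square part, and for inner cells the part beyond
    the edge is a null set.\<close>
  define Wd where "Wd c = (if c \<in> H \<or> insd c then cell c \<inter> Om - Ar else cell c - Ar)" for c
  define G where "G = {c \<in> Sc. hasz c \<and> c \<notin> Xc A \<and> c \<notin> Yx}"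
  have finH: "finite H" using H finite_Sc finite_subset by blast
  have m0: "0 \<le> m S" for S by (simp add: m_def)
  have mcell: "m (cell c) = 1" for c by (simp add: m_def measure_cell)
  have split1: "m (cell c \<inter> Om) = m (cell c \<inter> Ar) + m (cell c \<inter> Om - Ar)" for c
  proof -
    have "cell c \<inter> Om \<inter> Ar = cell c \<inter> Ar" using ArOm by auto
    then show ?thesis using measure_cell_split[OF Om_borel Ar(1), of c] by (simp only: m_def)
  qed
  have split2: "1 = m (cell c \<inter> Ar) + m (cell c - Ar)" for c
    using measure_cell_split[OF _ Ar(1), of UNIV c] by (simp add: m_def measure_cell)
  have split3: "1 = m (cell c \<inter> Om) + m (cell c - Om)" for c
    using measure_cell_split[OF _ Om_borel, of UNIV c] by (simp add: m_def measure_cell)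
  have inOm: "ind Ar c \<le> ind Om c" "0 \<le> ind Ar c" "ind Om c \<le> 1" "ind Ar c \<le> 1" for c using ArOm by (auto simp: ind)
  have mass: "mass \<rho> \<zeta> c = \<rho> * ind Om c - m (cell c \<inter> Om)" for c by (simp add: mass_def ind_def m_def)
  have ccH: "cc c \<le> m (cell c \<inter> Om - Ar)" if "c \<in> H" for c
  proof -
    have "\<rho> * ind Ar c \<le> \<rho> * ind Om c" using inOm \<rho> by (intro mult_left_mono) auto
    then show ?thesis using that split1[of c] by (simp add: cc_def \<nu>_def mass)
  qed
  have ccN: "cc c \<le> \<bar>\<rho> - 1\<bar> + m (cell c - Ar)" if "c \<notin> H" for c
  proof -
    have "\<rho> * ind Ar c \<le> \<rho> * 1" using inOm \<rho> by (intro mult_left_mono) auto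
    then show ?thesis using that split2[of c] by (simp add: cc_def \<nu>_def)
  qed
  have le1: "m (cell c \<inter> Om - Ar) \<le> 1" "m (cell c - Ar) \<le> 1" for c
    using split1[of c] split2[of c] split3[of c] m0[of "cell c - Om"] m0[of "cell c \<inter> Ar"] by linarith+
  have any: "cc c \<le> \<bar>\<rho> - 1\<bar> + 1" for c using ccH[of c] ccN[of c] le1[of c] by (cases "c \<in> H") auto
  have insdW: "m (cell c - Ar) = m (cell c \<inter> Om - Ar)" if "insd c" for c
    using insd_measure[OF that] split1[of c] split2[of c] by (simp add: m_def)
  have GW: "cc c \<le> \<bar>\<rho> - 1\<bar> + m (Wd c)" if "c \<in> G" for c
    using ccH[of c] ccN[of c] insdW[of c] by (cases "c \<in> H"; cases "insd c") (auto simp: Wd_def intro: order.trans[OF _ le_add_same_cancel2[THEN iffD2]])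
  \<comment> \<open>A cell with the wrong sign for its place, in or outside \<open>H\<close>, that
    meets the edge would have an edge point where F vanishes in the limit; it would then be near an
    exceptional point.\<close>
  have rest: "cc c \<le> \<bar>\<rho> - 1\<bar>" if c: "c \<in> Sc" "c \<notin> Xc A" "c \<notin> Yx" "\<not> hasz c" for c
  proof -
    have nn: "\<not> near c" using c(2) by (auto simp: Xc_def)
    have nob: "F b \<noteq> 0" if "b \<in> icell c" "b \<in> bd" for b
      using bd_zero_near[of b c] that nn icell_subset by blast
    consider (pos) "\<forall>P\<in>cell c \<inter> Om. 0 < F P" | (neg) "\<forall>P\<in>cell c \<inter> Om. F P < 0" using constant_sign[OF c(4)] by blast
    then show ?thesis
    proof cases
      case pos
      then have e: "cell c \<inter> Om \<subseteq> Ar" using Ar(2) by auto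
      then have W0: "cell c \<inter> Om - Ar = {}" by auto
      show ?thesis
      proof (cases "c \<in> H")
        case True then show ?thesis using ccH[of c] unfolding W0 by (simp add: m_def)
      next
        case False
        have nt: "\<not> touch c"
        proof
          assume "touch c"
          then obtain b where b: "b \<in> icell c" "b \<in> bd" "F b \<le> 0" using touch2[of c] c False by auto
          have "0 \<le> F P" if "P \<in> cell c \<inter> Om" for P using pos that by (blast intro: less_imp_le)
          then have "0 \<le> F b" by (rule limit_at_touch[OF b(1,2) continuous_FK])
          then show False using nob[OF b(1,2)] b(3) by simp
        qed
        show ?thesis
        proof (cases "insd c")
          case True then show ?thesis using ccN[OF False] insdW[OF True] unfolding W0 by (simp add: m_def)
        next
          case F2: False
          then have "outs c" using not_touch[OF nt] by simp
          then have "\<zeta> c \<notin> Ar" using extra1[of c] c False by auto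
          then show ?thesis using False m0[of "cell c \<inter> Ar"] by (simp add: cc_def \<nu>_def ind)
        qed
      qed
    next
      case neg
      then have e: "cell c \<inter> Ar = {}" using Ar(3) by force
      show ?thesis
      proof (cases "c \<in> H")
        case False
        have "\<zeta> c \<notin> Ar" using e \<zeta>[of c] by auto
        then show ?thesis using False m0[of "cell c \<inter> Ar"] by (simp add: cc_def \<nu>_def ind)
      next
        case True
        have nt: "\<not> touch c"
        proof
          assume "touch c"
          then obtain b where b: "b \<in> icell c" "b \<in> bd" "0 \<le> F b" using touch1[of c] c True by auto
          have "0 \<le> - F P" if "P \<in> cell c \<inter> Om" for P using neg that by (auto intro: less_imp_le)
          then have "0 \<le> - F b"
            by (rule limit_at_touch[OF b(1,2) continuous_on_minus[OF continuous_FK]])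
          then show False using nob[OF b(1,2)] b(3) by simp
        qed
        show ?thesis
        proof (cases "insd c")
          case T2: True
          then have "\<zeta> c \<in> Om" using extra2[of c] c True neg by blast
          moreover have "\<zeta> c \<notin> Ar" using e \<zeta>[of c] by auto
          moreover have "m (cell c \<inter> Om) = 1" using insd_measure[OF T2] by (simp add: m_def)
          ultimately show ?thesis using True e by (simp add: cc_def \<nu>_def mass ind m_def)
        next
          case False
          then have "outs c" using not_touch[OF nt] by simp
          from outs_measure[OF this _ Om_borel] have "m (cell c \<inter> Om) = 0" by (simp add: m_def)
          then show ?thesis using ccH[OF True] split1[of c] m0[of "cell c \<inter> Ar"] m0[of "cell c \<inter> Om - Ar"] by linarith
        qed
      qed
    qed
  qed
  have Wsub: "Wd c \<subseteq> cell c" for c by (auto simp: Wd_def)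
  have Whit: "\<exists>k\<in>{1, -1} \<times> Bl. arc_hit (A k) c \<and> 0 \<le> side (A k) x" if c: "c \<in> G" and x: "x \<in> Wd c" for c x
  proof -
    obtain P0 where P0: "P0 \<in> cell c" "P0 \<in> Om" "F P0 = 0" using c by (auto simp: G_def hasz_def)
    have cX: "c \<notin> Xc A" using c by (simp add: G_def)
    then have nn: "\<not> near c" by (auto simp: Xc_def)
    have cov: "\<exists>k\<in>{1, -1} \<times> Bl. arc_full (A k) c \<and> P \<in> arc_pts (A k)" if "P \<in> cell c" "F P = 0" for P
      using arcs_cover[OF cX fam P0 that] by blast
    have zOm: "P \<in> Om" if "P \<in> cell c" "F P = 0" for P
      using arcs_cover[OF cX fam P0 that] by blast
    have Fx: "F x \<le> 0"
    proof (cases "x \<in> Om")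
      case True
      then show ?thesis using x Ar(2) by (force simp: Wd_def split: if_splits)
    next
      case False
      then have n: "c \<notin> H" "\<not> insd c" "x \<in> cell c" using x by (auto simp: Wd_def split: if_splits)
      then have t: "touch c" using not_touch[of c] hasz_outs_near[of c] c nn by (auto simp: G_def)
      then obtain b where b: "b \<in> icell c" "b \<in> bd" "F b \<le> 0" using touch2[of c] c n by (auto simp: G_def)
      have "b \<in> cell c" using b(1) icell_subset by (rule subsetD[rotated])
      from outside_nonpos[OF nn zOm this b(2,3) n(3) False] show ?thesis .
    qed
    show ?thesis
    proof (rule zero_crossing_side[OF continuous_FK[of UNIV K]])
      show "finite ({1, -1} \<times> Bl)" using finite_card_Bk(1) by (simp add: Bl_def)
      show "arc_ok (A k)" if "k \<in> {1, -1} \<times> Bl" for k using fam[OF that] by (simp add: arc_for_def)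
      show "F P = 0" if "k \<in> {1, -1} \<times> Bl" "P \<in> arc_closure (A k)" for k P using fam[OF that(1)] that(2) by (simp add: arc_for_def)
      show "\<forall>\<^sub>F R in at P. F R < 0 \<longrightarrow> 0 < side (A k) R" if "k \<in> {1, -1} \<times> Bl" "P \<in> arc_pts (A k)" for k P
        using fam[OF that(1)] that(2) by (simp add: arc_for_def)
      show "convex (cell c)" by (rule convex_cell)
      show "x \<in> cell c" using x Wsub[of c] by (rule subsetD[rotated])
    qed (use cov Fx P0 in auto)
  qed
  have "(\<Sum>c\<in>Sc. cc c) \<le> (\<Sum>c\<in>Sc. \<bar>\<rho> - 1\<bar> + (if c \<in> Xc A then 1 else 0) + (if c \<in> Yx then 1 else 0) + (if c \<in> G then m (Wd c) else 0))"
  proof (rule sum_mono)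
    fix c assume c: "c \<in> Sc"
    show "cc c \<le> \<bar>\<rho> - 1\<bar> + (if c \<in> Xc A then 1 else 0) + (if c \<in> Yx then 1 else 0) + (if c \<in> G then m (Wd c) else 0)"
    proof (cases "c \<in> Xc A \<or> c \<in> Yx")
      case True then show ?thesis using any[of c] m0[of "Wd c"] by auto
    next
      case False
      then show ?thesis using GW[of c] rest[of c] c by (cases "hasz c") (auto simp: G_def)
    qed
  qed
  also have "\<dots> = \<bar>\<rho> - 1\<bar> * card Sc + card (Xc A \<inter> Sc) + card (Yx \<inter> Sc) + (\<Sum>c\<in>G. m (Wd c))"
  proof -
    have "(\<Sum>c\<in>Sc. if c \<in> G then m (Wd c) else 0) = (\<Sum>c\<in>G. m (Wd c))"
    proof -
      have "Sc \<inter> G = G" by (auto simp: G_def)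
      then show ?thesis using sum.inter_restrict[OF finite_Sc, of "\<lambda>c. m (Wd c)" G] by simp
    qed
    moreover have "(\<Sum>c\<in>Sc. if c \<in> T then 1 else 0) = real (card (T \<inter> Sc))" for T
      using sum.inter_restrict[OF finite_Sc, of "\<lambda>c. 1::real" T] by (simp add: Int_commute)
    ultimately show ?thesis by (simp add: sum.distrib)
  qed
  also have "(\<Sum>c\<in>G. m (Wd c)) \<le> (\<Sum>k\<in>{1, -1} \<times> Bl. (aq (A k) - ap (A k)) + \<bar>af (A k) (aq (A k)) - af (A k) (ap (A k))\<bar> / 2 + 7)"
    unfolding m_def
  proof (rule leftover_sum)
    show "finite G" using finite_Sc by (simp add: G_def)
    show "finite ({1, -1} \<times> Bl)" using finite_card_Bk(1) by (simp add: Bl_def)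
    show "arc_ok (A k)" if "k \<in> {1, -1} \<times> Bl" for k using fam[OF that] by (simp add: arc_for_def)
  qed (use Wsub Whit in auto)
  also have "real (card (Yx \<inter> Sc)) \<le> card Yx" using Yx by (simp add: card_mono)
  finally have fin: "(\<Sum>c\<in>Sc. cc c) \<le> \<bar>\<rho> - 1\<bar> * card Sc + card (Xc A \<inter> Sc) + card Yx
       + (\<Sum>k\<in>{1, -1} \<times> Bl. (aq (A k) - ap (A k)) + \<bar>af (A k) (aq (A k)) - af (A k) (ap (A k))\<bar> / 2 + 7)" by simp
  have "(\<Sum>c\<in>Sc. \<nu> c) = \<rho> * card {c \<in> Sc. \<zeta> c \<in> Ar} - measure lborel Ar"
  proof -
    have "(\<Sum>c\<in>Sc. ind Ar c) = card {c \<in> Sc. \<zeta> c \<in> Ar}"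
      using finite_Sc by (simp add: ind sum.If_cases Int_def)
    then show ?thesis using measure_sum_cells[OF Ar(1) ArOm] unfolding \<nu>_def m_def
      by (simp add: sum_subtractf sum_distrib_left[symmetric])
  qed
  moreover have "(\<Sum>c\<in>Sc. if c \<in> H then mass \<rho> \<zeta> c else 0) = (\<Sum>c\<in>H. mass \<rho> \<zeta> c)"
    using finite_Sc H by (simp add: sum.If_cases Int_absorb1)
  ultimately have "(\<Sum>c\<in>Sc. cc c) = \<rho> * card {c \<in> Sc. \<zeta> c \<in> Ar} - measure lborel Ar - (\<Sum>c\<in>H. mass \<rho> \<zeta> c)"
    by (simp add: cc_def sum_subtractf)
  then show ?thesis using fin by simp
qed

end

section \<open>Counting cells\<close>

lemma card_ints_interval:
  assumes "\<And>i. i \<in> I \<Longrightarrow> a \<le> real_of_int i \<and> real_of_int i \<le> a + l" "0 \<le> l"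
  shows "finite I" "real (card I) \<le> l + 1"
proof -
  have sub: "I \<subseteq> {\<lceil>a\<rceil>..\<lfloor>a + l\<rfloor>}" using assms(1) by (auto simp: ceiling_le_iff le_floor_iff)
  then show "finite I" by (rule finite_subset) simp
  have "card I \<le> card {\<lceil>a\<rceil>..\<lfloor>a + l\<rfloor>}" using sub by (intro card_mono) auto
  also have "\<dots> = nat (\<lfloor>a + l\<rfloor> + 1 - \<lceil>a\<rceil>)" by simp
  finally have "real (card I) \<le> real (nat (\<lfloor>a + l\<rfloor> + 1 - \<lceil>a\<rceil>))" by simp
  moreover have "real_of_int \<lfloor>a + l\<rfloor> \<le> a + l" "a \<le> real_of_int \<lceil>a\<rceil>" by linarith+
  ultimately show "real (card I) \<le> l + 1" using assms(2) by linarith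
qed

text \<open>With signs adapted to the direction, both integer parts increase along the segment.
  Their sum therefore tells the cells apart and takes its values in an interval of length at most
  |\<alpha>| + |\<beta>| + 2.\<close>

lemma card_cells_segment:
  fixes u v \<alpha> \<beta> :: real
  defines "S \<equiv> {c. \<exists>\<tau>\<in>{0..1}. (u + \<tau> * \<alpha>, v + \<tau> * \<beta>) \<in> cell c}"
  shows "finite S" "real (card S) \<le> \<bar>\<alpha>\<bar> + \<bar>\<beta>\<bar> + 3"
proof -
  define p q :: int where "p = (if 0 \<le> \<alpha> then 1 else -1)" "q = (if 0 \<le> \<beta> then 1 else -1)"
  define key where "key c = p * fst c + q * snd c" for c :: "int \<times> int"
  have cellD: "c = (\<lfloor>u + \<tau> * \<alpha>\<rfloor>, \<lfloor>v + \<tau> * \<beta>\<rfloor>)" if "(u + \<tau> * \<alpha>, v + \<tau> * \<beta>) \<in> cell c" for c \<tau>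
    using that by (cases c) (simp add: mem_cell)
  have mono: "p * \<lfloor>u + \<tau> * \<alpha>\<rfloor> \<le> p * \<lfloor>u + \<tau>' * \<alpha>\<rfloor>" "q * \<lfloor>v + \<tau> * \<beta>\<rfloor> \<le> q * \<lfloor>v + \<tau>' * \<beta>\<rfloor>" if "\<tau> \<le> \<tau>'" for \<tau> \<tau>'
    using floor_mono[OF add_left_mono[OF mult_right_mono[OF that, of \<alpha>], of u]]
      floor_mono[OF add_left_mono[OF mult_right_mono_neg[OF that, of \<alpha>], of u]]
      floor_mono[OF add_left_mono[OF mult_right_mono[OF that, of \<beta>], of v]]
      floor_mono[OF add_left_mono[OF mult_right_mono_neg[OF that, of \<beta>], of v]] by (auto simp: p_q_def)
  have pq: "p \<noteq> 0" "q \<noteq> 0" by (auto simp: p_q_def)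
  have inj: "inj_on key S"
  proof (rule inj_onI)
    have *: "c = c'" if "c = (\<lfloor>u + \<tau> * \<alpha>\<rfloor>, \<lfloor>v + \<tau> * \<beta>\<rfloor>)" "c' = (\<lfloor>u + \<tau>' * \<alpha>\<rfloor>, \<lfloor>v + \<tau>' * \<beta>\<rfloor>)" "key c = key c'" "\<tau> \<le> \<tau>'" for c c' \<tau> \<tau>'
    proof -
      have "p * fst c = p * fst c' \<and> q * snd c = q * snd c'" 
      proof -
        have *: "A = A' \<and> B = B'" if "A \<le> A'" "B \<le> B'" "A + B = A' + B'" for A A' B B' :: int using that by linarith
        show ?thesis using *[OF mono[OF that(4)]] that(1-3) by (simp add: key_def)
      qed
      then show ?thesis using pq by (simp add: prod_eq_iff)
    qed
    fix c c' assume "c \<in> S" "c' \<in> S" and e: "key c = key c'"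
    then obtain \<tau> \<tau>' where "c = (\<lfloor>u + \<tau> * \<alpha>\<rfloor>, \<lfloor>v + \<tau> * \<beta>\<rfloor>)" "c' = (\<lfloor>u + \<tau>' * \<alpha>\<rfloor>, \<lfloor>v + \<tau>' * \<beta>\<rfloor>)"
      unfolding S_def using cellD by blast
    then show "c = c'" using *[of c \<tau> c' \<tau>'] *[of c' \<tau>' c \<tau>] e by (cases "\<tau> \<le> \<tau>'") auto
  qed
  define a where "a = real_of_int (p * \<lfloor>u\<rfloor> + q * \<lfloor>v\<rfloor>)"
  define b where "b = real_of_int (p * \<lfloor>u + \<alpha>\<rfloor> + q * \<lfloor>v + \<beta>\<rfloor>)"
  have ba: "b - a \<le> \<bar>\<alpha>\<bar> + \<bar>\<beta>\<bar> + 2" unfolding a_def b_def p_q_def by (cases "0 \<le> \<alpha>"; cases "0 \<le> \<beta>"; simp; linarith)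
  have rng: "a \<le> real_of_int (key c) \<and> real_of_int (key c) \<le> b" if "c \<in> S" for c
  proof -
    obtain \<tau> where t: "0 \<le> \<tau>" "\<tau> \<le> 1" and c: "c = (\<lfloor>u + \<tau> * \<alpha>\<rfloor>, \<lfloor>v + \<tau> * \<beta>\<rfloor>)"
    proof -
      obtain \<tau> where "\<tau> \<in> {0..1}" "(u + \<tau> * \<alpha>, v + \<tau> * \<beta>) \<in> cell c" using \<open>c \<in> S\<close> unfolding S_def by blast
      then show ?thesis using that[of \<tau>] cellD[of \<tau> c] by simp
    qed
    have "p * \<lfloor>u\<rfloor> + q * \<lfloor>v\<rfloor> \<le> key c" "key c \<le> p * \<lfloor>u + \<alpha>\<rfloor> + q * \<lfloor>v + \<beta>\<rfloor>"
      using mono[OF t(1)] mono[OF t(2)] by (simp_all add: c key_def)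
    then show ?thesis unfolding a_def b_def by (simp only: of_int_le_iff)
  qed
  have "0 \<in> {0..1::real}" "(u + 0 * \<alpha>, v + 0 * \<beta>) \<in> cell (\<lfloor>u\<rfloor>, \<lfloor>v\<rfloor>)" by (simp_all add: mem_cell)
  then have "(\<lfloor>u\<rfloor>, \<lfloor>v\<rfloor>) \<in> S" unfolding S_def by blast
  then have "a \<le> b" using rng by force
  then have k: "a \<le> real_of_int i \<and> real_of_int i \<le> a + (b - a)" if "i \<in> key ` S" for i using that rng by auto
  have "finite (key ` S)" "real (card (key ` S)) \<le> (b - a) + 1" using card_ints_interval[OF k] \<open>a \<le> b\<close> by auto
  then show "finite S" "real (card S) \<le> \<bar>\<alpha>\<bar> + \<bar>\<beta>\<bar> + 3"
    using finite_imageD[OF _ inj] card_image[OF inj] ba by auto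
qed

lemma card_cells_box:
  fixes u v a :: real
  assumes "0 \<le> a"
  defines "S \<equiv> {c. \<exists>P\<in>cell c. \<bar>fst P - u\<bar> \<le> a \<and> \<bar>snd P - v\<bar> \<le> a}"
  shows "finite S" "real (card S) \<le> (2 * a + 2)\<^sup>2"
proof -
  define I J where "I = {i::int. (u - a) - 1 \<le> i \<and> i \<le> ((u - a) - 1) + (2 * a + 1)}"
    "J = {i::int. (v - a) - 1 \<le> i \<and> i \<le> ((v - a) - 1) + (2 * a + 1)}"
  have IJ: "finite I" "finite J" "real (card I) \<le> 2 * a + 2" "real (card J) \<le> 2 * a + 2"
    using card_ints_interval[of I "(u - a) - 1" "2 * a + 1"] card_ints_interval[of J "(v - a) - 1" "2 * a + 1"] assms(1)
    by (auto simp: I_J_def)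
  have sub: "S \<subseteq> I \<times> J"
  proof
    fix c assume "c \<in> S"
    then obtain P where "P \<in> cell c" "\<bar>fst P - u\<bar> \<le> a \<and> \<bar>snd P - v\<bar> \<le> a" by (auto simp: S_def)
    then show "c \<in> I \<times> J" by (cases c; cases P) (auto simp: cell_def I_J_def abs_le_iff)
  qed
  then show "finite S" using IJ finite_subset by blast
  have "real (card S) \<le> real (card I) * real (card J)"
    using card_mono[OF _ sub] IJ by (simp add: card_cartesian_product flip: of_nat_mult)
  also have "\<dots> \<le> (2 * a + 2) * (2 * a + 2)" using IJ assms(1) by (intro mult_mono) auto
  finally show "real (card S) \<le> (2 * a + 2)\<^sup>2" by (simp add: power2_eq_square)
qed

context cap_cells
begin

text \<open>\<open>b1\<close>, \<open>b2\<close> are the absolute coordinates of the preimage of e2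
  under Q, and \<open>e1\<close>, \<open>e2\<close> those of the preimage of e1: the lattice
  increments of a vertical and of a horizontal unit step.\<close>

definition "b1 = \<bar>q12\<bar> / \<bar>dtq\<bar>"
definition "b2 = \<bar>q11\<bar> / \<bar>dtq\<bar>"
definition "e1 = \<bar>q22\<bar> / \<bar>dtq\<bar>"
definition "e2 = \<bar>q21\<bar> / \<bar>dtq\<bar>"

lemma be_nonneg: "0 \<le> b1" "0 \<le> b2" "0 \<le> e1" "0 \<le> e2" by (auto simp: b1_def b2_def e1_def e2_def)

lemma cells_vertical:
  fixes a b x0 :: real
  assumes "a \<le> b"
  defines "S \<equiv> {c. \<exists>P\<in>cell c. X P = x0 \<and> a \<le> Y P \<and> Y P \<le> b}"
  shows "finite S" "real (card S) \<le> K * (b1 + b2) * (b - a) + 3"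
proof -
  define \<alpha> \<beta> where "\<alpha> = K * ((- q12 * (b - a)) / dtq)" "\<beta> = K * ((q11 * (b - a)) / dtq)"
  define T where "T = {c. \<exists>\<tau>\<in>{0..1}. (latu K x0 a + \<tau> * \<alpha>, latv K x0 a + \<tau> * \<beta>) \<in> cell c}"
  have lin: "(latu K x0 a + \<tau> * \<alpha>, latv K x0 a + \<tau> * \<beta>) = (latu K x0 (a + \<tau> * (b - a)), latv K x0 (a + \<tau> * (b - a)))" for \<tau>
    using dtq_nz by (simp add: latu_def latv_def \<alpha>_\<beta>_def field_simps)
  have "S \<subseteq> T"
  proof
    fix c assume "c \<in> S"
    then obtain P where P: "P \<in> cell c" "X P = x0" "a \<le> Y P" "Y P \<le> b" by (auto simp: S_def)
    define \<tau> where "\<tau> = (if a = b then 0 else (Y P - a) / (b - a))"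
    have t: "\<tau> \<in> {0..1}" "Y P = a + \<tau> * (b - a)" using P assms by (auto simp: \<tau>_def field_simps)
    have "(latu K x0 a + \<tau> * \<alpha>, latv K x0 a + \<tau> * \<beta>) = P"
      unfolding lin unfolding t(2)[symmetric] P(2)[symmetric] using K_pos by (simp add: lat_sq)
    then show "c \<in> T" unfolding T_def using t P(1) by blast
  qed
  moreover have "finite T" "real (card T) \<le> \<bar>\<alpha>\<bar> + \<bar>\<beta>\<bar> + 3" unfolding T_def by (rule card_cells_segment)+
  moreover have "\<bar>\<alpha>\<bar> + \<bar>\<beta>\<bar> = K * (b1 + b2) * (b - a)"
  proof -
    have "\<bar>\<alpha>\<bar> = K * b1 * (b - a)" "\<bar>\<beta>\<bar> = K * b2 * (b - a)"
      unfolding \<alpha>_\<beta>_def b1_def b2_def abs_mult abs_divide abs_minus_cancel using assms(1) K_pos by simp_all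
    then show ?thesis by (simp add: algebra_simps)
  qed
  ultimately show "finite S" "real (card S) \<le> K * (b1 + b2) * (b - a) + 3"
    using finite_subset card_mono[of T S] by auto
qed

lemma cells_horizontal:
  fixes y0 :: real
  defines "S \<equiv> {c. \<exists>P\<in>cell c. Y P = y0 \<and> 0 \<le> X P \<and> X P \<le> 1}"
  shows "finite S" "real (card S) \<le> K * (e1 + e2) + 3"
proof -
  define \<alpha> \<beta> where "\<alpha> = K * (q22 / dtq)" "\<beta> = K * (- q21 / dtq)"
  define T where "T = {c. \<exists>\<tau>\<in>{0..1}. (latu K 0 y0 + \<tau> * \<alpha>, latv K 0 y0 + \<tau> * \<beta>) \<in> cell c}"
  have lin: "(latu K 0 y0 + \<tau> * \<alpha>, latv K 0 y0 + \<tau> * \<beta>) = (latu K \<tau> y0, latv K \<tau> y0)" for \<tau>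
    using dtq_nz by (simp add: latu_def latv_def \<alpha>_\<beta>_def field_simps)
  have "S \<subseteq> T"
  proof
    fix c assume "c \<in> S"
    then obtain P where P: "P \<in> cell c" "Y P = y0" "0 \<le> X P" "X P \<le> 1" by (auto simp: S_def)
    have "(latu K 0 y0 + X P * \<alpha>, latv K 0 y0 + X P * \<beta>) = P"
      unfolding lin unfolding P(2)[symmetric] using K_pos by (simp add: lat_sq)
    then have "(latu K 0 y0 + X P * \<alpha>, latv K 0 y0 + X P * \<beta>) \<in> cell c" using P(1) by simp
    moreover have "X P \<in> {0..1}" using P by simp
    ultimately show "c \<in> T" unfolding T_def by blast
  qed
  moreover have "finite T" "real (card T) \<le> \<bar>\<alpha>\<bar> + \<bar>\<beta>\<bar> + 3" unfolding T_def by (rule card_cells_segment)+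
  moreover have "\<bar>\<alpha>\<bar> + \<bar>\<beta>\<bar> = K * (e1 + e2)"
    using K_pos dtq_nz by (simp add: \<alpha>_\<beta>_def e1_def e2_def abs_mult abs_divide field_simps)
  ultimately show "finite S" "real (card S) \<le> K * (e1 + e2) + 3"
    using finite_subset card_mono[of T S] by auto
qed

text \<open>On a line parallel to neither lattice axis each coordinate determines the vertex, so the
  shorter of the two projections bounds their number. Such vertices are the only points at which
  certain tiles can reach a vertical edge.\<close>

lemma vertices_vertical:
  fixes x0 :: real
  assumes q: "q11 \<noteq> 0" "q12 \<noteq> 0"
  defines "S \<equiv> {c :: int \<times> int. X (real_of_int (fst c), real_of_int (snd c)) = x0
     \<and> 0 \<le> Y (real_of_int (fst c), real_of_int (snd c)) \<and> Y (real_of_int (fst c), real_of_int (snd c)) \<le> 1}"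
  shows "finite S" "real (card S) \<le> K * min b1 b2 + 1"
proof -
  define pt where "pt c = (real_of_int (fst c), real_of_int (snd c))" for c :: "int \<times> int"
  have S: "S = {c. X (pt c) = x0 \<and> 0 \<le> Y (pt c) \<and> Y (pt c) \<le> 1}" by (simp add: S_def pt_def)
  have lin: "q11 * real_of_int (fst c) + q12 * real_of_int (snd c) = K * x0" if "c \<in> S" for c
    using that K_pos by (auto simp: S pt_def sqx_def field_simps)
  have inj1: "inj_on fst S"
  proof (rule inj_onI)
    fix c c' assume a: "c \<in> S" "c' \<in> S" "fst c = fst c'"
    then have "q12 * real_of_int (snd c) = q12 * real_of_int (snd c')" using lin[OF a(1)] lin[OF a(2)] unfolding a(3) by linarith
    then show "c = c'" using q a(3) by (simp add: prod_eq_iff)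
  qed
  have inj2: "inj_on snd S"
  proof (rule inj_onI)
    fix c c' assume a: "c \<in> S" "c' \<in> S" "snd c = snd c'"
    then have "q11 * real_of_int (fst c) = q11 * real_of_int (fst c')" using lin[OF a(1)] lin[OF a(2)] unfolding a(3) by linarith
    then show "c = c'" using q a(3) by (simp add: prod_eq_iff)
  qed
  have co: "real_of_int (fst c) = latu K x0 (Y (pt c))" "real_of_int (snd c) = latv K x0 (Y (pt c))" if "c \<in> S" for c
    using lat_sq[of K "pt c"] K_pos that by (auto simp: S pt_def)
  define w1 w2 where "w1 = K * (- q12 / dtq)" "w2 = K * (q11 / dtq)"
  have l: "latu K x0 y = latu K x0 0 + w1 * y" "latv K x0 y = latv K x0 0 + w2 * y" for y
    using dtq_nz by (simp_all add: latu_def latv_def w1_w2_def field_simps)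
  have wa: "\<bar>w1\<bar> = K * b1" "\<bar>w2\<bar> = K * b2" using K_pos by (simp_all add: w1_w2_def b1_def b2_def abs_mult abs_divide)
  have rng: "g + min w 0 \<le> g + w * y \<and> g + w * y \<le> g + min w 0 + \<bar>w\<bar>" if "0 \<le> y" "y \<le> 1" for g w y :: real
  proof (cases "0 \<le> w")
    case True then show ?thesis using mult_left_mono[of y 1 w] that by auto
  next
    case False
    then have "w * 1 \<le> w * y" "w * y \<le> w * 0" using that by (auto intro: mult_left_mono_neg mult_nonpos_nonneg)
    then show ?thesis using False by auto
  qed
  have "finite (fst ` S) \<and> real (card (fst ` S)) \<le> K * b1 + 1"
  proof -
    have "latu K x0 0 + min w1 0 \<le> real_of_int i \<and> real_of_int i \<le> latu K x0 0 + min w1 0 + \<bar>w1\<bar>" if i: "i \<in> fst ` S" for i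
    proof -
      obtain c where c: "c \<in> S" "i = fst c" using i by auto
      show ?thesis unfolding c(2) co(1)[OF c(1)] l(1)[of "Y (pt c)"] by (rule rng) (use c in \<open>auto simp: S\<close>)
    qed
    from card_ints_interval[OF this] show ?thesis using be_nonneg K_pos by (simp add: wa)
  qed
  moreover have "finite (snd ` S) \<and> real (card (snd ` S)) \<le> K * b2 + 1"
  proof -
    have "latv K x0 0 + min w2 0 \<le> real_of_int i \<and> real_of_int i \<le> latv K x0 0 + min w2 0 + \<bar>w2\<bar>" if i: "i \<in> snd ` S" for i
    proof -
      obtain c where c: "c \<in> S" "i = snd c" using i by auto
      show ?thesis unfolding c(2) co(2)[OF c(1)] l(2)[of "Y (pt c)"] by (rule rng) (use c in \<open>auto simp: S\<close>)
    qed
    from card_ints_interval[OF this] show ?thesis using be_nonneg K_pos by (simp add: wa)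
  qed
  ultimately show "finite S" "real (card S) \<le> K * min b1 b2 + 1"
    using finite_imageD[OF _ inj1] card_image[OF inj1] card_image[OF inj2] by (auto simp: min_def)
qed

definition "C1 = (e1 + b1 + b2 + e2) * C0"
text \<open>26 exceptional points, each with a box of nearby cells; 212 cells with break points; 34
  end cells for each of at most 212 arcs. The last two add up to 7420.\<close>

definition "Cx = 26 * (2 * C1 + 2)\<^sup>2 + 7420"

lemma C1_nonneg: "0 \<le> C1" using be_nonneg mxy_nonneg by (auto simp: C1_def C0_def)

lemma finite_card_SP: "finite SP" "card SP \<le> 26"
proof -
  define Z where "Z = {y \<in> {0..1}. sqF 0 y = 0}"
  define G where "G = (\<lambda>(k::int, h). (\<phi> / (2 * pi) + real_of_int k / 2, (1 - h) / 2)) ` ({-4..4} \<times> {hmin, hmax})"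
  have Z: "finite Z" "card Z \<le> 2" using meridian_zeros by (auto simp: Z_def)
  have SP: "SP = ({0, 1} \<times> Z) \<union> ({0, 1} \<times> {0, 1}) \<union> G" by (simp add: SP_def Z_def G_def)
  have G: "finite G" "card G \<le> 18"
  proof -
    have "card ({-4..4::int} \<times> {hmin, hmax}) = 18" using hmin_less_hmax by (simp add: card_cartesian_product)
    moreover have "finite ({-4..4::int} \<times> {hmin, hmax})" by simp
    ultimately show "finite G" "card G \<le> 18" unfolding G_def by (auto intro: order.trans[OF card_image_le])
  qed
  show "finite SP" using Z G by (simp add: SP)
  have "card SP \<le> card ({0, 1 :: real} \<times> Z) + card ({0, 1 :: real} \<times> {0, 1 :: real}) + card G"
    unfolding SP by (intro order.trans[OF card_Un_le] add_mono card_Un_le order_refl)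
  also have "\<dots> \<le> 2 * 2 + 4 + 18" using Z G by (intro add_mono) (auto simp: card_cartesian_product)
  finally show "card SP \<le> 26" by simp
qed

lemma near_count: "finite {c. near c}" "real (card {c. near c}) \<le> 26 * (2 * C1 + 2)\<^sup>2"
proof -
  define S where "S p = {c. \<exists>P\<in>cell c. \<bar>fst P - latu K (fst p) (snd p)\<bar> \<le> C1 \<and> \<bar>snd P - latv K (fst p) (snd p)\<bar> \<le> C1}" for p
  have S: "finite (S p)" "real (card (S p)) \<le> (2 * C1 + 2)\<^sup>2" for p
    unfolding S_def by (rule card_cells_box[OF C1_nonneg])+
  have sub: "{c. near c} \<subseteq> (\<Union>p\<in>SP. S p)"
  proof
    fix c assume "c \<in> {c. near c}"
    then obtain p P where p: "p \<in> SP" "P \<in> cell c" "\<bar>X P - fst p\<bar> \<le> C0 / K" "\<bar>Y P - snd p\<bar> \<le> C0 / K" by (auto simp: near_def)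
    define x y where "x = X P - fst p" "y = Y P - snd p"
    have xy: "K * \<bar>x\<bar> \<le> C0" "K * \<bar>y\<bar> \<le> C0" using p(3,4) K_pos by (auto simp: x_y_def field_simps)
    have "fst P - latu K (fst p) (snd p) = latu K (X P) (Y P) - latu K (fst p) (snd p)"
      "snd P - latv K (fst p) (snd p) = latv K (X P) (Y P) - latv K (fst p) (snd p)" using K_pos by (simp_all add: lat_sq)
    moreover have "latu K (X P) (Y P) - latu K (fst p) (snd p) = K * ((q22 * x - q12 * y) / dtq)"
      unfolding x_y_def latu_def by (simp add: algebra_simps diff_divide_distrib add_divide_distrib)
    moreover have "latv K (X P) (Y P) - latv K (fst p) (snd p) = K * ((q11 * y - q21 * x) / dtq)"
      unfolding x_y_def latv_def by (simp add: algebra_simps diff_divide_distrib add_divide_distrib)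
    ultimately have e: "fst P - latu K (fst p) (snd p) = (q22 / dtq) * (K * x) - (q12 / dtq) * (K * y)"
      "snd P - latv K (fst p) (snd p) = (q11 / dtq) * (K * y) - (q21 / dtq) * (K * x)"
      by (simp_all add: diff_divide_distrib right_diff_distrib mult_ac)
    have tri: "\<bar>A * a - B * b\<bar> \<le> \<bar>A\<bar> * \<bar>a\<bar> + \<bar>B\<bar> * \<bar>b\<bar>" for A a B b :: real by (metis abs_triangle_ineq4 abs_mult)
    have x: "\<bar>K * x\<bar> \<le> C0" "\<bar>K * y\<bar> \<le> C0" using xy K_pos by (auto simp: abs_mult)
    have "\<bar>fst P - latu K (fst p) (snd p)\<bar> \<le> e1 * C0 + b1 * C0" "\<bar>snd P - latv K (fst p) (snd p)\<bar> \<le> b2 * C0 + e2 * C0"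
      unfolding e by (rule order.trans[OF tri], intro add_mono mult_mono x; simp add: e1_def b1_def b2_def e2_def abs_divide)+
    moreover have "0 \<le> e1 * C0" "0 \<le> e2 * C0" "0 \<le> b1 * C0" "0 \<le> b2 * C0" using be_nonneg mxy_nonneg by (auto simp: C0_def)
    ultimately have "c \<in> S p" using p(2) unfolding S_def C1_def by (auto simp: algebra_simps intro!: bexI[of _ P])
    then show "c \<in> (\<Union>p\<in>SP. S p)" using p(1) by auto
  qed
  have fin: "finite (\<Union>p\<in>SP. S p)" using finite_card_SP S by auto
  then show "finite {c. near c}" using sub finite_subset by blast
  have "real (card {c. near c}) \<le> card (\<Union>p\<in>SP. S p)" using card_mono[OF fin sub] by simp
  also have "\<dots> \<le> (\<Sum>p\<in>SP. real (card (S p)))" using card_UN_le[OF finite_card_SP(1), of S] by (simp flip: of_nat_sum)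
  also have "\<dots> \<le> card SP * (2 * C1 + 2)\<^sup>2" using S(2) by (rule sum_bounded_above)
  also have "\<dots> \<le> 26 * (2 * C1 + 2)\<^sup>2" using finite_card_SP(2) by (intro mult_right_mono) auto
  finally show "real (card {c. near c}) \<le> 26 * (2 * C1 + 2)\<^sup>2" .
qed

text \<open>A height and a choice of branch determine the point of the curve in the square, its
  longitude being reduced modulo 1, and hence its cell.\<close>

lemma break_count:
  defines "S \<equiv> {c. \<exists>P\<in>cell c \<inter> Om. F P = 0 \<and> 1 - 2 * Y P \<in> Bk}"
  shows "finite S" "card S \<le> 212"
proof -
  define g where "g = (\<lambda>(\<sigma>, h). (\<lfloor>latu K (frac (xraw \<sigma> h)) ((1 - h) / 2)\<rfloor>, \<lfloor>latv K (frac (xraw \<sigma> h)) ((1 - h) / 2)\<rfloor>))"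
  have sub: "S \<subseteq> g ` ({1, -1} \<times> Bk)"
  proof
    fix c assume "c \<in> S"
    then obtain P where P: "P \<in> cell c" "P \<in> Om" "F P = 0" "1 - 2 * Y P \<in> Bk" by (auto simp: S_def)
    have y: "0 < Y P" "Y P < 1" "0 \<le> X P" "X P < 1" using P(2) by (auto simp: Om_def)
    obtain \<sigma> n where s: "\<sigma> = 1 \<or> \<sigma> = -1" "X P = xraw \<sigma> (1 - 2 * Y P) + of_int n"
      using zero_repr[of "X P" "Y P"] P(3) y by (auto simp: FK_def)
    have "frac (xraw \<sigma> (1 - 2 * Y P)) = frac (X P)" using s(2) by (simp add: frac_def)
    also have "\<dots> = X P" using y by (simp add: frac_eq)
    finally have "g (\<sigma>, 1 - 2 * Y P) = (\<lfloor>fst P\<rfloor>, \<lfloor>snd P\<rfloor>)" using K_pos by (simp add: g_def lat_sq)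
    also have "\<dots> = c" using P(1) by (cases P; cases c) (simp add: mem_cell)
    finally show "c \<in> g ` ({1, -1} \<times> Bk)" using s(1) P(4) by force
  qed
  have fin: "finite ({1, -1 :: real} \<times> Bk)" using finite_card_Bk by simp
  show "finite S" using sub fin finite_subset by blast
  have "card S \<le> card (g ` ({1, -1 :: real} \<times> Bk))" using sub fin by (intro card_mono) auto
  also have "\<dots> \<le> card ({1, -1 :: real} \<times> Bk)" using fin by (rule card_image_le)
  also have "\<dots> \<le> 212" using finite_card_Bk by (simp add: card_cartesian_product)
  finally show "card S \<le> 212" .
qed

lemma card_arcs: "finite ({1, -1 :: real} \<times> Bl)" "card ({1, -1 :: real} \<times> Bl) \<le> 212"
proof -
  have "finite Bl" "card Bl \<le> 106" using finite_card_Bk card_mono[of Bk Bl] by (auto simp: Bl_def)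
  then show "finite ({1, -1 :: real} \<times> Bl)" "card ({1, -1 :: real} \<times> Bl) \<le> 212" by (auto simp: card_cartesian_product)
qed

lemma Xc_count:
  assumes fam: "\<And>k. k \<in> {1, -1} \<times> Bl \<Longrightarrow> arc_for K (fst k) (snd k) (A k)"
  shows "real (card (Xc A \<inter> Sc)) \<le> Cx"
proof -
  define E where "E = (\<lambda>k. {c. arc_pts (A k) \<inter> cell c \<noteq> {} \<and> \<not> arc_full (A k) c})"
  have E: "finite (E k)" "card (E k) \<le> 34" if "k \<in> {1, -1} \<times> Bl" for k
    using arc_end_cells[of "A k"] fam[OF that] by (auto simp: E_def arc_for_def)
  define U where "U = (\<Union>k\<in>{1, -1} \<times> Bl. E k)"
  have "card U \<le> (\<Sum>k\<in>{1, -1} \<times> Bl. card (E k))" unfolding U_def by (rule card_UN_le[OF card_arcs(1)])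
  also have "\<dots> \<le> (\<Sum>k\<in>{1, -1 :: real} \<times> Bl. 34)" by (intro sum_mono E(2))
  also have "\<dots> = 34 * card ({1, -1 :: real} \<times> Bl)" by simp
  also have "\<dots> \<le> 34 * 212" using card_arcs(2) by (intro mult_left_mono) auto
  finally have U: "card U \<le> 7208" "finite U" using E(1) card_arcs(1) by (auto simp: U_def)
  define T where "T = {c. \<exists>P\<in>cell c \<inter> Om. F P = 0 \<and> 1 - 2 * Y P \<in> Bk}"
  have T: "finite T" "card T \<le> 212" unfolding T_def by (rule break_count)+
  have X: "Xc A = {c. near c} \<union> T \<union> U" by (simp add: Xc_def T_def U_def E_def)
  have "card (Xc A \<inter> Sc) \<le> card ({c. near c} \<union> T \<union> U)" using near_count T U by (intro card_mono) (auto simp: X)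
  also have "\<dots> \<le> card {c. near c} + card T + card U"
    by (intro order.trans[OF card_Un_le] add_mono card_Un_le order_refl)
  finally have "real (card (Xc A \<inter> Sc)) \<le> real (card {c. near c}) + 7420" using T U by linarith
  then show ?thesis using near_count(2) by (simp add: Cx_def)
qed

text \<open>The cost run + rise / 2 of a unit displacement in x (\<open>N1\<close>) and in y
  (\<open>N2\<close>, twice used), over whichever lattice axis is worse.\<close>

definition "N1 = max (e1 + e2 / 2) (e2 + e1 / 2)"
definition "N2 = max (b1 + b2 / 2) (b2 + b1 / 2)"

text \<open>Each increment is split into its x and y parts. On either branch the longitude varies by
  at most half a turn and y by at most 1, which gives \<open>N1\<close> once and \<open>N2\<close>
  twice; 1484 is 7 for each of 212 arcs.\<close>

lemma arcs_sum:
  assumes fam: "\<And>k. k \<in> {1, -1} \<times> Bl \<Longrightarrow> arc_for K (fst k) (snd k) (A k)"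
  shows "(\<Sum>k\<in>{1, -1} \<times> Bl. (aq (A k) - ap (A k)) + \<bar>af (A k) (aq (A k)) - af (A k) (ap (A k))\<bar> / 2 + 7)
     \<le> K * (2 * N2 + N1) + 1484"
proof -
  define \<Delta> where "\<Delta> b = \<bar>ang (nxt b) - ang b\<bar> / (2 * pi)" for b
  define g where "g b = (nxt b - b) / 2" for b
  have bound: "(aq (A k) - ap (A k)) + \<bar>af (A k) (aq (A k)) - af (A k) (ap (A k))\<bar> / 2 \<le> K * (N1 * \<Delta> (snd k) + N2 * g (snd k))"
    if k: "k \<in> {1, -1} \<times> Bl" for k
  proof -
    obtain \<sigma> b where kb: "k = (\<sigma>, b)" "\<sigma> = 1 \<or> \<sigma> = -1" "b \<in> Bl" using k by auto
    define x where "x = xc \<sigma> b (nxt b) - xc \<sigma> b b"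
    have dxx: "\<bar>x\<bar> = \<Delta> b"
    proof -
      have "x = \<sigma> * (ang (nxt b) - ang b) / (2 * pi)" by (simp add: x_def xc_affine diff_divide_distrib right_diff_distrib)
      then show ?thesis using kb(2) by (auto simp: \<Delta>_def abs_mult abs_minus_commute)
    qed
    have gb: "0 \<le> g b" using nxt(1)[OF kb(3)] by (simp add: g_def)
    have ch: "chu \<sigma> b = (q22 / dtq) * x - (q12 / dtq) * (- g b)" "chv \<sigma> b = (q11 / dtq) * (- g b) - (q21 / dtq) * x"
      using dtq_nz by (simp_all add: chu_def chv_def latu_def latv_def x_def g_def field_simps)
    have tri: "\<bar>A * a - B * b\<bar> \<le> \<bar>A\<bar> * \<bar>a\<bar> + \<bar>B\<bar> * \<bar>b\<bar>" for A a B b :: real by (metis abs_triangle_ineq4 abs_mult)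
    have cu: "\<bar>chu \<sigma> b\<bar> \<le> e1 * \<Delta> b + b1 * g b" "\<bar>chv \<sigma> b\<bar> \<le> b2 * g b + e2 * \<Delta> b"
      unfolding ch by (rule order.trans[OF tri], simp add: dxx gb e1_def b1_def b2_def e2_def abs_divide)+
    have D0: "0 \<le> \<Delta> b" by (simp add: \<Delta>_def)
    have n: "(e1 + e2 / 2) * \<Delta> b \<le> N1 * \<Delta> b" "(e2 + e1 / 2) * \<Delta> b \<le> N1 * \<Delta> b" "(b1 + b2 / 2) * g b \<le> N2 * g b" "(b2 + b1 / 2) * g b \<le> N2 * g b"
      using D0 gb by (auto simp: N1_def N2_def intro!: mult_right_mono)
    have "\<bar>chu \<sigma> b\<bar> + \<bar>chv \<sigma> b\<bar> / 2 \<le> (e1 + e2 / 2) * \<Delta> b + (b1 + b2 / 2) * g b"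
      "\<bar>chv \<sigma> b\<bar> + \<bar>chu \<sigma> b\<bar> / 2 \<le> (e2 + e1 / 2) * \<Delta> b + (b2 + b1 / 2) * g b" using cu by (simp_all add: algebra_simps)
    then have "\<bar>chu \<sigma> b\<bar> + \<bar>chv \<sigma> b\<bar> / 2 \<le> N1 * \<Delta> b + N2 * g b" "\<bar>chv \<sigma> b\<bar> + \<bar>chu \<sigma> b\<bar> / 2 \<le> N1 * \<Delta> b + N2 * g b" using n by linarith+
    then have "K * (\<bar>chu \<sigma> b\<bar> + \<bar>chv \<sigma> b\<bar> / 2) \<le> K * (N1 * \<Delta> b + N2 * g b)" "K * (\<bar>chv \<sigma> b\<bar> + \<bar>chu \<sigma> b\<bar> / 2) \<le> K * (N1 * \<Delta> b + N2 * g b)"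
      using K_pos by (auto intro: mult_left_mono)
    then show ?thesis using fam[OF k] unfolding kb(1) arc_for_def by (auto simp: distrib_left)
  qed
  have "(\<Sum>k\<in>{1, -1} \<times> Bl. (aq (A k) - ap (A k)) + \<bar>af (A k) (aq (A k)) - af (A k) (ap (A k))\<bar> / 2 + 7)
      \<le> (\<Sum>k\<in>{1, -1 :: real} \<times> Bl. K * (N1 * \<Delta> (snd k) + N2 * g (snd k)) + 7)"
    using bound by (intro sum_mono add_right_mono) auto
  also have "\<dots> = (\<Sum>k\<in>{1, -1 :: real} \<times> Bl. K * (N1 * \<Delta> (snd k) + N2 * g (snd k))) + 7 * card ({1, -1 :: real} \<times> Bl)"
    by (simp add: sum.distrib)
  also have "(\<Sum>k\<in>{1, -1 :: real} \<times> Bl. K * (N1 * \<Delta> (snd k) + N2 * g (snd k))) = 2 * (\<Sum>b\<in>Bl. K * (N1 * \<Delta> b + N2 * g b))"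
    using sum.cartesian_product[of "\<lambda>_ b. K * (N1 * \<Delta> b + N2 * g b)" Bl "{1, -1 :: real}", symmetric] by (simp add: case_prod_beta)
  also have "(\<Sum>b\<in>Bl. K * (N1 * \<Delta> b + N2 * g b)) = K * (N1 * (\<Sum>b\<in>Bl. \<Delta> b) + N2 * (\<Sum>b\<in>Bl. g b))"
    by (simp only: sum_distrib_left sum.distrib distrib_left)
  also have "(\<Sum>b\<in>Bl. g b) = (hmax - hmin) / 2" unfolding g_def variation_sum(2)[symmetric] by (simp add: sum_divide_distrib)
  also have "(\<Sum>b\<in>Bl. \<Delta> b) = (\<Sum>b\<in>Bl. \<bar>ang (nxt b) - ang b\<bar>) / (2 * pi)" unfolding \<Delta>_def by (simp add: sum_divide_distrib)
  finally have *: "(\<Sum>k\<in>{1, -1} \<times> Bl. (aq (A k) - ap (A k)) + \<bar>af (A k) (aq (A k)) - af (A k) (ap (A k))\<bar> / 2 + 7)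
      \<le> 2 * (K * (N1 * ((\<Sum>b\<in>Bl. \<bar>ang (nxt b) - ang b\<bar>) / (2 * pi)) + N2 * ((hmax - hmin) / 2))) + 7 * card ({1, -1 :: real} \<times> Bl)" .
  have NN: "0 \<le> N1" "0 \<le> N2" using be_nonneg by (auto simp: N1_def N2_def le_max_iff_disj)
  have "(\<Sum>b\<in>Bl. \<bar>ang (nxt b) - ang b\<bar>) / (2 * pi) \<le> pi / (2 * pi)" using variation_sum(1) by (intro divide_right_mono) auto
  then have "N1 * ((\<Sum>b\<in>Bl. \<bar>ang (nxt b) - ang b\<bar>) / (2 * pi)) \<le> N1 * (1 / 2)" using NN by (intro mult_left_mono) auto
  moreover have "N2 * ((hmax - hmin) / 2) \<le> N2 * 1" using hmax_less hmin_gr NN by (intro mult_left_mono) auto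
  ultimately have "K * (N1 * ((\<Sum>b\<in>Bl. \<bar>ang (nxt b) - ang b\<bar>) / (2 * pi)) + N2 * ((hmax - hmin) / 2)) \<le> K * (N1 * (1 / 2) + N2 * 1)"
    using K_pos by (intro mult_left_mono) auto
  moreover have "7 * real (card ({1, -1 :: real} \<times> Bl)) \<le> 1484" using card_arcs(2) by linarith
  moreover have "2 * (K * (N1 * (1 / 2) + N2 * 1)) = K * (2 * N2 + N1)" by (simp add: algebra_simps)
  ultimately show ?thesis using * by linarith
qed

end

section \<open>Cells along the edge of the square\<close>

text \<open>The interval runs from the infimum to the supremum of the points with g > 0. A dip below
  0 in between would produce two zeros, and the negative end a third one.\<close>

lemma two_zeros_interval:
  fixes g :: "real \<Rightarrow> real"
  assumes g: "continuous_on {0..1} g" and fin: "finite {y \<in> {0..1}. g y = 0}" and cd: "card {y \<in> {0..1}. g y = 0} \<le> 2"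
    and ends: "g 0 < 0 \<or> g 1 < 0"
  obtains "\<And>y. 0 \<le> y \<Longrightarrow> y \<le> 1 \<Longrightarrow> g y \<le> 0"
  | a b where "0 \<le> a" "a < b" "b \<le> 1" "\<And>y. a \<le> y \<Longrightarrow> y \<le> b \<Longrightarrow> 0 \<le> g y"
      "\<And>y. 0 \<le> y \<Longrightarrow> y < a \<Longrightarrow> g y \<le> 0" "\<And>y. b < y \<Longrightarrow> y \<le> 1 \<Longrightarrow> g y \<le> 0"
      "0 < a \<Longrightarrow> g a \<le> 0" "b < 1 \<Longrightarrow> g b \<le> 0"
proof -
  define W where "W = {y \<in> {0..1}. 0 < g y}"
  have cg: "continuous_on {x..y} g" if "0 \<le> x" "y \<le> 1" for x y
    using continuous_on_subset[OF g] that by auto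
  have zero: "\<exists>z>x. z < y \<and> g z = 0" if "0 \<le> x" "x \<le> y" "y \<le> 1" "g x < 0 \<and> 0 < g y \<or> 0 < g x \<and> g y < 0" for x y
  proof -
    have "\<exists>z\<ge>x. z \<le> y \<and> g z = 0" using IVT'[of g x 0 y] IVT2'[of g y 0 x] cg[of x y] that by auto
    then obtain z where "x \<le> z" "z \<le> y" "g z = 0" by blast
    moreover from this have "z \<noteq> x" "z \<noteq> y" using that(4) by auto
    ultimately show ?thesis by (intro exI[of _ z]) auto
  qed
  have three: False if "0 \<le> z1" "z1 < z2" "z2 < z3" "z3 \<le> 1" "g z1 = 0" "g z2 = 0" "g z3 = 0" for z1 z2 z3
  proof -
    have "card {z1, z2, z3} \<le> card {y \<in> {0..1}. g y = 0}" using that fin by (intro card_mono) auto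
    then show False using cd that by simp
  qed
  show ?thesis
  proof (cases "W = {}")
    case True
    have "g y \<le> 0" if "0 \<le> y" "y \<le> 1" for y
    proof (rule ccontr)
      assume "\<not> g y \<le> 0" then have "y \<in> W" using that by (simp add: W_def) then show False using True by simp
    qed
    then show ?thesis by (rule that(1))
  next
    case False
    then obtain p where p: "p \<in> W" by auto
    define a b where "a = Inf W" "b = Sup W"
    have bw: "bdd_below W" "bdd_above W" by (auto simp: W_def bdd_below_def bdd_above_def)
    have ab: "a \<le> y" "y \<le> b" if "y \<in> W" for y using that bw by (auto simp: a_b_def cInf_lower cSup_upper)
    have cl: "a \<in> closure W" "b \<in> closure W" unfolding a_b_def using False bw by (auto intro: closure_contains_Inf closure_contains_Sup)
    have clW: "closure W \<subseteq> {y \<in> {0..1}. 0 \<le> g y}"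
    proof (rule closure_minimal)
      have "closed ({0..1} \<inter> g -` {0..})" using g by (intro continuous_closed_preimage) auto
      moreover have "{0..1} \<inter> g -` {0..} = {y \<in> {0..1}. 0 \<le> g y}" by auto
      ultimately show "closed {y \<in> {0..1}. 0 \<le> g y}" by simp
    qed (auto simp: W_def)
    then have e: "0 \<le> a" "b \<le> 1" "0 \<le> g a" "0 \<le> g b" "a \<le> 1" "0 \<le> b" using cl by auto
    have p01: "0 \<le> p" "p \<le> 1" "0 < g p" using p by (auto simp: W_def)
    obtain q where q: "q \<in> W" "q \<noteq> p"
    proof (cases "g 0 < 0")
      case True
      then obtain q where "0 \<le> q" "q \<le> p" "g q = g p / 2" using IVT'[of g 0 "g p / 2" p] cg[of 0 p] p01 by auto
      then show ?thesis using that[of q] p01 by (cases "q = p") (auto simp: W_def)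
    next
      case False
      then have "g 1 < 0" using ends by simp
      then obtain q where "p \<le> q" "q \<le> 1" "g q = g p / 2" using IVT2'[of g 1 "g p / 2" p] cg[of p 1] p01 by auto
      then show ?thesis using that[of q] p01 by (cases "q = p") (auto simp: W_def)
    qed
    have lt: "a < b" using ab[OF p] ab[OF q(1)] q(2) by (cases p q rule: linorder_cases) auto
    have inner: "0 \<le> g y" if y: "a \<le> y" "y \<le> b" for y
    proof (rule ccontr)
      assume "\<not> 0 \<le> g y"
      then have gy: "g y < 0" by simp
      then have ay: "a < y" "y < b" using e y by (auto simp: less_le)
      obtain u where u: "u \<in> W" "u < y" using ay(1) False bw unfolding a_b_def by (auto simp: cInf_less_iff)
      obtain v where v: "v \<in> W" "y < v" using ay(2) False bw unfolding a_b_def by (auto simp: less_cSup_iff)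
      have uv: "0 \<le> u" "v \<le> 1" "0 < g u" "0 < g v" using u v by (auto simp: W_def)
      obtain z1 where z1: "u < z1" "z1 < y" "g z1 = 0" using zero[of u y] u v uv gy by auto
      obtain z2 where z2: "y < z2" "z2 < v" "g z2 = 0" using zero[of y v] u v uv gy by auto
      show False
      proof (cases "g 0 < 0")
        case True
        then obtain z0 where "0 < z0" "z0 < u" "g z0 = 0" using zero[of 0 u] u v uv by auto
        then show False using three[of z0 z1 z2] z1 z2 uv by auto
      next
        case False
        then obtain z0 where "v < z0" "z0 < 1" "g z0 = 0" using ends zero[of v 1] u v uv by auto
        then show False using three[of z1 z2 z0] z1 z2 uv by auto
      qed
    qed
    have o1: "g y \<le> 0" if "0 \<le> y" "y < a" for y
    proof (rule ccontr)
      assume "\<not> g y \<le> 0" then have "y \<in> W" using that e by (simp add: W_def) then show False using ab(1)[of y] that by simp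
    qed
    have o2: "g y \<le> 0" if "b < y" "y \<le> 1" for y
    proof (rule ccontr)
      assume "\<not> g y \<le> 0" then have "y \<in> W" using that e by (simp add: W_def) then show False using ab(2)[of y] that by simp
    qed
    have o3: "g a \<le> 0" if "0 < a"
    proof (rule ccontr)
      assume n: "\<not> g a \<le> 0"
      have "g 0 \<le> 0" using o1[of 0] that by simp
      then obtain q where "0 \<le> q" "q \<le> a" "g q = g a / 2" using IVT'[of g 0 "g a / 2" a] cg[of 0 a] n that e by auto
      then show False using ab(1)[of q] n e by (cases "q = a") (auto simp: W_def)
    qed
    have o4: "g b \<le> 0" if "b < 1"
    proof (rule ccontr)
      assume n: "\<not> g b \<le> 0"
      have "g 1 \<le> 0" using o2[of 1] that by simp
      then obtain q where "b \<le> q" "q \<le> 1" "g q = g b / 2" using IVT2'[of g 1 "g b / 2" b] cg[of b 1] n that e by auto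
      then show False using ab(2)[of q] n e by (cases "q = b") (auto simp: W_def)
    qed
    show ?thesis using that(2)[OF e(1) lt e(2) inner o1 o2 o3 o4] .
  qed
qed

text \<open>At any point of a half-open cell other than its lower left corner, at least one
  coordinate can be moved both ways, so a functional with two nonzero coefficients can be increased.
  \<open>cell_to_icell\<close> then moves the point into the interior.\<close>

lemma corner_move:
  fixes L :: "real \<times> real \<Rightarrow> real"
  assumes L: "\<And>P. L P = \<alpha> * fst P + \<beta> * snd P" "\<alpha> \<noteq> 0" "\<beta> \<noteq> 0"
    and P: "P \<in> cell c" "P \<noteq> (real_of_int (fst c), real_of_int (snd c))" and U: "open U" "P \<in> U"
  shows "\<exists>R\<in>icell c \<inter> U. L P < L R"
proof -
  obtain d where d: "\<forall>\<^sub>F \<tau> in at_right 0. P + \<tau> *\<^sub>R d \<in> cell c" "0 < \<alpha> * fst d + \<beta> * snd d"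
  proof (cases "real_of_int (fst c) < fst P")
    case True
    have "\<forall>\<^sub>F \<tau> in at_right 0. P + \<tau> *\<^sub>R (sgn \<alpha>, 0) \<in> cell c"
    proof -
      have "((\<lambda>\<tau>. fst P + \<tau> * sgn \<alpha>) \<longlongrightarrow> fst P + 0 * sgn \<alpha>) (at_right 0)" by (intro tendsto_intros)
      then have t: "((\<lambda>\<tau>. fst P + \<tau> * sgn \<alpha>) \<longlongrightarrow> fst P) (at_right 0)" by simp
      have "fst P < real_of_int (fst c) + 1" using P(1) by (auto simp: cell_def)
      from order_tendstoD(1)[OF t True] order_tendstoD(2)[OF t this] show ?thesis
        by eventually_elim (use P(1) in \<open>cases P, auto simp: cell_def\<close>)
    qed
    moreover have "0 < \<alpha> * fst (sgn \<alpha>, 0::real) + \<beta> * snd (sgn \<alpha>, 0::real)" using L(2) by (auto simp: sgn_if)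
    ultimately show ?thesis by (rule that)
  next
    case False
    then have s: "real_of_int (snd c) < snd P" using P by (cases P) (auto simp: cell_def)
    have "\<forall>\<^sub>F \<tau> in at_right 0. P + \<tau> *\<^sub>R (0, sgn \<beta>) \<in> cell c"
    proof -
      have "((\<lambda>\<tau>. snd P + \<tau> * sgn \<beta>) \<longlongrightarrow> snd P + 0 * sgn \<beta>) (at_right 0)" by (intro tendsto_intros)
      then have t: "((\<lambda>\<tau>. snd P + \<tau> * sgn \<beta>) \<longlongrightarrow> snd P) (at_right 0)" by simp
      have "snd P < real_of_int (snd c) + 1" using P(1) by (auto simp: cell_def)
      from order_tendstoD(1)[OF t s] order_tendstoD(2)[OF t this] show ?thesis
        by eventually_elim (use P(1) in \<open>cases P, auto simp: cell_def\<close>)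
    qed
    moreover have "0 < \<alpha> * fst (0::real, sgn \<beta>) + \<beta> * snd (0::real, sgn \<beta>)" using L(3) by (auto simp: sgn_if)
    ultimately show ?thesis by (rule that)
  qed
  have "((\<lambda>\<tau>. P + \<tau> *\<^sub>R d) \<longlongrightarrow> P + 0 *\<^sub>R d) (at_right 0)" by (intro tendsto_intros)
  then have "((\<lambda>\<tau>. P + \<tau> *\<^sub>R d) \<longlongrightarrow> P) (at_right 0)" by simp
  then have "\<forall>\<^sub>F \<tau> in at_right 0. P + \<tau> *\<^sub>R d \<in> U" using U by (rule topological_tendstoD)
  moreover have "\<forall>\<^sub>F \<tau> in at_right 0. 0 < (\<tau>::real)" by (simp add: eventually_at_right_less)
  ultimately have "\<forall>\<^sub>F \<tau> in at_right 0. P + \<tau> *\<^sub>R d \<in> cell c \<and> P + \<tau> *\<^sub>R d \<in> U \<and> 0 < \<tau>" using d(1) by eventually_elim auto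
  then obtain \<tau> where t: "P + \<tau> *\<^sub>R d \<in> cell c" "P + \<tau> *\<^sub>R d \<in> U" "0 < \<tau>"
    using eventually_happens trivial_limit_at_right_real by blast
  have "L (P + \<tau> *\<^sub>R d) = L P + \<tau> * (\<alpha> * fst d + \<beta> * snd d)" by (simp add: L(1) algebra_simps)
  then have gt: "L P < L (P + \<tau> *\<^sub>R d)" using t(3) d(2) by simp
  have "continuous_on UNIV L" unfolding L(1)[abs_def] by (intro continuous_intros)
  then have "open {R. L P < L R}" by (intro open_Collect_less continuous_on_const)
  then have "open (U \<inter> {R. L P < L R})" using U(1) by blast
  from cell_to_icell[OF t(1) this] show ?thesis using t(2) gt by blast
qed

context cap_cells
begin

definition "AdL E = {c. \<exists>b\<in>icell c \<inter> bd. Y b \<in> E}"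
definition "Vc x0 a b = {c. \<exists>P\<in>cell c. X P = x0 \<and> a \<le> Y P \<and> Y P \<le> (b::real)}"
definition "Hc y0 = {c. \<exists>P\<in>cell c. Y P = y0 \<and> 0 \<le> X P \<and> X P \<le> 1}"

lemma touch_osq:
  assumes "b \<in> icell c" "b \<in> bd"
  shows "icell c \<inter> osq \<noteq> {}"
proof -
  define M where "M = (latu K (1/2) (1/2), latv K (1/2) (1/2))"
  have M: "X M = 1/2" "Y M = 1/2" using K_pos by (simp_all add: M_def sq_lat)
  define \<gamma> where "\<gamma> \<tau> = (1 - \<tau>) *\<^sub>R b + \<tau> *\<^sub>R M" for \<tau> :: real
  have "(\<gamma> \<longlongrightarrow> (1 - 0) *\<^sub>R b + 0 *\<^sub>R M) (at_right 0)" unfolding \<gamma>_def by (intro tendsto_intros)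
  then have lim: "(\<gamma> \<longlongrightarrow> b) (at_right 0)" by simp
  then have ev1: "\<forall>\<^sub>F \<tau> in at_right 0. \<gamma> \<tau> \<in> icell c" using open_icell assms(1) by (metis topological_tendstoD)
  moreover have "\<forall>\<^sub>F \<tau> in at_right 0. 0 < \<tau> \<and> \<tau> < (1::real)"
    by (auto simp: eventually_at_right_field intro!: exI[of _ 1])
  ultimately have "\<forall>\<^sub>F \<tau> in at_right 0. \<gamma> \<tau> \<in> icell c \<and> 0 < \<tau> \<and> \<tau> < 1" by eventually_elim auto
  then obtain \<tau> where t: "\<gamma> \<tau> \<in> icell c" "0 < \<tau>" "\<tau> < 1" using eventually_happens trivial_limit_at_right_real by blast
  have lin: "0 < (1 - \<tau>) * p + \<tau> * (1/2) \<and> (1 - \<tau>) * p + \<tau> * (1/2) < 1" if "0 \<le> p" "p \<le> 1" for p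
  proof -
    have "0 \<le> (1 - \<tau>) * p" "(1 - \<tau>) * p \<le> (1 - \<tau>) * 1" using that t mult_left_mono[of p 1 "1 - \<tau>"] by auto
    moreover define w where "w = (1 - \<tau>) * p"
    ultimately show ?thesis unfolding w_def[symmetric] using t by auto
  qed
  have xb: "0 \<le> X b" "X b \<le> 1" "0 \<le> Y b" "Y b \<le> 1" using assms(2) by (auto simp: bd_def)
  have "\<gamma> \<tau> \<in> osq" using lin[OF xb(1,2)] lin[OF xb(3,4)] by (auto simp: osq_def \<gamma>_def XY_convex_comb M)
  then show ?thesis using t(1) by blast
qed

lemma osq_Om: "osq \<subseteq> Om" by (auto simp: osq_def Om_def)

lemma AdL_Sc: "AdL E \<subseteq> Sc"
proof
  fix c assume "c \<in> AdL E"
  then obtain b where "b \<in> icell c" "b \<in> bd" by (auto simp: AdL_def)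
  from touch_osq[OF this] have "cell c \<inter> Om \<noteq> {}" using osq_Om icell_subset[of c] by blast
  then show "c \<in> Sc" by (simp add: Sc_def)
qed

lemma AdL_touch: "c \<in> AdL E \<Longrightarrow> \<not> outs c \<and> \<not> insd c"
proof -
  assume "c \<in> AdL E"
  then obtain b where b: "b \<in> icell c" "b \<in> bd" by (auto simp: AdL_def)
  have "b \<notin> osq" using b(2) by (auto simp: bd_def osq_def)
  moreover from touch_osq[OF b] have "icell c \<inter> Om \<noteq> {}" using osq_Om by blast
  ultimately show ?thesis using b(1) by (auto simp: outs_def insd_def)
qed

lemma F_bd: "b \<in> bd \<Longrightarrow> F b = sqF 0 (Y b)"
  using sqF_periodic[of 0 1 "Y b"] pole_values[of "Y b" "X b"] pole_values[of "Y b" 0] by (auto simp: bd_def FK_def)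

lemma Vc_count:
  assumes "a \<le> b"
  shows "finite (Vc x0 a b)" "real (card (Vc x0 a b)) \<le> K * (b1 + b2) * (b - a) + 3"
  unfolding Vc_def by (rule cells_vertical[OF assms])+

lemma Hc_count: "finite (Hc y0)" "real (card (Hc y0)) \<le> K * (e1 + e2) + 3"
  unfolding Hc_def by (rule cells_horizontal)+

lemma bd_cell_cover:
  assumes "b \<in> cell c" "b \<in> bd"
  shows "X b = 0 \<and> c \<in> Vc 0 (Y b) (Y b) \<or> X b = 1 \<and> c \<in> Vc 1 (Y b) (Y b) \<or> Y b = 0 \<and> c \<in> Hc 0 \<or> Y b = 1 \<and> c \<in> Hc 1"
  using assms unfolding bd_def Vc_def Hc_def by auto

lemma insd_closure:
  assumes "insd c" "P \<in> cell c"
  shows "0 \<le> X P" "X P \<le> 1" "0 \<le> Y P" "Y P \<le> 1"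
proof -
  have *: "P \<notin> U" if "open U" "U \<inter> osq = {}" for U
    using cell_to_icell[OF assms(2) that(1)] that(2) assms(1) by (auto simp: insd_def)
  have "P \<notin> {P. X P < 0}" "P \<notin> {P. 1 < X P}" "P \<notin> {P. Y P < 0}" "P \<notin> {P. 1 < Y P}"
    by (rule *; auto simp: osq_def intro!: open_Collect_less continuous_on_const continuous_XY)+
  then show "0 \<le> X P" "X P \<le> 1" "0 \<le> Y P" "Y P \<le> 1" by auto
qed

text \<open>A half-open cell leaves room to increase either coordinate. If the cell does not leave
  the closed square, such moves must not decrease y at the lower edge or increase it at the upper
  one. As Q is invertible, inner cells can have points on only one of the two horizontal
  edges.\<close>

lemma insd_vertical_sign:
  assumes "insd c" "P \<in> cell c"
  shows "Y P = 0 \<Longrightarrow> 0 \<le> q21 \<and> 0 \<le> q22" "Y P = 1 \<Longrightarrow> q21 \<le> 0 \<and> q22 \<le> 0"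
proof -
  obtain u v where P: "P = (u, v)" "real_of_int (fst c) \<le> u" "u < real_of_int (fst c) + 1" "real_of_int (snd c) \<le> v" "v < real_of_int (snd c) + 1"
    using assms(2) by (cases P) (auto simp: cell_def)
  obtain d where d: "0 < d" "u + d < real_of_int (fst c) + 1" "v + d < real_of_int (snd c) + 1"
  proof
    define d where "d = min (real_of_int (fst c) + 1 - u) (real_of_int (snd c) + 1 - v) / 2"
    show "0 < d" "u + d < real_of_int (fst c) + 1" "v + d < real_of_int (snd c) + 1" using P by (auto simp: d_def min_def field_simps)
  qed
  have m: "(u + d, v) \<in> cell c" "(u, v + d) \<in> cell c" using P d by (auto simp: cell_def)
  have e: "Y (u + d, v) = Y P + q21 * d / K" "Y (u, v + d) = Y P + q22 * d / K"
    by (simp_all add: sqy_def P add_divide_distrib algebra_simps)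
  have b: "0 \<le> Y P + q21 * d / K" "Y P + q21 * d / K \<le> 1" "0 \<le> Y P + q22 * d / K" "Y P + q22 * d / K \<le> 1"
    using insd_closure(3,4)[OF assms(1) m(1)] insd_closure(3,4)[OF assms(1) m(2)] unfolding e by auto
  show "0 \<le> q21 \<and> 0 \<le> q22" if "Y P = 0" using b that d K_pos by (auto simp: zero_le_divide_iff zero_le_mult_iff)
  show "q21 \<le> 0 \<and> q22 \<le> 0" if "Y P = 1" using b that d K_pos by (auto simp: divide_le_0_iff mult_le_0_iff)
qed

lemma not_both_signs: "\<not> ((0 \<le> q21 \<and> 0 \<le> q22) \<and> (q21 \<le> 0 \<and> q22 \<le> 0))"
  using det_nz by auto

end

section \<open>Excess of a generic cap: the choice of edge intervals\<close>

locale cap_points = cap_cells r s t \<phi> q11 q12 q21 q22 K for r s t \<phi> q11 q12 q21 q22 K +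
  fixes \<zeta> :: "int \<times> int \<Rightarrow> real \<times> real" and \<rho> Mm :: real and Ar :: "(real \<times> real) set"
  assumes zc: "\<And>c. \<zeta> c \<in> cell c" and rho: "0 < \<rho>"
    and bal: "\<rho> * card {c \<in> Sc. \<zeta> c \<in> Om} = measure lborel Om"
    and Mb: "\<And>a b. 0 \<le> a \<Longrightarrow> a < b \<Longrightarrow> b \<le> 1 \<Longrightarrow> \<bar>\<Sum>c\<in>AdL {a..b}. mass \<rho> \<zeta> c\<bar> \<le> Mm"
    and Ar: "Ar \<in> sets borel" "{P \<in> Om. 0 < F P} \<subseteq> Ar" "Ar \<subseteq> {P \<in> Om. 0 \<le> F P}"
begin

definition "err = \<rho> * card {c \<in> Sc. \<zeta> c \<in> Ar} - measure lborel Ar"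
definition "base = Mm + \<bar>\<rho> - 1\<bar> * card Sc + Cx + 1484 + K * (2 * N2 + N1)"
definition "G y = sqF 0 y"
text \<open>These are the two kinds of cells invisible to sets of adjacent tiles. A cell of
  \<open>Lx\<close> has its interior outside but contributes a point on the edge x = 0. A cell of
  \<open>BD\<close> lies inside but loses its point to an excluded edge; if it is counted with its
  whole mass although F is negative there, the lost point shows up as an excess.\<close>

definition "Lx = {c \<in> Sc. outs c \<and> \<zeta> c \<in> Ar \<and> \<not> near c}"
definition "BD = {c \<in> Sc. insd c \<and> \<zeta> c \<notin> Om \<and> \<not> near c \<and> (\<forall>P\<in>cell c \<inter> Om. F P < 0)}"

lemma Mm_nonneg: "0 \<le> Mm" using Mb[of 0 1] by simp

text \<open>The weight makes the points balance the area of the whole square. A set of cells can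
  therefore be replaced by its complement at the price of a sign, which is how intervals where the
  edge lies outside the cap come under the bound \<open>Mm\<close>.\<close>

lemma sum_mass: "(\<Sum>c\<in>Sc. mass \<rho> \<zeta> c) = 0"
proof -
  have "(\<Sum>c\<in>Sc. indicator Om (\<zeta> c)) = real (card {c \<in> Sc. \<zeta> c \<in> Om})"
    using finite_Sc by (simp add: indicator_def sum.If_cases Int_def)
  then show ?thesis using bal measure_sum_cells[OF Om_borel order_refl]
    by (simp add: mass_def sum_subtractf sum_distrib_left[symmetric])
qed

lemma base_bound:
  assumes H: "H \<subseteq> Sc" "(\<Sum>c\<in>H. mass \<rho> \<zeta> c) \<le> Mm" and Yx: "finite Yx"
    and "\<And>c. c \<in> H \<Longrightarrow> \<not> near c \<Longrightarrow> c \<notin> Yx \<Longrightarrow> touch c \<Longrightarrow> \<exists>b\<in>icell c \<inter> bd. 0 \<le> F b"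
    and "\<And>c. c \<in> Sc - H \<Longrightarrow> \<not> near c \<Longrightarrow> c \<notin> Yx \<Longrightarrow> touch c \<Longrightarrow> \<exists>b\<in>icell c \<inter> bd. F b \<le> 0"
    and "\<And>c. c \<in> Sc - H \<Longrightarrow> \<not> near c \<Longrightarrow> c \<notin> Yx \<Longrightarrow> outs c \<Longrightarrow> \<zeta> c \<notin> Ar"
    and "\<And>c. c \<in> H \<Longrightarrow> \<not> near c \<Longrightarrow> c \<notin> Yx \<Longrightarrow> insd c \<Longrightarrow> \<zeta> c \<notin> Om
        \<Longrightarrow> (\<forall>P\<in>cell c \<inter> Om. F P < 0) \<Longrightarrow> False"
  shows "err \<le> base + card Yx"
proof -
  obtain A where A: "\<forall>k\<in>{1, -1} \<times> Bl. arc_for K (fst k) (snd k) (A k)" using arcs_family[OF K_pos] by blast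
  have nX: "\<not> near c" if "c \<notin> Xc A" for c using that by (auto simp: Xc_def)
  have "err \<le> (\<Sum>c\<in>H. mass \<rho> \<zeta> c) + \<bar>\<rho> - 1\<bar> * card Sc + card (Xc A \<inter> Sc) + card Yx
       + (\<Sum>k\<in>{1, -1} \<times> Bl. (aq (A k) - ap (A k)) + \<bar>af (A k) (aq (A k)) - af (A k) (ap (A k))\<bar> / 2 + 7)"
    unfolding err_def
  proof (rule cap_cells_main)
    show "arc_for K (fst k) (snd k) (A k)" if "k \<in> {1, -1} \<times> Bl" for k using A that by blast
  qed (use zc rho H Yx Ar assms nX in \<open>blast+\<close>)
  moreover have "real (card (Xc A \<inter> Sc)) \<le> Cx" using Xc_count[of A] A by blast
  moreover have "(\<Sum>k\<in>{1, -1} \<times> Bl. (aq (A k) - ap (A k)) + \<bar>af (A k) (aq (A k)) - af (A k) (ap (A k))\<bar> / 2 + 7) \<le> K * (2 * N2 + N1) + 1484"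
    using arcs_sum[of A] A by blast
  ultimately show ?thesis using H(2) by (simp add: base_def)
qed

lemma Ad_sum:
  assumes "E = {} \<or> (\<exists>a b. 0 \<le> a \<and> a < b \<and> b \<le> 1 \<and> E = {a..b})"
  shows "\<bar>\<Sum>c\<in>AdL E. mass \<rho> \<zeta> c\<bar> \<le> Mm"
  using assms
proof
  assume "E = {}" then show ?thesis using Mm_nonneg by (simp add: AdL_def)
qed (use Mb in auto)

lemma bd_height: "b \<in> bd \<Longrightarrow> 0 \<le> Y b \<and> Y b \<le> 1" by (auto simp: bd_def)

text \<open>Here \<open>H\<close> consists of the cells whose interior meets the edge at heights in
  \<open>E\<close>, where the edge lies in the cap. \<open>J\<close> collects further heights with
  that property which one interval cannot include; their cells are paid for in \<open>U\<close>,
  together with those of \<open>Lx\<close>.\<close>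

lemma view1:
  assumes E: "E = {} \<or> (\<exists>a b. 0 \<le> a \<and> a < b \<and> b \<le> 1 \<and> E = {a..b})"
    and pos: "\<And>y. y \<in> E \<Longrightarrow> 0 \<le> G y" and neg: "\<And>y. 0 \<le> y \<Longrightarrow> y \<le> 1 \<Longrightarrow> y \<notin> E \<Longrightarrow> y \<notin> J \<Longrightarrow> G y \<le> 0"
    and U: "finite U" "Lx \<union> AdL J \<subseteq> U"
  shows "err \<le> base + card U"
proof (rule base_bound[OF AdL_Sc _ U(1)])
  show "(\<Sum>c\<in>AdL E. mass \<rho> \<zeta> c) \<le> Mm" using Ad_sum[OF E] by simp
  fix c
  show "\<exists>b\<in>icell c \<inter> bd. 0 \<le> F b" if "c \<in> AdL E" using that pos F_bd by (auto simp: AdL_def G_def)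
  show "\<exists>b\<in>icell c \<inter> bd. F b \<le> 0" if c: "c \<in> Sc - AdL E" "c \<notin> U" "touch c"
  proof -
    obtain b where b: "b \<in> icell c" "b \<in> bd" using c(3) by (auto simp: touch_def)
    have "Y b \<notin> E" "Y b \<notin> J" using c b U(2) by (auto simp: AdL_def)
    then show ?thesis using neg[of "Y b"] bd_height[OF b(2)] F_bd[OF b(2)] b by (intro bexI[of _ b]) (auto simp: G_def)
  qed
  show "\<zeta> c \<notin> Ar" if "c \<in> Sc - AdL E" "\<not> near c" "c \<notin> U" "outs c" using that U(2) by (auto simp: Lx_def)
  show False if "c \<in> AdL E" "insd c" using AdL_touch[OF that(1)] that(2) by simp
qed

text \<open>The opposite choice: \<open>E\<close> belongs to the outside of the cap and
  \<open>H\<close> is the complement of its cells. Now \<open>BD\<close> is the set of harmful cells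
  instead of \<open>Lx\<close>.\<close>

lemma view2:
  assumes E: "E = {} \<or> (\<exists>a b. 0 \<le> a \<and> a < b \<and> b \<le> 1 \<and> E = {a..b})"
    and neg: "\<And>y. y \<in> E \<Longrightarrow> G y \<le> 0" and pos: "\<And>y. 0 \<le> y \<Longrightarrow> y \<le> 1 \<Longrightarrow> y \<notin> E \<Longrightarrow> y \<notin> J \<Longrightarrow> 0 \<le> G y"
    and U: "finite U" "BD \<union> AdL J \<subseteq> U"
  shows "err \<le> base + card U"
proof (rule base_bound[of "Sc - AdL E", OF Diff_subset _ U(1)])
  have "(\<Sum>c\<in>Sc - AdL E. mass \<rho> \<zeta> c) = - (\<Sum>c\<in>AdL E. mass \<rho> \<zeta> c)"
    using sum_diff[OF finite_Sc AdL_Sc, of "mass \<rho> \<zeta>" E] sum_mass by simp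
  then show "(\<Sum>c\<in>Sc - AdL E. mass \<rho> \<zeta> c) \<le> Mm" using Ad_sum[OF E] by simp
  fix c
  show "\<exists>b\<in>icell c \<inter> bd. 0 \<le> F b" if c: "c \<in> Sc - AdL E" "c \<notin> U" "touch c"
  proof -
    obtain b where b: "b \<in> icell c" "b \<in> bd" using c(3) by (auto simp: touch_def)
    have "Y b \<notin> E" "Y b \<notin> J" using c b U(2) by (auto simp: AdL_def)
    then show ?thesis using pos[of "Y b"] bd_height[OF b(2)] F_bd[OF b(2)] b by (intro bexI[of _ b]) (auto simp: G_def)
  qed
  show "\<exists>b\<in>icell c \<inter> bd. F b \<le> 0" if "c \<in> Sc - (Sc - AdL E)" using that neg F_bd by (auto simp: AdL_def G_def)
  show "\<zeta> c \<notin> Ar" if "c \<in> Sc - (Sc - AdL E)" "outs c" using that AdL_touch by blast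
  show False if "c \<in> Sc - AdL E" "\<not> near c" "c \<notin> U" "insd c" "\<zeta> c \<notin> Om" "\<forall>P\<in>cell c \<inter> Om. F P < 0"
    using that U(2) by (auto simp: BD_def)
qed

text \<open>The point lies in the square, but not in the open square, since the interior of its cell
  misses it; so it lies on x = 0. If this line is not parallel to a lattice axis, any position but
  the corner of the cell would allow a move into the open square.\<close>

lemma Lx_point:
  assumes "c \<in> Lx"
  shows "\<zeta> c \<in> cell c" "X (\<zeta> c) = 0" "0 < Y (\<zeta> c)" "Y (\<zeta> c) < 1" "0 < G (Y (\<zeta> c))"
    "q11 \<noteq> 0 \<Longrightarrow> q12 \<noteq> 0 \<Longrightarrow> \<zeta> c = (real_of_int (fst c), real_of_int (snd c))"
proof -
  have c: "outs c" "\<zeta> c \<in> Ar" "\<not> near c" using assms by (auto simp: Lx_def)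
  show z: "\<zeta> c \<in> cell c" by (rule zc)
  have Om: "\<zeta> c \<in> Om" "0 \<le> F (\<zeta> c)" using c Ar(3) by auto
  have "\<zeta> c \<notin> osq" using cell_to_icell[OF z open_osq] c(1) osq_Om by (auto simp: outs_def)
  then show x: "X (\<zeta> c) = 0" and y: "0 < Y (\<zeta> c)" "Y (\<zeta> c) < 1" using Om(1) by (auto simp: osq_def Om_def)
  then have b: "\<zeta> c \<in> bd" by (auto simp: bd_def)
  then show "0 < G (Y (\<zeta> c))" using bd_zero_near[OF z b] c(3) Om(2) F_bd[OF b] by (auto simp: G_def less_le)
  assume q: "q11 \<noteq> 0" "q12 \<noteq> 0"
  show "\<zeta> c = (real_of_int (fst c), real_of_int (snd c))"
  proof (rule ccontr)
    assume ne: "\<not> ?thesis"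
    define U where "U = {P. X P < 1 \<and> 0 < Y P \<and> Y P < 1}"
    have oU: "open U" unfolding U_def by (intro open_Collect_conj open_Collect_less continuous_on_const continuous_XY)
    have zU: "\<zeta> c \<in> U" using x y by (simp add: U_def)
    have Xl: "X P = (q11 / K) * fst P + (q12 / K) * snd P" for P by (simp add: sqx_def add_divide_distrib)
    obtain R where "R \<in> icell c \<inter> U" "X (\<zeta> c) < X R"
      using corner_move[OF Xl _ _ z ne oU zU] q K_pos by auto
    then have "R \<in> icell c \<inter> osq" using x by (auto simp: U_def osq_def)
    then show False using c(1) osq_Om by (auto simp: outs_def)
  qed
qed

lemma BD_point:
  assumes "c \<in> BD"
  shows "\<zeta> c \<in> cell c" "\<zeta> c \<in> bd" "X (\<zeta> c) = 1 \<or> Y (\<zeta> c) = 0 \<or> Y (\<zeta> c) = 1" "G (Y (\<zeta> c)) < 0" "insd c"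
    "q11 \<noteq> 0 \<Longrightarrow> q12 \<noteq> 0 \<Longrightarrow> X (\<zeta> c) = 1 \<Longrightarrow> \<zeta> c = (real_of_int (fst c), real_of_int (snd c))"
proof -
  have c: "insd c" "\<zeta> c \<notin> Om" "\<not> near c" "\<forall>P\<in>cell c \<inter> Om. F P < 0" using assms by (auto simp: BD_def)
  show z: "\<zeta> c \<in> cell c" by (rule zc)
  show "insd c" by (rule c(1))
  note i = insd_closure[OF c(1) z]
  then show xx: "X (\<zeta> c) = 1 \<or> Y (\<zeta> c) = 0 \<or> Y (\<zeta> c) = 1" using c(2) by (auto simp: Om_def)
  then show b: "\<zeta> c \<in> bd" using i by (auto simp: bd_def)
  have "\<not> 0 < F (\<zeta> c)"
  proof
    assume "0 < F (\<zeta> c)"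
    moreover have "open {P. 0 < F P}" by (intro open_Collect_less continuous_on_const continuous_FK)
    ultimately obtain R where R: "R \<in> icell c" "0 < F R" using cell_to_icell[OF z, of "{P. 0 < F P}"] by auto
    then have "R \<in> cell c \<inter> Om" using c(1) osq_Om icell_subset[of c] by (auto simp: insd_def)
    then show False using c(4) R(2) by force
  qed
  then show "G (Y (\<zeta> c)) < 0" using bd_zero_near[OF z b] c(3) F_bd[OF b] by (auto simp: G_def less_le)
  assume q: "q11 \<noteq> 0" "q12 \<noteq> 0" and x: "X (\<zeta> c) = 1"
  show "\<zeta> c = (real_of_int (fst c), real_of_int (snd c))"
  proof (rule ccontr)
    assume ne: "\<not> ?thesis"
    have Xl: "X P = (q11 / K) * fst P + (q12 / K) * snd P" for P by (simp add: sqx_def add_divide_distrib)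
    obtain R where "R \<in> icell c" "X (\<zeta> c) < X R"
      using corner_move[OF Xl _ _ z ne open_UNIV UNIV_I] q K_pos by auto
    then show False using x c(1) by (auto simp: insd_def osq_def)
  qed
qed

lemma G_cont: "continuous_on S G"
  unfolding G_def[abs_def] sqF_def hgt_def by (intro continuous_intros)

lemma G_ends: "G 0 \<noteq> 0" "G 1 \<noteq> 0" using pole_values[of 0 0] pole_values[of 1 0] t_neq by (auto simp: G_def)

lemma G_zeros: "finite {y \<in> {0..1}. G y = 0}" "card {y \<in> {0..1}. G y = 0} \<le> 2"
  using meridian_zeros by (simp_all add: G_def)

end

context cap_points
begin

lemma finite_Lx: "finite Lx" and finite_BD: "finite BD"
  using finite_Sc by (auto simp: Lx_def BD_def)

lemma alt_count:
  fixes a b l m x x' y :: real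
  assumes "0 \<le> a" "a \<le> b" "b \<le> 1" "l = 0 \<and> m = a \<or> l = b \<and> m = 1"
  defines "U \<equiv> Vc x 0 a \<union> Vc x b 1 \<union> Vc x' l m \<union> Hc y"
  shows "finite U" "real (card U) \<le> 2 * (K * (b1 + b2)) * (1 - (b - a)) + K * (e1 + e2) + 12"
proof -
  have lm: "l \<le> m" "m - l \<le> 1 - (b - a)" using assms(1-4) by auto
  show "finite U" using Vc_count(1) Hc_count(1) assms(1-4) lm by (auto simp: U_def)
  have "card U \<le> card (Vc x 0 a) + card (Vc x b 1) + card (Vc x' l m) + card (Hc y)"
    unfolding U_def by (intro order.trans[OF card_Un_le] add_mono card_Un_le order_refl)
  then have 1: "real (card U) \<le> real (card (Vc x 0 a)) + real (card (Vc x b 1)) + real (card (Vc x' l m)) + real (card (Hc y))" by linarith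
  define W where "W = K * (b1 + b2)"
  have W: "0 \<le> W" using K_pos be_nonneg by (simp add: W_def)
  have "W * (m - l) \<le> W * (1 - (b - a))" using W lm by (intro mult_left_mono) auto
  moreover have "real (card (Vc x 0 a)) \<le> W * (a - 0) + 3" "real (card (Vc x b 1)) \<le> W * (1 - b) + 3"
    "real (card (Vc x' l m)) \<le> W * (m - l) + 3" "real (card (Hc y)) \<le> K * (e1 + e2) + 3"
    unfolding W_def using Vc_count(2)[of 0 a x] Vc_count(2)[of b 1 x] Vc_count(2)[OF lm(1)] Hc_count(2) assms(1-3) by simp_all
  ultimately show "real (card U) \<le> 2 * (K * (b1 + b2)) * (1 - (b - a)) + K * (e1 + e2) + 12"
    unfolding W_def[symmetric] using 1 by (simp add: algebra_simps)
qed

text \<open>The edge heights with one sign of \<open>G\<close> form an interval of length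
  \<open>\<eta>\<close>. With this interval as \<open>E\<close> the loss is confined to it, and to
  lattice vertices if the edge is oblique. With one of the two outer intervals as \<open>E\<close>
  the loss is confined to the outer heights on one vertical edge, one outer interval on the other,
  and a single horizontal edge. The two bounds compete, one growing and the other shrinking with
  \<open>\<eta>\<close>.\<close>

lemma views:
  obtains \<eta> and U U' :: "(int \<times> int) set" where "0 \<le> \<eta>" "\<eta> \<le> 1" "finite U" "err \<le> base + card U"
      "real (card U) \<le> K * (b1 + b2) * \<eta> + 3"
      "q11 \<noteq> 0 \<and> q12 \<noteq> 0 \<longrightarrow> real (card U) \<le> K * min b1 b2 + 1"
      "err \<le> base + card U'" "real (card U') \<le> 2 * (K * (b1 + b2)) * (1 - \<eta>) + K * (e1 + e2) + 12"
proof -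
  note obt = that
  define VS where "VS x0 = {c :: int \<times> int. X (real_of_int (fst c), real_of_int (snd c)) = x0
     \<and> 0 \<le> Y (real_of_int (fst c), real_of_int (snd c)) \<and> Y (real_of_int (fst c), real_of_int (snd c)) \<le> 1}" for x0
  have VS: "finite (VS x0)" "real (card (VS x0)) \<le> K * min b1 b2 + 1" if "q11 \<noteq> 0" "q12 \<noteq> 0" for x0
    unfolding VS_def by (rule vertices_vertical[OF that])+
  have W: "0 \<le> K * (b1 + b2)" "0 \<le> K * min b1 b2" "0 \<le> K * (e1 + e2)" using K_pos be_nonneg by auto
  have Lx_VS: "Lx \<subseteq> VS 0" if "q11 \<noteq> 0" "q12 \<noteq> 0"
  proof
    fix c assume "c \<in> Lx"
    from Lx_point[OF this] that show "c \<in> VS 0" by (auto simp: VS_def)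
  qed
  have empt: ?thesis if "err \<le> base"
    by (rule obt[of 0 "{}" "{}"]) (use that W in auto)
  show ?thesis
  proof (cases "G 0 < 0 \<or> G 1 < 0")
    case True
    show ?thesis
    proof (rule two_zeros_interval[OF G_cont G_zeros True])
      assume n: "\<And>y. 0 \<le> y \<Longrightarrow> y \<le> 1 \<Longrightarrow> G y \<le> 0"
      have "Lx = {}"
      proof (rule equals0I)
        fix c assume "c \<in> Lx" from Lx_point(3-5)[OF this] n[of "Y (\<zeta> c)"] show False by auto
      qed
      then have "err \<le> base + card ({} :: (int \<times> int) set)"
        using n by (intro view1[of "{}" "{}" "{}"]) (auto simp: AdL_def)
      then show ?thesis using empt by simp
    next
      fix a b assume ab: "0 \<le> a" "a < b" "b \<le> 1" and inn: "\<And>y. a \<le> y \<Longrightarrow> y \<le> b \<Longrightarrow> 0 \<le> G y"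
        and o: "\<And>y. 0 \<le> y \<Longrightarrow> y < a \<Longrightarrow> G y \<le> 0" "\<And>y. b < y \<Longrightarrow> y \<le> 1 \<Longrightarrow> G y \<le> 0"
          "0 < a \<Longrightarrow> G a \<le> 0" "b < 1 \<Longrightarrow> G b \<le> 0"
      have LV: "Lx \<subseteq> Vc 0 a b"
      proof
        fix c assume c: "c \<in> Lx"
        note L = Lx_point[OF c]
        have "a \<le> Y (\<zeta> c)" "Y (\<zeta> c) \<le> b" using o(1,2)[of "Y (\<zeta> c)"] L(3-5) by (auto simp: not_less[symmetric])
        then show "c \<in> Vc 0 a b" using L(1,2) by (auto simp: Vc_def)
      qed
      have m1: "err \<le> base + card Lx"
        using ab inn o finite_Lx by (intro view1[of "{a..b}" "{}"]) (auto simp: AdL_def)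
      have m2: "real (card Lx) \<le> K * (b1 + b2) * (b - a) + 3"
        using card_mono[OF Vc_count(1) LV] Vc_count(2)[of a b 0] ab by linarith
      have m3: "real (card Lx) \<le> K * min b1 b2 + 1" if "q11 \<noteq> 0" "q12 \<noteq> 0"
        using card_mono[OF VS(1)[OF that] Lx_VS[OF that]] VS(2)[OF that] by (meson of_nat_le_iff order_trans)
      have bdpt: "Y (\<zeta> c) < a \<or> b < Y (\<zeta> c)" "0 \<le> Y (\<zeta> c)" "Y (\<zeta> c) \<le> 1" if "c \<in> BD" for c
        using inn[of "Y (\<zeta> c)"] BD_point(4)[OF that] bd_height[OF BD_point(2)[OF that]] by (auto simp: not_le[symmetric])
      have "\<exists>U' :: (int \<times> int) set. err \<le> base + card U' \<and> real (card U') \<le> 2 * (K * (b1 + b2)) * (1 - (b - a)) + K * (e1 + e2) + 12"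
      \<comment> \<open>Inner cells put points on at most one of the two horizontal edges. The outer
        interval used as \<open>E\<close> is chosen so that only this edge has to be paid
        for.\<close>
      proof (cases "\<forall>c\<in>BD. Y (\<zeta> c) \<noteq> 0")
        case True
        define U where "U = Vc 1 0 a \<union> Vc 1 b 1 \<union> Vc 0 b 1 \<union> Hc 1"
        \<comment> \<open>\<open>Mb\<close> speaks of proper intervals only, hence the empty set
          when \<open>a\<close> is 0.\<close>
        define E where "E = (if 0 < a then {0..a} else {})"
        have U: "finite U" "real (card U) \<le> 2 * (K * (b1 + b2)) * (1 - (b - a)) + K * (e1 + e2) + 12"
          unfolding U_def by (rule alt_count; use ab in auto)+
        have "BD \<subseteq> U"
        proof
          fix c assume c: "c \<in> BD"
          have "X (\<zeta> c) = 1 \<or> Y (\<zeta> c) = 1" using BD_point(3)[OF c] True c by blast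
          then show "c \<in> U" using bdpt[OF c] BD_point(1)[OF c] bd_cell_cover[OF BD_point(1,2)[OF c]]
            by (auto simp: U_def Vc_def Hc_def intro: less_imp_le)
        qed
        moreover have "AdL {b..1} \<subseteq> U"
        proof
          fix c assume "c \<in> AdL {b..1}"
          then obtain P where P': "P \<in> icell c" and P0: "P \<in> bd" "b \<le> Y P" "Y P \<le> 1" by (auto simp: AdL_def)
          from P' icell_subset have "P \<in> cell c" by (rule subsetD[rotated])
          note P = this P0
          then show "c \<in> U" using bd_cell_cover[OF P(1,2)] ab by (auto simp: U_def Vc_def)
        qed
        ultimately have "err \<le> base + card U"
          by (intro view2[of E "{b..1}" U] U(1)) (use ab o inn in \<open>auto simp: E_def less_le split: if_splits\<close>)
        then show ?thesis using U by blast
      next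
        case False
        then obtain c0 where c0: "c0 \<in> BD" "Y (\<zeta> c0) = 0" by auto
        have no1: "Y (\<zeta> c) \<noteq> 1" if "c \<in> BD" for c
          using insd_vertical_sign[OF BD_point(5,1)[OF that]] insd_vertical_sign[OF BD_point(5,1)[OF c0(1)]] c0(2) not_both_signs by auto
        define U where "U = Vc 1 0 a \<union> Vc 1 b 1 \<union> Vc 0 0 a \<union> Hc 0"
        define E where "E = (if b < 1 then {b..1} else {})"
        have U: "finite U" "real (card U) \<le> 2 * (K * (b1 + b2)) * (1 - (b - a)) + K * (e1 + e2) + 12"
          unfolding U_def by (rule alt_count; use ab in auto)+
        have "BD \<subseteq> U"
        proof
          fix c assume c: "c \<in> BD"
          have "X (\<zeta> c) = 1 \<or> Y (\<zeta> c) = 0" using BD_point(3)[OF c] no1[OF c] by blast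
          then show "c \<in> U" using bdpt[OF c] BD_point(1)[OF c] bd_cell_cover[OF BD_point(1,2)[OF c]]
            by (auto simp: U_def Vc_def Hc_def intro: less_imp_le)
        qed
        moreover have "AdL {0..a} \<subseteq> U"
        proof
          fix c assume "c \<in> AdL {0..a}"
          then obtain P where P': "P \<in> icell c" and P0: "P \<in> bd" "0 \<le> Y P" "Y P \<le> a" by (auto simp: AdL_def)
          from P' icell_subset have "P \<in> cell c" by (rule subsetD[rotated])
          note P = this P0
          then show "c \<in> U" using bd_cell_cover[OF P(1,2)] ab by (auto simp: U_def Vc_def)
        qed
        ultimately have "err \<le> base + card U"
          by (intro view2[of E "{0..a}" U] U(1)) (use ab o inn in \<open>auto simp: E_def less_le split: if_splits\<close>)
        then show ?thesis using U by blast
      qed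
      then obtain U' :: "(int \<times> int) set" where "err \<le> base + card U'" "real (card U') \<le> 2 * (K * (b1 + b2)) * (1 - (b - a)) + K * (e1 + e2) + 12" by blast
      then show ?thesis using that[of "b - a" Lx U'] ab m1 m2 m3 finite_Lx by simp
    qed
  next
    case False
    then have g01: "\<not> G 0 < 0" "\<not> G 1 < 0" by auto
    \<comment> \<open>At both horizontal edges \<open>G\<close> is not negative, whereas a cell of
      \<open>BD\<close> needs it negative; only the edge x = 1 is left.\<close>
    have xx: "X (\<zeta> c) = 1" if "c \<in> BD" for c using BD_point(3,4)[OF that] g01 by auto
    have F': "- G 0 < 0 \<or> - G 1 < 0" using g01 G_ends by auto
    have z: "{y \<in> {0..1}. - G y = 0} = {y \<in> {0..1}. G y = 0}" by simp
    have BD_VS: "BD \<subseteq> VS 1" if "q11 \<noteq> 0" "q12 \<noteq> 0"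
    proof
      fix c assume c: "c \<in> BD"
      from BD_point(6)[OF c that xx[OF c]] xx[OF c] bd_height[OF BD_point(2)[OF c]] show "c \<in> VS 1" by (auto simp: VS_def)
    qed
    show ?thesis
    proof (rule two_zeros_interval[OF continuous_on_minus[OF G_cont] _ _ F', unfolded z, OF G_zeros])
      assume "\<And>y. 0 \<le> y \<Longrightarrow> y \<le> 1 \<Longrightarrow> - G y \<le> 0"
      then have n: "\<And>y. 0 \<le> y \<Longrightarrow> y \<le> 1 \<Longrightarrow> 0 \<le> G y" by simp
      have "BD = {}"
      proof (rule equals0I)
        fix c assume c: "c \<in> BD" from BD_point(4)[OF c] n[of "Y (\<zeta> c)"] bd_height[OF BD_point(2)[OF c]] show False by auto
      qed
      then have "err \<le> base + card ({} :: (int \<times> int) set)"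
        using n by (intro view2[of "{}" "{}" "{}"]) (auto simp: AdL_def)
      then show ?thesis using empt by simp
    next
      fix a b assume ab: "0 \<le> a" "a < b" "b \<le> 1" and inn': "\<And>y. a \<le> y \<Longrightarrow> y \<le> b \<Longrightarrow> 0 \<le> - G y"
        and o': "\<And>y. 0 \<le> y \<Longrightarrow> y < a \<Longrightarrow> - G y \<le> 0" "\<And>y. b < y \<Longrightarrow> y \<le> 1 \<Longrightarrow> - G y \<le> 0"
          "0 < a \<Longrightarrow> - G a \<le> 0" "b < 1 \<Longrightarrow> - G b \<le> 0"
      have inn: "G y \<le> 0" if "a \<le> y" "y \<le> b" for y using inn'[OF that] by simp
      have o: "\<And>y. 0 \<le> y \<Longrightarrow> y < a \<Longrightarrow> 0 \<le> G y" "\<And>y. b < y \<Longrightarrow> y \<le> 1 \<Longrightarrow> 0 \<le> G y" "0 < a \<Longrightarrow> 0 \<le> G a" "b < 1 \<Longrightarrow> 0 \<le> G b"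
        using o' by force+
      have BV: "BD \<subseteq> Vc 1 a b"
      proof
        fix c assume c: "c \<in> BD"
        have "a \<le> Y (\<zeta> c)" "Y (\<zeta> c) \<le> b" using o(1,2)[of "Y (\<zeta> c)"] BD_point(4)[OF c] bd_height[OF BD_point(2)[OF c]] by (auto simp: not_less[symmetric])
        then show "c \<in> Vc 1 a b" using BD_point(1)[OF c] xx[OF c] by (auto simp: Vc_def)
      qed
      have m1: "err \<le> base + card BD"
        using ab inn o finite_BD by (intro view2[of "{a..b}" "{}"]) (auto simp: AdL_def)
      have m2: "real (card BD) \<le> K * (b1 + b2) * (b - a) + 3"
        using card_mono[OF Vc_count(1) BV] Vc_count(2)[of a b 1] ab by linarith
      have m3: "real (card BD) \<le> K * min b1 b2 + 1" if "q11 \<noteq> 0" "q12 \<noteq> 0"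
        using card_mono[OF VS(1)[OF that] BD_VS[OF that]] VS(2)[OF that] by (meson of_nat_le_iff order_trans)
      define U where "U = Vc 0 0 a \<union> Vc 0 b 1 \<union> Vc 1 b 1 \<union> Hc 1"
      define E where "E = (if 0 < a then {0..a} else {})"
      have U: "finite U" "real (card U) \<le> 2 * (K * (b1 + b2)) * (1 - (b - a)) + K * (e1 + e2) + 12"
        unfolding U_def by (rule alt_count; use ab in auto)+
      have "Lx \<subseteq> U"
      proof
        fix c assume c: "c \<in> Lx"
        note L = Lx_point[OF c]
        have "Y (\<zeta> c) < a \<or> b < Y (\<zeta> c)" using inn[of "Y (\<zeta> c)"] L(5) by (auto simp: not_le[symmetric])
        then show "c \<in> U" using L(1-4) by (auto simp: U_def Vc_def intro: less_imp_le)
      qed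
      moreover have "AdL {b..1} \<subseteq> U"
      proof
        fix c assume "c \<in> AdL {b..1}"
        then obtain P where P': "P \<in> icell c" and P0: "P \<in> bd" "b \<le> Y P" "Y P \<le> 1" by (auto simp: AdL_def)
          from P' icell_subset have "P \<in> cell c" by (rule subsetD[rotated])
          note P = this P0
        then show "c \<in> U" using bd_cell_cover[OF P(1,2)] ab by (auto simp: U_def Vc_def)
      qed
      ultimately have "err \<le> base + card U"
        by (intro view1[of E "{b..1}" U] U(1)) (use ab o inn in \<open>auto simp: E_def less_le split: if_splits\<close>)
      then show ?thesis using that[of "b - a" BD U] ab m1 m2 m3 finite_BD U by simp
    qed
  qed
qed

section \<open>Comparison with the lower bound for the length\<close>

definition "VV = sqrt (b1\<^sup>2 + b2\<^sup>2)"
definition "RR = sqrt (e1\<^sup>2 + e2\<^sup>2)"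

text \<open>All are instances of the Cauchy-Schwarz inequality. The decimals lie slightly above sqrt
  2 and sqrt 5 / 2.\<close>

lemma norm_bounds:
  "b1 + b2 \<le> sqrt 2 * VV" "e1 + e2 \<le> (14143 / 10000) * RR" "N1 \<le> (11181 / 10000) * RR" "0 \<le> VV" "0 \<le> RR"
proof -
  show nn: "0 \<le> VV" "0 \<le> RR" by (simp_all add: VV_def RR_def)
  have v2: "VV\<^sup>2 = b1\<^sup>2 + b2\<^sup>2" "RR\<^sup>2 = e1\<^sup>2 + e2\<^sup>2" by (simp_all add: VV_def RR_def)
  show "b1 + b2 \<le> sqrt 2 * VV"
  proof (rule power2_le_imp_le)
    have "2 * (b1\<^sup>2 + b2\<^sup>2) - (b1 + b2)\<^sup>2 = (b1 - b2)\<^sup>2" by (simp add: power2_eq_square algebra_simps)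
    then have "0 \<le> 2 * (b1\<^sup>2 + b2\<^sup>2) - (b1 + b2)\<^sup>2" by simp
    then show "(b1 + b2)\<^sup>2 \<le> (sqrt 2 * VV)\<^sup>2" by (simp add: power_mult_distrib v2)
  qed (use nn in simp)
  have R0: "0 \<le> RR\<^sup>2" by simp
  show "e1 + e2 \<le> (14143 / 10000) * RR"
  proof (rule power2_le_imp_le)
    have "2 * RR\<^sup>2 - (e1 + e2)\<^sup>2 = (e1 - e2)\<^sup>2" unfolding v2 by (simp add: power2_eq_square algebra_simps)
    then have "0 \<le> 2 * RR\<^sup>2 - (e1 + e2)\<^sup>2" by simp
    moreover have "((14143 / 10000) * RR)\<^sup>2 = (200024449 / 100000000) * RR\<^sup>2" by (simp add: power2_eq_square)
    ultimately show "(e1 + e2)\<^sup>2 \<le> ((14143 / 10000) * RR)\<^sup>2" using R0 by linarith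
  qed (use nn in simp)
  have half: "p + q / 2 \<le> (11181 / 10000) * RR" if "RR\<^sup>2 = p\<^sup>2 + q\<^sup>2" for p q
  proof (rule power2_le_imp_le)
    have "5/4 * RR\<^sup>2 - (p + q / 2)\<^sup>2 = (p / 2 - q)\<^sup>2" unfolding that by (simp add: power2_eq_square field_simps)
    then have "0 \<le> 5/4 * RR\<^sup>2 - (p + q / 2)\<^sup>2" by simp
    moreover have "((11181 / 10000) * RR)\<^sup>2 = (125014761 / 100000000) * RR\<^sup>2" by (simp add: power2_eq_square)
    ultimately show "(p + q / 2)\<^sup>2 \<le> ((11181 / 10000) * RR)\<^sup>2" using R0 by linarith
  qed (use nn in simp)
  show "N1 \<le> (11181 / 10000) * RR" unfolding N1_def using half[of e1 e2] half[of e2 e1] v2 by (intro max.boundedI) (simp_all add: add.commute)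
qed

theorem positive_side:
  "err \<le> Mm + \<bar>\<rho> - 1\<bar> * card Sc + K * (sqrt 2 * (2 * VV + RR)) + (Cx + 1500)"
proof -
  obtain \<eta> and U U' :: "(int \<times> int) set" where w: "0 \<le> \<eta>" "\<eta> \<le> 1" "finite U" "err \<le> base + card U"
      "real (card U) \<le> K * (b1 + b2) * \<eta> + 3"
      "q11 \<noteq> 0 \<and> q12 \<noteq> 0 \<longrightarrow> real (card U) \<le> K * min b1 b2 + 1"
      "err \<le> base + card U'" "real (card U') \<le> 2 * (K * (b1 + b2)) * (1 - \<eta>) + K * (e1 + e2) + 12"
    by (rule views)
  note nb = norm_bounds
  have s2: "1.414 \<le> sqrt 2" by (rule real_le_rsqrt) (simp add: power2_eq_square)
  have base: "base = Mm + \<bar>\<rho> - 1\<bar> * card Sc + (Cx + 1484) + K * (2 * N2 + N1)" by (simp add: base_def)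
  have *: ?thesis if "err \<le> base + K * T + 12" "2 * N2 + N1 + T \<le> sqrt 2 * (2 * VV + RR)" for T
  proof -
    have "K * (2 * N2 + N1 + T) \<le> K * (sqrt 2 * (2 * VV + RR))" using that(2) K_pos by (intro mult_left_mono) auto
    then show ?thesis using that(1) unfolding base by (simp add: distrib_left)
  qed
  have R: "1.414 * RR \<le> sqrt 2 * RR" "1.414 * VV \<le> sqrt 2 * VV" using s2 nb by (simp_all only: mult_right_mono)
  show ?thesis
  proof (cases "q11 \<noteq> 0 \<and> q12 \<noteq> 0")
    case True
    \<comment> \<open>For an oblique edge the vertices use up exactly what the halved increment had
      saved in the vertical direction: the sum is twice \<open>b1 + b2\<close>, at most 2 sqrt 2
      \<open>VV\<close>.\<close>
    have "2 * N2 + min b1 b2 = 2 * (b1 + b2)" using be_nonneg by (auto simp: N2_def min_def max_def)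
    then have "2 * N2 + N1 + min b1 b2 \<le> sqrt 2 * (2 * VV + RR)" using nb R by (simp add: algebra_simps)
    then show ?thesis using w(4) w(6) True by (intro *[of "min b1 b2"]) auto
  next
    case False
    then have z: "b1 = 0 \<or> b2 = 0" by (auto simp: b1_def b2_def)
    then have N2: "N2 = VV" "b1 + b2 = VV" using be_nonneg by (auto simp: N2_def VV_def)
    \<comment> \<open>For an edge parallel to a lattice axis one of \<open>b1\<close>,
      \<open>b2\<close> is 0, so \<open>2 * N2\<close> is only 2 \<open>VV\<close> and about 0.828
      \<open>VV\<close> is free for the better of the two views.\<close>
    define T where "T = min (VV * \<eta>) (2 * (VV * (1 - \<eta>)) + (e1 + e2))"
    have "err \<le> base + K * T + 12"
      using w(4,5,7,8) unfolding T_def N2 by (auto simp: min_def algebra_simps)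
    moreover have "2 * N2 + N1 + T \<le> sqrt 2 * (2 * VV + RR)"
    proof -
      have "VV * \<eta> \<le> VV" using w nb by (simp add: mult_left_le)
      moreover have "T \<le> VV * \<eta>" "T \<le> 2 * (VV - VV * \<eta>) + (e1 + e2)" by (auto simp: T_def right_diff_distrib)
      moreover define p where "p = VV * \<eta>"
      ultimately have "T \<le> 8 / 10 * VV + 28286 / 100000 * RR" 
      proof -
        assume a: "VV * \<eta> \<le> VV" "T \<le> VV * \<eta>" "T \<le> 2 * (VV - VV * \<eta>) + (e1 + e2)" "p = VV * \<eta>"
        \<comment> \<open>The two bounds for \<open>T\<close> are averaged with weights 8 and 2. The
          result 0.8 \<open>VV\<close> + 0.2 (\<open>e1 + e2\<close>) fits into the slack in both
          directions, as 1.1181 + 0.28286 is below 1.414.\<close>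
        have "10 * T \<le> 8 * VV + 2 * (e1 + e2)" using a(1-3) unfolding a(4)[symmetric] by argo
        moreover have "2 * (e1 + e2) \<le> (28286 / 10000) * RR" using nb(2) by simp
        ultimately show ?thesis by simp
      qed
      then show ?thesis using nb R N2 by (simp add: distrib_left)
    qed
    ultimately show ?thesis by (rule *)
  qed
qed

end

section \<open>The Lambert map preserves area\<close>

lemma vector2_chi: "(vector [a, b] :: real^2) = (\<chi> i. if i = 1 then a else b)"
  by (simp add: vec_eq_iff forall_2)

lemma vector3_chi: "(vector [a, b, c] :: real^3) = (\<chi> i. if i = 1 then a else if i = 2 then b else c)"
  by (simp add: vec_eq_iff forall_3)

lemma continuous_on_vector2:
  assumes "continuous_on S f" "continuous_on S g"
  shows "continuous_on S (\<lambda>x. vector [f x, g x] :: real^2)"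
  unfolding vector2_chi
proof (rule continuous_on_vec_lambda)
  fix i :: 2
  show "continuous_on S (\<lambda>x. if i = 1 then f x else g x)"
    using assms by (cases "i = 1") simp_all
qed

lemma continuous_on_vector3:
  assumes "continuous_on S f" "continuous_on S g" "continuous_on S h"
  shows "continuous_on S (\<lambda>x. vector [f x, g x, h x] :: real^3)"
  unfolding vector3_chi
proof (rule continuous_on_vec_lambda)
  fix i :: 3
  show "continuous_on S (\<lambda>x. if i = 1 then f x else if i = 2 then g x else h x)"
    using assms by (cases "i = 1"; cases "i = 2") simp_all
qed

lemma Basis2: "(Basis :: (real^2) set) = {axis 1 1, axis 2 1}"
  by (auto simp: Basis_vec_def UNIV_2)

lemma Basis3: "(Basis :: (real^3) set) = {axis 1 1, axis 2 1, axis 3 1}"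
  by (auto simp: Basis_vec_def UNIV_3)

text \<open>Product measure is at hand on pairs, while the square and the lattice live in vectors;
  the two Lebesgue measures agree on boxes.\<close>

lemma lborel_vec2: "lborel = distr lborel borel (\<lambda>P::real \<times> real. vector [fst P, snd P] :: real^2)"
proof (rule lborel_eqI)
  fix l u :: "real^2" assume a: "\<And>b. b \<in> Basis \<Longrightarrow> l \<bullet> b \<le> u \<bullet> b"
  have le: "l $ 1 \<le> u $ 1" "l $ 2 \<le> u $ 2" using a[of "axis 1 1"] a[of "axis 2 1"] by (auto simp: Basis2 inner_axis)
  have m: "(\<lambda>P::real \<times> real. vector [fst P, snd P] :: real^2) \<in> borel_measurable lborel"
    by (simp, intro borel_measurable_continuous_onI continuous_on_vector2 continuous_intros)
  have "(\<lambda>P::real \<times> real. vector [fst P, snd P] :: real^2) -` box l u = {l $ 1<..<u $ 1} \<times> {l $ 2<..<u $ 2}"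
    by (auto simp: box_def Basis2 inner_axis)
  then have "emeasure (distr lborel borel (\<lambda>P::real \<times> real. vector [fst P, snd P] :: real^2)) (box l u)
     = emeasure lborel ({l $ 1<..<u $ 1} \<times> {l $ 2<..<u $ 2})"
    using m by (subst emeasure_distr) auto
  also have "\<dots> = ennreal (u $ 1 - l $ 1) * ennreal (u $ 2 - l $ 2)"
    using le by (subst emeasure_lborel_Times) auto
  also have "\<dots> = ennreal (\<Prod>b\<in>Basis. (u - l) \<bullet> b)"
    using le by (simp add: Basis2 inner_axis axis_eq_axis ennreal_mult)
  finally show "emeasure (distr lborel borel (\<lambda>P::real \<times> real. vector [fst P, snd P] :: real^2)) (box l u)
     = ennreal (\<Prod>b\<in>Basis. (u - l) \<bullet> b)" .
qed simp

lemma lborel_vec3: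
  "lborel = distr lborel borel (\<lambda>P::(real \<times> real) \<times> real. vector [fst (fst P), snd (fst P), snd P] :: real^3)"
proof (rule lborel_eqI)
  fix l u :: "real^3" assume a: "\<And>b. b \<in> Basis \<Longrightarrow> l \<bullet> b \<le> u \<bullet> b"
  have le: "l $ 1 \<le> u $ 1" "l $ 2 \<le> u $ 2" "l $ 3 \<le> u $ 3"
    using a[of "axis 1 1"] a[of "axis 2 1"] a[of "axis 3 1"] by (auto simp: Basis3 inner_axis)
  have m: "(\<lambda>P::(real \<times> real) \<times> real. vector [fst (fst P), snd (fst P), snd P] :: real^3) \<in> borel_measurable lborel"
    by (simp, intro borel_measurable_continuous_onI continuous_on_vector3 continuous_intros)
  have "(\<lambda>P::(real \<times> real) \<times> real. vector [fst (fst P), snd (fst P), snd P] :: real^3) -` box l u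
     = ({l $ 1<..<u $ 1} \<times> {l $ 2<..<u $ 2}) \<times> {l $ 3<..<u $ 3}"
    by (auto simp: box_def Basis3 inner_axis)
  then have "emeasure (distr lborel borel (\<lambda>P::(real \<times> real) \<times> real. vector [fst (fst P), snd (fst P), snd P] :: real^3)) (box l u)
     = emeasure lborel (({l $ 1<..<u $ 1} \<times> {l $ 2<..<u $ 2}) \<times> {l $ 3<..<u $ 3})"
    using m by (subst emeasure_distr) auto
  also have "\<dots> = ennreal (u $ 1 - l $ 1) * ennreal (u $ 2 - l $ 2) * ennreal (u $ 3 - l $ 3)"
    unfolding lborel_prod[symmetric, where 'a = "real \<times> real"]
    using le by (subst lborel.emeasure_pair_measure_Times) (auto simp: emeasure_lborel_Times borel_Times)
  also have "\<dots> = ennreal (\<Prod>b\<in>Basis. (u - l) \<bullet> b)"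
    using le by (simp add: Basis3 inner_axis axis_eq_axis ennreal_mult mult.assoc)
  finally show "emeasure (distr lborel borel (\<lambda>P::(real \<times> real) \<times> real. vector [fst (fst P), snd (fst P), snd P] :: real^3)) (box l u)
     = ennreal (\<Prod>b\<in>Basis. (u - l) \<bullet> b)" .
qed simp

lemma measure_vec2:
  assumes "S \<in> sets borel"
  shows "measure lborel (S :: (real^2) set) = measure lborel {P. vector [fst P, snd P] \<in> S}"
    "{P::real \<times> real. (vector [fst P, snd P] :: real^2) \<in> S} \<in> sets borel"
proof -
  have m: "(\<lambda>P::real \<times> real. vector [fst P, snd P] :: real^2) \<in> borel_measurable borel"
    by (intro borel_measurable_continuous_onI continuous_on_vector2 continuous_intros)
  show "{P::real \<times> real. (vector [fst P, snd P] :: real^2) \<in> S} \<in> sets borel"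
    using measurable_sets[OF m assms] by (simp add: vimage_def)
  have "measure lborel S = measure (distr lborel borel (\<lambda>P::real \<times> real. vector [fst P, snd P] :: real^2)) S"
    using lborel_vec2 by simp
  also have "\<dots> = measure lborel {P. vector [fst P, snd P] \<in> S}"
    using m assms by (subst measure_distr) (auto simp: vimage_def)
  finally show "measure lborel S = measure lborel {P. vector [fst P, snd P] \<in> S}" .
qed

lemma measure_cylinder:
  assumes W: "W \<in> sets borel"
  shows "{v::real^3. (vector [v $ 1, v $ 2] :: real^2) \<in> W \<and> 0 < v $ 3 \<and> v $ 3 < 1} \<in> sets borel" (is "?S \<in> _")
    "emeasure lborel {v::real^3. (vector [v $ 1, v $ 2] :: real^2) \<in> W \<and> 0 < v $ 3 \<and> v $ 3 < 1} = emeasure lborel W"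
proof -
  define W' where "W' = {P::real \<times> real. (vector [fst P, snd P] :: real^2) \<in> W}"
  have m: "(\<lambda>P::(real \<times> real) \<times> real. vector [fst (fst P), snd (fst P), snd P] :: real^3) \<in> borel_measurable borel"
    by (intro borel_measurable_continuous_onI continuous_on_vector3 continuous_intros)
  have m2: "(\<lambda>P::real \<times> real. vector [fst P, snd P] :: real^2) \<in> borel_measurable borel"
    by (intro borel_measurable_continuous_onI continuous_on_vector2 continuous_intros)
  have m3: "(\<lambda>v::real^3. vector [v $ 1, v $ 2] :: real^2) \<in> borel_measurable borel"
    by (intro borel_measurable_continuous_onI continuous_on_vector2 continuous_intros)
  have W': "W' \<in> sets borel" unfolding W'_def by (rule measure_vec2(2)[OF W])
  have "(\<lambda>v::real^3. vector [v $ 1, v $ 2] :: real^2) -` W \<in> sets borel" using measurable_sets[OF m3 W] by simp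
  moreover have "open {v::real^3. 0 < v $ 3}" "open {v::real^3. v $ 3 < 1}"
    by (intro open_Collect_less continuous_intros)+
  ultimately have "(\<lambda>v::real^3. vector [v $ 1, v $ 2] :: real^2) -` W \<inter> {v. 0 < v $ 3} \<inter> {v. v $ 3 < 1} \<in> sets borel" by auto
  moreover have "(\<lambda>v::real^3. vector [v $ 1, v $ 2] :: real^2) -` W \<inter> {v. 0 < v $ 3} \<inter> {v. v $ 3 < 1} = ?S" by auto
  ultimately show S: "?S \<in> sets borel" by simp
  have "emeasure lborel ?S = emeasure (distr lborel borel (\<lambda>P::(real \<times> real) \<times> real. vector [fst (fst P), snd (fst P), snd P] :: real^3)) ?S"
    using lborel_vec3 by simp
  also have "\<dots> = emeasure lborel (W' \<times> {0<..<1::real})"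
    using m S by (subst emeasure_distr) (auto simp: W'_def intro!: arg_cong[where f = "emeasure lborel"])
  also have "\<dots> = emeasure lborel W'"
    unfolding lborel_prod[symmetric, where 'a = "real \<times> real"]
    using W' by (subst lborel.emeasure_pair_measure_Times) auto
  also have "\<dots> = emeasure (distr lborel borel (\<lambda>P::real \<times> real. vector [fst P, snd P] :: real^2)) W"
    using m2 W by (subst emeasure_distr) (auto simp: W'_def vimage_def)
  finally show "emeasure lborel ?S = emeasure lborel W" using lborel_vec2 by simp
qed

lemma square_expr: "(0::real) < y \<Longrightarrow> y < 1 \<Longrightarrow> 0 < y - y\<^sup>2"
  by (simp add: power2_eq_square)

lemma lambert_norm:
  assumes "v \<in> unit_square"
  shows "norm (lambert v) = 1"
proof -
  define q c s where "q = sqrt (v $ 2 - (v $ 2)\<^sup>2)" "c = cos (2 * pi * v $ 1)" "s = sin (2 * pi * v $ 1)"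
  have "0 < v $ 2 - (v $ 2)\<^sup>2" using assms square_expr by (simp add: unit_square_def)
  then have q: "q\<^sup>2 = v $ 2 - (v $ 2)\<^sup>2" by (simp add: q_c_s_def)
  have cs: "c\<^sup>2 + s\<^sup>2 = 1" by (simp add: q_c_s_def)
  have L: "lambert v = vector [2 * q * c, 2 * q * s, 1 - 2 * v $ 2]" by (simp add: lambert_def q_c_s_def)
  have "lambert v \<bullet> lambert v = 4 * q\<^sup>2 * (c\<^sup>2 + s\<^sup>2) + (1 - 2 * v $ 2)\<^sup>2"
    unfolding L by (simp add: inner_vec_def sum_3 power2_eq_square algebra_simps)
  also have "\<dots> = 1" unfolding cs q by (simp add: power2_eq_square algebra_simps)
  finally show ?thesis by (simp add: norm_eq_sqrt_inner)
qed

lemma inj_on_lambert: "inj_on lambert unit_square"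
proof (rule inj_onI)
  fix v w assume v: "v \<in> unit_square" and w: "w \<in> unit_square" and e: "lambert v = lambert w"
  have e3: "v $ 2 = w $ 2" using arg_cong[OF e, of "\<lambda>p. p $ 3"] by (simp add: lambert_def)
  have q: "0 < sqrt (w $ 2 - (w $ 2)\<^sup>2)" using w square_expr by (simp add: unit_square_def)
  have "cos (2 * pi * v $ 1) = cos (2 * pi * w $ 1)" "sin (2 * pi * v $ 1) = sin (2 * pi * w $ 1)"
    using arg_cong[OF e, of "\<lambda>p. p $ 1"] arg_cong[OF e, of "\<lambda>p. p $ 2"] q by (simp_all add: lambert_def e3)
  then obtain n :: int where "2 * pi * v $ 1 = 2 * pi * w $ 1 + 2 * pi * n" using sin_cos_eq_iff by metis
  then have "2 * pi * (v $ 1 - w $ 1) = 2 * pi * n" by (simp add: algebra_simps)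
  then have n: "v $ 1 - w $ 1 = n" by simp
  have "\<bar>v $ 1 - w $ 1\<bar> < 1" using v w by (auto simp: unit_square_def)
  then have "\<bar>real_of_int n\<bar> < 1" using n by simp
  then have "n = 0" by linarith
  then show "v = w" using e3 n by (simp add: vec_eq_iff forall_2)
qed

lemma lambert_surj:
  assumes "norm p = 1" "p $ 1 \<noteq> 0 \<or> p $ 2 \<noteq> 0"
  obtains v where "v \<in> unit_square" "lambert v = p"
proof -
  have n: "(p $ 1)\<^sup>2 + (p $ 2)\<^sup>2 + (p $ 3)\<^sup>2 = 1"
    using assms(1) by (simp add: norm_eq_sqrt_inner inner_vec_def sum_3 power2_eq_square)
  have "0 < (p $ 1)\<^sup>2 + (p $ 2)\<^sup>2" using assms(2) by (simp add: sum_power2_gt_zero_iff)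
  then have z: "(p $ 3)\<^sup>2 < 1" using n by linarith
  then have z1: "-1 < p $ 3" "p $ 3 < 1" using abs_square_less_1[of "p $ 3"] by auto
  define q where "q = sqrt (1 - (p $ 3)\<^sup>2)"
  have q: "0 < q" "q\<^sup>2 = 1 - (p $ 3)\<^sup>2" using z by (simp_all add: q_def)
  have "(p $ 1 / q)\<^sup>2 + (p $ 2 / q)\<^sup>2 = ((p $ 1)\<^sup>2 + (p $ 2)\<^sup>2) / q\<^sup>2" by (simp add: power_divide add_divide_distrib)
  also have "\<dots> = 1" using q n by (simp add: field_simps)
  finally obtain \<theta> where th: "0 \<le> \<theta>" "\<theta> < 2 * pi" "p $ 1 / q = cos \<theta>" "p $ 2 / q = sin \<theta>" by (rule sincos_total_2pi)
  define v :: "real^2" where "v = vector [\<theta> / (2 * pi), (1 - p $ 3) / 2]"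
  have "(1 - p $ 3) / 2 - ((1 - p $ 3) / 2)\<^sup>2 = (q / 2)\<^sup>2" using q(2) by (simp add: power_divide power2_eq_square field_simps)
  then have "2 * sqrt ((1 - p $ 3) / 2 - ((1 - p $ 3) / 2)\<^sup>2) = q" using q(1) by simp
  then have "lambert v = p" using th q(1) by (simp add: lambert_def v_def vec_eq_iff forall_3 field_simps)
  moreover have "v \<in> unit_square" using z1 th by (simp add: unit_square_def v_def field_simps)
  ultimately show ?thesis using that by blast
qed

lemma continuous_lambert: "continuous_on S lambert"
  unfolding lambert_def[abs_def] by (intro continuous_on_vector3 continuous_intros)

lemma unit_square_borel [measurable]: "unit_square \<in> sets borel"
proof -
  have "unit_square = {v. 0 \<le> v $ 1} \<inter> {v. v $ 1 < 1} \<inter> {v. 0 < v $ 2} \<inter> {v. v $ 2 < 1}" by (auto simp: unit_square_def)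
  moreover have "closed {v::real^2. 0 \<le> v $ 1}" "open {v::real^2. v $ 1 < 1}" "open {v::real^2. 0 < v $ 2}" "open {v::real^2. v $ 2 < 1}"
    by (intro closed_Collect_le open_Collect_less continuous_intros)+
  ultimately show ?thesis by (metis borel_closed borel_open sets.Int)
qed

lemma lambert_preimage_borel: "A \<in> sets borel \<Longrightarrow> lambert_preimage A \<in> sets borel"
proof -
  assume "A \<in> sets borel"
  moreover have "lambert \<in> borel_measurable borel" by (intro borel_measurable_continuous_onI continuous_lambert)
  ultimately have "lambert -` A \<in> sets borel" using measurable_sets[of lambert borel borel A] by simp
  moreover have "lambert_preimage A = unit_square \<inter> lambert -` A" by (auto simp: lambert_preimage_def)
  ultimately show ?thesis by auto
qed

lemma measure_unit_square: "emeasure lborel unit_square = 1"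
proof -
  have "emeasure lborel unit_square = emeasure (distr lborel borel (\<lambda>P::real \<times> real. vector [fst P, snd P] :: real^2)) unit_square"
    using lborel_vec2 by simp
  also have "\<dots> = emeasure lborel ((\<lambda>P::real \<times> real. vector [fst P, snd P] :: real^2) -` unit_square)"
    by (subst emeasure_distr) (auto intro!: borel_measurable_continuous_onI continuous_on_vector2 continuous_intros)
  also have "(\<lambda>P::real \<times> real. vector [fst P, snd P] :: real^2) -` unit_square = {0..<1} \<times> {0<..<1}"
    by (auto simp: unit_square_def)
  finally show ?thesis by (simp add: emeasure_lborel_Times)
qed

text \<open>The surface measure is defined through volumes of cones, so the Lambert map is extended
  to a parametrization of the ball by the square times (0, 1). The cube root in the radius makes its
  volume factor constant, equal to 4 pi / 3.\<close>

definition solid :: "real^3 \<Rightarrow> real^3" where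
  "solid v = root 3 (v $ 3) *\<^sub>R lambert (vector [v $ 1, v $ 2])"

definition solid_deriv :: "real^3 \<Rightarrow> real^3 \<Rightarrow> real^3" where
  "solid_deriv v h = (let x = 2 * pi * v $ 1; q = sqrt (v $ 2 - (v $ 2)\<^sup>2); g = root 3 (v $ 3);
       f = (1 - 2 * v $ 2) / q; k = inverse (3 * g\<^sup>2) in
     vector [(- 4 * pi * g * q * sin x) * h $ 1 + (g * f * cos x) * h $ 2 + (2 * k * q * cos x) * h $ 3,
             (4 * pi * g * q * cos x) * h $ 1 + (g * f * sin x) * h $ 2 + (2 * k * q * sin x) * h $ 3,
             (- 2 * g) * h $ 2 + (k * (1 - 2 * v $ 2)) * h $ 3])"

lemma solid_components:
  "solid v $ 1 = root 3 (v $ 3) * (2 * sqrt (v $ 2 - (v $ 2)\<^sup>2) * cos (2 * pi * v $ 1))"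
  "solid v $ 2 = root 3 (v $ 3) * (2 * sqrt (v $ 2 - (v $ 2)\<^sup>2) * sin (2 * pi * v $ 1))"
  "solid v $ 3 = root 3 (v $ 3) * (1 - 2 * v $ 2)"
  by (simp_all add: solid_def lambert_def)

lemma solid_has_derivative:
  assumes y: "0 < v $ 2" "v $ 2 < 1" and z: "0 < v $ 3"
  shows "(solid has_derivative solid_deriv v) (at v within S)"
proof -
  have c: "((\<lambda>v::real^3. v $ i) has_derivative (\<lambda>h. h $ i)) (at v within S)" for i
    by (rule bounded_linear_imp_has_derivative[OF bounded_linear_vec_nth])
  have q0: "0 < v $ 2 - (v $ 2)\<^sup>2" using square_expr y by blast
  have dg: "((\<lambda>v. root 3 (v $ 3)) has_derivative (\<lambda>h. h $ 3 * inverse (3 * (root 3 (v $ 3))\<^sup>2))) (at v within S)"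
    by (rule DERIV_compose_FDERIV[OF _ c]) (use DERIV_real_root[of 3 "v $ 3"] z in \<open>simp add: numeral_2_eq_2\<close>)
  have "((\<lambda>y. 2 * sqrt (y - y\<^sup>2)) has_real_derivative (1 - 2 * v $ 2) / sqrt (v $ 2 - (v $ 2)\<^sup>2)) (at (v $ 2))"
    using q0 by (auto intro!: derivative_eq_intros simp: field_simps)
  then have df: "((\<lambda>v. 2 * sqrt (v $ 2 - (v $ 2)\<^sup>2)) has_derivative (\<lambda>h. h $ 2 * ((1 - 2 * v $ 2) / sqrt (v $ 2 - (v $ 2)\<^sup>2)))) (at v within S)"
    by (rule DERIV_compose_FDERIV[OF _ c])
  have "((\<lambda>x. cos (2 * pi * x)) has_real_derivative (- sin (2 * pi * v $ 1) * (2 * pi))) (at (v $ 1))"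
    by (auto intro!: derivative_eq_intros)
  then have dc: "((\<lambda>v. cos (2 * pi * v $ 1)) has_derivative (\<lambda>h. h $ 1 * (- sin (2 * pi * v $ 1) * (2 * pi)))) (at v within S)"
    by (rule DERIV_compose_FDERIV[OF _ c])
  have "((\<lambda>x. sin (2 * pi * x)) has_real_derivative (cos (2 * pi * v $ 1) * (2 * pi))) (at (v $ 1))"
    by (auto intro!: derivative_eq_intros)
  then have ds: "((\<lambda>v. sin (2 * pi * v $ 1)) has_derivative (\<lambda>h. h $ 1 * (cos (2 * pi * v $ 1) * (2 * pi)))) (at v within S)"
    by (rule DERIV_compose_FDERIV[OF _ c])
  have dl: "((\<lambda>v. 1 - 2 * v $ 2) has_derivative (\<lambda>h. - 2 * h $ 2)) (at v within S)"
    using has_derivative_diff[OF has_derivative_const has_derivative_mult_right[OF c[of 2], of 2], of 1] by simp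
  have "((\<lambda>v. solid v $ i) has_derivative (\<lambda>h. solid_deriv v h $ i)) (at v within S)" for i
  proof -
    have 1: "((\<lambda>v. solid v $ 1) has_derivative (\<lambda>h. solid_deriv v h $ 1)) (at v within S)"
      unfolding solid_components using has_derivative_mult[OF dg has_derivative_mult[OF df dc]]
      by (rule has_derivative_eq_rhs) (auto simp: solid_deriv_def Let_def fun_eq_iff algebra_simps)
    have 2: "((\<lambda>v. solid v $ 2) has_derivative (\<lambda>h. solid_deriv v h $ 2)) (at v within S)"
      unfolding solid_components using has_derivative_mult[OF dg has_derivative_mult[OF df ds]]
      by (rule has_derivative_eq_rhs) (auto simp: solid_deriv_def Let_def fun_eq_iff algebra_simps)
    have 3: "((\<lambda>v. solid v $ 3) has_derivative (\<lambda>h. solid_deriv v h $ 3)) (at v within S)"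
      unfolding solid_components using has_derivative_mult[OF dg dl]
      by (rule has_derivative_eq_rhs) (auto simp: solid_deriv_def Let_def fun_eq_iff algebra_simps diff_divide_distrib)
    show ?thesis using 1 2 3 exhaust_3[of i] by auto
  qed
  then show ?thesis
    unfolding has_derivative_componentwise_within[of solid] by (auto simp: Basis3 inner_axis)
qed

text \<open>Everything cancels by sin^2 + cos^2 = 1 and (1 - 2y)^2 + 4 (y - y^2) = 1; the radial
  factors combine to \<open>g\<^sup>2 * k\<close>, which is 1/3.\<close>

lemma solid_det:
  assumes y: "0 < v $ 2" "v $ 2 < 1" and z: "0 < v $ 3"
  shows "\<bar>det (matrix (solid_deriv v))\<bar> = 4 * pi / 3"
proof -
  define x q g y where "x = 2 * pi * v $ 1" "q = sqrt (v $ 2 - (v $ 2)\<^sup>2)" "g = root 3 (v $ 3)" "y = v $ 2"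
  define k f C T where "k = inverse (3 * g\<^sup>2)" "f = (1 - 2 * y) / q" "C = cos x" "T = sin x"
  have CT: "T\<^sup>2 + C\<^sup>2 = 1" by (simp add: k_f_C_T_def)
  have "0 < v $ 2 - (v $ 2)\<^sup>2" using square_expr y by blast
  then have q: "0 < q" "q\<^sup>2 = y - y\<^sup>2" by (simp_all add: x_q_g_y_def)
  have g: "0 < g" using z by (simp add: x_q_g_y_def)
  have gk: "g\<^sup>2 * k = 1 / 3" using g by (simp add: k_f_C_T_def field_simps)
  have qf: "q * f = 1 - 2 * y" using q by (simp add: k_f_C_T_def)
  have m: "matrix (solid_deriv v) $ i $ j = solid_deriv v (axis j 1) $ i" for i j by (simp add: matrix_def)
  have d: "solid_deriv v h = vector [(- 4 * pi * g * q * T) * h $ 1 + (g * f * C) * h $ 2 + (2 * k * q * C) * h $ 3,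
             (4 * pi * g * q * C) * h $ 1 + (g * f * T) * h $ 2 + (2 * k * q * T) * h $ 3,
             (- 2 * g) * h $ 2 + (k * (1 - 2 * y)) * h $ 3]" for h
    by (simp add: solid_deriv_def Let_def x_q_g_y_def k_f_C_T_def)
  have "det (matrix (solid_deriv v)) = - 4 * pi * (g\<^sup>2 * k) * (T\<^sup>2 + C\<^sup>2) * ((q * f) * (1 - 2 * y) + 4 * q\<^sup>2)"
    unfolding det_3 m d by (simp add: axis_def power2_eq_square algebra_simps)
  also have "\<dots> = - 4 * pi / 3" unfolding gk qf q(2) CT by (simp add: power2_eq_square algebra_simps)
  finally show ?thesis by simp
qed

lemma solid_norm: "vector [v $ 1, v $ 2] \<in> unit_square \<Longrightarrow> 0 \<le> v $ 3 \<Longrightarrow> norm (solid v) = root 3 (v $ 3)"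
  by (simp add: solid_def lambert_norm)

lemma inj_on_solid: "inj_on solid {v. (vector [v $ 1, v $ 2] :: real^2) \<in> unit_square \<and> 0 < v $ 3}"
proof (rule inj_onI)
  fix v w :: "real^3" assume "v \<in> {v. (vector [v $ 1, v $ 2] :: real^2) \<in> unit_square \<and> 0 < v $ 3}"
    "w \<in> {v. (vector [v $ 1, v $ 2] :: real^2) \<in> unit_square \<and> 0 < v $ 3}" and e: "solid v = solid w"
  then have v: "(vector [v $ 1, v $ 2] :: real^2) \<in> unit_square" "0 < v $ 3" and w: "(vector [w $ 1, w $ 2] :: real^2) \<in> unit_square" "0 < w $ 3" by auto
  have "root 3 (v $ 3) = root 3 (w $ 3)" using arg_cong[OF e, of norm] solid_norm[of v] solid_norm[of w] v w by simp
  then have e3: "v $ 3 = w $ 3" by simp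
  have "root 3 (w $ 3) > 0" using w by simp
  then have "lambert (vector [v $ 1, v $ 2]) = lambert (vector [w $ 1, w $ 2])" using e by (simp add: solid_def e3)
  then have "(vector [v $ 1, v $ 2] :: real^2) = vector [w $ 1, w $ 2]" using inj_onD[OF inj_on_lambert _ v(1) w(1)] by blast
  then show "v = w" using e3 by (simp add: vec_eq_iff forall_2 forall_3)
qed

lemma solid_image:
  "solid ` {v. (vector [v $ 1, v $ 2] :: real^2) \<in> lambert_preimage A \<and> 0 < v $ 3 \<and> v $ 3 < 1}
    = {p \<in> ball 0 1. sgn p \<in> A} - {p. p $ 1 = 0 \<and> p $ 2 = 0}" (is "solid ` ?S = ?R")
proof (intro equalityI subsetI)
  fix p assume "p \<in> solid ` ?S"
  then obtain v where v: "(vector [v $ 1, v $ 2] :: real^2) \<in> unit_square" "lambert (vector [v $ 1, v $ 2]) \<in> A" "0 < v $ 3" "v $ 3 < 1" "p = solid v"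
    by (auto simp: lambert_preimage_def)
  have r: "0 < root 3 (v $ 3)" "root 3 (v $ 3) < 1" using v by auto
  have "norm p < 1" using solid_norm[OF v(1)] v r by simp
  moreover have "sgn p = lambert (vector [v $ 1, v $ 2])"
    using r lambert_norm[OF v(1)] by (simp add: v(5) solid_def sgn_div_norm)
  moreover have "\<not> (p $ 1 = 0 \<and> p $ 2 = 0)"
  proof
    assume z: "p $ 1 = 0 \<and> p $ 2 = 0"
    have "0 < v $ 2 - (v $ 2)\<^sup>2" using v(1) square_expr by (simp add: unit_square_def)
    then have "cos (2 * pi * v $ 1) = 0 \<and> sin (2 * pi * v $ 1) = 0" using z r unfolding v(5) solid_components by simp
    then show False using sin_cos_squared_add[of "2 * pi * v $ 1"] by simp
  qed
  ultimately show "p \<in> ?R" using v(2) by simp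
next
  fix p assume p: "p \<in> ?R"
  then have p1: "norm p < 1" "sgn p \<in> A" "p $ 1 \<noteq> 0 \<or> p $ 2 \<noteq> 0" by auto
  then have p0: "p \<noteq> 0" by auto
  have "norm (sgn p) = 1" using p0 by (simp add: norm_sgn)
  moreover have "sgn p $ 1 \<noteq> 0 \<or> sgn p $ 2 \<noteq> 0" using p1(3) p0 by (simp add: sgn_div_norm)
  ultimately obtain u where u: "u \<in> unit_square" "lambert u = sgn p" by (rule lambert_surj)
  define v :: "real^3" where "v = vector [u $ 1, u $ 2, norm p ^ 3]"
  have vu: "(vector [v $ 1, v $ 2] :: real^2) = u" by (simp add: v_def vec_eq_iff forall_2)
  have "root 3 (v $ 3) = norm p" by (simp add: v_def real_root_power_cancel)
  then have "solid v = p" unfolding solid_def vu u(2) using p0 by (simp add: sgn_div_norm)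
  moreover have "v \<in> ?S" using u p1 p0 unfolding mem_Collect_eq vu lambert_preimage_def
    by (auto simp: v_def power_less_one_iff)
  ultimately show "p \<in> solid ` ?S" by force
qed

text \<open>The cylinder over the preimage of \<open>A\<close> is mapped injectively onto the cone
  over \<open>A\<close> without its axis, a null set, and change of variables multiplies its volume
  by 4 pi / 3.\<close>

lemma measure_cone:
  assumes A: "A \<in> sets borel" and m: "{p \<in> ball 0 1. sgn p \<in> A} \<in> sets borel"
  shows "measure lborel {p \<in> ball 0 1. sgn p \<in> A} = 4 * pi / 3 * measure lborel (lambert_preimage A)"
proof -
  define S where "S = {v::real^3. (vector [v $ 1, v $ 2] :: real^2) \<in> lambert_preimage A \<and> 0 < v $ 3 \<and> v $ 3 < 1}"
  define Z where "Z = {p::real^3. p $ 1 = 0 \<and> p $ 2 = 0}"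
  note W = lambert_preimage_borel[OF A]
  have S: "S \<in> sets borel" "emeasure lborel S = emeasure lborel (lambert_preimage A)" unfolding S_def by (rule measure_cylinder[OF W])+
  have "emeasure lborel (lambert_preimage A) \<le> emeasure lborel unit_square"
    by (rule emeasure_mono) (auto simp: lambert_preimage_def)
  then have "emeasure lborel (lambert_preimage A) < \<infinity>" by (simp add: measure_unit_square order_le_less_trans[OF _ ennreal_one_less_top])
  then have Sm: "S \<in> lmeasurable" using S by (auto simp: fmeasurable_def)
  have Sy: "0 < v $ 2 \<and> v $ 2 < 1 \<and> 0 < v $ 3" if "v \<in> S" for v
    using that by (auto simp: S_def lambert_preimage_def unit_square_def)
  have inj: "inj_on solid S" by (rule inj_on_subset[OF inj_on_solid]) (auto simp: S_def lambert_preimage_def)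
  have i0: "((\<lambda>v. 4 * pi / 3) has_integral 4 * pi / 3 * measure lebesgue S) S"
  proof -
    have "((\<lambda>v. 1) has_integral measure lebesgue S) S"
      using Sm integrable_integral by (simp add: lmeasure_integral lmeasurable_iff_integrable_on)
    from has_integral_mult_right[OF this, of "4 * pi / 3"] show ?thesis by simp
  qed
  have i: "((\<lambda>v. \<bar>det (matrix (solid_deriv v))\<bar>) has_integral 4 * pi / 3 * measure lebesgue S) S"
    by (rule has_integral_eq[OF _ i0]) (use Sy solid_det in auto)
  have "solid ` S \<in> lmeasurable \<and> measure lebesgue (solid ` S) = 4 * pi / 3 * measure lebesgue S"
    using has_measure_differentiable_image[of S solid solid_deriv "4 * pi / 3 * measure lebesgue S"] i inj solid_has_derivative Sy S(1) by auto
  moreover have "solid ` S = {p \<in> ball 0 1. sgn p \<in> A} - Z" unfolding S_def Z_def by (rule solid_image)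
  ultimately have 1: "measure lebesgue ({p \<in> ball 0 1. sgn p \<in> A} - Z) = 4 * pi / 3 * measure lebesgue S" by simp
  have "negligible Z" by (rule negligible_subset[OF negligible_standard_hyperplane_cart[of 1]]) (auto simp: Z_def)
  then have "measure lebesgue ({p \<in> ball 0 1. sgn p \<in> A} - Z) = measure lebesgue {p \<in> ball 0 1. sgn p \<in> A}"
    using m by (intro measure_Diff_null_set) (auto simp: negligible_iff_null_sets)
  then show ?thesis using 1 S m by (simp add: measure_def)
qed

lemma measure_sphere_lambert:
  assumes A: "A \<in> sets borel"
  shows "measure sphere_measure A = measure lborel (lambert_preimage A)"
proof -
  have sm: "(sgn :: real^3 \<Rightarrow> real^3) \<in> borel_measurable borel"
    unfolding sgn_div_norm[abs_def] by measurable
  have B: "{p \<in> ball 0 1. sgn p \<in> A} \<in> sets borel" if "A \<in> sets borel" for A :: "(real^3) set"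
  proof -
    have "sgn -` A \<inter> space borel \<in> sets (borel :: (real^3) measure)" using sm that by (rule measurable_sets)
    then have "ball 0 1 \<inter> sgn -` A \<in> sets (borel :: (real^3) measure)" by auto
    moreover have "ball 0 1 \<inter> sgn -` A = {p \<in> ball 0 1. sgn p \<in> A}" by auto
    ultimately show ?thesis by simp
  qed
  have U: "lambert_preimage UNIV = unit_square" by (auto simp: lambert_preimage_def)
  have b: "measure lborel (ball 0 1 :: (real^3) set) = 4 * pi / 3"
  proof -
    have "{p \<in> ball 0 1. sgn p \<in> (UNIV :: (real^3) set)} = ball 0 1" by blast
    then show ?thesis using measure_cone[of UNIV] U measure_unit_square by (simp add: measure_def del: mem_ball mem_ball_0)
  qed
  have e: "emeasure lborel (ball 0 1 :: (real^3) set) \<noteq> \<infinity>" "emeasure lborel (ball 0 1 :: (real^3) set) \<noteq> 0"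
    using b emeasure_lborel_ball_finite[of "0 :: real^3" 1] by (auto simp: measure_def)
  have "measure sphere_measure A = measure (uniform_measure lborel (ball 0 1 :: (real^3) set)) (sgn -` A)"
    unfolding sphere_measure_def using sm A by (subst measure_distr) auto
  also have "\<dots> = measure lborel (ball 0 1 \<inter> sgn -` A) / measure lborel (ball 0 1 :: (real^3) set)"
    using e measurable_sets[OF sm A] by (intro measure_uniform_measure) auto
  also have "ball 0 1 \<inter> sgn -` A = {p \<in> ball 0 1. sgn p \<in> A}" by auto
  also have "measure lborel {p \<in> ball 0 1. sgn p \<in> A} / measure lborel (ball 0 1 :: (real^3) set) = measure lborel (lambert_preimage A)"
    unfolding measure_cone[OF A B[OF A]] b by simp
  finally show ?thesis .
qed

section \<open>A lower bound for the lengths of cap boundaries\<close>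

definition sgm :: "real \<Rightarrow> real" where "sgm m = m / sqrt (1 + m\<^sup>2)"
text \<open>The great circle with normal proportional to (1, 0, c), solved for y as a function of x
  on the square.\<close>

definition tilt_y :: "real \<Rightarrow> real \<Rightarrow> real" where "tilt_y c x = 1 / 2 + sgm (cos (2 * pi * x) / c) / 2"

lemma sgm_bounds: "-1 < sgm m" "sgm m < 1"
proof -
  have "\<bar>m\<bar> < sqrt (1 + m\<^sup>2)" by (rule real_less_rsqrt) simp
  moreover have "0 < sqrt (1 + m\<^sup>2)" by (simp add: add_pos_nonneg)
  ultimately have "\<bar>sgm m\<bar> < 1" by (simp add: sgm_def abs_divide)
  then show "-1 < sgm m" "sgm m < 1" by auto
qed

lemma pos_1sq: "0 < 1 + (m::real)\<^sup>2" by (rule add_pos_nonneg) simp_all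

lemma tilt_point:
  assumes c: "0 < c" and x: "0 \<le> x" "x < 1"
  shows "(vector [x, tilt_y c x] :: real^2)
    \<in> lambert_preimage (cap_boundary (vector [1 / sqrt (1 + c\<^sup>2), 0, c / sqrt (1 + c\<^sup>2)]) 0)"
proof -
  define v :: "real^2" where "v = vector [x, tilt_y c x]"
  define m S where "m = cos (2 * pi * x) / c" "S = sqrt (1 + m\<^sup>2)"
  have S: "0 < S" "S\<^sup>2 = 1 + m\<^sup>2" using pos_1sq[of m] by (simp_all add: m_S_def)
  have y: "tilt_y c x = 1 / 2 + (m / S) / 2" by (simp add: tilt_y_def sgm_def m_S_def)
  have U: "v \<in> unit_square" using x sgm_bounds[of "cos (2 * pi * x) / c"] by (auto simp: v_def unit_square_def tilt_y_def)
  have "tilt_y c x - (tilt_y c x)\<^sup>2 = (1 - (m / S)\<^sup>2) / 4" unfolding y by (simp add: power2_eq_square algebra_simps)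
  also have "1 - (m / S)\<^sup>2 = (S\<^sup>2 - m\<^sup>2) / S\<^sup>2" using S(1) by (simp add: power_divide diff_divide_distrib)
  also have "\<dots> = (1 / S)\<^sup>2" unfolding S(2) by (simp add: power_divide S(2))
  finally have "tilt_y c x - (tilt_y c x)\<^sup>2 = (1 / (2 * S))\<^sup>2" by (simp add: power_divide power2_eq_square)
  then have q: "2 * sqrt (tilt_y c x - (tilt_y c x)\<^sup>2) = 1 / S" using S(1) by simp
  have h: "1 - 2 * tilt_y c x = - (m / S)" unfolding y by simp
  have z: "1 / S * cos (2 * pi * x) + c * (- (m / S)) = 0" using c by (simp add: m_S_def(1))
  define w :: "real^3" where "w = vector [1 / sqrt (1 + c\<^sup>2), 0, c / sqrt (1 + c\<^sup>2)]"
  have "w \<bullet> lambert v = (1 / S * cos (2 * pi * x) + c * (- (m / S))) / sqrt (1 + c\<^sup>2)"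
    by (simp add: w_def lambert_def v_def q h inner_vec_def sum_3 add_divide_distrib diff_divide_distrib mult.commute)
  then have "w \<bullet> lambert v = 0" using z by simp
  then show ?thesis using U lambert_norm[OF U] by (simp add: lambert_preimage_def cap_boundary_def v_def w_def)
qed

lemma tilt_normal: "(vector [1 / sqrt (1 + c\<^sup>2), 0, c / sqrt (1 + c\<^sup>2)] :: real^3) \<in> sphere 0 1"
proof -
  have "0 < 1 + c\<^sup>2" by (rule pos_1sq)
  then have "norm (vector [1 / sqrt (1 + c\<^sup>2), 0, c / sqrt (1 + c\<^sup>2)] :: real^3) = 1"
    by (simp add: norm_eq_sqrt_inner inner_vec_def sum_3 power_divide add_divide_distrib[symmetric] flip: power2_eq_square)
  then show ?thesis by simp
qed

lemma tilt_continuous: "0 < c \<Longrightarrow> continuous_on T (tilt_y c)"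
  unfolding tilt_y_def[abs_def] sgm_def using pos_1sq
  by (intro continuous_intros) (auto simp: less_imp_neq[symmetric] add_nonneg_eq_0_iff)

lemma sgm_limit:
  assumes "q \<noteq> 0"
  shows "(\<lambda>n. sgm (q / inverse (real (Suc n)))) \<longlonglongrightarrow> sgn q"
proof -
  have pos: "(\<lambda>n. sgm (q / inverse (real (Suc n)))) \<longlonglongrightarrow> 1" if "0 < q" for q :: real
    using that unfolding sgm_def by real_asymp
  show ?thesis
  proof (cases "0 < q")
    case True then show ?thesis using pos[OF True] by simp
  next
    case False
    then have "0 < - q" using assms by simp
    from tendsto_minus[OF pos[OF this]] show ?thesis using False assms by (simp add: sgm_def)
  qed
qed

lemma tilt_limit:
  assumes "cos (2 * pi * x) \<noteq> 0"
  shows "(\<lambda>n. tilt_y (inverse (real (Suc n))) x) \<longlonglongrightarrow> 1 / 2 + sgn (cos (2 * pi * x)) / 2"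
  unfolding tilt_y_def by (intro tendsto_intros sgm_limit assms) simp

lemma matrix_inv_mult:
  fixes A :: "'a::semiring_1^'n^'n"
  assumes "invertible A"
  shows "A ** matrix_inv A = mat 1" "matrix_inv A ** A = mat 1"
  using someI_ex[OF assms[unfolded invertible_def]] unfolding matrix_inv_def by auto

text \<open>The curve is a graph over x, so arcs over disjoint intervals have disjoint images, also
  under the inverse of Q, and \<open>hausdorff_length_ge_arcs\<close> applies.\<close>

lemma cap_length_ge_chords:
  fixes Q :: "real^2^2"
  assumes Q: "invertible Q" and c: "0 < c" and I: "finite I"
    and lm: "\<And>k::nat. k \<in> I \<Longrightarrow> 0 \<le> l k \<and> l k < m k \<and> m k \<le> 1"
    and dj: "\<And>k j. k \<in> I \<Longrightarrow> j \<in> I \<Longrightarrow> k \<noteq> j \<Longrightarrow> {l k<..<m k} \<inter> {l j<..<m j} = {}"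
  shows "ennreal (\<Sum>k\<in>I. norm (matrix_inv Q *v (vector [m k - l k, tilt_y c (m k) - tilt_y c (l k)] :: real^2))) \<le> cap_length Q"
proof -
  define p where "p x = matrix_inv Q *v (vector [x, tilt_y c x] :: real^2)" for x
  have injQ: "inj ((*v) (matrix_inv Q))"
  proof (rule injI)
    fix x y assume "matrix_inv Q *v x = matrix_inv Q *v y"
    then have "Q *v (matrix_inv Q *v x) = Q *v (matrix_inv Q *v y)" by simp
    then show "x = y" using matrix_inv_mult(1)[OF Q] by (simp add: matrix_vector_mul_assoc)
  qed
  have pinj: "x = y" if "p x = p y" for x y
  proof -
    have "(vector [x, tilt_y c x] :: real^2) = vector [y, tilt_y c y]" using injD[OF injQ] that by (simp add: p_def)
    then have "(vector [x, tilt_y c x] :: real^2) $ 1 = (vector [y, tilt_y c y] :: real^2) $ 1" by simp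
    then show ?thesis by simp
  qed
  have pc: "continuous_on T p" for T
    unfolding p_def
    by (intro linear_continuous_on_compose[OF _ matrix_vector_mul_linear] continuous_on_vector2 continuous_on_id tilt_continuous[OF c])
  define w :: "real^3" where "w = vector [1 / sqrt (1 + c\<^sup>2), 0, c / sqrt (1 + c\<^sup>2)]"
  have "ennreal (\<Sum>k\<in>I. dist (p (l k)) (p (m k))) \<le> hausdorff_length ((*v) (matrix_inv Q) ` lambert_preimage (cap_boundary w 0))"
  proof (rule hausdorff_length_ge_arcs[OF I _ pc])
    show "l k < m k" if "k \<in> I" for k using lm[OF that] by simp
    show "p ` {l k<..<m k} \<subseteq> (*v) (matrix_inv Q) ` lambert_preimage (cap_boundary w 0)" if "k \<in> I" for k
      using lm[OF that] tilt_point[OF c] unfolding p_def w_def by auto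
    show "p ` {l k<..<m k} \<inter> p ` {l j<..<m j} = {}" if "k \<in> I" "j \<in> I" "k \<noteq> j" for k j
      using dj[OF that] pinj by blast
  qed
  also have "\<dots> \<le> cap_length Q"
    unfolding cap_length_def using tilt_normal[of c] by (intro SUP_upper2[of w] SUP_upper2[of 0]) (auto simp: w_def)
  also have "(\<Sum>k\<in>I. dist (p (l k)) (p (m k))) = (\<Sum>k\<in>I. norm (matrix_inv Q *v (vector [m k - l k, tilt_y c (m k) - tilt_y c (l k)] :: real^2)))"
  proof (rule sum.cong[OF refl])
    fix k
    have "(vector [m k - l k, tilt_y c (m k) - tilt_y c (l k)] :: real^2) = vector [m k, tilt_y c (m k)] - vector [l k, tilt_y c (l k)]"
      by (simp add: vec_eq_iff forall_2)
    then show "dist (p (l k)) (p (m k)) = norm (matrix_inv Q *v (vector [m k - l k, tilt_y c (m k) - tilt_y c (l k)] :: real^2))"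
      by (simp add: p_def dist_norm matrix_vector_mult_diff_distrib norm_minus_commute)
  qed
  finally show ?thesis .
qed

lemma vector2_axis: "(vector [a, b] :: real^2) = a *\<^sub>R axis 1 1 + b *\<^sub>R axis 2 1"
  by (simp add: vec_eq_iff forall_2 axis_def)

text \<open>The great circles \<open>w\<^sub>1 x\<^sub>1 + w\<^sub>3 x\<^sub>3 = 0\<close> degenerate, as \<open>w\<^sub>3 \<rightarrow> 0\<close>, to two vertical segments
  and the horizontal edges of the square.\<close>

lemma cap_length_ge:
  fixes Q :: "real^2^2"
  assumes Q: "invertible Q"
  shows "ennreal (2 * norm (matrix_inv Q *v axis 2 1) + norm (matrix_inv Q *v axis 1 1)) \<le> cap_length Q"
proof -
  define R V where "R = norm (matrix_inv Q *v axis 1 1)" "V = norm (matrix_inv Q *v axis 2 1)"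
  define nn where "nn a b = norm (matrix_inv Q *v (vector [a, b] :: real^2))" for a b
  have nnc: "((\<lambda>n. nn (f n) (g n)) \<longlongrightarrow> nn a b) F" if "(f \<longlongrightarrow> a) F" "(g \<longlongrightarrow> b) F" for f g a b and F :: "nat filter"
    unfolding nn_def vector2_axis matrix_vector_right_distrib matrix_vector_mult_scaleR
    using that by (intro tendsto_intros)
  have nnv: "nn a 0 = \<bar>a\<bar> * R" "nn 0 b = \<bar>b\<bar> * V" for a b
    unfolding nn_def vector2_axis R_V_def by (simp_all add: matrix_vector_mult_scaleR)
  have main: "ennreal ((1 / 4 - d) * R + nn (2 * d) (-1) + (1 / 2 - 2 * d) * R + nn (2 * d) 1 + (1 / 4 - d) * R) \<le> cap_length Q"
    if d: "0 < d" "d < 1 / 8" for d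
  proof -
    \<comment> \<open>As c tends to 0 the heights at these nodes tend to 1, 1, 0, 0, 1, 1. The gaps
      of size d keep the nodes away from 1/4 and 3/4, where the cosine vanishes and the limit graph
      jumps; d tends to 0 afterwards.\<close>
    define ls where "ls = [0, 1 / 4 - d, 1 / 4 + d, 3 / 4 - d, 3 / 4 + d, 1 :: real]"
    define l m where "l k = ls ! k" "m k = ls ! Suc k" for k
    have ls: "ls ! 0 = 0" "ls ! 1 = 1 / 4 - d" "ls ! 2 = 1 / 4 + d" "ls ! 3 = 3 / 4 - d" "ls ! 4 = 3 / 4 + d" "ls ! 5 = 1"
      by (simp_all add: ls_def eval_nat_numeral)
    have srt: "sorted ls" using d by (simp add: ls_def)
    have I: "k \<in> {..<5} \<longleftrightarrow> k = 0 \<or> k = 1 \<or> k = 2 \<or> k = 3 \<or> k = (4::nat)" for k by auto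
    have lm: "0 \<le> l k \<and> l k < m k \<and> m k \<le> 1" if "k \<in> {..<5}" for k
      using that d ls unfolding I by (auto simp: l_m_def eval_nat_numeral)
    have dj0: "{l k<..<m k} \<inter> {l j<..<m j} = {}" if "j < 5" "k < j" for k j
    proof -
      have "m k \<le> l j" using sorted_nth_mono[OF srt, of "Suc k" j] that by (simp add: l_m_def ls_def)
      then show ?thesis by auto
    qed
    have dj: "{l k<..<m k} \<inter> {l j<..<m j} = {}" if "k \<in> {..<5}" "j \<in> {..<5}" "k \<noteq> j" for k j
      using that dj0[of j k] dj0[of k j] by (cases k j rule: linorder_cases) auto
    define Y where "Y x n = tilt_y (inverse (real (Suc n))) x" for x n
    define Sg where "Sg n = (\<Sum>k<5. nn (m k - l k) (Y (m k) n - Y (l k) n))" for n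
    have le: "ennreal (Sg n) \<le> cap_length Q" for n
      using cap_length_ge_chords[OF Q, of "inverse (real (Suc n))" "{..<5}" l m] lm dj unfolding Sg_def Y_def nn_def by simp
    have cosv: "cos (2 * pi * (1 / 4 - d)) = sin (2 * pi * d)" "cos (2 * pi * (1 / 4 + d)) = - sin (2 * pi * d)"
      "cos (2 * pi * (3 / 4 - d)) = - sin (2 * pi * d)" "cos (2 * pi * (3 / 4 + d)) = sin (2 * pi * d)"
    proof -
      have e: "2 * pi * (1 / 4 - d) = pi / 2 - 2 * pi * d" "2 * pi * (1 / 4 + d) = 2 * pi * d + pi / 2"
        "2 * pi * (3 / 4 - d) = pi / 2 - 2 * pi * d + pi" "2 * pi * (3 / 4 + d) = (2 * pi * d + pi / 2) + pi" by (simp_all add: algebra_simps)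
      have s: "cos (x + pi / 2) = - sin x" for x :: real by (simp add: cos_add)
      show "cos (2 * pi * (1 / 4 - d)) = sin (2 * pi * d)" "cos (2 * pi * (1 / 4 + d)) = - sin (2 * pi * d)"
        "cos (2 * pi * (3 / 4 - d)) = - sin (2 * pi * d)" "cos (2 * pi * (3 / 4 + d)) = sin (2 * pi * d)"
        unfolding e by (simp_all only: cos_periodic_pi s minus_minus, simp_all add: cos_diff)
    qed
    have sp: "0 < sin (2 * pi * d)" using d by (intro sin_gt_zero) auto
    have lims: "Y 0 \<longlonglongrightarrow> 1" "Y (1 / 4 - d) \<longlonglongrightarrow> 1" "Y (1 / 4 + d) \<longlonglongrightarrow> 0" "Y (3 / 4 - d) \<longlonglongrightarrow> 0" "Y (3 / 4 + d) \<longlonglongrightarrow> 1" "Y 1 \<longlonglongrightarrow> 1"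
      using tilt_limit[of 0] tilt_limit[of "1 / 4 - d"] tilt_limit[of "1 / 4 + d"] tilt_limit[of "3 / 4 - d"] tilt_limit[of "3 / 4 + d"] tilt_limit[of 1] sp
      unfolding Y_def[abs_def] cosv by simp_all
    have exp: "Sg n = nn (1 / 4 - d) (Y (1 / 4 - d) n - Y 0 n) + nn (2 * d) (Y (1 / 4 + d) n - Y (1 / 4 - d) n)
       + nn (1 / 2 - 2 * d) (Y (3 / 4 - d) n - Y (1 / 4 + d) n) + nn (2 * d) (Y (3 / 4 + d) n - Y (3 / 4 - d) n)
       + nn (1 / 4 - d) (Y 1 n - Y (3 / 4 + d) n)" for n
      unfolding Sg_def l_m_def by (simp add: eval_nat_numeral lessThan_Suc ls_def algebra_simps)
    have "Sg \<longlonglongrightarrow> nn (1 / 4 - d) (1 - 1) + nn (2 * d) (0 - 1) + nn (1 / 2 - 2 * d) (0 - 0) + nn (2 * d) (1 - 0) + nn (1 / 4 - d) (1 - 1)"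
      unfolding exp[abs_def] by (intro tendsto_add nnc tendsto_diff lims tendsto_const)
    then have "Sg \<longlonglongrightarrow> (1 / 4 - d) * R + nn (2 * d) (-1) + (1 / 2 - 2 * d) * R + nn (2 * d) 1 + (1 / 4 - d) * R"
      using d by (simp add: nnv)
    from tendsto_ennrealI[OF this] show ?thesis
      by (rule tendsto_upperbound) (auto simp: le)
  qed
  define dd where "dd n = 1 / (real n + 9)" for n
  have ddr: "0 < dd n" "dd n < 1 / 8" for n by (simp_all add: dd_def field_simps)
  have dd: "dd \<longlonglongrightarrow> 0" unfolding dd_def by real_asymp
  have "(\<lambda>n. (1 / 4 - dd n) * R + nn (2 * dd n) (-1) + (1 / 2 - 2 * dd n) * R + nn (2 * dd n) 1 + (1 / 4 - dd n) * R)
     \<longlonglongrightarrow> (1 / 4 - 0) * R + nn (2 * 0) (-1) + (1 / 2 - 2 * 0) * R + nn (2 * 0) 1 + (1 / 4 - 0) * R"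
    by (intro tendsto_add nnc tendsto_diff tendsto_mult tendsto_const dd)
  then have "(\<lambda>n. (1 / 4 - dd n) * R + nn (2 * dd n) (-1) + (1 / 2 - 2 * dd n) * R + nn (2 * dd n) 1 + (1 / 4 - dd n) * R) \<longlonglongrightarrow> 2 * V + R"
    by (simp add: nnv add.commute)
  from tendsto_ennrealI[OF this] have "ennreal (2 * V + R) \<le> cap_length Q"
    by (rule tendsto_upperbound) (intro always_eventually allI main ddr, simp)
  then show ?thesis by (simp add: R_V_def)
qed

section \<open>Tiles as unit cells\<close>

lemma cap_in_borel: "cap w t \<in> sets borel"
proof -
  have "closed ({x. w \<bullet> x \<ge> t} \<inter> sphere 0 1)" by (intro closed_Int closed_halfspace_ge closed_sphere)
  moreover have "cap w t = {x. w \<bullet> x \<ge> t} \<inter> sphere 0 1" by (auto simp: cap_def)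
  ultimately show ?thesis by simp
qed

locale lattice_sample =
  fixes Q :: "real^2^2" and K :: nat and z :: "real^2 \<Rightarrow> real^2"
  assumes Qinv: "invertible Q" and K1: "1 \<le> K" and zt: "\<And>p. p \<in> plane_lattice Q \<Longrightarrow> z p \<in> tile Q K p"
begin

definition "emb P = (1 / real K) *\<^sub>R (Q *v (vector [fst P, snd P] :: real^2))"
definition "demb v = ((matrix_inv Q *v (real K *\<^sub>R v)) $ 1, (matrix_inv Q *v (real K *\<^sub>R v)) $ 2)"
definition "lat c = Q *v (vector [real_of_int (fst c), real_of_int (snd c)] :: real^2)"
definition "zz c = demb (z (lat c))"

lemma K0: "0 < real K" using K1 by simp

lemma vec2_eta: "(vector [v $ 1, v $ 2] :: real^2) = v" by (simp add: vec_eq_iff forall_2)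

lemma emb_demb [simp]: "emb (demb v) = v"
proof -
  have "Q *v (matrix_inv Q *v (real K *\<^sub>R v)) = real K *\<^sub>R v"
    using matrix_inv_mult(1)[OF Qinv] by (simp add: matrix_vector_mul_assoc)
  then show ?thesis using K0 by (simp add: emb_def demb_def vec2_eta)
qed

lemma demb_emb [simp]: "demb (emb P) = P"
proof -
  have "matrix_inv Q *v (real K *\<^sub>R emb P) = vector [fst P, snd P]"
    using K0 matrix_inv_mult(2)[OF Qinv] by (simp add: emb_def matrix_vector_mul_assoc)
  then show ?thesis by (simp add: demb_def)
qed

lemma continuous_emb: "continuous_on S emb"
  unfolding emb_def
  by (intro continuous_intros linear_continuous_on_compose[OF _ matrix_vector_mul_linear] continuous_on_vector2)

lemma continuous_demb: "continuous_on S demb"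
  unfolding demb_def
  by (intro continuous_intros linear_continuous_on_compose[OF _ matrix_vector_mul_linear])

lemma plane_lattice_lat: "plane_lattice Q = range lat"
proof (intro equalityI subsetI)
  fix p assume "p \<in> plane_lattice Q"
  then obtain v :: "real^2" where v: "\<forall>i. v $ i \<in> \<int>" "p = Q *v v" by (auto simp: plane_lattice_def)
  then obtain i j where "v $ 1 = real_of_int i" "v $ 2 = real_of_int j" by (meson Ints_cases)
  then have "p = lat (i, j)" using v(2) vec2_eta[of v] by (simp add: lat_def)
  then show "p \<in> range lat" by blast
qed (auto simp: plane_lattice_def lat_def forall_2)

lemma lat_emb: "lat c = real K *\<^sub>R emb (real_of_int (fst c), real_of_int (snd c))"
  using K0 by (simp add: lat_def emb_def)

lemma inj_lat: "inj lat"
proof (rule injI)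
  fix c c' assume "lat c = lat c'"
  then have "demb (emb (real_of_int (fst c), real_of_int (snd c))) = demb (emb (real_of_int (fst c'), real_of_int (snd c')))"
    using K0 by (simp add: lat_emb del: demb_emb)
  then show "c = c'" by (simp add: prod_eq_iff)
qed

lemma tile_lat: "tile Q K (lat c) = {v. demb v \<in> cell c}"
proof (intro equalityI subsetI)
  fix v assume "v \<in> tile Q K (lat c)"
  then obtain a :: "real^2" where a: "\<forall>i. 0 \<le> a $ i \<and> a $ i < 1" "v = (1 / real K) *\<^sub>R (lat c + Q *v a)"
    by (auto simp: tile_def fundamental_domain_def)
  have "v = emb (real_of_int (fst c) + a $ 1, real_of_int (snd c) + a $ 2)"
    unfolding a(2) lat_def emb_def matrix_vector_right_distrib[symmetric]
    by (rule arg_cong[where f = "\<lambda>v. (1 / real K) *\<^sub>R (Q *v v)"]) (simp add: vec_eq_iff forall_2)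
  then show "v \<in> {v. demb v \<in> cell c}" using a(1) by (simp add: cell_def)
next
  fix v assume "v \<in> {v. demb v \<in> cell c}"
  then obtain x y where xy: "demb v = (x, y)" "(x, y) \<in> cell c" by (cases "demb v") auto
  define a :: "real^2" where "a = vector [x - real_of_int (fst c), y - real_of_int (snd c)]"
  have "v = emb (x, y)" using emb_demb[of v] xy(1) by simp
  also have "\<dots> = (1 / real K) *\<^sub>R (lat c + Q *v a)"
    unfolding lat_def emb_def matrix_vector_right_distrib[symmetric]
    by (rule arg_cong[where f = "\<lambda>v. (1 / real K) *\<^sub>R (Q *v v)"]) (simp add: vec_eq_iff forall_2 a_def)
  finally have "v = (1 / real K) *\<^sub>R (lat c + Q *v a)" .
  moreover have "\<forall>i. 0 \<le> a $ i \<and> a $ i < 1" using xy(2) by (auto simp: a_def forall_2 cell_def)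
  ultimately show "v \<in> tile Q K (lat c)" by (auto simp: tile_def fundamental_domain_def)
qed

lemma interior_cell: "interior (cell c) = icell c"
  by (simp add: cell_eq_Times icell_def interior_Times)

lemma interior_tile: "interior (tile Q K (lat c)) = {v. demb v \<in> icell c}"
proof (rule interior_unique)
  show "{v. demb v \<in> icell c} \<subseteq> tile Q K (lat c)" using icell_subset[of c] by (auto simp: tile_lat)
  show "open {v. demb v \<in> icell c}"
    using open_vimage[OF open_icell continuous_demb] by (simp add: vimage_def)
  fix T assume T: "T \<subseteq> tile Q K (lat c)" "open T"
  have "open (emb -` T)" using open_vimage[OF T(2) continuous_emb] .
  moreover have "emb -` T \<subseteq> cell c" using T(1) by (auto simp: tile_lat)
  ultimately have "emb -` T \<subseteq> icell c" using interior_maximal interior_cell by blast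
  then show "T \<subseteq> {v. demb v \<in> icell c}" by (metis (mono_tags, lifting) emb_demb mem_Collect_eq subsetI subset_eq vimageI)
qed

lemma zz_cell: "zz c \<in> cell c"
  using zt[of "lat c"] by (auto simp: plane_lattice_lat tile_lat zz_def)

lemma emb_zz: "emb (zz c) = z (lat c)" by (simp add: zz_def)

lemma det_pos: "0 < \<bar>det Q\<bar>" using Qinv by (simp add: invertible_det_nz)

text \<open>The factor is the determinant of the map Q / K from lattice coordinates to the
  square.\<close>

lemma measure_emb:
  assumes S: "S \<in> sets borel" "bounded S"
  shows "measure lborel S = \<bar>det Q\<bar> / (real K)\<^sup>2 * measure lborel {P. emb P \<in> S}"
proof -
  define f where "f w = (1 / real K) *\<^sub>R (Q *v w)" for w
  define g where "g v = matrix_inv Q *v (real K *\<^sub>R v)" for v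
  have lf: "linear f" unfolding f_def[abs_def] by (intro linear_compose_scale_right matrix_vector_mul_linear)
  have lg: "linear g" unfolding g_def[abs_def]
    by (rule linear_compose[OF linear_scaleR matrix_vector_mul_linear, unfolded o_def])
  have fg: "f (g v) = v" for v using K0 matrix_inv_mult(1)[OF Qinv] by (simp add: f_def g_def matrix_vector_mul_assoc)
  have gf: "g (f v) = v" for v using K0 matrix_inv_mult(2)[OF Qinv] by (simp add: f_def g_def matrix_vector_mul_assoc)
  have Sl: "S \<in> lmeasurable" using S by (intro bounded_set_imp_lmeasurable) auto
  have gS: "g ` S \<in> lmeasurable" by (rule measurable_linear_image[OF lg Sl])
  have eq: "g ` S = {w. f w \<in> S}" using fg gf by (auto simp: image_iff) (metis gf)
  have "f \<in> borel_measurable borel" using linear_continuous_on[OF linear_conv_bounded_linear[THEN iffD1, OF lf]]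
    by (intro borel_measurable_continuous_onI) auto
  then have b: "{w. f w \<in> S} \<in> sets borel" using measurable_sets[of f borel borel S] S(1) by (simp add: vimage_def)
  have "f ` (g ` S) = S" by (simp add: image_image fg)
  then have "measure lebesgue S = \<bar>det (matrix f)\<bar> * measure lebesgue {w. f w \<in> S}"
    using measure_linear_image[OF lf gS] eq by simp
  moreover have "det (matrix f) = det Q / (real K)\<^sup>2"
  proof -
    have "matrix f $ i $ j = Q $ i $ j / real K" for i j
      by (simp add: matrix_def f_def matrix_vector_mul_component column_def matrix_vector_mult_basis)
    then show ?thesis by (simp add: det_2 power2_eq_square diff_divide_distrib)
  qed
  ultimately have "measure lborel S = \<bar>det Q\<bar> / (real K)\<^sup>2 * measure lborel {w. f w \<in> S}"
    using S(1) b by (simp add: abs_divide measure_def)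
  also have "measure lborel {w. f w \<in> S} = measure lborel {P. emb P \<in> S}"
    using measure_vec2(1)[OF b] by (simp add: f_def emb_def)
  finally show ?thesis .
qed

end

section \<open>A generic cap and the sampled points in lattice coordinates\<close>

locale cap_sample = lattice_sample Q K z +
  cap_cells r s t \<phi> "Q $ 1 $ 1" "Q $ 1 $ 2" "Q $ 2 $ 1" "Q $ 2 $ 2" "real K" for Q K z r s t \<phi> +
  assumes N1: "1 \<le> card (lattice_points Q z)"
begin

lemma emb_XY: "emb P $ 1 = X P" "emb P $ 2 = Y P"
  by (simp_all add: emb_def sqx_def sqy_def matrix_vector_mult_def sum_2)

lemma Om_emb: "P \<in> Om \<longleftrightarrow> emb P \<in> unit_square"
  by (simp add: Om_def unit_square_def emb_XY)

lemma bounded_unit_square: "bounded unit_square"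
proof (rule bounded_subset)
  show "bounded (cbox (0::real^2) 1)" by (rule bounded_cbox)
  show "unit_square \<subseteq> cbox 0 1" by (auto simp: unit_square_def mem_box_cart forall_2)
qed

lemma measure_emb_sub: "S \<in> sets borel \<Longrightarrow> S \<subseteq> unit_square \<Longrightarrow> measure lborel S = \<bar>det Q\<bar> / (real K)\<^sup>2 * measure lborel {P. emb P \<in> S}"
  using measure_emb bounded_subset[OF bounded_unit_square] by blast

lemma measure_Om: "measure lborel Om = (real K)\<^sup>2 / \<bar>det Q\<bar>"
proof -
  have O: "Om = {P. emb P \<in> unit_square}" using Om_emb by auto
  have u: "measure lborel unit_square = 1" using measure_unit_square by (simp add: measure_def)
  define m where "m = measure lborel Om"
  have "1 = \<bar>det Q\<bar> / (real K)\<^sup>2 * m"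
    using measure_emb_sub[OF unit_square_borel order_refl] unfolding O[symmetric] u m_def .
  then show ?thesis unfolding m_def[symmetric] using det_pos K0 by (simp add: field_simps)
qed

lemma sample_cells:
  "bij_betw (\<lambda>c. z (lat c)) {c \<in> Sc. zz c \<in> Om \<and> R (z (lat c))} {p \<in> lattice_points Q z. R p}"
  unfolding bij_betw_def
proof
  show "inj_on (\<lambda>c. z (lat c)) {c \<in> Sc. zz c \<in> Om \<and> R (z (lat c))}"
  proof (rule inj_onI)
    fix c c' assume "z (lat c) = z (lat c')"
    then have "zz c = zz c'" by (simp add: zz_def)
    then show "c = c'" using zz_cell[of c] zz_cell[of c'] cell_disjoint[of c c'] by force
  qed
  show "(\<lambda>c. z (lat c)) ` {c \<in> Sc. zz c \<in> Om \<and> R (z (lat c))} = {p \<in> lattice_points Q z. R p}"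
  proof (intro equalityI subsetI)
    fix p assume "p \<in> (\<lambda>c. z (lat c)) ` {c \<in> Sc. zz c \<in> Om \<and> R (z (lat c))}"
    then show "p \<in> {p \<in> lattice_points Q z. R p}"
      by (auto simp: lattice_points_def plane_lattice_lat Om_emb emb_zz)
  next
    fix p assume "p \<in> {p \<in> lattice_points Q z. R p}"
    then obtain c where c: "p = z (lat c)" "p \<in> unit_square" "R p" by (auto simp: lattice_points_def plane_lattice_lat)
    then have "zz c \<in> Om" by (simp add: Om_emb emb_zz)
    moreover from this have "c \<in> Sc" using zz_cell[of c] by (auto simp: Sc_def)
    ultimately show "p \<in> (\<lambda>c. z (lat c)) ` {c \<in> Sc. zz c \<in> Om \<and> R (z (lat c))}" using c by auto
  qed
qed

lemma card_sample: "card {p \<in> lattice_points Q z. R p} = card {c \<in> Sc. zz c \<in> Om \<and> R (emb (zz c))}"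
  using bij_betw_same_card[OF sample_cells[of R]] by (simp add: emb_zz)

definition "NN = card (lattice_points Q z)"

lemma NN: "NN = card {c \<in> Sc. zz c \<in> Om}"
  using card_sample[of "\<lambda>_. True"] by (simp add: NN_def)

lemma NN_pos: "0 < real NN" using N1 by (simp add: NN_def)

text \<open>The area of the square in units of cells, divided by the number of points. Scaled back
  to the square, each point gets the weight 1/N.\<close>

definition "\<rho> = (real K)\<^sup>2 / \<bar>det Q\<bar> / real NN"
definition "EE = 2 * (real K * (b1 + b2)) + 2 * (real K * (e1 + e2)) + 12"

lemma rho_pos: "0 < \<rho>" using K0 det_pos NN_pos by (simp add: \<rho>_def)

lemma frontier_Om: "frontier Om \<subseteq> bd"
proof -
  have "closure Om \<subseteq> {P. 0 \<le> X P \<and> X P \<le> 1 \<and> 0 \<le> Y P \<and> Y P \<le> 1}"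
  proof (rule closure_minimal)
    show "closed {P. 0 \<le> X P \<and> X P \<le> 1 \<and> 0 \<le> Y P \<and> Y P \<le> 1}"
      by (intro closed_Collect_conj closed_Collect_le continuous_on_const continuous_XY)
  qed (auto simp: Om_def)
  moreover have "osq \<subseteq> interior Om" using osq_Om open_osq by (rule interior_maximal)
  moreover have "frontier Om = closure Om - interior Om" by (simp add: frontier_def)
  moreover have "{P. 0 \<le> X P \<and> X P \<le> 1 \<and> 0 \<le> Y P \<and> Y P \<le> 1} - osq \<subseteq> bd" by (auto simp: osq_def bd_def)
  ultimately show ?thesis by blast
qed

definition "Bc = Vc 0 0 1 \<union> Vc 1 0 1 \<union> Hc 0 \<union> Hc 1"

lemma Bc_count: "finite Bc" "real (card Bc) \<le> EE"
proof -
  show "finite Bc" using Vc_count(1) Hc_count(1) by (simp add: Bc_def)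
  have "card Bc \<le> card (Vc 0 0 1) + card (Vc 1 0 1) + card (Hc 0) + card (Hc 1)"
    unfolding Bc_def by (intro order.trans[OF card_Un_le] add_mono card_Un_le order_refl)
  then show "real (card Bc) \<le> EE"
    using Vc_count(2)[of 0 1 0] Vc_count(2)[of 0 1 1] Hc_count(2)[of 0] Hc_count(2)[of 1] by (simp add: EE_def)
qed

lemma bd_Bc: "P \<in> cell c \<Longrightarrow> P \<in> bd \<Longrightarrow> c \<in> Bc"
  unfolding Bc_def Vc_def Hc_def bd_def by auto

lemma inner_cells:
  assumes "c \<in> Sc" "c \<notin> Bc"
  shows "cell c \<subseteq> Om"
proof (rule ccontr)
  assume "\<not> cell c \<subseteq> Om"
  then have "cell c \<inter> frontier Om \<noteq> {}"
    using connected_Int_frontier[OF convex_connected[OF convex_cell], of c Om] assms(1) by (auto simp: Sc_def)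
  then show False using frontier_Om bd_Bc assms(2) by blast
qed

text \<open>A cell that does not meet the edge contributes one point and area one, so number and
  area differ by at most the number of edge cells.\<close>

lemma N_bound: "\<bar>real NN - (real K)\<^sup>2 / \<bar>det Q\<bar>\<bar> \<le> EE" "real (card Sc) \<le> real NN + EE"
proof -
  define h where "h c = indicator Om (zz c) - measure lborel (cell c \<inter> Om)" for c
  have h1: "\<bar>h c\<bar> \<le> 1" for c using measure_cell_Int_le[of c Om] Om_borel by (auto simp: h_def indicator_def)
  have h0: "h c = 0" if "c \<in> Sc - Bc" for c
  proof -
    have "cell c \<subseteq> Om" using inner_cells that by blast
    then have "cell c \<inter> Om = cell c" "zz c \<in> Om" using zz_cell[of c] by auto
    then show ?thesis by (simp add: h_def measure_cell)
  qed
  have ind: "(\<Sum>c\<in>Sc. indicator Om (zz c)) = real NN"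
    using finite_Sc by (simp add: NN indicator_def sum.If_cases Int_def)
  have "real NN - (real K)\<^sup>2 / \<bar>det Q\<bar> = (\<Sum>c\<in>Sc. h c)"
    unfolding h_def sum_subtractf ind measure_sum_cells[OF Om_borel order_refl, symmetric] measure_Om ..
  also have "\<dots> = (\<Sum>c\<in>Sc \<inter> Bc. h c)" by (rule sum.mono_neutral_right) (use finite_Sc h0 in auto)
  finally have "\<bar>real NN - (real K)\<^sup>2 / \<bar>det Q\<bar>\<bar> \<le> (\<Sum>c\<in>Sc \<inter> Bc. \<bar>h c\<bar>)" using sum_abs by simp
  also have "\<dots> \<le> real (card (Sc \<inter> Bc)) * 1" using h1 by (rule sum_bounded_above)
  also have "\<dots> \<le> card Bc" using Bc_count by (simp add: card_mono)
  finally show "\<bar>real NN - (real K)\<^sup>2 / \<bar>det Q\<bar>\<bar> \<le> EE" using Bc_count by simp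
  have "Sc \<subseteq> {c \<in> Sc. zz c \<in> Om} \<union> Bc" using inner_cells zz_cell by blast
  then have "card Sc \<le> card ({c \<in> Sc. zz c \<in> Om} \<union> Bc)" using finite_Sc Bc_count by (intro card_mono) auto
  also have "\<dots> \<le> NN + card Bc" unfolding NN by (rule card_Un_le)
  finally show "real (card Sc) \<le> real NN + EE" using Bc_count by linarith
qed

lemma edge_path_image:
  assumes "S \<subseteq> {0..1}"
  shows "square_boundary_path ` height_params S = {v. demb v \<in> bd \<and> v $ 2 \<in> S}"
proof -
  have bdv: "demb v \<in> bd \<longleftrightarrow> (v $ 1 = 0 \<or> v $ 1 = 1) \<and> 0 \<le> v $ 2 \<and> v $ 2 \<le> 1 \<or> (v $ 2 = 0 \<or> v $ 2 = 1) \<and> 0 \<le> v $ 1 \<and> v $ 1 \<le> 1" for v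
    using emb_XY[of "demb v"] by (simp add: bd_def)
  have comp: "square_boundary_path x $ 1 = edge_fun x" "square_boundary_path x $ 2 = edge_fun (4 - x)" for x
    by (simp_all add: square_boundary_path_def axis_def)
  show ?thesis
  proof (intro equalityI subsetI)
    fix v assume "v \<in> square_boundary_path ` height_params S"
    then obtain x where x: "0 \<le> x" "x \<le> 4" "edge_fun (4 - x) \<in> S" "v = square_boundary_path x" by (auto simp: height_params_def)
    have "(v $ 1 = 0 \<or> v $ 1 = 1) \<and> 0 \<le> v $ 2 \<and> v $ 2 \<le> 1 \<or> (v $ 2 = 0 \<or> v $ 2 = 1) \<and> 0 \<le> v $ 1 \<and> v $ 1 \<le> 1"
      unfolding x(4) comp using x(1,2) unfolding edge_fun_def by (auto simp: min_def max_def)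
    then show "v \<in> {v. demb v \<in> bd \<and> v $ 2 \<in> S}" using x(3) unfolding mem_Collect_eq bdv x(4) comp by blast
  next
    fix v assume "v \<in> {v. demb v \<in> bd \<and> v $ 2 \<in> S}"
    then have v: "(v $ 1 = 0 \<or> v $ 1 = 1) \<and> 0 \<le> v $ 2 \<and> v $ 2 \<le> 1 \<or> (v $ 2 = 0 \<or> v $ 2 = 1) \<and> 0 \<le> v $ 1 \<and> v $ 1 \<le> 1" "v $ 2 \<in> S"
      unfolding mem_Collect_eq bdv by auto
    have "\<exists>x. 0 \<le> x \<and> x \<le> 4 \<and> edge_fun x = v $ 1 \<and> edge_fun (4 - x) = v $ 2"
    proof -
      consider "v $ 2 = 0" "0 \<le> v $ 1" "v $ 1 \<le> 1" | "v $ 1 = 1" "0 \<le> v $ 2" "v $ 2 \<le> 1"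
        | "v $ 2 = 1" "0 \<le> v $ 1" "v $ 1 \<le> 1" | "v $ 1 = 0" "0 \<le> v $ 2" "v $ 2 \<le> 1" using v(1) by blast
      then show ?thesis
      proof cases
        case 1 then show ?thesis by (intro exI[of _ "v $ 1"]) (auto simp: edge_fun_def)
      next
        case 2 then show ?thesis by (intro exI[of _ "1 + v $ 2"]) (auto simp: edge_fun_def)
      next
        case 3 then show ?thesis by (intro exI[of _ "3 - v $ 1"]) (auto simp: edge_fun_def)
      next
        case 4 then show ?thesis by (intro exI[of _ "4 - v $ 2"]) (auto simp: edge_fun_def)
      qed
    qed
    then obtain x where x: "0 \<le> x" "x \<le> 4" "edge_fun x = v $ 1" "edge_fun (4 - x) = v $ 2" by blast
    have "v = square_boundary_path x" using x comp[of x] by (simp add: vec_eq_iff forall_2)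
    moreover have "x \<in> height_params S" using x v(2) by (simp add: height_params_def)
    ultimately show "v \<in> square_boundary_path ` height_params S" by blast
  qed
qed

lemma adjacent_AdL:
  assumes "S \<subseteq> {0..1}"
  shows "adjacent Q K S = lat ` AdL S"
proof -
  have "interior (tile Q K (lat c)) \<inter> square_boundary_path ` height_params S \<noteq> {} \<longleftrightarrow> c \<in> AdL S" for c
  proof -
    have "(\<exists>v. demb v \<in> icell c \<and> demb v \<in> bd \<and> v $ 2 \<in> S) \<longleftrightarrow> (\<exists>b. b \<in> icell c \<and> b \<in> bd \<and> Y b \<in> S)"
      using emb_XY(2) by (metis demb_emb emb_demb)
    then show ?thesis unfolding interior_tile edge_path_image[OF assms] AdL_def by auto
  qed
  then show ?thesis unfolding adjacent_def plane_lattice_lat by auto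
qed

lemma defect_mass:
  assumes "S \<subseteq> {0..1}"
  shows "real K / \<bar>det Q\<bar> * \<bar>\<Sum>p\<in>adjacent Q K S. indicator (lattice_points Q z) (z p) / real (card (lattice_points Q z))
             - measure lborel (tile Q K p \<inter> unit_square)\<bar> = \<bar>\<Sum>c\<in>AdL S. mass \<rho> zz c\<bar> / real K"
proof -
  define \<kappa> where "\<kappa> = \<bar>det Q\<bar> / (real K)\<^sup>2"
  have \<kappa>: "0 < \<kappa>" using det_pos K0 by (simp add: \<kappa>_def)
  have tm: "indicator (lattice_points Q z) (z (lat c)) / real (card (lattice_points Q z)) - measure lborel (tile Q K (lat c) \<inter> unit_square)
      = \<kappa> * mass \<rho> zz c" for c
  proof -
    have "z (lat c) \<in> lattice_points Q z \<longleftrightarrow> zz c \<in> Om"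
      by (simp add: lattice_points_def plane_lattice_lat Om_emb emb_zz)
    then have i: "indicator (lattice_points Q z) (z (lat c)) = (indicator Om (zz c) :: real)" by (simp add: indicator_def)
    have "tile Q K (lat c) \<in> sets borel"
      using measurable_sets[OF borel_measurable_continuous_onI[OF continuous_demb] cell_borel, of c] by (simp add: tile_lat vimage_def)
    then have "measure lborel (tile Q K (lat c) \<inter> unit_square) = \<kappa> * measure lborel {P. emb P \<in> tile Q K (lat c) \<inter> unit_square}"
      unfolding \<kappa>_def by (intro measure_emb_sub) auto
    also have "{P. emb P \<in> tile Q K (lat c) \<inter> unit_square} = cell c \<inter> Om" by (auto simp: tile_lat Om_emb)
    finally have m: "measure lborel (tile Q K (lat c) \<inter> unit_square) = \<kappa> * measure lborel (cell c \<inter> Om)" .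
    have "\<kappa> * \<rho> = 1 / real NN" using det_pos K0 by (simp add: \<kappa>_def \<rho>_def)
    then show ?thesis unfolding i m mass_def NN_def[symmetric] by (simp add: right_diff_distrib mult.assoc[symmetric])
  qed
  have "(\<Sum>p\<in>adjacent Q K S. indicator (lattice_points Q z) (z p) / real (card (lattice_points Q z)) - measure lborel (tile Q K p \<inter> unit_square))
      = (\<Sum>c\<in>AdL S. \<kappa> * mass \<rho> zz c)"
    unfolding adjacent_AdL[OF assms] using inj_lat by (subst sum.reindex) (auto simp: inj_on_def tm dest: injD)
  also have "\<dots> = \<kappa> * (\<Sum>c\<in>AdL S. mass \<rho> zz c)" by (simp add: sum_distrib_left)
  finally have e: "(\<Sum>p\<in>adjacent Q K S. indicator (lattice_points Q z) (z p) / real (card (lattice_points Q z)) - measure lborel (tile Q K p \<inter> unit_square))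
      = \<kappa> * (\<Sum>c\<in>AdL S. mass \<rho> zz c)" .
  have "real K / \<bar>det Q\<bar> * \<kappa> = 1 / real K" using det_pos K0 by (simp add: \<kappa>_def power2_eq_square)
  then show ?thesis unfolding e abs_mult using \<kappa> by (simp add: mult.assoc[symmetric])
qed

text \<open>Besides giving a first estimate of M, this shows that the real supremum defining
  \<open>boundary_defect\<close> is over a bounded set, without which its value would not bound the
  single sums.\<close>

lemma AdL_mass_bound: "\<bar>\<Sum>c\<in>AdL S. mass \<rho> zz c\<bar> \<le> (\<rho> + 1) * EE"
proof -
  have m: "\<bar>mass \<rho> zz c\<bar> \<le> \<rho> + 1" for c
  proof -
    define m where "m = measure lborel (cell c \<inter> Om)"
    have "0 \<le> m" "m \<le> 1" using measure_cell_Int_le[of c Om] by (simp_all add: m_def)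
    then show ?thesis using rho_pos unfolding mass_def m_def[symmetric] by (simp add: indicator_def abs_le_iff)
  qed
  have sub: "AdL S \<subseteq> Bc" using bd_Bc icell_subset by (fastforce simp: AdL_def)
  have "\<bar>\<Sum>c\<in>AdL S. mass \<rho> zz c\<bar> \<le> (\<Sum>c\<in>AdL S. \<bar>mass \<rho> zz c\<bar>)" by (rule sum_abs)
  also have "\<dots> \<le> real (card (AdL S)) * (\<rho> + 1)" using m by (rule sum_bounded_above)
  also have "\<dots> \<le> EE * (\<rho> + 1)"
    using card_mono[OF Bc_count(1) sub] Bc_count(2) rho_pos by (intro mult_right_mono) auto
  finally show ?thesis by (simp add: mult.commute)
qed

lemma defect_bounds:
  shows "0 \<le> a \<Longrightarrow> a < b \<Longrightarrow> b \<le> 1 \<Longrightarrow> \<bar>\<Sum>c\<in>AdL {a..b}. mass \<rho> zz c\<bar> \<le> real K * boundary_defect Q K z"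
    "boundary_defect Q K z \<le> (\<rho> + 1) * EE / real K" "0 \<le> boundary_defect Q K z"
proof -
  define I where "I = {(a, b). 0 \<le> a \<and> a < b \<and> b \<le> (1::real)}"
  define f where "f = (\<lambda>(a, b). real K / \<bar>det Q\<bar> * \<bar>\<Sum>p\<in>adjacent Q K {a..b}. indicator (lattice_points Q z) (z p) / real (card (lattice_points Q z))
             - measure lborel (tile Q K p \<inter> unit_square)\<bar>)"
  have bdf: "boundary_defect Q K z = Sup (f ` I)" by (simp add: boundary_defect_def f_def I_def)
  have fI: "f (a, b) = \<bar>\<Sum>c\<in>AdL {a..b}. mass \<rho> zz c\<bar> / real K" if "(a, b) \<in> I" for a b
    unfolding f_def prod.case by (rule defect_mass) (use that in \<open>auto simp: I_def\<close>)
  have fb: "f x \<le> (\<rho> + 1) * EE / real K" "0 \<le> f x" if "x \<in> I" for x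
    using that fI[of "fst x" "snd x"] AdL_mass_bound K0 by (auto intro!: divide_right_mono)
  have bdd: "bdd_above (f ` I)" by (rule bdd_aboveI2) (rule fb(1))
  have ne: "(0, 1) \<in> I" by (simp add: I_def)
  show "boundary_defect Q K z \<le> (\<rho> + 1) * EE / real K" unfolding bdf using ne fb(1) by (intro cSUP_least) auto
  show "0 \<le> boundary_defect Q K z" unfolding bdf using cSUP_upper[OF ne bdd] fb(2)[OF ne] by simp
  assume "0 \<le> a" "a < b" "b \<le> 1"
  then have i: "(a, b) \<in> I" by (simp add: I_def)
  have "\<bar>\<Sum>c\<in>AdL {a..b}. mass \<rho> zz c\<bar> / real K \<le> boundary_defect Q K z"
    unfolding bdf fI[OF i, symmetric] by (rule cSUP_upper[OF i bdd])
  then show "\<bar>\<Sum>c\<in>AdL {a..b}. mass \<rho> zz c\<bar> \<le> real K * boundary_defect Q K z" using K0 by (simp add: field_simps)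
qed

definition "wv = (vector [r * cos \<phi>, r * sin \<phi>, s] :: real^3)"

lemma wv_F:
  assumes "P \<in> Om"
  shows "wv \<bullet> lambert (emb P) - t = F P"
proof -
  have y: "0 < Y P" "Y P < 1" using assms by (auto simp: Om_def)
  have h: "hgt (Y P) = 1 - 2 * Y P" using y by (simp add: hgt_def)
  have "1 - (1 - 2 * Y P)\<^sup>2 = 2\<^sup>2 * (Y P - (Y P)\<^sup>2)" by (simp add: power2_eq_square algebra_simps)
  then have "sqrt (1 - (1 - 2 * Y P)\<^sup>2) = sqrt (2\<^sup>2 * (Y P - (Y P)\<^sup>2))" by (simp only:)
  also have "\<dots> = 2 * sqrt (Y P - (Y P)\<^sup>2)" unfolding real_sqrt_mult by simp
  finally have q: "sqrt (1 - (1 - 2 * Y P)\<^sup>2) = 2 * sqrt (Y P - (Y P)\<^sup>2)" .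
  show ?thesis unfolding FK_def sqF_def h q cos_diff
    by (simp add: wv_def lambert_def inner_vec_def sum_3 emb_XY algebra_simps)
qed

definition "cap_set = {P \<in> Om. 0 \<le> F P}"

lemma cap_set_emb: "{P. emb P \<in> lambert_preimage (cap wv t)} = cap_set"
proof -
  have "emb P \<in> lambert_preimage (cap wv t) \<longleftrightarrow> P \<in> Om \<and> 0 \<le> F P" for P
  proof (cases "P \<in> Om")
    case True
    then have "emb P \<in> unit_square" by (simp add: Om_emb)
    then show ?thesis using lambert_norm[of "emb P"] wv_F[OF True] True by (auto simp: lambert_preimage_def cap_def)
  qed (simp add: lambert_preimage_def Om_emb)
  then show ?thesis by (auto simp: cap_set_def)
qed

text \<open>Only the excess of points over area is bounded. Deficits are treated later as excesses
  of complementary caps, so that the estimate over cells has to be made in one direction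
  only.\<close>

lemma cap_excess:
  "real (card {p \<in> lattice_points Q z. lambert p \<in> cap wv t}) / real NN - measure sphere_measure (cap wv t)
   \<le> \<bar>det Q\<bar> / (real K)\<^sup>2 * (real K * boundary_defect Q K z + \<bar>\<rho> - 1\<bar> * card Sc
       + real K * (sqrt 2 * (2 * sqrt (b1\<^sup>2 + b2\<^sup>2) + sqrt (e1\<^sup>2 + e2\<^sup>2))) + (Cx + 1500))"
proof -
  have Arb: "cap_set \<in> sets borel"
  proof -
    have "closed {P. 0 \<le> F P}" by (intro closed_Collect_le continuous_on_const continuous_FK)
    then have "{P. 0 \<le> F P} \<in> sets borel" by simp
    then have "Om \<inter> {P. 0 \<le> F P} \<in> sets borel" using Om_borel by (rule sets.Int[rotated])
    moreover have "Om \<inter> {P. 0 \<le> F P} = cap_set" by (auto simp: cap_set_def)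
    ultimately show ?thesis by simp
  qed
  interpret CP: cap_points r s t \<phi> "Q $ 1 $ 1" "Q $ 1 $ 2" "Q $ 2 $ 1" "Q $ 2 $ 2" "real K" zz \<rho> "real K * boundary_defect Q K z" cap_set
  proof
    show "\<rho> * real (card {c \<in> Sc. zz c \<in> Om}) = measure lborel Om"
      unfolding NN[symmetric] measure_Om using NN_pos by (simp add: \<rho>_def)
  qed (use zz_cell rho_pos defect_bounds(1) Arb in \<open>auto simp: cap_set_def\<close>)
  define \<kappa> where "\<kappa> = \<bar>det Q\<bar> / (real K)\<^sup>2"
  have \<kappa>: "0 < \<kappa>" "\<kappa> * \<rho> = 1 / real NN" using det_pos K0 by (simp_all add: \<kappa>_def \<rho>_def)
  have "measure sphere_measure (cap wv t) = measure lborel (lambert_preimage (cap wv t))"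
    by (rule measure_sphere_lambert[OF cap_in_borel])
  also have "\<dots> = \<kappa> * measure lborel cap_set"
    unfolding \<kappa>_def cap_set_emb[symmetric]
    by (rule measure_emb_sub) (auto simp: lambert_preimage_def intro!: lambert_preimage_borel[OF cap_in_borel, unfolded lambert_preimage_def])
  finally have m: "measure sphere_measure (cap wv t) = \<kappa> * measure lborel cap_set" .
  have "{c \<in> Sc. zz c \<in> Om \<and> lambert (emb (zz c)) \<in> cap wv t} = {c \<in> Sc. zz c \<in> cap_set}"
    unfolding cap_set_emb[symmetric] by (auto simp: lambert_preimage_def Om_emb)
  then have "card {p \<in> lattice_points Q z. lambert p \<in> cap wv t} = card {c \<in> Sc. zz c \<in> cap_set}"
    using card_sample[of "\<lambda>p. lambert p \<in> cap wv t"] by simp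
  then have "real (card {p \<in> lattice_points Q z. lambert p \<in> cap wv t}) / real NN - measure sphere_measure (cap wv t) = \<kappa> * CP.err"
    unfolding m CP.err_def right_diff_distrib mult.assoc[symmetric] \<kappa>(2) by simp
  also have "\<dots> \<le> \<kappa> * (real K * boundary_defect Q K z + \<bar>\<rho> - 1\<bar> * card Sc
       + real K * (sqrt 2 * (2 * CP.VV + CP.RR)) + (Cx + 1500))"
    using CP.positive_side \<kappa>(1) by (intro mult_left_mono) auto
  finally show ?thesis by (simp add: \<kappa>_def CP.VV_def CP.RR_def)
qed

end

section \<open>From generic caps to all caps\<close>

text \<open>The scale D / K has to be exchanged for sqrt(D / N), and |\<rho> - 1| S has to become
  the defect \<open>d\<close>. Since N and A = K^2 / D differ by O(K), both replacements cost O(1 /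
  N). The assumption \<open>KG\<close> keeps N and A within a factor of 2 of each other.\<close>

lemma main_arith:
  fixes A D G K M N S W X d \<rho> :: real
  assumes K: "1 \<le> K" and D: "0 < D" and G: "0 \<le> G" and N: "0 < N" and A: "A = K\<^sup>2 / D"
    and NA: "\<bar>N - A\<bar> \<le> K * G" and KG: "2 * D * G \<le> K" and S: "0 \<le> S" "S \<le> N + K * G"
    and \<rho>: "\<rho> = A / N" and d: "d = 1 / K * \<bar>N - A\<bar>" and M: "0 \<le> M" "M \<le> (\<rho> + 1) * G" and W: "0 \<le> W" and X: "0 \<le> X"
  shows "D / K\<^sup>2 * (K * M + \<bar>\<rho> - 1\<bar> * S + K * W + X)
    \<le> (d + W + M) * (sqrt D / sqrt N) + (D * G * (4 * G + W) + D * G\<^sup>2 + 2 * X) / N"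
proof -
  have A0: "0 < A" using K D by (simp add: A)
  have "K * (2 * D * G) \<le> K * K" using K KG by (intro mult_left_mono) auto
  then have "2 * (K * G) \<le> A" using D by (simp add: A field_simps power2_eq_square)
  then have NA2: "A \<le> 2 * N" "N \<le> 2 * A" using NA by (auto simp: abs_le_iff)
  have "\<rho> \<le> 2" using NA2 N by (simp add: \<rho> field_simps)
  then have "(\<rho> + 1) * G \<le> 3 * G" using G by (intro mult_right_mono) auto
  then have M3: "M \<le> 3 * G" using M by simp
  have dG: "d \<le> G" "0 \<le> d" using NA K by (simp_all add: d field_simps)
  have r1: "\<bar>\<rho> - 1\<bar> = K * d / N"
  proof -
    have "\<rho> - 1 = (A - N) / N" using N by (simp add: \<rho> diff_divide_distrib)
    then show ?thesis using N K by (simp add: d abs_divide abs_minus_commute)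
  qed
  have "\<bar>\<rho> - 1\<bar> * S \<le> K * d / N * (N + K * G)"
    unfolding r1 using S N K dG by (intro mult_left_mono) auto
  also have "\<dots> = K * d + K\<^sup>2 * (d * G) / N" using N by (simp add: field_simps power2_eq_square)
  finally have "D / K\<^sup>2 * (K * M + \<bar>\<rho> - 1\<bar> * S + K * W + X) \<le> D / K\<^sup>2 * (K * M + (K * d + K\<^sup>2 * (d * G) / N) + K * W + X)"
    using D K by (intro mult_left_mono add_mono) auto
  also have "\<dots> = D / K * (d + W + M) + D * (d * G) / N + X / A"
    using K D N by (simp add: A field_simps power2_eq_square)
  also have "\<dots> \<le> (sqrt D / sqrt N + D * G / N) * (d + W + M) + D * (G * G) / N + 2 * X / N"
  proof (intro add_mono mult_right_mono)
    define a b where "a = D / K" "b = sqrt D / sqrt N"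
    have a: "0 < a" using D K by (simp add: a_b_def)
    have b: "0 < b" "b\<^sup>2 = D / N" using D N by (simp_all add: a_b_def power_divide)
    \<comment> \<open>Comparing squares avoids roots: the difference of the squares contains a
      factor a, which is cancelled against a + b.\<close>
    have "a\<^sup>2 - b\<^sup>2 = D * (N - A) / (A * N)" using D N K unfolding b(2) by (simp add: a_b_def A field_simps power2_eq_square)
    also have "\<dots> \<le> D * (K * G) / (A * N)" using NA D A0 N by (intro divide_right_mono mult_left_mono) auto
    also have "\<dots> = a * (D * G / N)" using D N K by (simp add: a_b_def A field_simps power2_eq_square)
    finally have 1: "(a - b) * (a + b) \<le> a * (D * G / N)" by (simp add: power2_eq_square algebra_simps)
    show "D / K \<le> sqrt D / sqrt N + D * G / N"
    proof (cases "a \<le> b")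
      case True
      have "0 \<le> D * G / N" using D G N by simp
      then show ?thesis using True unfolding a_b_def by linarith
    next
      case False
      then have "a * (a - b) \<le> (a - b) * (a + b)" using b by (simp add: algebra_simps)
      then have "a * (a - b) \<le> a * (D * G / N)" using 1 by simp
      then have "a - b \<le> D * G / N" using a by (simp only: mult_le_cancel_left_pos)
      then show ?thesis unfolding a_b_def by simp
    qed
    show "D * (d * G) / N \<le> D * (G * G) / N" using D G N dG by (intro divide_right_mono mult_left_mono mult_right_mono) auto
    have "X * N \<le> X * (2 * A)" using X NA2 by (intro mult_left_mono)
    then show "X / A \<le> 2 * X / N" using A0 N by (simp add: field_simps)
  qed (use dG W M in auto)
  also have "\<dots> = (d + W + M) * (sqrt D / sqrt N) + (D * G * (d + W + M) + D * G\<^sup>2 + 2 * X) / N"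
    by (simp add: add_divide_distrib power2_eq_square distrib_left distrib_right mult_ac)
  also have "\<dots> \<le> (d + W + M) * (sqrt D / sqrt N) + (D * G * (4 * G + W) + D * G\<^sup>2 + 2 * X) / N"
  proof -
    have "D * G * (d + W + M) \<le> D * G * (4 * G + W)" using dG M3 D G by (intro mult_left_mono) auto
    then have "(D * G * (d + W + M) + D * G\<^sup>2 + 2 * X) / N \<le> (D * G * (4 * G + W) + D * G\<^sup>2 + 2 * X) / N"
      using N by (intro divide_right_mono) auto
    then show ?thesis by simp
  qed
  finally show ?thesis .
qed

text \<open>The longitude is kept and the latitude varied inside (-pi/2, pi/2). Its sine is
  injective there and takes infinitely many values, so \<tau> and -\<tau> can be avoided while the
  cosine stays positive.\<close>

lemma spherical_approx:
  fixes w :: "real^3"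
  assumes w: "w \<in> sphere 0 1" and \<eta>: "0 < \<eta>"
  obtains r s \<phi> where "0 < r" "r\<^sup>2 + s\<^sup>2 = 1" "s \<noteq> \<tau>" "s \<noteq> - \<tau>" "0 \<le> \<phi>" "\<phi> < 2 * pi"
    "norm (vector [r * cos \<phi>, r * sin \<phi>, s] - w) < \<eta>"
proof -
  have n: "(w $ 1)\<^sup>2 + (w $ 2)\<^sup>2 + (w $ 3)\<^sup>2 = 1"
    using w by (simp add: norm_eq_sqrt_inner inner_vec_def sum_3 power2_eq_square)
  then have "(w $ 3)\<^sup>2 \<le> 1" by (smt (verit) zero_le_power2)
  then have s1: "-1 \<le> w $ 3" "w $ 3 \<le> 1" using abs_square_le_1[of "w $ 3"] by auto
  define \<psi> where "\<psi> = arcsin (w $ 3)"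
  have p: "- (pi / 2) \<le> \<psi>" "\<psi> \<le> pi / 2" "sin \<psi> = w $ 3" using arcsin[OF s1] by (simp_all add: \<psi>_def)
  have c0: "0 \<le> cos \<psi>" using p by (intro cos_ge_zero) auto
  have c2: "(cos \<psi>)\<^sup>2 = (w $ 1)\<^sup>2 + (w $ 2)\<^sup>2" using n sin_cos_squared_add[of \<psi>] unfolding p(3) by linarith
  obtain \<phi> where ph: "0 \<le> \<phi>" "\<phi> < 2 * pi" "w $ 1 = cos \<psi> * cos \<phi>" "w $ 2 = cos \<psi> * sin \<phi>"
  proof (cases "cos \<psi> = 0")
    case True
    then have "w $ 1 = 0" "w $ 2 = 0" using c2 by (auto simp: sum_power2_eq_zero_iff)
    then show ?thesis using that[of 0] True by simp
  next
    case False
    have "(w $ 1 / cos \<psi>)\<^sup>2 + (w $ 2 / cos \<psi>)\<^sup>2 = 1" 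
    proof -
      have "(w $ 1 / cos \<psi>)\<^sup>2 + (w $ 2 / cos \<psi>)\<^sup>2 = ((w $ 1)\<^sup>2 + (w $ 2)\<^sup>2) / (cos \<psi>)\<^sup>2" by (simp add: power_divide add_divide_distrib)
      also have "\<dots> = 1" unfolding c2[symmetric] using False by simp
      finally show ?thesis .
    qed
    then obtain \<phi> where "0 \<le> \<phi>" "\<phi> < 2 * pi" "w $ 1 / cos \<psi> = cos \<phi>" "w $ 2 / cos \<psi> = sin \<phi>" by (rule sincos_total_2pi)
    then show ?thesis using that[of \<phi>] False by (simp add: field_simps)
  qed
  define V :: "real \<Rightarrow> real^3" where "V x = vector [cos x * cos \<phi>, cos x * sin \<phi>, sin x]" for x
  have Vw: "V \<psi> = w" using ph p(3) by (simp add: V_def vec_eq_iff forall_3)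
  have "continuous_on UNIV V" unfolding V_def[abs_def] by (intro continuous_on_vector3 continuous_intros)
  then obtain \<delta> where \<delta>: "0 < \<delta>" "\<And>x. dist x \<psi> < \<delta> \<Longrightarrow> dist (V x) (V \<psi>) < \<eta>"
    using \<eta> unfolding continuous_on_iff by (metis UNIV_I)
  define a b where "a = max (- (pi / 2)) (\<psi> - \<delta>)" "b = min (pi / 2) (\<psi> + \<delta>)"
  have ab: "a < b" using p \<delta>(1) pi_gt_zero by (simp add: a_b_def max_def min_def)
  have "inj_on sin {a<..<b}" by (rule inj_onI, rule sin_inj_pi) (auto simp: a_b_def)
  then have "infinite (sin ` {a<..<b})" using ab by (simp add: finite_image_iff)
  then have "\<not> sin ` {a<..<b} \<subseteq> {\<tau>, - \<tau>}" using finite_subset by blast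
  then obtain x where "x \<in> {a<..<b}" "sin x \<notin> {\<tau>, - \<tau>}" by blast
  then have x: "a < x" "x < b" "sin x \<noteq> \<tau>" "sin x \<noteq> - \<tau>" by auto
  have "0 < cos x" using x by (intro cos_gt_zero_pi) (auto simp: a_b_def)
  moreover have "dist (V x) w < \<eta>" using x unfolding Vw[symmetric] by (intro \<delta>(2)) (auto simp: a_b_def dist_real_def)
  ultimately show ?thesis
    using that[of "cos x" "sin x" \<phi>] x ph unfolding V_def dist_norm by simp
qed

lemma cap_discrepancy_le:
  assumes "\<And>w t. w \<in> sphere 0 1 \<Longrightarrow> -1 \<le> t \<Longrightarrow> t \<le> 1 \<Longrightarrow>
    \<bar>1 / real (card P) * (\<Sum>p\<in>P. indicator (cap w t) p) - measure sphere_measure (cap w t)\<bar> \<le> B"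
  shows "cap_discrepancy P \<le> B"
proof -
  have "(axis 1 1 :: real^3) \<in> sphere 0 1" by (simp add: norm_axis_1)
  then have "sphere (0 :: real^3) 1 \<noteq> {}" by blast
  then show ?thesis unfolding cap_discrepancy_def using assms by (intro cSUP_least) auto
qed

lemma sphere_measure_facts:
  "sets sphere_measure = sets borel" "emeasure sphere_measure A \<noteq> \<infinity>"
  "measure sphere_measure A \<le> 1"
  "A \<in> sets borel \<Longrightarrow> B \<in> sets borel \<Longrightarrow> A \<subseteq> B \<Longrightarrow> measure sphere_measure A \<le> measure sphere_measure B"
  "measure sphere_measure (sphere 0 1) = 1"
proof -
  show s: "sets sphere_measure = sets borel" by (simp add: sphere_measure_def)
  have sp: "space sphere_measure = UNIV" by (simp add: sphere_measure_def)
  have "lambert_preimage UNIV = unit_square" by (auto simp: lambert_preimage_def)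
  then have one: "measure sphere_measure UNIV = 1"
    using measure_sphere_lambert[of UNIV] measure_unit_square by (simp add: measure_def)
  interpret S: finite_measure sphere_measure
    by (rule finite_measureI) (use one sp in \<open>auto simp: measure_def\<close>)
  show "emeasure sphere_measure A \<noteq> \<infinity>" by simp
  show "measure sphere_measure A \<le> 1" using S.bounded_measure[of A] one sp by simp
  show "measure sphere_measure A \<le> measure sphere_measure B" if "A \<in> sets borel" "B \<in> sets borel" "A \<subseteq> B"
    using that by (intro S.finite_measure_mono) (simp_all add: s)
  have "lambert_preimage (sphere 0 1) = unit_square" using lambert_norm by (auto simp: lambert_preimage_def)
  then show "measure sphere_measure (sphere 0 1) = 1"
    using measure_sphere_lambert[of "sphere 0 1"] measure_unit_square by (simp add: measure_def)
qed

section \<open>Approximation of arbitrary caps by generic ones\<close>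

context
  fixes P :: "(real^3) set" and B :: real
  assumes P: "finite P" "P \<noteq> {}" "P \<subseteq> sphere 0 1" and B: "0 \<le> B"
    and generic: "\<And>r s \<phi> t. 0 < r \<Longrightarrow> r\<^sup>2 + s\<^sup>2 = 1 \<Longrightarrow> \<bar>t\<bar> < 1 \<Longrightarrow> s \<noteq> t \<Longrightarrow> s \<noteq> - t \<Longrightarrow> 0 \<le> \<phi> \<Longrightarrow> \<phi> < 2 * pi \<Longrightarrow>
      real (card (P \<inter> cap (vector [r * cos \<phi>, r * sin \<phi>, s]) t)) / real (card P)
        - measure sphere_measure (cap (vector [r * cos \<phi>, r * sin \<phi>, s]) t) \<le> B"
begin

lemma card_mono_P: "S \<inter> P \<subseteq> T \<Longrightarrow> real (card (P \<inter> S)) / real (card P) \<le> real (card (P \<inter> T)) / real (card P)"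
  using P by (intro divide_right_mono) (auto intro!: card_mono)

lemma near_cap:
  assumes w: "w \<in> sphere 0 1" and \<eta>: "0 < \<eta>" and \<tau>: "\<bar>\<tau>\<bar> < 1"
  obtains w' where "\<And>x. x \<in> sphere 0 1 \<Longrightarrow> \<bar>w' \<bullet> x - w \<bullet> x\<bar> < \<eta>"
    "real (card (P \<inter> cap w' \<tau>)) / real (card P) - measure sphere_measure (cap w' \<tau>) \<le> B"
proof -
  obtain r s \<phi> where g: "0 < r" "r\<^sup>2 + s\<^sup>2 = 1" "s \<noteq> \<tau>" "s \<noteq> - \<tau>" "0 \<le> \<phi>" "\<phi> < 2 * pi"
    "norm (vector [r * cos \<phi>, r * sin \<phi>, s] - w) < \<eta>" by (rule spherical_approx[OF w \<eta>])
  define w' :: "real^3" where "w' = vector [r * cos \<phi>, r * sin \<phi>, s]"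
  have "\<bar>w' \<bullet> x - w \<bullet> x\<bar> < \<eta>" if "x \<in> sphere 0 1" for x
  proof -
    have "\<bar>w' \<bullet> x - w \<bullet> x\<bar> \<le> norm (w' - w) * norm x" unfolding inner_diff_left[symmetric] by (rule Cauchy_Schwarz_ineq2)
    then show ?thesis using that g(7) by (simp add: w'_def)
  qed
  then show ?thesis using that generic[OF g(1,2) \<tau> g(3-6)] unfolding w'_def by blast
qed

text \<open>A slightly tilted and enlarged generic cap contains the points of the given one and lies
  in a cap about w that shrinks to it. Closedness of caps makes the measures converge
  downwards.\<close>

lemma upper_side:
  assumes w: "w \<in> sphere 0 1" and t: "-1 < t" "t \<le> 1"
  shows "real (card (P \<inter> cap w t)) / real (card P) - measure sphere_measure (cap w t) \<le> B"
proof -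
  define \<eta> where "\<eta> n = (t + 1) / 2 / real (Suc n)" for n
  have \<eta>: "0 < \<eta> n" "\<eta> n \<le> (t + 1) / 2" for n
  proof -
    show "0 < \<eta> n" using t by (simp add: \<eta>_def)
    have "(t + 1) / 2 / real (Suc n) \<le> (t + 1) / 2 / 1" using t by (intro divide_left_mono) auto
    then show "\<eta> n \<le> (t + 1) / 2" by (simp add: \<eta>_def)
  qed
  define C where "C n = cap w (t - 2 * \<eta> n)" for n
  have le: "real (card (P \<inter> cap w t)) / real (card P) \<le> B + measure sphere_measure (C n)" for n
  proof -
    have "\<bar>t - \<eta> n\<bar> < 1" using t \<eta>[of n] by auto
    from near_cap[OF w \<eta>(1) this] obtain w' where w': "\<And>x. x \<in> sphere 0 1 \<Longrightarrow> \<bar>w' \<bullet> x - w \<bullet> x\<bar> < \<eta> n"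
      "real (card (P \<inter> cap w' (t - \<eta> n))) / real (card P) - measure sphere_measure (cap w' (t - \<eta> n)) \<le> B" by metis
    have "cap w t \<inter> P \<subseteq> cap w' (t - \<eta> n)" using w'(1) P(3) unfolding cap_def by (smt (verit) Int_iff mem_Collect_eq subsetI)
    moreover have "cap w' (t - \<eta> n) \<subseteq> C n" using w'(1) unfolding C_def cap_def by (smt (verit) mem_Collect_eq subsetI)
    then have "measure sphere_measure (cap w' (t - \<eta> n)) \<le> measure sphere_measure (C n)"
      unfolding C_def by (intro sphere_measure_facts(4) cap_in_borel)
    ultimately show ?thesis using card_mono_P[of "cap w t" "cap w' (t - \<eta> n)"] w'(2) by linarith
  qed
  have e0: "\<eta> \<longlonglongrightarrow> 0" unfolding \<eta>_def by real_asymp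
  have "(\<Inter>n. C n) = cap w t"
  proof (intro equalityI subsetI)
    fix x assume "x \<in> (\<Inter>n. C n)"
    then have x: "x \<in> sphere 0 1" "\<And>n. t - 2 * \<eta> n \<le> w \<bullet> x" by (auto simp: C_def cap_def)
    have "(\<lambda>n. t - 2 * \<eta> n) \<longlonglongrightarrow> t - 2 * 0" by (intro tendsto_intros e0)
    then have "t - 2 * 0 \<le> w \<bullet> x" by (rule LIMSEQ_le_const2) (use x(2) in auto)
    then show "x \<in> cap w t" using x(1) by (simp add: cap_def)
  next
    fix x assume "x \<in> cap w t"
    then have "x \<in> C n" for n using \<eta>(1)[of n] by (auto simp: C_def cap_def)
    then show "x \<in> (\<Inter>n. C n)" by simp
  qed
  moreover have "decseq C"
  proof (rule decseq_SucI)
    fix n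
    have "\<eta> (Suc n) \<le> \<eta> n" using t unfolding \<eta>_def by (intro divide_left_mono) auto
    then show "C (Suc n) \<subseteq> C n" by (auto simp: C_def cap_def)
  qed
  ultimately have "(\<lambda>n. measure sphere_measure (C n)) \<longlonglongrightarrow> measure sphere_measure (cap w t)"
    using Lim_measure_decseq[of C sphere_measure] sphere_measure_facts(1,2) cap_in_borel by (force simp: C_def)
  from tendsto_add[OF tendsto_const[of B] this]
  have "real (card (P \<inter> cap w t)) / real (card P) \<le> B + measure sphere_measure (cap w t)"
    by (rule LIMSEQ_le_const) (use le in auto)
  then show ?thesis by simp
qed

text \<open>Too few points in a cap are too many in the complement. The complement is open, but
  finitely many points leave a gap \<open>\<delta>\<close> below the boundary, so a closed generic
  cap inside the complement contains the same points; having smaller measure, it inherits the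
  excess.\<close>

lemma lower_side:
  assumes w: "w \<in> sphere 0 1" and t: "-1 < t" "t \<le> 1"
  shows "measure sphere_measure (cap w t) - real (card (P \<inter> cap w t)) / real (card P) \<le> B"
proof -
  define T where "T = {p \<in> P. w \<bullet> p < t}"
  obtain \<delta> where \<delta>: "0 < \<delta>" "\<delta> < 1 + t" "\<And>p. p \<in> T \<Longrightarrow> w \<bullet> p + 2 * \<delta> \<le> t"
  proof -
    define \<delta> where "\<delta> = Min (insert ((1 + t) / 2) ((\<lambda>p. (t - w \<bullet> p) / 2) ` T))"
    have fin: "finite (insert ((1 + t) / 2) ((\<lambda>p. (t - w \<bullet> p) / 2) ` T))" using P(1) by (simp add: T_def)
    have "0 < \<delta>" unfolding \<delta>_def using fin t by (subst Min_gr_iff) (auto simp: T_def)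
    moreover have "\<delta> \<le> (1 + t) / 2" unfolding \<delta>_def using fin by (intro Min_le) auto
    moreover have "\<delta> \<le> (t - w \<bullet> p) / 2" if "p \<in> T" for p unfolding \<delta>_def using fin that by (intro Min_le) auto
    ultimately have "0 < \<delta>" "\<delta> < 1 + t" "\<And>p. p \<in> T \<Longrightarrow> w \<bullet> p + 2 * \<delta> \<le> t" using t by (auto simp: field_simps)
    then show ?thesis by (rule that)
  qed
  have "- w \<in> sphere 0 1" using w by simp
  moreover have "\<bar>- t + \<delta>\<bar> < 1" using t \<delta> by auto
  ultimately obtain w' where w': "\<And>x. x \<in> sphere 0 1 \<Longrightarrow> \<bar>w' \<bullet> x - (- w) \<bullet> x\<bar> < \<delta> / 2"
      "real (card (P \<inter> cap w' (- t + \<delta>))) / real (card P) - measure sphere_measure (cap w' (- t + \<delta>)) \<le> B"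
    using near_cap[of "- w" "\<delta> / 2" "- t + \<delta>"] \<delta>(1) by (metis half_gt_zero)
  have sub: "cap w' (- t + \<delta>) \<subseteq> sphere 0 1 - cap w t"
  proof
    fix x assume "x \<in> cap w' (- t + \<delta>)"
    then have x: "x \<in> sphere 0 1" "- t + \<delta> \<le> w' \<bullet> x" by (auto simp: cap_def)
    then show "x \<in> sphere 0 1 - cap w t" using w'(1)[OF x(1)] \<delta>(1) by (auto simp: cap_def abs_less_iff)
  qed
  have sc: "sphere 0 1 - cap w t \<in> sets borel" using cap_in_borel by auto
  have "measure sphere_measure (cap w' (- t + \<delta>)) \<le> measure sphere_measure (sphere 0 1 - cap w t)"
    by (rule sphere_measure_facts(4)[OF cap_in_borel sc sub])
  also have "\<dots> = 1 - measure sphere_measure (cap w t)"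
  proof -
    have "cap w t \<subseteq> sphere 0 1" by (auto simp: cap_def)
    then show ?thesis
      using measure_Diff[of sphere_measure "sphere 0 1" "cap w t"] sphere_measure_facts(1,2,5) cap_in_borel by simp
  qed
  finally have m: "measure sphere_measure (cap w' (- t + \<delta>)) \<le> 1 - measure sphere_measure (cap w t)" .
  have "(sphere 0 1 - cap w t) \<inter> P \<subseteq> cap w' (- t + \<delta>)"
  proof
    fix p assume "p \<in> (sphere 0 1 - cap w t) \<inter> P"
    then have p: "p \<in> sphere 0 1" "p \<in> T" by (auto simp: cap_def T_def)
    have "\<bar>w' \<bullet> p + w \<bullet> p\<bar> < \<delta> / 2" using w'(1)[OF p(1)] by (simp only: inner_minus_left diff_minus_eq_add)
    then have "- t + \<delta> \<le> w' \<bullet> p" using \<delta>(1) \<delta>(3)[OF p(2)] by linarith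
    then show "p \<in> cap w' (- t + \<delta>)" using p(1) by (simp add: cap_def)
  qed
  from card_mono_P[OF this] have c: "real (card (P \<inter> (sphere 0 1 - cap w t))) / real (card P) \<le> real (card (P \<inter> cap w' (- t + \<delta>))) / real (card P)" .
  have "card P = card (P \<inter> cap w t) + card (P \<inter> (sphere 0 1 - cap w t))"
  proof -
    have "P = (P \<inter> cap w t) \<union> (P \<inter> (sphere 0 1 - cap w t))" using P(3) by auto
    moreover have "card ((P \<inter> cap w t) \<union> (P \<inter> (sphere 0 1 - cap w t))) = card (P \<inter> cap w t) + card (P \<inter> (sphere 0 1 - cap w t))"
      using P(1) by (intro card_Un_disjoint) auto
    ultimately show ?thesis by simp
  qed
  then have "real (card (P \<inter> (sphere 0 1 - cap w t))) = real (card P) - real (card (P \<inter> cap w t))" by simp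
  moreover have "0 < real (card P)" using P by (simp add: card_gt_0_iff)
  ultimately have "real (card (P \<inter> (sphere 0 1 - cap w t))) / real (card P) = 1 - real (card (P \<inter> cap w t)) / real (card P)"
    by (simp only: diff_divide_distrib) simp
  then show ?thesis using c m w'(2) by linarith
qed

lemma discrepancy_le: "cap_discrepancy P \<le> B"
proof (rule cap_discrepancy_le)
  fix w :: "real^3" and t :: real assume w: "w \<in> sphere 0 1" and t: "-1 \<le> t" "t \<le> 1"
  have "(\<Sum>p\<in>P. indicator (cap w t) p) = real (card (P \<inter> cap w t))" using P(1) by (simp add: indicator_def sum.If_cases)
  then have e: "1 / real (card P) * (\<Sum>p\<in>P. indicator (cap w t) p) = real (card (P \<inter> cap w t)) / real (card P)" by simp
  show "\<bar>1 / real (card P) * (\<Sum>p\<in>P. indicator (cap w t) p) - measure sphere_measure (cap w t)\<bar> \<le> B"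
  \<comment> \<open>For t = -1 the cap is the whole sphere and cannot be enlarged to a generic cap,
    but its error is 0.\<close>
  proof (cases "t = -1")
    case True
    have c: "cap w t = sphere 0 1"
    proof -
      have "- 1 \<le> w \<bullet> x" if "x \<in> sphere 0 1" for x
        using Cauchy_Schwarz_ineq2[of w x] w that by (simp add: abs_le_iff)
      then show ?thesis using True by (auto simp: cap_def)
    qed
    have "P \<inter> sphere 0 1 = P" using P(3) by auto
    then show ?thesis unfolding e unfolding c using P B sphere_measure_facts(5) by simp
  next
    case False
    then show ?thesis unfolding e using upper_side[OF w, of t] lower_side[OF w, of t] t by (auto simp: abs_le_iff)
  qed
qed

end

lemma discrepancy_le_1:
  assumes "finite P"
  shows "cap_discrepancy P \<le> 1"
proof (rule cap_discrepancy_le)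
  fix w :: "real^3" and t :: real
  have ab: "\<bar>q - m\<bar> \<le> 1" if "0 \<le> q" "q \<le> 1" "0 \<le> m" "m \<le> 1" for q m :: real using that by auto
  have "(\<Sum>p\<in>P. indicator (cap w t) p) = real (card (P \<inter> cap w t))" using assms by (simp add: indicator_def sum.If_cases)
  moreover have "real (card (P \<inter> cap w t)) / real (card P) \<le> 1"
    using assms by (cases "card P = 0") (auto simp: divide_le_eq_1 card_mono)
  moreover have "0 \<le> real (card (P \<inter> cap w t)) / real (card P)" "0 \<le> measure sphere_measure (cap w t)" by simp_all
  moreover have "measure sphere_measure (cap w t) \<le> 1" by (rule sphere_measure_facts(3))
  ultimately show "\<bar>1 / real (card P) * (\<Sum>p\<in>P. indicator (cap w t) p) - measure sphere_measure (cap w t)\<bar> \<le> 1"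
    using ab[of "real (card (P \<inter> cap w t)) / real (card P)" "measure sphere_measure (cap w t)"] by simp
qed

text \<open>Serves the small values of \<open>K\<close>, for which the bounds relating the size of a
  cell to the square fail: whatever points are chosen, N cannot exceed the number of cells that meet
  the square.\<close>

lemma (in lattice_sample) finite_cells_square: "finite {c. \<exists>P\<in>cell c. emb P \<in> unit_square}"
proof -
  have "bounded (cbox (0::real^2) 1)" by (rule bounded_cbox)
  have "compact (demb ` cbox 0 1)" by (rule compact_continuous_image[OF continuous_demb compact_cbox])
  then obtain a where a: "\<forall>P\<in>demb ` cbox 0 1. norm P \<le> a" using compact_imp_bounded bounded_iff by metis
  have sub: "{c. \<exists>P\<in>cell c. emb P \<in> unit_square} \<subseteq> {c. \<exists>P\<in>cell c. \<bar>fst P - 0\<bar> \<le> \<bar>a\<bar> \<and> \<bar>snd P - 0\<bar> \<le> \<bar>a\<bar>}"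
  proof
    fix c assume "c \<in> {c. \<exists>P\<in>cell c. emb P \<in> unit_square}"
    then obtain P where P: "P \<in> cell c" "emb P \<in> unit_square" by blast
    then have "emb P \<in> cbox 0 1" by (auto simp: unit_square_def mem_box_cart forall_2)
    then have "norm P \<le> a" using a by (metis demb_emb imageI)
    moreover have "\<bar>fst P\<bar> \<le> norm P" "\<bar>snd P\<bar> \<le> norm P" using norm_fst_le[of "fst P" "snd P"] norm_snd_le[of "snd P" "fst P"] by simp_all
    ultimately show "c \<in> {c. \<exists>P\<in>cell c. \<bar>fst P - 0\<bar> \<le> \<bar>a\<bar> \<and> \<bar>snd P - 0\<bar> \<le> \<bar>a\<bar>}" using P(1) by (auto intro!: bexI[of _ P])
  qed
  show ?thesis by (rule finite_subset[OF sub card_cells_box(1)]) simp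
qed

lemma (in lattice_sample) card_lattice_points_le:
  "finite (lattice_points Q z)" "card (lattice_points Q z) \<le> card {c. \<exists>P\<in>cell c. emb P \<in> unit_square}"
proof -
  have sub: "lattice_points Q z \<subseteq> (\<lambda>c. z (lat c)) ` {c. \<exists>P\<in>cell c. emb P \<in> unit_square}"
  proof
    fix p assume "p \<in> lattice_points Q z"
    then obtain c where c: "p = z (lat c)" "p \<in> unit_square" by (auto simp: lattice_points_def plane_lattice_lat)
    then have "c \<in> {c. \<exists>P\<in>cell c. emb P \<in> unit_square}" using zz_cell[of c] emb_zz[of c] by (auto intro!: bexI[of _ "zz c"])
    then show "p \<in> (\<lambda>c. z (lat c)) ` {c. \<exists>P\<in>cell c. emb P \<in> unit_square}" using c(1) by blast
  qed
  show "finite (lattice_points Q z)" using finite_subset[OF sub] finite_cells_square by blast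
  have "card (lattice_points Q z) \<le> card ((\<lambda>c. z (lat c)) ` {c. \<exists>P\<in>cell c. emb P \<in> unit_square})"
    using sub finite_cells_square by (intro card_mono) auto
  also have "\<dots> \<le> card {c. \<exists>P\<in>cell c. emb P \<in> unit_square}" by (rule card_image_le[OF finite_cells_square])
  finally show "card (lattice_points Q z) \<le> card {c. \<exists>P\<in>cell c. emb P \<in> unit_square}" .
qed

section \<open>The discrepancy bound\<close>

context
  fixes Q :: "real^2^2"
begin

definition "entry_sum = \<bar>Q $ 1 $ 1\<bar> + \<bar>Q $ 1 $ 2\<bar> + \<bar>Q $ 2 $ 1\<bar> + \<bar>Q $ 2 $ 2\<bar>"
text \<open>\<open>edge_const\<close> bounds the number of edge cells divided by K. In
  \<open>exc_const\<close> the number 8920 is 7420 + 1500. All these constants are functions of Q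
  only.\<close>

definition "edge_const = 2 * (entry_sum / \<bar>det Q\<bar>) + 12"
definition "exc_const = 26 * (2 * (entry_sum / \<bar>det Q\<bar> * (4 * entry_sum)) + 2)\<^sup>2 + 8920"
definition "len_const = sqrt 2 * (2 * norm (matrix_inv Q *v axis 2 1) + norm (matrix_inv Q *v axis 1 1))"
definition "err_const = \<bar>det Q\<bar> * edge_const * (4 * edge_const + len_const) + \<bar>det Q\<bar> * edge_const\<^sup>2 + 2 * exc_const"

lemma const_nonneg: "0 \<le> edge_const" "0 \<le> exc_const" "0 \<le> len_const" "0 \<le> err_const"
proof -
  have e: "0 \<le> entry_sum" by (simp add: entry_sum_def)
  then show 1: "0 \<le> edge_const" "0 \<le> exc_const" "0 \<le> len_const" by (simp_all add: edge_const_def exc_const_def len_const_def)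
  then show "0 \<le> err_const" by (simp add: err_const_def)
qed

lemma matrix_inv_axis:
  assumes "invertible Q"
  shows "norm (matrix_inv Q *v axis 1 1) = sqrt ((\<bar>Q $ 2 $ 2\<bar> / \<bar>det Q\<bar>)\<^sup>2 + (\<bar>Q $ 2 $ 1\<bar> / \<bar>det Q\<bar>)\<^sup>2)"
    "norm (matrix_inv Q *v axis 2 1) = sqrt ((\<bar>Q $ 1 $ 2\<bar> / \<bar>det Q\<bar>)\<^sup>2 + (\<bar>Q $ 1 $ 1\<bar> / \<bar>det Q\<bar>)\<^sup>2)"
proof -
  define D where "D = det Q"
  have D: "D = Q $ 1 $ 1 * Q $ 2 $ 2 - Q $ 1 $ 2 * Q $ 2 $ 1" "D \<noteq> 0" using assms by (simp_all add: D_def det_2 invertible_det_nz)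
  have inv: "matrix_inv Q *v (Q *v v) = v" for v using matrix_inv_mult(2)[OF assms] by (simp add: matrix_vector_mul_assoc)
  have "(Q $ 1 $ 1 * Q $ 2 $ 2 - Q $ 1 $ 2 * Q $ 2 $ 1) / D = 1" using D by simp
  then have "Q *v (vector [Q $ 2 $ 2 / D, - Q $ 2 $ 1 / D] :: real^2) = axis 1 1" "Q *v (vector [- Q $ 1 $ 2 / D, Q $ 1 $ 1 / D] :: real^2) = axis 2 1"
    by (simp_all add: vec_eq_iff forall_2 matrix_vector_mult_def sum_2 axis_def diff_divide_distrib mult.commute)
  then have m: "matrix_inv Q *v axis 1 1 = vector [Q $ 2 $ 2 / D, - Q $ 2 $ 1 / D]" "matrix_inv Q *v axis 2 1 = vector [- Q $ 1 $ 2 / D, Q $ 1 $ 1 / D]"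
    using inv by metis+
  show "norm (matrix_inv Q *v axis 1 1) = sqrt ((\<bar>Q $ 2 $ 2\<bar> / \<bar>det Q\<bar>)\<^sup>2 + (\<bar>Q $ 2 $ 1\<bar> / \<bar>det Q\<bar>)\<^sup>2)"
    "norm (matrix_inv Q *v axis 2 1) = sqrt ((\<bar>Q $ 1 $ 2\<bar> / \<bar>det Q\<bar>)\<^sup>2 + (\<bar>Q $ 1 $ 1\<bar> / \<bar>det Q\<bar>)\<^sup>2)"
    unfolding m D_def[symmetric] by (simp_all add: norm_eq_sqrt_inner inner_vec_def sum_2 power_divide power2_eq_square)
qed

end

context cap_sample
begin

lemma dtq_det: "dtq = det Q" by (simp add: dtq_def det_2)

lemma excess_bound:
  assumes "2 * \<bar>det Q\<bar> * edge_const Q \<le> real K"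
  shows "real (card {p \<in> lattice_points Q z. lambert p \<in> cap wv t}) / real NN - measure sphere_measure (cap wv t)
    \<le> (count_defect Q K z + len_const Q + boundary_defect Q K z) * (sqrt \<bar>det Q\<bar> / sqrt (real NN)) + err_const Q / real NN"
proof -
  have bs: "b1 + b2 + (e1 + e2) = entry_sum Q / \<bar>det Q\<bar>"
    by (simp add: b1_def b2_def e1_def e2_def dtq_det entry_sum_def add_divide_distrib)
  have EE: "EE \<le> real K * edge_const Q"
  proof -
    have "EE = real K * (2 * (entry_sum Q / \<bar>det Q\<bar>)) + 12" unfolding bs[symmetric] by (simp add: EE_def algebra_simps)
    then show ?thesis using K1 by (simp add: edge_const_def distrib_left)
  qed
  have Cx: "Cx + 1500 = exc_const Q"
  proof -
    have "C0 = 4 * entry_sum Q" by (simp add: C0_def mx_def my_def entry_sum_def)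
    moreover have "C1 = (b1 + b2 + (e1 + e2)) * C0" by (simp add: C1_def algebra_simps)
    ultimately show ?thesis unfolding Cx_def bs by (simp add: exc_const_def)
  qed
  have len: "sqrt 2 * (2 * sqrt (b1\<^sup>2 + b2\<^sup>2) + sqrt (e1\<^sup>2 + e2\<^sup>2)) = len_const Q"
    by (simp add: len_const_def matrix_inv_axis[OF Qinv] b1_def b2_def e1_def e2_def dtq_det)
  have "(\<rho> + 1) * EE / real K \<le> (\<rho> + 1) * (real K * edge_const Q) / real K"
    using rho_pos K0 EE by (intro divide_right_mono mult_left_mono) auto
  then have M: "boundary_defect Q K z \<le> (\<rho> + 1) * edge_const Q" using defect_bounds(2) K0 by simp
  have "\<bar>det Q\<bar> / (real K)\<^sup>2 * (real K * boundary_defect Q K z + \<bar>\<rho> - 1\<bar> * card Sc + real K * len_const Q + exc_const Q)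
    \<le> (count_defect Q K z + len_const Q + boundary_defect Q K z) * (sqrt \<bar>det Q\<bar> / sqrt (real NN)) + err_const Q / real NN"
    unfolding err_const_def
  proof (rule main_arith[where A = "(real K)\<^sup>2 / \<bar>det Q\<bar>"])
    show "1 \<le> real K" using K1 by simp
    show "0 < \<bar>det Q\<bar>" by (rule det_pos)
    show "\<bar>real NN - (real K)\<^sup>2 / \<bar>det Q\<bar>\<bar> \<le> real K * edge_const Q" using N_bound(1) EE by simp
    show "real (card Sc) \<le> real NN + real K * edge_const Q" using N_bound(2) EE by simp
    show "\<rho> = (real K)\<^sup>2 / \<bar>det Q\<bar> / real NN" by (rule \<rho>_def)
    show "count_defect Q K z = 1 / real K * \<bar>real NN - (real K)\<^sup>2 / \<bar>det Q\<bar>\<bar>" by (simp add: count_defect_def NN_def)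
  qed (use assms M NN_pos defect_bounds(3) const_nonneg in auto)
  moreover have "real (card {p \<in> lattice_points Q z. lambert p \<in> cap wv t}) / real NN - measure sphere_measure (cap wv t)
    \<le> \<bar>det Q\<bar> / (real K)\<^sup>2 * (real K * boundary_defect Q K z + \<bar>\<rho> - 1\<bar> * card Sc + real K * len_const Q + exc_const Q)"
    using cap_excess unfolding len Cx .
  ultimately show ?thesis by (rule order.trans[rotated])
qed

end

context lattice_sample
begin

lemma discrepancy_bound:
  assumes N: "1 \<le> card (lattice_points Q z)" and K: "2 * \<bar>det Q\<bar> * edge_const Q \<le> real K" "4 * entry_sum Q < real K"
  shows "cap_discrepancy (lambert ` lattice_points Q z)
    \<le> (count_defect Q K z + len_const Q + boundary_defect Q K z) * (sqrt \<bar>det Q\<bar> / sqrt (real (card (lattice_points Q z))))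
      + err_const Q / real (card (lattice_points Q z))" (is "_ \<le> ?B")
    and "0 \<le> boundary_defect Q K z"
proof -
  have cs: "cap_sample Q K z r s t \<phi>" if "0 < r" "r\<^sup>2 + s\<^sup>2 = 1" "\<bar>t\<bar> < 1" "s \<noteq> t" "s \<noteq> - t" "0 \<le> \<phi>" "\<phi> < 2 * pi" for r s t \<phi>
  proof unfold_locales
    show "Q $ 1 $ 1 * Q $ 2 $ 2 - Q $ 1 $ 2 * Q $ 2 $ 1 \<noteq> 0" using Qinv by (simp add: invertible_det_nz det_2)
    show "4 * (\<bar>Q $ 1 $ 1\<bar> + \<bar>Q $ 1 $ 2\<bar>) < real K" "4 * (\<bar>Q $ 2 $ 1\<bar> + \<bar>Q $ 2 $ 2\<bar>) < real K"
      using K(2) by (auto simp: entry_sum_def)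
  qed (use that K0 N in auto)
  show M: "0 \<le> boundary_defect Q K z"
    using cap_sample.defect_bounds(3)[OF cs[of 1 0 "1 / 2" 0]] by simp
  note fin = card_lattice_points_le(1)
  have inj: "inj_on lambert (lattice_points Q z)"
    by (rule inj_on_subset[OF inj_on_lambert]) (auto simp: lattice_points_def)
  have cd: "card (lambert ` lattice_points Q z) = card (lattice_points Q z)" by (rule card_image[OF inj])
  show "cap_discrepancy (lambert ` lattice_points Q z) \<le> ?B"
  proof (rule discrepancy_le)
    show "finite (lambert ` lattice_points Q z)" using fin by simp
    show "lambert ` lattice_points Q z \<noteq> {}" using N by auto
    show "lambert ` lattice_points Q z \<subseteq> sphere 0 1" using lambert_norm by (auto simp: lattice_points_def)
    show "0 \<le> ?B" using M const_nonneg[of Q] by (simp add: count_defect_def)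
    fix r s \<phi> t :: real
    assume a: "0 < r" "r\<^sup>2 + s\<^sup>2 = 1" "\<bar>t\<bar> < 1" "s \<noteq> t" "s \<noteq> - t" "0 \<le> \<phi>" "\<phi> < 2 * pi"
    interpret S: cap_sample Q K z r s t \<phi> using cs[OF a] .
    have "lambert ` lattice_points Q z \<inter> cap S.wv t = lambert ` {p \<in> lattice_points Q z. lambert p \<in> cap S.wv t}" by auto
    then have "card (lambert ` lattice_points Q z \<inter> cap S.wv t) = card {p \<in> lattice_points Q z. lambert p \<in> cap S.wv t}"
      using card_image[OF inj_on_subset[OF inj]] by simp
    then show "real (card (lambert ` lattice_points Q z \<inter> cap (vector [r * cos \<phi>, r * sin \<phi>, s]) t)) / real (card (lambert ` lattice_points Q z))
       - measure sphere_measure (cap (vector [r * cos \<phi>, r * sin \<phi>, s]) t) \<le> ?B"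
      using S.excess_bound[OF K(1)] unfolding cd S.NN_def S.wv_def by simp
  qed
qed

end

theorem theorem1:
  fixes Q :: "real^2^2"
  assumes "invertible Q"
  shows "\<exists>c\<ge>0. \<forall>(K::nat) (z :: real^2 \<Rightarrow> real^2).
           K \<ge> 1 \<longrightarrow> (\<forall>p\<in>plane_lattice Q. z p \<in> tile Q K p) \<longrightarrow> card (lattice_points Q z) \<ge> 1 \<longrightarrow>
           ennreal (cap_discrepancy (lambert ` lattice_points Q z))
             \<le> (ennreal (count_defect Q K z) + ennreal (sqrt 2) * cap_length Q
                  + ennreal (boundary_defect Q K z))
                * ennreal (sqrt \<bar>det Q\<bar> / sqrt (real (card (lattice_points Q z))))
               + ennreal (c / real (card (lattice_points Q z)))"
proof -
  \<comment> \<open>Above \<open>K1\<close> cells are small compared with the square and N is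
    comparable to its expected value, so the geometric estimate holds.\<close>
  obtain K1 :: nat where K1_large: "2 * \<bar>det Q\<bar> * edge_const Q + 4 * entry_sum Q < real K1" using reals_Archimedean2 by blast
  have pos: "0 \<le> 2 * \<bar>det Q\<bar> * edge_const Q" "0 \<le> 4 * entry_sum Q" using const_nonneg[of Q] by (auto simp: entry_sum_def)
  define nb where "nb K = card {c. \<exists>P\<in>cell c. lattice_sample.emb Q K P \<in> unit_square}" for K
  \<comment> \<open>For each of the finitely many smaller K the number N is at most
    \<open>nb K\<close>, so with this \<open>c\<close> the last term alone is at least 1 and exceeds
    any discrepancy.\<close>
  define c where "c = err_const Q + real (\<Sum>K<K1. nb K)"
  have c0: "0 \<le> c" using const_nonneg(4)[of Q] by (simp add: c_def del: of_nat_sum)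
  show ?thesis
  proof (intro exI conjI allI impI)
    show "0 \<le> c" by (rule c0)
    fix K :: nat and z :: "real^2 \<Rightarrow> real^2"
    assume a: "1 \<le> K" "\<forall>p\<in>plane_lattice Q. z p \<in> tile Q K p" and N: "1 \<le> card (lattice_points Q z)"
    interpret lattice_sample Q K z using assms a by unfold_locales auto
    define N where "N = real (card (lattice_points Q z))"
    have N0: "0 < N" using N by (simp add: N_def)
    define q where "q = sqrt \<bar>det Q\<bar> / sqrt N"
    have q0: "0 \<le> q" using N0 by (simp add: q_def)
    define L where "L = 2 * norm (matrix_inv Q *v axis 2 1) + norm (matrix_inv Q *v axis 1 1)"
    have L0: "0 \<le> L" by (simp add: L_def)
    have d0: "0 \<le> count_defect Q K z" by (simp add: count_defect_def)
    show "ennreal (cap_discrepancy (lambert ` lattice_points Q z))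
             \<le> (ennreal (count_defect Q K z) + ennreal (sqrt 2) * cap_length Q + ennreal (boundary_defect Q K z))
                * ennreal (sqrt \<bar>det Q\<bar> / sqrt (real (card (lattice_points Q z))))
               + ennreal (c / real (card (lattice_points Q z)))"
      unfolding N_def[symmetric] q_def[symmetric]
    proof (cases "K < K1")
      case True
      have "nb K \<le> (\<Sum>K<K1. nb K)" using True by (intro member_le_sum) auto
      moreover have "card (lattice_points Q z) \<le> nb K" unfolding nb_def by (rule card_lattice_points_le(2))
      ultimately have "real (card (lattice_points Q z)) \<le> real (\<Sum>K<K1. nb K)" by (simp only: of_nat_le_iff)
      then have "N \<le> c" using const_nonneg(4)[of Q] unfolding N_def c_def by linarith
      then have "1 \<le> c / N" using N0 by simp
      then have "cap_discrepancy (lambert ` lattice_points Q z) \<le> c / N"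
        using discrepancy_le_1[of "lambert ` lattice_points Q z"] card_lattice_points_le(1) by simp
      then have "ennreal (cap_discrepancy (lambert ` lattice_points Q z)) \<le> ennreal (c / N)" by (rule ennreal_leI)
      then show "ennreal (cap_discrepancy (lambert ` lattice_points Q z))
             \<le> (ennreal (count_defect Q K z) + ennreal (sqrt 2) * cap_length Q + ennreal (boundary_defect Q K z)) * ennreal q + ennreal (c / N)"
        by (rule order.trans) simp
    next
      case False
      then have "real K1 \<le> real K" by simp
      then have K: "2 * \<bar>det Q\<bar> * edge_const Q \<le> real K" "4 * entry_sum Q < real K" using K1_large pos by linarith+
      note b = discrepancy_bound[OF N K, folded N_def, folded q_def]
      have "err_const Q / N \<le> c / N" using N0 by (intro divide_right_mono) (simp_all add: c_def del: of_nat_sum)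
      then have "cap_discrepancy (lambert ` lattice_points Q z) \<le> (count_defect Q K z + sqrt 2 * L + boundary_defect Q K z) * q + c / N"
        using b(1) by (simp add: len_const_def L_def)
      then have "ennreal (cap_discrepancy (lambert ` lattice_points Q z)) \<le> ennreal ((count_defect Q K z + sqrt 2 * L + boundary_defect Q K z) * q + c / N)"
        by (rule ennreal_leI)
      also have "\<dots> = (ennreal (count_defect Q K z) + ennreal (sqrt 2) * ennreal L + ennreal (boundary_defect Q K z)) * ennreal q + ennreal (c / N)"
        using d0 b(2) L0 q0 c0 N0 by (simp add: ennreal_plus ennreal_mult)
      also have "\<dots> \<le> (ennreal (count_defect Q K z) + ennreal (sqrt 2) * cap_length Q + ennreal (boundary_defect Q K z)) * ennreal q + ennreal (c / N)"
        using cap_length_ge[OF assms] unfolding L_def by (intro add_mono mult_mono order_refl) auto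
      finally show "ennreal (cap_discrepancy (lambert ` lattice_points Q z))
             \<le> (ennreal (count_defect Q K z) + ennreal (sqrt 2) * cap_length Q + ennreal (boundary_defect Q K z)) * ennreal q + ennreal (c / N)" .
    qed
  qed
qed

end
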